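(* Let $D\subset\mathbb R^3$ be a nonempty bounded open set with $C^2$ boundary such that $\mathbb R^3\setminus\overline D$ is connected, let $\epsilon,\mu>0$, $0<T<\infty$, let $B$ be the open ball of centre $p$ and radius $\eta>0$ with $\overline B\cap\overline D=\emptyset$, let $\mathbf a$ be a constant unit vector and $f\in H^1(0,T)$ with $f(0)=0$. Let $(\mathbf E,\mathbf H)$, $\tilde f$, $\mathbf f$, $\mathbf W_e$, $\mathbf V$ be as in the context. Assume that there exists $\gamma\in\mathbb R$ with $$\liminf_{\tau\to\infty}\tau^{\gamma}|\tilde f(\tau)|>0.$$ If $T>2\sqrt{\mu\epsilon}\,\mathrm{dist}(D,B)$, then there exists $\tau_0>0$ such that for all $\tau\ge\tau_0$ $$\int_B\mathbf f(x,\tau)\cdot(\mathbf W_e(x,\tau)-\mathbf V(x,\tau))\,dx>0,$$ and moreover $$\lim_{\tau\to\infty}\frac1\tau\log\left|\int_B\mathbf f\cdot(\mathbf W_e-\mathbf V)\,dx\right|=-2\sqrt{\mu\epsilon}\,\mathrm{dist}(D,B).$$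
   Context: $\boldsymbol\nu$ denotes the unit normal on $\partial D$ pointing to the exterior of $D$; $\chi_B$ is the characteristic function of $B$. The current density is $\mathbf J(x,t)=f(t)\chi_B(x)\mathbf a$. $(\mathbf E,\mathbf H)$ is the solution of $\epsilon\partial_t\mathbf E-\nabla\times\mathbf H=\mathbf J$, $\mu\partial_t\mathbf H+\nabla\times\mathbf E=\mathbf 0$ in $(\mathbb R^3\setminus\overline D)\times(0,T)$, $\boldsymbol\nu\times\mathbf E=\mathbf 0$ on $\partial D\times(0,T)$, $\mathbf E|_{t=0}=\mathbf H|_{t=0}=\mathbf 0$, understood in the semigroup (Stone's theorem) sense of Dautray–Lions: $(\mathbf E,\mathbf H)\in C^1([0,T];L^2(\mathbb R^3\setminus\overline D)^3\times L^2(\mathbb R^3\setminus\overline D)^3)$, $\nabla\times\mathbf E(t),\nabla\times\mathbf H(t)\in L^2(\mathbb R^3\setminus\overline D)^3$ and $\mathbf E(t)\times\boldsymbol\nu|_{\partial D}=\mathbf 0$ for all $t\in[0,T]$. For $\tau>0$: $\tilde f(\tau)=\int_0^Te^{-\tau t}f(t)\,dt$; $\mathbf f(x,\tau)=-\frac{\tau}{\epsilon}\tilde f(\tau)\chi_B(x)\mathbf a$; $\mathbf W_e(x,\tau)=\int_0^Te^{-\tau t}\mathbf E(x,t)\,dt$ for $x\in\mathbb R^3\setminus\overline D$; $H(\mathrm{curl},\mathbb R^3)=\{\mathbf U\in L^2(\mathbb R^3)^3:\nabla\times\mathbf U\in L^2(\mathbb R^3)^3\}$, and $\mathbf V=\mathbf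 V(\cdot,\tau)\in H(\mathrm{curl},\mathbb R^3)$ is the unique function with $\int_{\mathbb R^3}\big(\frac1{\mu\epsilon}\nabla\times\mathbf V\cdot\nabla\times\boldsymbol\Psi+\tau^2\mathbf V\cdot\boldsymbol\Psi\big)dx+\int_{\mathbb R^3}\mathbf f\cdot\boldsymbol\Psi\,dx=0$ for all $\boldsymbol\Psi\in H(\mathrm{curl},\mathbb R^3)$ (weak solution of $\frac1{\mu\epsilon}\nabla\times\nabla\times\mathbf V+\tau^2\mathbf V+\mathbf f=\mathbf 0$ in $\mathbb R^3$). $\mathrm{dist}(D,B)$ is the Euclidean distance between the sets. *)

theory Defs
  imports "HOL-Analysis.Analysis"
begin

definition L2 :: "'a::euclidean_space set \<Rightarrow> ('a \<Rightarrow> 'b::euclidean_space) set" where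
  "L2 \<Omega> = {u. u \<in> borel_measurable (lebesgue_on \<Omega>) \<and>
                 integrable (lebesgue_on \<Omega>) (\<lambda>x. (norm (u x))^2)}"

definition L2norm :: "'a::euclidean_space set \<Rightarrow> ('a \<Rightarrow> 'b::euclidean_space) \<Rightarrow> real" where
  "L2norm \<Omega> u = sqrt (\<integral>x. (norm (u x))^2 \<partial>(lebesgue_on \<Omega>))"

fun smoothk :: "nat \<Rightarrow> ('a::euclidean_space \<Rightarrow> real) \<Rightarrow> bool" where
  "smoothk 0 g = continuous_on UNIV g"
| "smoothk (Suc k) g = (continuous_on UNIV g \<and> (\<forall>x. g differentiable (at x)) \<and>
      (\<forall>i\<in>Basis. smoothk k (\<lambda>x. frechet_derivative g (at x) i)))"

definition smooth_fun :: "('a::euclidean_space \<Rightarrow> real) \<Rightarrow> bool" where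
  "smooth_fun g = (\<forall>k. smoothk k g)"

definition tsupport :: "('a::euclidean_space \<Rightarrow> 'b::zero) \<Rightarrow> 'a set" where
  "tsupport g = closure {x. g x \<noteq> 0}"

definition test_fun :: "'a::euclidean_space set \<Rightarrow> ('a \<Rightarrow> real) \<Rightarrow> bool" where
  "test_fun \<Omega> g = (smooth_fun g \<and> compact (tsupport g) \<and> tsupport g \<subseteq> \<Omega>)"

definition vtest_fun :: "(real^3) set \<Rightarrow> (real^3 \<Rightarrow> real^3) \<Rightarrow> bool" where
  "vtest_fun \<Omega> \<phi> = (\<forall>i. test_fun \<Omega> (\<lambda>x. \<phi> x $ i))"

definition pdiff :: "(real^3 \<Rightarrow> real^3) \<Rightarrow> 3 \<Rightarrow> 3 \<Rightarrow> real^3 \<Rightarrow> real" where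
  "pdiff \<phi> i j x = frechet_derivative (\<lambda>y. \<phi> y $ i) (at x) (axis j 1)"

definition curl :: "(real^3 \<Rightarrow> real^3) \<Rightarrow> real^3 \<Rightarrow> real^3" where
  "curl \<phi> x = vector [pdiff \<phi> 3 2 x - pdiff \<phi> 2 3 x,
                       pdiff \<phi> 1 3 x - pdiff \<phi> 3 1 x,
                       pdiff \<phi> 2 1 x - pdiff \<phi> 1 2 x]"

definition weak_curl :: "(real^3) set \<Rightarrow> (real^3 \<Rightarrow> real^3) \<Rightarrow> (real^3 \<Rightarrow> real^3) \<Rightarrow> bool" where
  "weak_curl \<Omega> u w = (\<forall>\<phi>. vtest_fun \<Omega> \<phi> \<longrightarrow>
      (\<integral>x. u x \<bullet> curl \<phi> x \<partial>(lebesgue_on \<Omega>)) = (\<integral>x. w x \<bullet> \<phi> x \<partial>(lebesgue_on \<Omega>)))"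

definition Hcurl :: "(real^3) set \<Rightarrow> (real^3 \<Rightarrow> real^3) set" where
  "Hcurl \<Omega> = {u. u \<in> L2 \<Omega> \<and> (\<exists>w \<in> L2 \<Omega>. weak_curl \<Omega> u w)}"

text \<open>Vanishing tangential trace (nu x u = 0 on the boundary of Omega), for u with curl w,
  via Green's formula against all smooth compactly supported fields on R^3.\<close>
definition tangential_trace_zero :: "(real^3) set \<Rightarrow> (real^3 \<Rightarrow> real^3) \<Rightarrow> (real^3 \<Rightarrow> real^3) \<Rightarrow> bool" where
  "tangential_trace_zero \<Omega> u w = (\<forall>\<phi>. vtest_fun UNIV \<phi> \<longrightarrow>
      (\<integral>x. w x \<bullet> \<phi> x \<partial>(lebesgue_on \<Omega>)) = (\<integral>x. u x \<bullet> curl \<phi> x \<partial>(lebesgue_on \<Omega>)))"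

definition C1_L2 :: "(real^3) set \<Rightarrow> real \<Rightarrow> (real \<Rightarrow> real^3 \<Rightarrow> real^3) \<Rightarrow> (real \<Rightarrow> real^3 \<Rightarrow> real^3) \<Rightarrow> bool" where
  "C1_L2 \<Omega> T E E' = ((\<forall>t\<in>{0..T}. E t \<in> L2 \<Omega> \<and> E' t \<in> L2 \<Omega>) \<and>
     (\<forall>t\<in>{0..T}. ((\<lambda>h. L2norm \<Omega> (\<lambda>x. (1/h) *\<^sub>R (E (t+h) x - E t x) - E' t x)) \<longlongrightarrow> 0)
                    (at 0 within {h. t + h \<in> {0..T}})) \<and>
     (\<forall>t\<in>{0..T}. ((\<lambda>s. L2norm \<Omega> (\<lambda>x. E' s x - E' t x)) \<longlongrightarrow> 0) (at t within {0..T})))"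

definition maxwell_solution ::
  "(real^3) set \<Rightarrow> real \<Rightarrow> real \<Rightarrow> real \<Rightarrow> (real^3 \<Rightarrow> real \<Rightarrow> real^3) \<Rightarrow>
   (real \<Rightarrow> real^3 \<Rightarrow> real^3) \<Rightarrow> (real \<Rightarrow> real^3 \<Rightarrow> real^3) \<Rightarrow> bool" where
  "maxwell_solution D \<epsilon> \<mu> T J E H =
    (let \<Omega> = - closure D in
     \<exists>E' H' cE cH.
       C1_L2 \<Omega> T E E' \<and> C1_L2 \<Omega> T H H' \<and>
       (\<forall>t\<in>{0..T}. cE t \<in> L2 \<Omega> \<and> cH t \<in> L2 \<Omega> \<and>
          weak_curl \<Omega> (E t) (cE t) \<and> weak_curl \<Omega> (H t) (cH t) \<and>
          tangential_trace_zero \<Omega> (E t) (cE t) \<and>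
          (AE x in lebesgue_on \<Omega>. \<epsilon> *\<^sub>R E' t x - cH t x = J x t) \<and>
          (AE x in lebesgue_on \<Omega>. \<mu> *\<^sub>R H' t x + cE t x = 0)) \<and>
       L2norm \<Omega> (E 0) = 0 \<and> L2norm \<Omega> (H 0) = 0)"

text \<open>f in H^1(0,T): f and its weak derivative lie in L^2(0,T).
  We identify f with its continuous representative on [0,T] so that f(0) makes sense.\<close>
definition H1_interval :: "real \<Rightarrow> (real \<Rightarrow> real) \<Rightarrow> bool" where
  "H1_interval T f = (f \<in> L2 {0<..<T} \<and> continuous_on {0..T} f \<and>
     (\<exists>g \<in> L2 {0<..<T}. \<forall>\<phi>. test_fun {0<..<T} \<phi> \<longrightarrow>
        (\<integral>t. f t * deriv \<phi> t \<partial>(lebesgue_on {0<..<T})) = - (\<integral>t. g t * \<phi> t \<partial>(lebesgue_on {0<..<T}))))"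

definition C2_fun :: "(real^2 \<Rightarrow> real) \<Rightarrow> bool" where
  "C2_fun h = (\<exists>(h1 :: real^2 \<Rightarrow> ((real^2) \<Rightarrow>\<^sub>L real)) (h2 :: real^2 \<Rightarrow> ((real^2) \<Rightarrow>\<^sub>L ((real^2) \<Rightarrow>\<^sub>L real))).
      (\<forall>x. (h has_derivative blinfun_apply (h1 x)) (at x)) \<and>
      (\<forall>x. (h1 has_derivative blinfun_apply (h2 x)) (at x)) \<and>
      continuous_on UNIV h2)"

definition C2_boundary :: "(real^3) set \<Rightarrow> bool" where
  "C2_boundary D = (\<forall>q\<in>frontier D. \<exists>r>0. \<exists>(R :: real^3 \<Rightarrow> real^3) (h :: real^2 \<Rightarrow> real). orthogonal_transformation R \<and> C2_fun h \<and>
      (\<forall>x\<in>ball q r. x \<in> D \<longleftrightarrow>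
          R (x - q) $ 3 < h (vector [R (x - q) $ 1, R (x - q) $ 2])))"

definition ftilde :: "real \<Rightarrow> (real \<Rightarrow> real) \<Rightarrow> real \<Rightarrow> real" where
  "ftilde T f \<tau> = (LINT t:{0..T}|lborel. exp (- \<tau> * t) * f t)"

end

theory Submission
  imports Defs "HOL-Real_Asymp.Real_Asymp"
begin

text \<open>
  The Laplace transform turns the Maxwell system into a coercive variational problem in the exterior
  of \<open>D\<close>, with data of relative size \<open>exp (- \<tau> T)\<close> coming from the final time; fields are extended by
  zero across \<open>D\<close>. With \<open>\<kappa> = \<tau> sqrt (\<mu> \<epsilon>)\<close>, the indicator equals, up to such terms and a constant factor,
  the energy \<open>\<parallel>curl (W - V)\<parallel>\<^sup>2 + \<kappa>\<^sup>2 \<parallel>W - V\<parallel>\<^sup>2\<close>, and \<open>W\<close> minimises this energy among the fields vanishing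
  in \<open>D\<close>. Comparing \<open>W\<close> with a cutoff of \<open>V\<close> bounds it from above by the energy of \<open>V\<close> near and beyond \<open>D\<close>, which decays
  like \<open>exp (- 2 \<kappa> dist(D, B))\<close> by a weighted (Agmon) estimate. From below it is at least the norm of
  \<open>curl V\<close> in \<open>D\<close>; testing the equation of \<open>V\<close> with the curl of a field that is a Yukawa potential
  outside a small ball in \<open>D\<close> near \<open>B\<close> bounds this norm in terms of an explicit integral over \<open>B\<close>.
\<close>

section \<open>The Hilbert space of square integrable fields\<close>

text \<open>Two obstacles shape the proof. The curl equation of the magnetic field is known only
  against test fields supported in the open exterior, while the transformed problem has to be tested
  with every field whose extension by zero has a curl; such fields are reached by pushing supports
  across the local boundary graph and mollifying. And no formula for V is used: its size in D is
  found by duality, playing a residual that is large only in a small ball inside D against an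
  explicit integral over B. The integrand is governed by the part of p - x0 orthogonal to a, so the
  pole x0 must be chosen with p - x0 not parallel to a. Every loss (Agmon factor, position of the
  pole, powers of \<tau>) is at most exp(\<delta> \<tau>) for arbitrary \<delta> > 0 and so
  invisible in the logarithmic limit. The growth hypothesis keeps the pulse from spoiling the lower
  bound, and the condition on T makes the final-time error smaller than the main term.\<close>

lemma L2_UNIV:
  "u \<in> L2 UNIV \<longleftrightarrow> u \<in> borel_measurable lebesgue \<and> integrable lebesgue (\<lambda>x. (norm (u x))\<^sup>2)"
  by (simp add: L2_def lebesgue_on_UNIV_eq)

lemma L2_measurable [measurable_dest]: "u \<in> L2 UNIV \<Longrightarrow> u \<in> borel_measurable lebesgue"
  by (simp add: L2_UNIV)

lemma L2_dominated:
  fixes u :: "'a::euclidean_space \<Rightarrow> 'b::euclidean_space" and v :: "'a \<Rightarrow> 'c::euclidean_space"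
  assumes "v \<in> L2 UNIV" "u \<in> borel_measurable lebesgue" "\<And>x. norm (u x) \<le> c * norm (v x)"
  shows "u \<in> L2 UNIV"
proof -
  have "integrable lebesgue (\<lambda>x. (norm (u x))\<^sup>2)"
  proof (rule Bochner_Integration.integrable_bound)
    show "integrable lebesgue (\<lambda>x. c\<^sup>2 * (norm (v x))\<^sup>2)"
      using assms(1) by (simp add: L2_UNIV)
    show "AE x in lebesgue. norm ((norm (u x))\<^sup>2) \<le> norm (c\<^sup>2 * (norm (v x))\<^sup>2)"
      using power_mono[OF assms(3) norm_ge_zero, where n=2] by (simp add: power_mult_distrib)
  qed (use assms(2) in measurable)
  with assms(2) show ?thesis by (simp add: L2_UNIV)
qed

lemma L2_zero: "(\<lambda>x. 0) \<in> L2 UNIV"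
  by (simp add: L2_UNIV)

lemma L2_scaleR: "u \<in> L2 UNIV \<Longrightarrow> (\<lambda>x. c *\<^sub>R u x) \<in> L2 UNIV"
  by (rule L2_dominated[where c="\<bar>c\<bar>"]) auto

lemma L2_add:
  fixes u v :: "'a::euclidean_space \<Rightarrow> 'b::euclidean_space"
  assumes "u \<in> L2 UNIV" "v \<in> L2 UNIV"
  shows "(\<lambda>x. u x + v x) \<in> L2 UNIV"
proof -
  have m: "(\<lambda>x. u x + v x) \<in> borel_measurable lebesgue"
    using assms by (auto simp: L2_UNIV)
  have "integrable lebesgue (\<lambda>x. (norm (u x + v x))\<^sup>2)"
  proof (rule Bochner_Integration.integrable_bound)
    show "integrable lebesgue (\<lambda>x. 2 * (norm (u x))\<^sup>2 + 2 * (norm (v x))\<^sup>2)"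
      using assms by (simp add: L2_UNIV)
    have "(norm (u x + v x))\<^sup>2 \<le> 2 * (norm (u x))\<^sup>2 + 2 * (norm (v x))\<^sup>2" for x
    proof -
      have "(norm (u x + v x))\<^sup>2 \<le> (norm (u x) + norm (v x))\<^sup>2"
        by (intro power_mono norm_triangle_ineq) auto
      also have "\<dots> \<le> 2 * (norm (u x))\<^sup>2 + 2 * (norm (v x))\<^sup>2"
        using sum_squares_bound[of "norm (u x)" "norm (v x)"] by (simp add: power2_sum)
      finally show ?thesis .
    qed
    then show "AE x in lebesgue. norm ((norm (u x + v x))\<^sup>2) \<le> norm (2 * (norm (u x))\<^sup>2 + 2 * (norm (v x))\<^sup>2)"
      by auto
  qed (use m in measurable)
  with m show ?thesis by (simp add: L2_UNIV)
qed

lemma L2_diff: "u \<in> L2 UNIV \<Longrightarrow> v \<in> L2 UNIV \<Longrightarrow> (\<lambda>x. u x - v x) \<in> L2 UNIV"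
  using L2_add[of u "\<lambda>x. (-1) *\<^sub>R v x"] L2_scaleR[of v "-1"] by simp

lemma L2_uminus: "u \<in> L2 UNIV \<Longrightarrow> (\<lambda>x. - u x) \<in> L2 UNIV"
  using L2_scaleR[of u "-1"] by simp

lemma L2_mult:
  fixes u :: "'a::euclidean_space \<Rightarrow> 'b::euclidean_space"
  assumes "u \<in> L2 UNIV" "m \<in> borel_measurable lebesgue" "\<And>x. \<bar>m x\<bar> \<le> c"
  shows "(\<lambda>x. m x *\<^sub>R u x) \<in> L2 UNIV"
  using assms by (intro L2_dominated[OF assms(1), where c=c]) (auto intro: mult_right_mono)

lemma L2_AE:
  assumes "u \<in> L2 UNIV" "AE x in lebesgue. u x = v x" "v \<in> borel_measurable lebesgue"
  shows "v \<in> L2 UNIV"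
proof -
  have "integrable lebesgue (\<lambda>x. (norm (v x))\<^sup>2) = integrable lebesgue (\<lambda>x. (norm (u x))\<^sup>2)"
    using assms by (intro integrable_cong_AE) (auto simp: L2_UNIV)
  with assms show ?thesis by (simp add: L2_UNIV)
qed

lemma L2_inner_integrable:
  assumes "u \<in> L2 UNIV" "v \<in> L2 UNIV"
  shows "integrable lebesgue (\<lambda>x. u x \<bullet> v x)"
proof (rule Bochner_Integration.integrable_bound)
  show "integrable lebesgue (\<lambda>x. (norm (u x))\<^sup>2 + (norm (v x))\<^sup>2)"
    using assms by (simp add: L2_UNIV)
  have "\<bar>u x \<bullet> v x\<bar> \<le> (norm (u x))\<^sup>2 + (norm (v x))\<^sup>2" for x
  proof -
    have "\<bar>u x \<bullet> v x\<bar> \<le> norm (u x) * norm (v x)" by (rule Cauchy_Schwarz_ineq2)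
    moreover have "2 * (norm (u x) * norm (v x)) \<le> (norm (u x))\<^sup>2 + (norm (v x))\<^sup>2"
      using sum_squares_bound[of "norm (u x)" "norm (v x)"] by simp
    moreover have "0 \<le> norm (u x) * norm (v x)" by simp
    ultimately show ?thesis by linarith
  qed
  then show "AE x in lebesgue. norm (u x \<bullet> v x) \<le> norm ((norm (u x))\<^sup>2 + (norm (v x))\<^sup>2)"
    by auto
qed (use assms in \<open>auto simp: L2_UNIV\<close>)

section \<open>Square integrable fields modulo null sets\<close>

definition L2_rel :: "('a::euclidean_space \<Rightarrow> 'b::euclidean_space) \<Rightarrow> ('a \<Rightarrow> 'b) \<Rightarrow> bool" where
  "L2_rel u v \<longleftrightarrow> u \<in> L2 UNIV \<and> v \<in> L2 UNIV \<and> (AE x in lebesgue. u x = v x)"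

\<comment> \<open>The equivalence is partial: a function that is not square integrable is not
  related to itself, so the rules for \<open>lsq_of\<close> need membership in
  \<open>L2 UNIV\<close>. A type, rather than a set of functions with a seminorm, is wanted because
  integrals and derivatives of curves use the type class banach.\<close>
quotient_type (overloaded) ('a, 'b) lsq = "'a::euclidean_space \<Rightarrow> 'b::euclidean_space" / partial: L2_rel
  morphisms rep_lsq lsq_of
proof (rule part_equivpI)
  show "\<exists>u. L2_rel u u"
    by (rule exI[of _ "\<lambda>x. 0"]) (simp add: L2_rel_def L2_zero)
  show "symp L2_rel"
    by (rule sympI) (auto simp: L2_rel_def elim: eventually_mono)
  show "transp L2_rel"
  proof (rule transpI)
    fix u v w
    assume "L2_rel u v" "L2_rel v w"
    then show "L2_rel u w"
      unfolding L2_rel_def by (auto elim: eventually_elim2)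
  qed
qed

lemma rep_lsq_L2: "rep_lsq U \<in> L2 UNIV"
  using Quotient3_rep_reflp[OF Quotient3_lsq, of U] by (simp add: L2_rel_def)

lemma lsq_of_rep: "lsq_of (rep_lsq U) = U"
  using Quotient3_abs_rep[OF Quotient3_lsq] .

lemma lsq_of_eq_iff:
  assumes "u \<in> L2 UNIV" "v \<in> L2 UNIV"
  shows "lsq_of u = lsq_of v \<longleftrightarrow> (AE x in lebesgue. u x = v x)"
  using Quotient3_rel[OF Quotient3_lsq, of u v] assms by (auto simp: L2_rel_def)

lemma lsq_cases: obtains u where "u \<in> L2 UNIV" "U = lsq_of u"
  using rep_lsq_L2 lsq_of_rep by metis

instantiation lsq :: (euclidean_space, euclidean_space) real_vector
begin

lift_definition zero_lsq :: "('a, 'b) lsq" is "\<lambda>x. 0"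
  by (simp add: L2_rel_def L2_zero)

lift_definition plus_lsq :: "('a, 'b) lsq \<Rightarrow> ('a, 'b) lsq \<Rightarrow> ('a, 'b) lsq" is "\<lambda>u v x. u x + v x"
  unfolding L2_rel_def by (auto intro!: L2_add elim: eventually_elim2)

lift_definition minus_lsq :: "('a, 'b) lsq \<Rightarrow> ('a, 'b) lsq \<Rightarrow> ('a, 'b) lsq" is "\<lambda>u v x. u x - v x"
  unfolding L2_rel_def by (auto intro!: L2_diff elim: eventually_elim2)

lift_definition uminus_lsq :: "('a, 'b) lsq \<Rightarrow> ('a, 'b) lsq" is "\<lambda>u x. - u x"
  unfolding L2_rel_def by (auto intro!: L2_uminus elim: eventually_mono)

lift_definition scaleR_lsq :: "real \<Rightarrow> ('a, 'b) lsq \<Rightarrow> ('a, 'b) lsq" is "\<lambda>c u x. c *\<^sub>R u x"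
  unfolding L2_rel_def by (auto intro!: L2_scaleR elim: eventually_mono)

instance
proof
  fix U V W :: "('a, 'b) lsq" and c d :: real
  show "U + V + W = U + (V + W)"
    by transfer (auto simp: L2_rel_def algebra_simps intro!: L2_add)
  show "U + V = V + U"
    by transfer (auto simp: L2_rel_def algebra_simps intro!: L2_add)
  show "0 + U = U"
    by transfer (auto simp: L2_rel_def)
  show "- U + U = 0"
    by transfer (auto simp: L2_rel_def L2_zero)
  show "U - V = U + - V"
    by transfer (auto simp: L2_rel_def intro!: L2_diff)
  show "c *\<^sub>R (U + V) = c *\<^sub>R U + c *\<^sub>R V"
    by transfer (auto simp: L2_rel_def algebra_simps intro!: L2_add L2_scaleR)
  show "(c + d) *\<^sub>R U = c *\<^sub>R U + d *\<^sub>R U"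
    by transfer (auto simp: L2_rel_def algebra_simps intro!: L2_add L2_scaleR)
  show "c *\<^sub>R d *\<^sub>R U = (c * d) *\<^sub>R U"
    by transfer (auto simp: L2_rel_def algebra_simps intro!: L2_scaleR)
  show "1 *\<^sub>R U = U"
    by transfer (auto simp: L2_rel_def)
qed

end

instantiation lsq :: (euclidean_space, euclidean_space) real_inner
begin

lift_definition inner_lsq :: "('a, 'b) lsq \<Rightarrow> ('a, 'b) lsq \<Rightarrow> real" is "\<lambda>u v. \<integral>x. u x \<bullet> v x \<partial>lebesgue"
  unfolding L2_rel_def by (intro integral_cong_AE) (auto simp: L2_UNIV elim: eventually_elim2)

definition norm_lsq :: "('a, 'b) lsq \<Rightarrow> real" where "norm_lsq U = sqrt (inner U U)"
definition sgn_lsq :: "('a, 'b) lsq \<Rightarrow> ('a, 'b) lsq" where "sgn_lsq U = inverse (norm U) *\<^sub>R U"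
definition dist_lsq :: "('a, 'b) lsq \<Rightarrow> ('a, 'b) lsq \<Rightarrow> real" where "dist_lsq U V = norm (U - V)"
definition uniformity_lsq :: "(('a, 'b) lsq \<times> ('a, 'b) lsq) filter" where
  "uniformity_lsq = (INF e\<in>{0<..}. principal {(U, V). dist U V < e})"
definition open_lsq :: "('a, 'b) lsq set \<Rightarrow> bool" where
  "open_lsq S \<longleftrightarrow> (\<forall>U\<in>S. \<forall>\<^sub>F (U', V) in uniformity. U' = U \<longrightarrow> V \<in> S)"

instance
proof
  fix U V W :: "('a, 'b) lsq" and c :: real and S :: "('a, 'b) lsq set"
  show "U \<bullet> V = V \<bullet> U"
    by transfer (auto simp: inner_commute)
  show "(U + V) \<bullet> W = U \<bullet> W + V \<bullet> W"
    by transfer (auto simp: L2_rel_def inner_add_left L2_inner_integrable)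
  show "c *\<^sub>R U \<bullet> V = c * (U \<bullet> V)"
    by transfer auto
  show "0 \<le> U \<bullet> U"
    by transfer (auto intro: integral_nonneg_AE)
  show "U \<bullet> U = 0 \<longleftrightarrow> U = 0"
  proof transfer
    fix u :: "'a \<Rightarrow> 'b"
    assume "L2_rel u u"
    then have u: "u \<in> L2 UNIV" by (simp add: L2_rel_def)
    have "(\<integral>x. u x \<bullet> u x \<partial>lebesgue) = 0 \<longleftrightarrow> (AE x in lebesgue. u x \<bullet> u x = 0)"
      using L2_inner_integrable[OF u u] by (intro integral_nonneg_eq_0_iff_AE) auto
    then show "(\<integral>x. u x \<bullet> u x \<partial>lebesgue) = 0 \<longleftrightarrow> L2_rel u (\<lambda>x. 0)"
      using u by (simp add: L2_rel_def L2_zero)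
  qed
qed (rule norm_lsq_def sgn_lsq_def dist_lsq_def uniformity_lsq_def open_lsq_def)+

end

lemma lsq_of_simps:
  "lsq_of (\<lambda>x. 0) = 0"
  "u \<in> L2 UNIV \<Longrightarrow> v \<in> L2 UNIV \<Longrightarrow> lsq_of (\<lambda>x. u x + v x) = lsq_of u + lsq_of v"
  "u \<in> L2 UNIV \<Longrightarrow> v \<in> L2 UNIV \<Longrightarrow> lsq_of (\<lambda>x. u x - v x) = lsq_of u - lsq_of v"
  "u \<in> L2 UNIV \<Longrightarrow> lsq_of (\<lambda>x. - u x) = - lsq_of u"
  "u \<in> L2 UNIV \<Longrightarrow> lsq_of (\<lambda>x. c *\<^sub>R u x) = c *\<^sub>R lsq_of u"
  by (auto simp: zero_lsq.abs_eq plus_lsq.abs_eq minus_lsq.abs_eq uminus_lsq.abs_eq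
      scaleR_lsq.abs_eq L2_rel_def)

lemma inner_lsq_of:
  "u \<in> L2 UNIV \<Longrightarrow> v \<in> L2 UNIV \<Longrightarrow> lsq_of u \<bullet> lsq_of v = (\<integral>x. u x \<bullet> v x \<partial>lebesgue)"
  by (simp add: inner_lsq.abs_eq L2_rel_def)

lemma norm_lsq_of_sq:
  "u \<in> L2 UNIV \<Longrightarrow> (norm (lsq_of u))\<^sup>2 = (\<integral>x. (norm (u x))\<^sup>2 \<partial>lebesgue)"
  by (simp add: power2_norm_eq_inner inner_lsq_of)

lemma norm_lsq_of_eq:
  "u \<in> L2 UNIV \<Longrightarrow> norm (lsq_of u) = L2norm UNIV u"
  unfolding L2norm_def lebesgue_on_UNIV_eq by (simp add: norm_lsq_def inner_lsq_of power2_norm_eq_inner)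

lemma nn_integral_norm_lsq:
  assumes "u \<in> L2 UNIV"
  shows "(\<integral>\<^sup>+x. ennreal ((norm (u x))\<^sup>2) \<partial>lebesgue) = ennreal ((norm (lsq_of u))\<^sup>2)"
  using assms by (simp add: norm_lsq_of_sq L2_UNIV nn_integral_eq_integral)

lemma lsq_of_cong_AE:
  assumes "u \<in> L2 UNIV" "v \<in> borel_measurable lebesgue" "AE x in lebesgue. u x = v x"
  shows "v \<in> L2 UNIV" "lsq_of u = lsq_of v"
  using L2_AE[OF assms(1) assms(3,2)] assms lsq_of_eq_iff by auto

lemma Cauchy_fast_subseq:
  fixes X :: "nat \<Rightarrow> 'a::metric_space"
  assumes "Cauchy X"
  obtains r where "strict_mono r" "\<And>n. dist (X (r (Suc n))) (X (r n)) < (1/2)^n"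
proof -
  have "\<exists>N. \<forall>m\<ge>N. \<forall>k\<ge>N. dist (X m) (X k) < (1/2)^n" for n :: nat
    using assms unfolding Cauchy_def by (meson zero_less_power half_gt_zero zero_less_one)
  then obtain N where N: "\<And>n m k. m \<ge> N n \<Longrightarrow> k \<ge> N n \<Longrightarrow> dist (X m) (X k) < (1/2)^n"
    by metis
  \<comment> \<open>Summing \<open>Suc (N i)\<close> makes \<open>r\<close> strictly increasing and
    still at least \<open>N n\<close>.\<close>
  define r where "r n = (\<Sum>i\<le>n. Suc (N i))" for n
  have "strict_mono r" by (simp add: strict_mono_Suc_iff r_def)
  moreover have "N n \<le> r n" for n
    unfolding r_def by (rule order_trans[OF _ member_le_sum[of n]]) auto
  then have "dist (X (r (Suc n))) (X (r n)) < (1/2)^n" for n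
    using N[of n "r (Suc n)" "r n"] strict_mono_leD[OF \<open>strict_mono r\<close>, of n "Suc n"] order_trans by auto
  ultimately show ?thesis using that by blast
qed

text \<open>Riesz-Fischer: along a fast subsequence the representatives converge almost everywhere,
  and Fatou turns this into convergence in norm.\<close>

instance lsq :: (euclidean_space, euclidean_space) complete_space
proof
  fix X :: "nat \<Rightarrow> ('a, 'b) lsq"
  assume C: "Cauchy X"
  obtain r where r: "strict_mono r" and rd: "\<And>n. dist (X (r (Suc n))) (X (r n)) < (1/2)^n"
    using Cauchy_fast_subseq[OF C] by blast
  define u where "u n = rep_lsq (X (r n))" for n
  have u: "u n \<in> L2 UNIV" and lu: "lsq_of (u n) = X (r n)" for n
    by (simp_all add: u_def rep_lsq_L2 lsq_of_rep)
  note [measurable] = L2_measurable[OF u]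
  define d where "d n x = u (Suc n) x - u n x" for n x
  have d: "d n \<in> L2 UNIV" and ld: "lsq_of (d n) = X (r (Suc n)) - X (r n)" for n
    unfolding d_def using u lu by (auto simp: L2_diff lsq_of_simps)
  note [measurable] = L2_measurable[OF d]
  \<comment> \<open>The squared norms of the increments are below \<open>(1/4)^n\<close>; the weight
    \<open>2^n\<close> leaves a summable bound and is still strong enough to control the unsquared
    increments pointwise.\<close>
  have dn: "(\<integral>\<^sup>+x. ennreal (2^n * (norm (d n x))\<^sup>2) \<partial>lebesgue) \<le> ennreal ((1/2)^n)" for n
  proof -
    have "(\<integral>\<^sup>+x. ennreal (2^n * (norm (d n x))\<^sup>2) \<partial>lebesgue) = ennreal (2^n) * ennreal ((norm (lsq_of (d n)))\<^sup>2)"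
      by (subst nn_integral_norm_lsq[OF d, symmetric], subst nn_integral_cmult[symmetric])
        (auto simp: ennreal_mult)
    also have "\<dots> = ennreal (2^n * (norm (lsq_of (d n)))\<^sup>2)"
      by (simp add: ennreal_mult)
    also have "\<dots> \<le> ennreal (2^n * ((1/2)^n)\<^sup>2)"
      using rd[of n] by (intro ennreal_leI mult_left_mono power_mono) (auto simp: ld dist_norm)
    also have "2^n * ((1/2)^n)\<^sup>2 = (1/2::real)^n"
      by (simp add: power2_eq_square flip: power_mult_distrib mult.assoc)
    finally show ?thesis .
  qed
  have "(\<integral>\<^sup>+x. (\<Sum>n. ennreal (2^n * (norm (d n x))\<^sup>2)) \<partial>lebesgue)
      = (\<Sum>n. \<integral>\<^sup>+x. ennreal (2^n * (norm (d n x))\<^sup>2) \<partial>lebesgue)"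
    by (rule nn_integral_suminf) simp
  also have "\<dots> \<le> (\<Sum>n. ennreal ((1/2)^n))"
    by (intro suminf_le dn) auto
  also have "\<dots> = ennreal (\<Sum>n. (1/2)^n)"
    by (intro suminf_ennreal2) (auto intro: summable_geometric)
  also have "\<dots> < \<infinity>" by simp
  finally have "AE x in lebesgue. (\<Sum>n. ennreal (2^n * (norm (d n x))\<^sup>2)) \<noteq> \<infinity>"
    by (intro nn_integral_PInf_AE) auto
  then have ae: "AE x in lebesgue. convergent (\<lambda>n. u n x)"
  proof eventually_elim
    case (elim x)
    then have s1: "summable (\<lambda>n. 2^n * (norm (d n x))\<^sup>2)"
      by (intro summable_suminf_not_top) (auto simp: top.not_eq_extremum less_top)
    have s2: "summable (\<lambda>n. (1/2::real)^n)" by (rule summable_geometric) simp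
    \<comment> \<open>Where \<open>norm (d n x)\<close> exceeds \<open>(1/2)^n\<close>, the factor
      \<open>2^n * norm (d n x)\<close> is at least 1, so the weighted square dominates.\<close>
    have "norm (d n x) \<le> (1/2)^n + 2^n * (norm (d n x))\<^sup>2" for n
    proof -
      define a where "a = norm (d n x)"
      have "0 \<le> a" by (simp add: a_def)
      have "a \<le> (1/2)^n + 2^n * a\<^sup>2"
      proof (cases "a \<le> (1/2)^n")
        case True then show ?thesis by (simp add: add_increasing2)
      next
        case False
        then have "1 \<le> 2^n * a" by (simp add: field_simps power_divide)
        then have "1 * a \<le> (2^n * a) * a" using \<open>0 \<le> a\<close> by (intro mult_right_mono) auto
        then show ?thesis by (simp add: power2_eq_square add_increasing mult.assoc)
      qed
      then show ?thesis by (simp add: a_def)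
    qed
    then have "summable (\<lambda>n. d n x)"
      by (intro summable_comparison_test'[OF summable_add[OF s2 s1], of 0]) auto
    then have "convergent (\<lambda>n. \<Sum>k<n. d k x)" by (simp add: summable_iff_convergent)
    then have "convergent (\<lambda>n. u n x - u 0 x)"
      by (simp add: d_def sum_lessThan_telescope[where f="\<lambda>n. u n x"])
    then show ?case by (rule convergent_diff_const_right_iff[THEN iffD1])
  qed
  define w where "w x = lim (\<lambda>n. u n x)" for x
  have [measurable]: "w \<in> borel_measurable lebesgue"
    unfolding w_def by (rule borel_measurable_lim_metric) auto
  have aw: "AE x in lebesgue. (\<lambda>n. u n x) \<longlonglongrightarrow> w x"
    using ae by eventually_elim (simp add: w_def convergent_LIMSEQ_iff)
  \<comment> \<open>Fatou lets the second index tend to infinity, so the Cauchy bound survives with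
    \<open>w\<close> in place of \<open>u m\<close>.\<close>
  have key: "(\<integral>\<^sup>+x. ennreal ((norm (u n x - w x))\<^sup>2) \<partial>lebesgue) \<le> ennreal (e\<^sup>2)"
    if "e \<ge> 0" "\<And>m. m \<ge> n \<Longrightarrow> dist (X (r n)) (X (r m)) \<le> e" for n e
  proof -
    have "(\<integral>\<^sup>+x. ennreal ((norm (u n x - w x))\<^sup>2) \<partial>lebesgue)
      = (\<integral>\<^sup>+x. liminf (\<lambda>m. ennreal ((norm (u n x - u m x))\<^sup>2)) \<partial>lebesgue)"
    proof (rule nn_integral_cong_AE)
      show "AE x in lebesgue. ennreal ((norm (u n x - w x))\<^sup>2) = liminf (\<lambda>m. ennreal ((norm (u n x - u m x))\<^sup>2))"
        using aw
      proof eventually_elim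
        case (elim x)
        have "(\<lambda>m. ennreal ((norm (u n x - u m x))\<^sup>2)) \<longlonglongrightarrow> ennreal ((norm (u n x - w x))\<^sup>2)"
          by (intro tendsto_ennrealI tendsto_power tendsto_norm tendsto_diff tendsto_const elim)
        then show ?case by (rule lim_imp_Liminf[OF sequentially_bot, symmetric])
      qed
    qed
    also have "\<dots> \<le> liminf (\<lambda>m. \<integral>\<^sup>+x. ennreal ((norm (u n x - u m x))\<^sup>2) \<partial>lebesgue)"
      by (rule nn_integral_liminf) simp
    also have "(\<lambda>m. \<integral>\<^sup>+x. ennreal ((norm (u n x - u m x))\<^sup>2) \<partial>lebesgue) = (\<lambda>m. ennreal ((dist (X (r n)) (X (r m)))\<^sup>2))"
      using nn_integral_norm_lsq[OF L2_diff[OF u u]] by (simp add: lsq_of_simps u lu dist_norm)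
    also have "liminf \<dots> \<le> ennreal (e\<^sup>2)"
    proof (rule order_trans[OF Liminf_le_Limsup])
      show "limsup (\<lambda>m. ennreal ((dist (X (r n)) (X (r m)))\<^sup>2)) \<le> ennreal (e\<^sup>2)"
        using that by (intro Limsup_bounded) (auto simp: eventually_sequentially intro!: exI[of _ n] ennreal_leI power_mono)
    qed simp
    finally show ?thesis .
  qed
  have cauchy: "\<exists>N. \<forall>n\<ge>N. \<forall>m\<ge>N. dist (X (r n)) (X (r m)) < e" if "e > 0" for e
    using Cauchy_subseq_Cauchy[OF C r] that unfolding Cauchy_def by (auto simp: o_def)
  have w: "w \<in> L2 UNIV" 
  proof -
    obtain N where N: "\<And>n m. n \<ge> N \<Longrightarrow> m \<ge> N \<Longrightarrow> dist (X (r n)) (X (r m)) < 1"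
      using cauchy[of 1] by auto
    have "(\<integral>\<^sup>+x. ennreal ((norm (u N x - w x))\<^sup>2) \<partial>lebesgue) \<le> ennreal (1\<^sup>2)"
      using N by (intro key) (auto simp: less_imp_le)
    then have "(\<lambda>x. u N x - w x) \<in> L2 UNIV"
      by (simp add: L2_UNIV integrable_iff_bounded) (metis ennreal_1 ennreal_less_top order_le_less_trans infinity_ennreal_def)
    from L2_diff[OF u[of N] this] show ?thesis by simp
  qed
  have "(\<lambda>n. X (r n)) \<longlonglongrightarrow> lsq_of w"
  proof (rule metric_LIMSEQ_I)
    fix e :: real assume "e > 0"
    obtain N where N: "\<And>n m. n \<ge> N \<Longrightarrow> m \<ge> N \<Longrightarrow> dist (X (r n)) (X (r m)) < e/2"
      using cauchy[of "e/2"] \<open>e > 0\<close> by auto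
    show "\<exists>N. \<forall>n\<ge>N. dist (X (r n)) (lsq_of w) < e"
    proof (intro exI allI impI)
      fix n assume "N \<le> n"
      then have "ennreal ((norm (lsq_of (\<lambda>x. u n x - w x)))\<^sup>2) \<le> ennreal ((e/2)\<^sup>2)"
        using nn_integral_norm_lsq[OF L2_diff[OF u w]] key[of "e/2" n] N \<open>e > 0\<close>
        by (simp add: less_imp_le)
      then have "norm (lsq_of (\<lambda>x. u n x - w x)) \<le> e/2"
        using \<open>e > 0\<close> by (auto intro: power2_le_imp_le)
      then show "dist (X (r n)) (lsq_of w) < e"
        using \<open>e > 0\<close> by (simp add: lsq_of_simps u w lu dist_norm)
    qed
  qed
  then have "X \<longlonglongrightarrow> lsq_of w"
    using Cauchy_converges_subseq[OF C r] by (simp add: o_def)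
  then show "convergent X" by (auto simp: convergent_def)
qed

instance lsq :: (euclidean_space, euclidean_space) banach ..

section \<open>Smooth functions and the weak curl\<close>

text \<open>Local version of \<open>smoothk\<close>: square root, reciprocal and the Yukawa kernel
  are smooth only away from 0. Derivatives are full ones, \<open>at x\<close>, which is why the
  calculus rules below assume open sets.\<close>

fun smoothk_on :: "nat \<Rightarrow> 'a::euclidean_space set \<Rightarrow> ('a \<Rightarrow> real) \<Rightarrow> bool" where
  "smoothk_on 0 S g = continuous_on S g"
| "smoothk_on (Suc k) S g = (continuous_on S g \<and> (\<forall>x\<in>S. g differentiable (at x)) \<and>
      (\<forall>i\<in>Basis. smoothk_on k S (\<lambda>x. frechet_derivative g (at x) i)))"

lemma smoothk_iff_smoothk_on: "smoothk k g \<longleftrightarrow> smoothk_on k UNIV g"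
  by (induction k arbitrary: g) auto

definition smooth_on :: "'a::euclidean_space set \<Rightarrow> ('a \<Rightarrow> real) \<Rightarrow> bool" where
  "smooth_on S g \<longleftrightarrow> (\<forall>k. smoothk_on k S g)"

lemma smooth_fun_iff: "smooth_fun g \<longleftrightarrow> smooth_on UNIV g"
  by (simp add: smooth_fun_def smooth_on_def smoothk_iff_smoothk_on)

lemma frechet_derivative_cong_open:
  assumes "open S" "x \<in> S" "\<And>y. y \<in> S \<Longrightarrow> f y = g y"
  shows "frechet_derivative f (at x) = frechet_derivative g (at x)"
proof -
  have "(f has_derivative f') (at x) \<longleftrightarrow> (g has_derivative f') (at x)" for f'
    using assms has_derivative_transform_within_open[of f f' x UNIV S g]
      has_derivative_transform_within_open[of g f' x UNIV S f] by auto
  then show ?thesis by (simp add: frechet_derivative_def)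
qed

lemma smoothk_on_cong:
  assumes "open S" "\<And>x. x \<in> S \<Longrightarrow> f x = g x" "smoothk_on k S f"
  shows "smoothk_on k S g"
  using assms(2,3)
proof (induction k arbitrary: f g)
  case 0 then show ?case using continuous_on_cong[of S S f g] by simp
next
  case (Suc k)
  have eq: "frechet_derivative f (at x) = frechet_derivative g (at x)" if "x \<in> S" for x
    using frechet_derivative_cong_open[OF assms(1) that Suc.prems(1)] by auto
  have "g differentiable (at x)" if "x \<in> S" for x
  proof -
    have "(f has_derivative frechet_derivative f (at x)) (at x)"
      using Suc.prems(2) that by (simp add: frechet_derivative_works)
    then show ?thesis
      using has_derivative_transform_within_open[OF _ assms(1) that] Suc.prems(1)
      unfolding differentiable_def by blast
  qed
  moreover have "smoothk_on k S (\<lambda>x. frechet_derivative g (at x) i)" if "i \<in> Basis" for i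
    by (rule Suc.IH[of "\<lambda>x. frechet_derivative f (at x) i"]) (use Suc.prems(2) that eq in simp_all)
  ultimately show ?case using Suc.prems continuous_on_cong[of S S f g] by simp
qed

lemma smoothk_on_Suc: "smoothk_on (Suc k) S g \<Longrightarrow> smoothk_on k S g"
  by (induction k arbitrary: g) auto

lemma smoothk_on_subset: "smoothk_on k S g \<Longrightarrow> T \<subseteq> S \<Longrightarrow> smoothk_on k T g"
  by (induction k arbitrary: g) (auto intro: continuous_on_subset)

lemma smoothk_on_Union:
  assumes "\<And>S. S \<in> F \<Longrightarrow> open S" "\<And>S. S \<in> F \<Longrightarrow> smoothk_on k S g"
  shows "smoothk_on k (\<Union>F) g"
  using assms(2)
proof (induction k arbitrary: g)
  case 0 then show ?case using continuous_on_open_Union[of F g] assms(1) by simp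
next
  case (Suc k)
  have "smoothk_on k (\<Union>F) (\<lambda>x. frechet_derivative g (at x) i)" if "i \<in> Basis" for i
    using Suc.prems that by (intro Suc.IH) auto
  then show ?case using Suc.prems continuous_on_open_Union[of F g] assms(1) by auto
qed

text \<open>Derivatives are unique, so any explicit derivative may stand in for
  \<open>frechet_derivative\<close>; most inductions on the order of smoothness go through this
  rule.\<close>

lemma smoothk_on_SucI:
  assumes "open S" "\<And>x. x \<in> S \<Longrightarrow> (g has_derivative g' x) (at x)"
    "\<And>i. i \<in> Basis \<Longrightarrow> smoothk_on k S (\<lambda>x. g' x i)"
  shows "smoothk_on (Suc k) S g"
proof -
  have eq: "g' x = frechet_derivative g (at x)" if "x \<in> S" for x
    using frechet_derivative_at[OF assms(2)[OF that]] .
  have "smoothk_on k S (\<lambda>x. frechet_derivative g (at x) i)" if "i \<in> Basis" for i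
    using smoothk_on_cong[OF assms(1) _ assms(3)[OF that]] eq by auto
  moreover have "continuous_on S g"
    using assms(2) by (intro continuous_at_imp_continuous_on) (auto intro: has_derivative_continuous)
  ultimately show ?thesis using assms(2) by (auto simp: differentiable_def)
qed

lemma smoothk_on_SucD:
  assumes "smoothk_on (Suc k) S g" "x \<in> S"
  shows "(g has_derivative frechet_derivative g (at x)) (at x)"
  using assms by (simp add: frechet_derivative_works)

lemma smoothk_on_const: "open S \<Longrightarrow> smoothk_on k S (\<lambda>x. c)"
proof (induction k arbitrary: c)
  case (Suc k)
  then show ?case by (intro smoothk_on_SucI[where g'="\<lambda>_ _. 0"]) auto
qed simp

lemma smoothk_on_linear: "open S \<Longrightarrow> bounded_linear g \<Longrightarrow> smoothk_on k S g"
proof (induction k)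
  case 0 then show ?case by (simp add: linear_continuous_on)
next
  case (Suc k)
  then show ?case
    by (intro smoothk_on_SucI[where g'="\<lambda>_. g"]) (auto intro: bounded_linear_imp_has_derivative smoothk_on_const)
qed

lemma smoothk_on_add:
  assumes "open S" shows "smoothk_on k S f \<Longrightarrow> smoothk_on k S g \<Longrightarrow> smoothk_on k S (\<lambda>x. f x + g x)"
proof (induction k arbitrary: f g)
  case 0 then show ?case by (auto intro: continuous_intros)
next
  case (Suc k)
  show ?case
    by (rule smoothk_on_SucI[OF assms has_derivative_add[OF smoothk_on_SucD[OF Suc.prems(1)] smoothk_on_SucD[OF Suc.prems(2)]]])
      (use Suc in auto)
qed

lemma smoothk_on_mult:
  assumes "open S" shows "smoothk_on k S f \<Longrightarrow> smoothk_on k S g \<Longrightarrow> smoothk_on k S (\<lambda>x. f x * g x)"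
proof (induction k arbitrary: f g)
  case 0 then show ?case by (auto intro: continuous_intros)
next
  case (Suc k)
  show ?case
    by (rule smoothk_on_SucI[OF assms has_derivative_mult[OF smoothk_on_SucD[OF Suc.prems(1)] smoothk_on_SucD[OF Suc.prems(2)]]])
      (use Suc smoothk_on_Suc[OF Suc.prems(1)] smoothk_on_Suc[OF Suc.prems(2)] in \<open>auto intro!: smoothk_on_add assms\<close>)
qed

text \<open>With a real outer function the chain rule yields a derivative of \<open>g\<close> times
  a composition of lower order, so the induction on \<open>k\<close> closes under products.\<close>

lemma smoothk_on_compose:
  fixes h :: "real \<Rightarrow> real"
  assumes S: "open S" and gT: "\<And>x. x \<in> S \<Longrightarrow> g x \<in> T"
  shows "smoothk_on k T h \<Longrightarrow> smoothk_on k S g \<Longrightarrow> smoothk_on k S (\<lambda>x. h (g x))"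
proof (induction k arbitrary: h)
  case 0 then show ?case using gT by (auto intro: continuous_on_compose2)
next
  case (Suc k)
  show ?case
  proof (rule smoothk_on_SucI[OF S])
    fix x assume x: "x \<in> S"
    note dh = smoothk_on_SucD[OF Suc.prems(1) gT[OF x]]
    have "(\<lambda>v. frechet_derivative h (at (g x)) (frechet_derivative g (at x) v))
        = (\<lambda>v. frechet_derivative g (at x) v * frechet_derivative h (at (g x)) 1)"
    proof
      fix v
      show "frechet_derivative h (at (g x)) (frechet_derivative g (at x) v)
          = frechet_derivative g (at x) v * frechet_derivative h (at (g x)) 1"
        using linear_scale[OF has_derivative_linear[OF dh], of "frechet_derivative g (at x) v" 1] by simp
    qed
    moreover have "((\<lambda>x. h (g x)) has_derivative (\<lambda>v. frechet_derivative h (at (g x)) (frechet_derivative g (at x) v))) (at x)"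
      using has_derivative_compose[OF smoothk_on_SucD[OF Suc.prems(2) x] dh] .
    ultimately show "((\<lambda>x. h (g x)) has_derivative (\<lambda>v. frechet_derivative g (at x) v * frechet_derivative h (at (g x)) 1)) (at x)"
      by (simp only:)
  next
    fix i :: 'a assume "i \<in> Basis"
    then show "smoothk_on k S (\<lambda>x. frechet_derivative g (at x) i * frechet_derivative h (at (g x)) 1)"
      using Suc.prems smoothk_on_Suc[OF Suc.prems(2)]
      by (intro smoothk_on_mult[OF S _ Suc.IH[where h="\<lambda>y. frechet_derivative h (at y) 1"]]) auto
  qed
qed

lemma smoothk_on_SucI_real:
  fixes h :: "real \<Rightarrow> real"
  assumes "open S" "\<And>x. x \<in> S \<Longrightarrow> (h has_real_derivative h' x) (at x)" "smoothk_on k S h'"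
  shows "smoothk_on (Suc k) S h"
  using assms
  by (intro smoothk_on_SucI[OF assms(1), where g'="\<lambda>x v. v * h' x"])
    (auto simp: has_field_derivative_def mult.commute[of _ "h' _"])

lemma smooth_on_subset: "smooth_on S g \<Longrightarrow> T \<subseteq> S \<Longrightarrow> smooth_on T g"
  by (auto simp: smooth_on_def intro: smoothk_on_subset)

lemma smooth_on_cong: "open S \<Longrightarrow> smooth_on S f \<Longrightarrow> (\<And>x. x \<in> S \<Longrightarrow> f x = g x) \<Longrightarrow> smooth_on S g"
  by (auto simp: smooth_on_def intro: smoothk_on_cong)

lemma smooth_on_Un:
  assumes "open S" "open T" "smooth_on S g" "smooth_on T g"
  shows "smooth_on (S \<union> T) g"
  using assms smoothk_on_Union[of "{S, T}" _ g] by (auto simp: smooth_on_def)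

lemma smooth_on_const: "open S \<Longrightarrow> smooth_on S (\<lambda>x. c)"
  by (simp add: smooth_on_def smoothk_on_const)

lemma smooth_on_linear: "open S \<Longrightarrow> bounded_linear g \<Longrightarrow> smooth_on S g"
  by (simp add: smooth_on_def smoothk_on_linear)

lemma smooth_on_ident: "open S \<Longrightarrow> smooth_on S (\<lambda>x::real. x)"
  by (rule smooth_on_linear[OF _ bounded_linear_ident])

lemma smooth_on_inner: "open S \<Longrightarrow> smooth_on S (\<lambda>x. x \<bullet> v)"
  by (rule smooth_on_linear[OF _ bounded_linear_inner_left])

lemma smooth_on_add: "open S \<Longrightarrow> smooth_on S f \<Longrightarrow> smooth_on S g \<Longrightarrow> smooth_on S (\<lambda>x. f x + g x)"
  by (simp add: smooth_on_def smoothk_on_add)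

lemma smooth_on_mult: "open S \<Longrightarrow> smooth_on S f \<Longrightarrow> smooth_on S g \<Longrightarrow> smooth_on S (\<lambda>x. f x * g x)"
  by (simp add: smooth_on_def smoothk_on_mult)

lemma smooth_on_uminus: "open S \<Longrightarrow> smooth_on S f \<Longrightarrow> smooth_on S (\<lambda>x. - f x)"
  using smooth_on_mult[of S "\<lambda>_. -1" f] smooth_on_const by auto

lemma smooth_on_diff: "open S \<Longrightarrow> smooth_on S f \<Longrightarrow> smooth_on S g \<Longrightarrow> smooth_on S (\<lambda>x. f x - g x)"
  using smooth_on_add[of S f "\<lambda>x. - g x"] smooth_on_uminus by auto

lemma smooth_on_sum:
  assumes "open S" "finite I" "\<And>i. i \<in> I \<Longrightarrow> smooth_on S (f i)"
  shows "smooth_on S (\<lambda>x. \<Sum>i\<in>I. f i x)"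
  using assms(2,3) assms(1) by (induction I rule: finite_induct) (auto intro: smooth_on_const smooth_on_add)

lemma smooth_on_power: "open S \<Longrightarrow> smooth_on S f \<Longrightarrow> smooth_on S (\<lambda>x. f x ^ n)"
  by (induction n) (auto intro: smooth_on_const smooth_on_mult)

lemma smooth_on_compose:
  fixes h :: "real \<Rightarrow> real"
  assumes "open S" "smooth_on T h" "smooth_on S g" "\<And>x. x \<in> S \<Longrightarrow> g x \<in> T"
  shows "smooth_on S (\<lambda>x. h (g x))"
  using assms smoothk_on_compose[of S g T] by (auto simp: smooth_on_def)

lemma smooth_on_differentiable: "smooth_on S g \<Longrightarrow> x \<in> S \<Longrightarrow> g differentiable (at x)"
  unfolding smooth_on_def by (drule spec[of _ 1]) simp

lemma smooth_on_has_derivative: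
  "smooth_on S g \<Longrightarrow> x \<in> S \<Longrightarrow> (g has_derivative frechet_derivative g (at x)) (at x)"
  using smooth_on_differentiable frechet_derivative_works by blast

lemma smooth_on_continuous: "smooth_on S g \<Longrightarrow> continuous_on S g"
  unfolding smooth_on_def by (drule spec[of _ 0]) simp

lemma smooth_on_frechet_Basis:
  "smooth_on S g \<Longrightarrow> i \<in> Basis \<Longrightarrow> smooth_on S (\<lambda>x. frechet_derivative g (at x) i)"
  unfolding smooth_on_def by (metis smoothk_on.simps(2))

lemma smooth_on_frechet:
  assumes "open S" "smooth_on S g"
  shows "smooth_on S (\<lambda>x. frechet_derivative g (at x) v)"
proof -
  have "smooth_on S (\<lambda>x. \<Sum>i\<in>Basis. (v \<bullet> i) * frechet_derivative g (at x) i)"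
    using assms by (intro smooth_on_sum smooth_on_mult smooth_on_const smooth_on_frechet_Basis) auto
  moreover have "(\<Sum>i\<in>Basis. (v \<bullet> i) * frechet_derivative g (at x) i) = frechet_derivative g (at x) v"
    if "x \<in> S" for x
  proof -
    have l: "linear (frechet_derivative g (at x))"
      using smooth_on_has_derivative[OF assms(2) that] has_derivative_linear by blast
    have "frechet_derivative g (at x) v = frechet_derivative g (at x) (\<Sum>i\<in>Basis. (v \<bullet> i) *\<^sub>R i)"
      by (simp add: euclidean_representation)
    also have "\<dots> = (\<Sum>i\<in>Basis. (v \<bullet> i) * frechet_derivative g (at x) i)"
      using l by (simp add: linear_sum linear_scale)
    finally show ?thesis by simp
  qed
  ultimately show ?thesis by (rule smooth_on_cong[OF assms(1)])
qed

lemma smooth_on_realI: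
  fixes F :: "nat \<Rightarrow> real \<Rightarrow> real"
  assumes "open S" "\<And>n x. x \<in> S \<Longrightarrow> (F n has_real_derivative F (Suc n) x) (at x)"
  shows "smooth_on S (F n)"
proof -
  have "smoothk_on k S (F n)" for k n
  proof (induction k arbitrary: n)
    case 0
    show ?case using assms(2) by (auto intro!: continuous_at_imp_continuous_on intro: DERIV_isCont)
  next
    case (Suc k)
    then show ?case using assms by (intro smoothk_on_SucI_real[where h'="F (Suc n)"]) auto
  qed
  then show ?thesis by (simp add: smooth_on_def)
qed

lemma smooth_on_exp: "smooth_on UNIV (exp :: real \<Rightarrow> real)"
  using smooth_on_realI[of UNIV "\<lambda>_. exp"] by (auto intro: DERIV_exp)

lemma smooth_on_inverse: "smooth_on (- {0}) (inverse :: real \<Rightarrow> real)"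
proof -
  have "smoothk_on k (- {0}) (inverse :: real \<Rightarrow> real)" for k
  proof (induction k)
    case 0 show ?case by (auto intro!: continuous_intros)
  next
    case (Suc k)
    have "smoothk_on k (- {0}) (\<lambda>x::real. (-1) * (inverse x * inverse x))"
      using Suc by (intro smoothk_on_mult smoothk_on_const) auto
    then show ?case
      by (intro smoothk_on_SucI_real[where h'="\<lambda>x. (-1) * (inverse x * inverse x)"])
        (auto intro!: derivative_eq_intros simp: power2_eq_square)
  qed
  then show ?thesis by (simp add: smooth_on_def)
qed

lemma smooth_on_divide:
  assumes "open S" "smooth_on S f" "smooth_on S g" "\<And>x. x \<in> S \<Longrightarrow> g x \<noteq> 0"
  shows "smooth_on S (\<lambda>x. f x / g x)"
  unfolding divide_inverse using assms
  by (intro smooth_on_mult smooth_on_compose[OF _ smooth_on_inverse]) auto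

lemma smooth_on_sqrt: "smooth_on {0<..} (sqrt :: real \<Rightarrow> real)"
proof -
  have "smoothk_on k {0<..} (sqrt :: real \<Rightarrow> real)" for k
  proof (induction k)
    case 0 show ?case by (auto intro!: continuous_intros)
  next
    case (Suc k)
    have "smoothk_on k {0<..} (\<lambda>x. inverse (sqrt x))"
      using Suc smooth_on_inverse
      by (intro smoothk_on_compose[where T="- {0}" and h=inverse and g=sqrt]) (auto simp: smooth_on_def)
    then have "smoothk_on k {0<..} (\<lambda>x. (1/2) * inverse (sqrt x))"
      by (rule smoothk_on_mult[rotated 2]) (auto intro: smoothk_on_const)
    then show ?case
      by (intro smoothk_on_SucI_real[where h'="\<lambda>x. (1/2) * inverse (sqrt x)"])
        (auto intro!: derivative_eq_intros)
  qed
  then show ?thesis by (simp add: smooth_on_def)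
qed

section \<open>Flat functions and a smooth transition from 0 to 1\<close>

definition flat_exp :: "nat \<Rightarrow> real \<Rightarrow> real" where
  "flat_exp n t = (if t \<le> 0 then 0 else inverse t ^ n * exp (- inverse t))"

text \<open>With y = 1/t a single term of the exponential series gives
  \<open>y ^ Suc n \<le> fact (Suc n) * exp y\<close>.\<close>

lemma flat_exp_bound: "\<bar>flat_exp n t\<bar> \<le> fact (Suc n) * \<bar>t\<bar>"
proof (cases "t \<le> 0")
  case False
  define y where "y = inverse t"
  have y: "y > 0" using False by (simp add: y_def)
  have "(\<Sum>k\<in>{Suc n}. y ^ k /\<^sub>R fact k) \<le> (\<Sum>k. y ^ k /\<^sub>R fact k)"
    using y by (intro sum_le_suminf summable_exp_generic) auto
  then have "y ^ Suc n / fact (Suc n) \<le> exp y"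
    by (simp only: exp_def) (simp add: divide_inverse mult.commute)
  then have "y ^ Suc n \<le> fact (Suc n) * exp y"
    by (simp add: pos_divide_le_eq mult.commute del: fact_Suc power_Suc)
  then have "y ^ n * exp (- y) \<le> fact (Suc n) * inverse y"
    using y by (simp add: exp_minus divide_simps mult.commute del: fact_Suc)
  then show ?thesis using False by (simp add: flat_exp_def y_def)
next
  case True
  have "0 \<le> fact (Suc n) * \<bar>t\<bar>" by (intro mult_nonneg_nonneg) auto
  with True show ?thesis by (simp only: flat_exp_def if_True abs_zero)
qed

text \<open>The index \<open>n\<close> makes the family closed under differentiation up to linear
  combinations. At 0 the difference quotient for h > 0 is \<open>flat_exp (Suc n) h\<close>, which
  tends to 0 by the linear bound above.\<close>

lemma flat_exp_deriv:
  "(flat_exp n has_real_derivative (flat_exp (n + 2) t - real n * flat_exp (Suc n) t)) (at t)"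
proof (cases t "0::real" rule: linorder_cases)
  case less
  have "(flat_exp n has_real_derivative 0) (at t)"
    by (rule has_field_derivative_transform_within_open[of "\<lambda>_. 0" 0 t "{..<0}"])
      (use less in \<open>auto simp: flat_exp_def\<close>)
  then show ?thesis using less by (simp add: flat_exp_def)
next
  case equal
  have "((\<lambda>h. (flat_exp n (0 + h) - flat_exp n 0) / h) \<longlongrightarrow> 0) (at 0)"
  proof (rule Lim_null_comparison)
    have "norm ((flat_exp n (0 + h) - flat_exp n 0) / h) \<le> fact (Suc (Suc n)) * \<bar>h\<bar>" if "h \<noteq> 0" for h
    proof (cases "h > 0")
      case True
      then have "(flat_exp n (0 + h) - flat_exp n 0) / h = flat_exp (Suc n) h"
        by (simp add: flat_exp_def field_simps)
      then show ?thesis using flat_exp_bound[of "Suc n" h] by simp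
    next
      case False
      moreover have "0 \<le> fact (Suc (Suc n)) * \<bar>h\<bar>" by (intro mult_nonneg_nonneg) auto
      ultimately show ?thesis by (simp add: flat_exp_def del: fact_Suc)
    qed
    then show "\<forall>\<^sub>F h in at 0. norm ((flat_exp n (0 + h) - flat_exp n 0) / h) \<le> fact (Suc (Suc n)) * \<bar>h\<bar>"
      by (auto simp: eventually_at_filter)
    show "((\<lambda>h::real. fact (Suc (Suc n)) * \<bar>h\<bar>) \<longlongrightarrow> 0) (at 0)"
      by (auto intro!: tendsto_eq_intros)
  qed
  then show ?thesis using equal by (simp add: DERIV_def flat_exp_def)
next
  case greater
  have "((\<lambda>t. inverse t ^ n * exp (- inverse t)) has_real_derivative (flat_exp (n + 2) t - real n * flat_exp (Suc n) t)) (at t)"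
  proof -
    have d: "(inverse has_real_derivative - (inverse t * inverse t)) (at t)"
      using DERIV_inverse[of t] greater by (simp add: power2_eq_square)
    have "((\<lambda>t. inverse t ^ n * exp (- inverse t)) has_real_derivative
        (real n * (- (inverse t * inverse t) * inverse t ^ (n - Suc 0))) * exp (- inverse t)
        + (exp (- inverse t) * - (- (inverse t * inverse t))) * inverse t ^ n) (at t)"
      by (intro DERIV_mult DERIV_power d DERIV_fun_exp DERIV_minus d)
    moreover have "(real n * (- (inverse t * inverse t) * inverse t ^ (n - Suc 0))) * exp (- inverse t)
        + (exp (- inverse t) * - (- (inverse t * inverse t))) * inverse t ^ n
        = flat_exp (n + 2) t - real n * flat_exp (Suc n) t"
      using greater by (cases n) (simp_all add: flat_exp_def algebra_simps)
    ultimately show ?thesis by simp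
  qed
  then show ?thesis
    by (rule has_field_derivative_transform_within_open[of _ _ _ "{0<..}"]) (use greater in \<open>auto simp: flat_exp_def\<close>)
qed

lemma smooth_on_flat_exp: "smooth_on UNIV (flat_exp n)"
proof -
  have "smoothk_on k UNIV (flat_exp n)" for k
  proof (induction k arbitrary: n)
    case 0
    show ?case by (auto intro!: continuous_at_imp_continuous_on intro: DERIV_isCont[OF flat_exp_deriv])
  next
    case (Suc k)
    have "smoothk_on k UNIV (\<lambda>t. flat_exp (n + 2) t + (- real n) * flat_exp (Suc n) t)"
      by (intro smoothk_on_add smoothk_on_mult smoothk_on_const Suc) auto
    then show ?case
      using flat_exp_deriv[of n] by (intro smoothk_on_SucI_real[of UNIV]) auto
  qed
  then show ?thesis by (simp add: smooth_on_def)
qed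

lemma flat_exp_nonneg: "0 \<le> flat_exp n t" and flat_exp_pos_iff: "0 < flat_exp n t \<longleftrightarrow> 0 < t"
  by (auto simp: flat_exp_def)

definition smooth_step :: "real \<Rightarrow> real" where
  "smooth_step t = flat_exp 0 t / (flat_exp 0 t + flat_exp 0 (1 - t))"

lemma smooth_step_denom: "flat_exp 0 t + flat_exp 0 (1 - t) > 0"
  using flat_exp_nonneg[of 0 t] flat_exp_nonneg[of 0 "1 - t"] flat_exp_pos_iff[of 0 t] flat_exp_pos_iff[of 0 "1-t"]
  by (cases "t > 0") linarith+

lemma smooth_on_smooth_step: "smooth_on UNIV smooth_step"
proof -
  have "smooth_on UNIV (\<lambda>t. flat_exp 0 (1 - t))"
    by (rule smooth_on_compose[OF _ smooth_on_flat_exp])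
      (auto intro!: smooth_on_diff smooth_on_const smooth_on_ident)
  then show ?thesis
    unfolding smooth_step_def[abs_def]
    using smooth_step_denom by (intro smooth_on_divide smooth_on_add smooth_on_flat_exp) (auto simp: less_le)
qed

lemma smooth_step_simps:
  "t \<le> 0 \<Longrightarrow> smooth_step t = 0" "1 \<le> t \<Longrightarrow> smooth_step t = 1"
  "0 \<le> smooth_step t" "smooth_step t \<le> 1"
  using flat_exp_nonneg[of 0 t] flat_exp_nonneg[of 0 "1 - t"] smooth_step_denom[of t]
  by (auto simp: smooth_step_def flat_exp_def divide_simps)

lemma smooth_on_norm_sq: "open S \<Longrightarrow> smooth_on S (\<lambda>x. (norm (x - c))\<^sup>2)"
proof -
  assume S: "open S"
  have "(norm (x - c))\<^sup>2 = (\<Sum>i\<in>Basis. (x \<bullet> i - c \<bullet> i)\<^sup>2)" for x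
    unfolding power2_norm_eq_inner
    by (subst euclidean_inner) (simp add: inner_diff_left power2_eq_square)
  then show ?thesis using S
    by (auto intro!: smooth_on_sum smooth_on_power smooth_on_diff smooth_on_const smooth_on_inner)
qed

section \<open>Test functions, uniform Taylor bounds and integrals of derivatives\<close>

abbreviation fderiv :: "('a::euclidean_space \<Rightarrow> real) \<Rightarrow> 'a \<Rightarrow> 'a \<Rightarrow> real" where
  "fderiv g v x \<equiv> frechet_derivative g (at x) v"

lemma test_fun_smooth: "test_fun S g \<Longrightarrow> smooth_on UNIV g"
  by (simp add: test_fun_def smooth_fun_iff)

lemma test_funI:
  assumes "smooth_on UNIV g" "compact K" "K \<subseteq> S" "\<And>x. x \<notin> K \<Longrightarrow> g x = 0"
  shows "test_fun S g"
proof -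
  have "tsupport g \<subseteq> K"
    unfolding tsupport_def using assms by (intro closure_minimal) (auto intro: compact_imp_closed)
  moreover have "compact (tsupport g)"
    using calculation assms(2) compact_Int_closed[of K "tsupport g"]
    by (auto simp: tsupport_def Int_absorb1)
  ultimately show ?thesis using assms by (auto simp: test_fun_def smooth_fun_iff)
qed

lemma tsupport_zero: "x \<notin> tsupport g \<Longrightarrow> g x = 0"
  unfolding tsupport_def using closure_subset[of "{x. g x \<noteq> 0}"] by auto

lemma test_fun_support:
  assumes "test_fun S g"
  shows "\<exists>K. compact K \<and> K \<subseteq> S \<and> (\<forall>x. x \<notin> K \<longrightarrow> g x = 0)"
  using assms by (intro exI[of _ "tsupport g"]) (auto simp: test_fun_def tsupport_zero)

lemma test_fun_mono: "test_fun S g \<Longrightarrow> S \<subseteq> T \<Longrightarrow> test_fun T g"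
  by (auto simp: test_fun_def)

lemma test_fun_mult:
  assumes "smooth_on UNIV m" "test_fun S g" shows "test_fun S (\<lambda>x. m x * g x)"
  using test_fun_support[OF assms(2)]
  by (auto intro!: test_funI smooth_on_mult assms(1) test_fun_smooth[OF assms(2)])

lemma test_fun_add:
  assumes "test_fun S f" "test_fun S g" shows "test_fun S (\<lambda>x. f x + g x)"
proof -
  obtain K where K: "compact K" "K \<subseteq> S" "\<forall>x. x \<notin> K \<longrightarrow> f x = 0"
    using test_fun_support[OF assms(1)] by auto
  obtain L where L: "compact L" "L \<subseteq> S" "\<forall>x. x \<notin> L \<longrightarrow> g x = 0"
    using test_fun_support[OF assms(2)] by auto
  show ?thesis using K L test_fun_smooth[OF assms(1)] test_fun_smooth[OF assms(2)]
    by (intro test_funI[where K="K \<union> L"] smooth_on_add) auto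
qed

lemma test_fun_cmult: "test_fun S g \<Longrightarrow> test_fun S (\<lambda>x. c * g x)"
  by (rule test_fun_mult) (auto intro: smooth_on_const)

lemma test_fun_diff: "test_fun S f \<Longrightarrow> test_fun S g \<Longrightarrow> test_fun S (\<lambda>x. f x - g x)"
  using test_fun_add[of S f "\<lambda>x. (-1) * g x"] test_fun_cmult[of S g "-1"] by simp

lemma test_fun_fderiv:
  assumes "test_fun S g" shows "test_fun S (fderiv g v)"
proof -
  obtain K where K: "compact K" "K \<subseteq> S" "\<forall>x. x \<notin> K \<longrightarrow> g x = 0"
    using test_fun_support[OF assms] by auto
  show ?thesis
  proof (rule test_funI[OF _ K(1,2)])
    show "smooth_on UNIV (fderiv g v)" using test_fun_smooth[OF assms] by (intro smooth_on_frechet) auto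
    fix x assume "x \<notin> K"
    then have "frechet_derivative g (at x) = frechet_derivative (\<lambda>x. 0) (at x)"
      using K by (intro frechet_derivative_cong_open[of "- K"]) (auto intro: compact_imp_closed)
    then show "fderiv g v x = 0" by simp
  qed
qed

lemma test_fun_continuous: "test_fun S g \<Longrightarrow> continuous_on UNIV g"
  by (simp add: test_fun_smooth smooth_on_continuous)

lemma test_fun_has_derivative: "test_fun S g \<Longrightarrow> (g has_derivative frechet_derivative g (at x)) (at x)"
  by (rule smooth_on_has_derivative[OF test_fun_smooth]) auto

lemma test_fun_bounded:
  assumes "test_fun S g"
  obtains C where "C \<ge> 0" "\<And>x. \<bar>g x\<bar> \<le> C"
proof -
  obtain K where K: "compact K" "\<forall>x. x \<notin> K \<longrightarrow> g x = 0"
    using test_fun_support[OF assms] by auto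
  have "compact (g ` K)"
    using K(1) test_fun_continuous[OF assms] by (intro compact_continuous_image) (auto intro: continuous_on_subset)
  then obtain C where "\<And>x. x \<in> K \<Longrightarrow> \<bar>g x\<bar> \<le> C"
    by (metis compact_imp_bounded bounded_iff imageI real_norm_def)
  then have "\<bar>g x\<bar> \<le> max C 0" for x
    using K(2) by (cases "x \<in> K") (auto intro: max.coboundedI1)
  then show ?thesis by (intro that[of "max C 0"]) auto
qed

lemma test_fun_support_ball:
  assumes "test_fun S g"
  obtains R where "R > 0" "\<And>x. norm x > R \<Longrightarrow> g x = 0"
proof -
  obtain K where K: "compact K" "\<forall>x. x \<notin> K \<longrightarrow> g x = 0"
    using test_fun_support[OF assms] by auto
  obtain R where "R > 0" "\<And>x. x \<in> K \<Longrightarrow> norm x \<le> R"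
    using compact_imp_bounded[OF K(1)] by (auto simp: bounded_pos)
  then show ?thesis using K(2) that[of R] by (metis not_less)
qed

lemma continuous_measurable_lebesgue: "continuous_on UNIV g \<Longrightarrow> g \<in> borel_measurable lebesgue"
  by (intro measurable_completion) (simp add: borel_measurable_continuous_onI)

lemma test_fun_measurable: "test_fun S g \<Longrightarrow> g \<in> borel_measurable lebesgue"
  by (simp add: continuous_measurable_lebesgue test_fun_continuous)

lemma integrable_bounded_support:
  fixes g :: "'a::euclidean_space \<Rightarrow> 'b::{banach, second_countable_topology}"
  assumes "g \<in> borel_measurable lebesgue" "\<And>x. norm (g x) \<le> C" "\<And>x. norm x > R \<Longrightarrow> g x = 0"
  shows "integrable lebesgue g"
    "norm (\<integral>x. g x \<partial>lebesgue) \<le> C * measure lebesgue (cball (0::'a) R)"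
proof -
  have i: "integrable lebesgue (\<lambda>x. C * indicator (cball (0::'a) R) x)"
    using lmeasurable_cball[of "0::'a" R] by (intro integrable_mult_right) (simp add: lmeasurable_iff_integrable)
  have b: "norm (g x) \<le> C * indicator (cball 0 R) x" for x
    using assms(2)[of x] assms(3)[of x] by (auto simp: indicator_def)
  show g: "integrable lebesgue g"
    by (rule Bochner_Integration.integrable_bound[OF i assms(1)]) (use b in \<open>auto intro: order_trans[OF _ abs_ge_self]\<close>)
  have "norm (\<integral>x. g x \<partial>lebesgue) \<le> (\<integral>x. C * indicator (cball (0::'a) R) x \<partial>lebesgue)"
    using b by (intro order_trans[OF integral_norm_bound] integral_mono i integrable_norm g) auto
  then show "norm (\<integral>x. g x \<partial>lebesgue) \<le> C * measure lebesgue (cball (0::'a) R)" by simp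
qed

lemma test_fun_integrable:
  assumes "test_fun S g" shows "integrable lebesgue g"
proof -
  obtain C where "C \<ge> 0" "\<And>x. \<bar>g x\<bar> \<le> C" using test_fun_bounded[OF assms] by blast
  moreover obtain R where "R > 0" "\<And>x. norm x > R \<Longrightarrow> g x = 0" using test_fun_support_ball[OF assms] by blast
  ultimately show ?thesis
    by (intro integrable_bounded_support(1)[OF test_fun_measurable[OF assms]]) auto
qed

lemma fderiv_bound:
  fixes g :: "'a::euclidean_space \<Rightarrow> real"
  assumes "test_fun S g"
  obtains C where "C \<ge> 0" "\<And>x v. \<bar>fderiv g v x\<bar> \<le> C * norm v"
proof -
  have "\<exists>C. C \<ge> 0 \<and> (\<forall>x. \<bar>fderiv g i x\<bar> \<le> C)" for i
    using test_fun_bounded[OF test_fun_fderiv[OF assms]] by metis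
  then obtain C where C: "\<And>i. C i \<ge> 0" "\<And>i x. \<bar>fderiv g i x\<bar> \<le> C i" by metis
  have "\<bar>fderiv g v x\<bar> \<le> (\<Sum>i\<in>Basis. C i) * norm v" for v x
  proof -
    have l: "linear (frechet_derivative g (at x))"
      by (rule has_derivative_linear[OF test_fun_has_derivative[OF assms]])
    have "fderiv g v x = frechet_derivative g (at x) (\<Sum>i\<in>Basis. (v \<bullet> i) *\<^sub>R i)"
      by (simp add: euclidean_representation)
    also have "\<dots> = (\<Sum>i\<in>Basis. (v \<bullet> i) * fderiv g i x)"
      using l by (simp add: linear_sum linear_scale)
    finally have "\<bar>fderiv g v x\<bar> \<le> (\<Sum>i\<in>Basis. \<bar>v \<bullet> i\<bar> * \<bar>fderiv g i x\<bar>)"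
      by (simp only: abs_mult[symmetric] sum_abs)
    also have "\<dots> \<le> (\<Sum>i\<in>Basis. norm v * C i)"
      by (intro sum_mono mult_mono C Basis_le_norm) auto
    finally show ?thesis by (simp add: sum_distrib_left mult.commute)
  qed
  moreover have "0 \<le> (\<Sum>i\<in>Basis. C i)" by (intro sum_nonneg C)
  ultimately show ?thesis using that by blast
qed

lemma test_fun_lipschitz:
  fixes g :: "'a::euclidean_space \<Rightarrow> real"
  assumes "test_fun S g"
  obtains C where "C \<ge> 0" "\<And>x y. \<bar>g x - g y\<bar> \<le> C * norm (x - y)"
proof -
  obtain C where C: "C \<ge> 0" "\<And>x v. \<bar>fderiv g v x\<bar> \<le> C * norm v"
    using fderiv_bound[OF assms] by blast
  have "norm (g x - g y) \<le> C * norm (x - y)" for x y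
    by (rule differentiable_bound[OF convex_UNIV test_fun_has_derivative[OF assms, THEN has_derivative_at_withinI]])
      (auto intro!: onorm_le C(2))
  then show ?thesis using that C(1) by simp
qed

text \<open>The remainder is quadratic uniformly in x because the partial derivatives are again test
  functions, hence Lipschitz. This uniformity replaces dominated convergence when integrals and
  convolutions are differentiated.\<close>

lemma test_fun_Taylor:
  fixes g :: "'a::euclidean_space \<Rightarrow> real"
  assumes "test_fun S g"
  obtains C where "C \<ge> 0" "\<And>x h. \<bar>g (x + h) - g x - fderiv g h x\<bar> \<le> C * (norm h)\<^sup>2"
proof -
  have "\<exists>C. C \<ge> 0 \<and> (\<forall>x y. \<bar>fderiv g i x - fderiv g i y\<bar> \<le> C * norm (x - y))" for i
    using test_fun_lipschitz[OF test_fun_fderiv[OF assms]] by metis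
  then obtain C where C: "\<And>i. C i \<ge> 0" "\<And>i x y. \<bar>fderiv g i x - fderiv g i y\<bar> \<le> C i * norm (x - y)"
    by metis
  define B where "B = (\<Sum>i\<in>Basis. C i)"
  have B: "0 \<le> B" unfolding B_def by (intro sum_nonneg C)
  have l: "linear (frechet_derivative g (at x))" for x
    by (rule has_derivative_linear[OF test_fun_has_derivative[OF assms]])
  have diff: "\<bar>fderiv g v x - fderiv g v y\<bar> \<le> B * norm (x - y) * norm v" for v x y
  proof -
    have e: "fderiv g v x = (\<Sum>i\<in>Basis. (v \<bullet> i) * fderiv g i x)" for x
    proof -
      have "fderiv g v x = frechet_derivative g (at x) (\<Sum>i\<in>Basis. (v \<bullet> i) *\<^sub>R i)"
        by (simp add: euclidean_representation)
      then show ?thesis using l[of x] by (simp add: linear_sum linear_scale)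
    qed
    have "\<bar>fderiv g v x - fderiv g v y\<bar> = \<bar>\<Sum>i\<in>Basis. (v \<bullet> i) * (fderiv g i x - fderiv g i y)\<bar>"
      by (simp add: e[of x] e[of y] sum_subtractf right_diff_distrib)
    also have "\<dots> \<le> (\<Sum>i\<in>Basis. \<bar>v \<bullet> i\<bar> * \<bar>fderiv g i x - fderiv g i y\<bar>)"
      by (simp only: abs_mult[symmetric] sum_abs)
    also have "\<dots> \<le> (\<Sum>i\<in>Basis. norm v * (C i * norm (x - y)))"
      by (intro sum_mono mult_mono C Basis_le_norm) auto
    finally show ?thesis by (simp add: sum_distrib_left sum_distrib_right B_def mult_ac)
  qed
  have "\<bar>g (x + h) - g x - fderiv g h x\<bar> \<le> B * (norm h)\<^sup>2" for x h
  proof -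
    have "norm (g (x + h) - g x - frechet_derivative g (at x) (x + h - x)) \<le> norm (x + h - x) * (B * norm h)"
    proof (rule differentiable_bound_linearization[where S="cball x (norm h)"])
      show "(g has_derivative frechet_derivative g (at y)) (at y within cball x (norm h))" for y
        by (rule has_derivative_at_withinI[OF test_fun_has_derivative[OF assms]])
      show "onorm (frechet_derivative g (at y) - frechet_derivative g (at x)) \<le> B * norm h"
        if "y \<in> cball x (norm h)" for y
        unfolding fun_diff_def
      proof (rule onorm_le)
        fix v
        have "norm (fderiv g v y - fderiv g v x) \<le> B * norm (y - x) * norm v" using diff by simp
        also have "\<dots> \<le> B * norm h * norm v"
          using that B by (intro mult_right_mono mult_left_mono) (auto simp: dist_norm norm_minus_commute)
        finally show "norm (fderiv g v y - fderiv g v x) \<le> B * norm h * norm v" .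
      qed
    qed (auto simp: dist_norm mult_left_le_one_le)
    then show ?thesis by (simp add: power2_eq_square mult_ac)
  qed
  then show ?thesis using that B by blast
qed

lemma integral_lebesgue_shift:
  fixes g :: "'a::euclidean_space \<Rightarrow> real"
  assumes "continuous_on UNIV g"
  shows "(\<integral>x. g (x + c) \<partial>lebesgue) = (\<integral>x. g x \<partial>lebesgue)"
proof -
  have [measurable]: "g \<in> borel_measurable borel" using assms by (rule borel_measurable_continuous_onI)
  have "(\<integral>x. g x \<partial>lebesgue) = (\<integral>x. g x \<partial>distr lborel borel ((+) c))"
    by (simp add: integral_completion lborel_distr_plus)
  also have "\<dots> = (\<integral>x. g (c + x) \<partial>lborel)" by (rule integral_distr) auto
  also have "\<dots> = (\<integral>x. g (x + c) \<partial>lebesgue)" by (subst integral_completion) (auto simp: add.commute)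
  finally show ?thesis by simp
qed

text \<open>Translation invariance makes the integral of \<open>g (x + s *\<^sub>R v) - g x\<close>
  vanish, so \<open>s * J\<close> is, up to sign, the integral of a Taylor remainder of order s^2
  over a fixed ball.\<close>

lemma integral_fderiv_zero:
  fixes g :: "'a::euclidean_space \<Rightarrow> real"
  assumes g: "test_fun S g" shows "(\<integral>x. fderiv g v x \<partial>lebesgue) = 0"
proof -
  obtain C where C: "C \<ge> 0" "\<And>x h. \<bar>g (x + h) - g x - fderiv g h x\<bar> \<le> C * (norm h)\<^sup>2"
    using test_fun_Taylor[OF g] by blast
  obtain R where R: "R > 0" "\<And>x. norm x > R \<Longrightarrow> g x = 0"
    using test_fun_support_ball[OF g] by blast
  obtain R' where R': "R' > 0" "\<And>x. norm x > R' \<Longrightarrow> fderiv g v x = 0"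
    using test_fun_support_ball[OF test_fun_fderiv[OF g]] by blast
  \<comment> \<open>Outside this radius \<open>g\<close>, its shifts by \<open>s *\<^sub>R v\<close>
    with s at most 1, and \<open>fderiv g v\<close> all vanish.\<close>
  define R1 where "R1 = R + R' + norm v"
  define K where "K = C * (norm v)\<^sup>2 * measure lebesgue (cball (0::'a) R1)"
  define J where "J = (\<integral>x. fderiv g v x \<partial>lebesgue)"
  have bd: "\<bar>J\<bar> \<le> s * K" if s: "0 < s" "s \<le> 1" for s
  proof -
    have sc: "fderiv g (s *\<^sub>R v) x = s * fderiv g v x" for x
      using linear_scale[OF has_derivative_linear[OF test_fun_has_derivative[OF g]]] by simp
    have c: "continuous_on UNIV (\<lambda>x. g (x + s *\<^sub>R v))"
      by (intro continuous_on_compose2[OF test_fun_continuous[OF g]] continuous_intros) auto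
    have z: "g (x + s *\<^sub>R v) = 0" if "norm x > R1" for x
    proof (rule R(2))
      have "norm x \<le> norm (x + s *\<^sub>R v) + norm (s *\<^sub>R v)"
        using norm_triangle_ineq4[of "x + s *\<^sub>R v" "s *\<^sub>R v"] by simp
      moreover have "norm (s *\<^sub>R v) \<le> norm v" using s by (simp add: mult_left_le_one_le)
      ultimately show "R < norm (x + s *\<^sub>R v)" using that R'(1) by (simp add: R1_def)
    qed
    obtain M where M: "\<And>x. \<bar>g x\<bar> \<le> M" using test_fun_bounded[OF g] by blast
    have i: "integrable lebesgue (\<lambda>x. g (x + s *\<^sub>R v))"
      using M z by (intro integrable_bounded_support(1)[OF continuous_measurable_lebesgue[OF c], of M R1]) auto
    note i' = test_fun_integrable[OF g] test_fun_integrable[OF test_fun_fderiv[OF g]]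
    have "(\<integral>x. g (x + s *\<^sub>R v) - g x - s * fderiv g v x \<partial>lebesgue) = - s * J"
      using i i' integral_lebesgue_shift[OF test_fun_continuous[OF g]] by (simp add: J_def)
    moreover have "norm (\<integral>x. g (x + s *\<^sub>R v) - g x - s * fderiv g v x \<partial>lebesgue)
        \<le> (C * (norm (s *\<^sub>R v))\<^sup>2) * measure lebesgue (cball (0::'a) R1)"
    proof (rule integrable_bounded_support(2))
      show "(\<lambda>x. g (x + s *\<^sub>R v) - g x - s * fderiv g v x) \<in> borel_measurable lebesgue"
        using i i' by (intro borel_measurable_diff borel_measurable_times) auto
      show "norm (g (x + s *\<^sub>R v) - g x - s * fderiv g v x) \<le> C * (norm (s *\<^sub>R v))\<^sup>2" for x
        using C(2)[of x "s *\<^sub>R v"] by (simp add: sc)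
      show "g (x + s *\<^sub>R v) - g x - s * fderiv g v x = 0" if "norm x > R1" for x
      proof -
        have "norm x > R" "norm x > R'" using that R(1) R'(1) norm_ge_zero[of v] unfolding R1_def by linarith+
        then show ?thesis using z[OF that] R(2) R'(2) by simp
      qed
    qed
    ultimately have "s * \<bar>J\<bar> \<le> s * (s * K)"
      using s by (simp add: abs_mult K_def power_mult_distrib power2_eq_square mult_ac)
    then show ?thesis using s by simp
  qed
  have "((\<lambda>s. s * K) \<longlongrightarrow> 0 * K) (at_right 0)" by (intro tendsto_intros)
  then have "\<bar>J\<bar> \<le> 0 * K"
    by (rule tendsto_lowerbound) (auto simp: eventually_at_right_field intro!: exI[of _ 1] bd)
  then show ?thesis by (simp add: J_def)
qed

lemma fderiv_mult:
  assumes "f differentiable (at x)" "g differentiable (at x)"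
  shows "fderiv (\<lambda>x. f x * g x) v x = f x * fderiv g v x + fderiv f v x * g x"
  by (rule fun_cong[OF frechet_derivative_at[OF has_derivative_mult[OF assms[unfolded frechet_derivative_works]]],
    symmetric])

lemma fderiv_diff:
  assumes "f differentiable (at x)" "g differentiable (at x)"
  shows "fderiv (\<lambda>x. f x - g x) v x = fderiv f v x - fderiv g v x"
  by (rule fun_cong[OF frechet_derivative_at[OF has_derivative_diff[OF assms[unfolded frechet_derivative_works]]],
    symmetric])

lemma fderiv_add:
  assumes "f differentiable (at x)" "g differentiable (at x)"
  shows "fderiv (\<lambda>x. f x + g x) v x = fderiv f v x + fderiv g v x"
  by (rule fun_cong[OF frechet_derivative_at[OF has_derivative_add[OF assms[unfolded frechet_derivative_works]]],
    symmetric])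

section \<open>Vector test fields, gradients and the weak curl\<close>

lemma vtest_funI: "(\<And>i. test_fun S (\<lambda>x. \<phi> x $ i)) \<Longrightarrow> vtest_fun S \<phi>"
  by (simp add: vtest_fun_def)

lemma vtest_funD: "vtest_fun S \<phi> \<Longrightarrow> test_fun S (\<lambda>x. \<phi> x $ i)"
  by (simp add: vtest_fun_def)

lemma vtest_fun_mult:
  "smooth_on UNIV m \<Longrightarrow> vtest_fun S \<phi> \<Longrightarrow> vtest_fun S (\<lambda>x. m x *\<^sub>R \<phi> x)"
  by (simp add: vtest_fun_def test_fun_mult)

lemma vtest_fun_scaled: "test_fun S g \<Longrightarrow> vtest_fun S (\<lambda>x. g x *\<^sub>R b)"
  using test_fun_cmult[of S g] by (simp add: vtest_fun_def mult.commute[of "g _"])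

lemma curl_components:
  "curl \<phi> x $ 1 = fderiv (\<lambda>y. \<phi> y $ 3) (axis 2 1) x - fderiv (\<lambda>y. \<phi> y $ 2) (axis 3 1) x"
  "curl \<phi> x $ 2 = fderiv (\<lambda>y. \<phi> y $ 1) (axis 3 1) x - fderiv (\<lambda>y. \<phi> y $ 3) (axis 1 1) x"
  "curl \<phi> x $ 3 = fderiv (\<lambda>y. \<phi> y $ 2) (axis 1 1) x - fderiv (\<lambda>y. \<phi> y $ 1) (axis 2 1) x"
  by (simp_all add: curl_def pdiff_def)

lemma vtest_fun_curl: "vtest_fun S \<phi> \<Longrightarrow> vtest_fun S (curl \<phi>)"
  unfolding vtest_fun_def forall_3 curl_components
  by (intro conjI test_fun_diff test_fun_fderiv) (auto simp: vtest_fun_def)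

lemma vtest_fun_continuous: "vtest_fun S \<phi> \<Longrightarrow> continuous_on UNIV \<phi>"
  using test_fun_continuous[OF vtest_funD] continuous_on_vec_lambda[of UNIV "\<lambda>i x. \<phi> x $ i"]
  by simp

lemma vtest_fun_L2:
  assumes "vtest_fun S \<phi>" shows "\<phi> \<in> L2 UNIV"
proof -
  have m: "\<phi> \<in> borel_measurable lebesgue"
    by (intro continuous_measurable_lebesgue vtest_fun_continuous[OF assms])
  have "integrable lebesgue (\<lambda>x. \<phi> x $ i * \<phi> x $ i)" for i
    by (rule test_fun_integrable[OF test_fun_mult[OF test_fun_smooth]]) (rule vtest_funD[OF assms])+
  then have "integrable lebesgue (\<lambda>x. (norm (\<phi> x))\<^sup>2)"
    by (simp add: power2_norm_eq_inner inner_vec_def)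
  with m show ?thesis by (simp add: L2_UNIV)
qed

definition grad :: "(real^3 \<Rightarrow> real) \<Rightarrow> real^3 \<Rightarrow> real^3" where
  "grad m x = (\<chi> j. fderiv m (axis j 1) x)"

lemma grad_component [simp]: "grad m x $ j = fderiv m (axis j 1) x"
  by (simp add: grad_def)

lemma smooth_on_grad: "smooth_on UNIV m \<Longrightarrow> smooth_on UNIV (\<lambda>x. grad m x $ j)"
  by (simp add: smooth_on_frechet)

lemma fderiv_grad:
  assumes "m differentiable (at x)" shows "fderiv m v x = grad m x \<bullet> v"
proof -
  have l: "linear (frechet_derivative m (at x))"
    by (rule has_derivative_linear[OF assms[unfolded frechet_derivative_works]])
  have "v = (\<Sum>j\<in>UNIV. (v $ j) *\<^sub>R axis j 1)"
    by (simp add: basis_expansion flip: scalar_mult_eq_scaleR)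
  then have "fderiv m v x = frechet_derivative m (at x) (\<Sum>j\<in>UNIV. (v $ j) *\<^sub>R axis j 1)" by simp
  also have "\<dots> = (\<Sum>j\<in>UNIV. (v $ j) * fderiv m (axis j 1) x)"
    using l by (simp add: linear_sum linear_scale)
  finally show ?thesis by (simp add: inner_vec_def mult.commute)
qed

lemma gradI: "(m has_derivative (\<lambda>v. g \<bullet> v)) (at x) \<Longrightarrow> grad m x = g"
  by (simp add: vec_eq_iff frechet_derivative_at[symmetric] inner_axis)

lemma curl_mult:
  assumes "smooth_on UNIV m" "\<And>i. (\<lambda>y. \<phi> y $ i) differentiable (at x)"
  shows "curl (\<lambda>x. m x *\<^sub>R \<phi> x) x = m x *\<^sub>R curl \<phi> x + cross3 (grad m x) (\<phi> x)"
proof -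
  have "fderiv (\<lambda>y. (m y *\<^sub>R \<phi> y) $ i) v x = m x * fderiv (\<lambda>y. \<phi> y $ i) v x + fderiv m v x * \<phi> x $ i" for i v
    using fderiv_mult[OF smooth_on_differentiable[OF assms(1)] assms(2)] by simp
  then show ?thesis
    by (simp add: vec_eq_iff forall_3 curl_components cross3_def algebra_simps)
qed

lemma vtest_fun_differentiable: "vtest_fun S \<phi> \<Longrightarrow> (\<lambda>y. \<phi> y $ i) differentiable (at x)"
  using smooth_on_differentiable[OF test_fun_smooth[OF vtest_funD]] by auto

text \<open>The difference of the integrands is the divergence of
  \<open>cross3 (\<psi> x) (\<phi> x)\<close>, a sum of derivatives of test functions.\<close>

lemma integral_curl_by_parts:
  assumes \<psi>: "vtest_fun UNIV \<psi>" and \<phi>: "vtest_fun UNIV \<phi>"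
  shows "(\<integral>x. \<psi> x \<bullet> curl \<phi> x \<partial>lebesgue) = (\<integral>x. curl \<psi> x \<bullet> \<phi> x \<partial>lebesgue)"
proof -
  let ?c = "\<lambda>j x. cross3 (\<psi> x) (\<phi> x) $ j"
  have t: "test_fun UNIV (?c j)" for j
  proof -
    have "test_fun UNIV (\<lambda>x. \<psi> x $ a * \<phi> x $ b)" for a b
      using test_fun_mult[OF test_fun_smooth[OF vtest_funD[OF \<psi>]] vtest_funD[OF \<phi>]] .
    then have "\<forall>j. test_fun UNIV (?c j)"
      by (simp add: forall_3 cross3_def test_fun_diff)
    then show ?thesis by blast
  qed
  note d = vtest_fun_differentiable[OF \<phi>] vtest_fun_differentiable[OF \<psi>]
  have e: "curl \<psi> x \<bullet> \<phi> x - \<psi> x \<bullet> curl \<phi> x = (\<Sum>j\<in>UNIV. fderiv (?c j) (axis j 1) x)" for x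
    using d by (simp add: inner_vec_def sum_3 curl_components cross3_def fderiv_diff fderiv_mult
        differentiable_mult algebra_simps)
  have "(\<integral>x. curl \<psi> x \<bullet> \<phi> x - \<psi> x \<bullet> curl \<phi> x \<partial>lebesgue) = 0"
    unfolding e using test_fun_integrable[OF test_fun_fderiv[OF t]] integral_fderiv_zero[OF t]
    by (subst Bochner_Integration.integral_sum) auto
  moreover note L2_inner_integrable[OF vtest_fun_L2[OF vtest_fun_curl[OF \<psi>]] vtest_fun_L2[OF \<phi>]]
    L2_inner_integrable[OF vtest_fun_L2[OF \<psi>] vtest_fun_L2[OF vtest_fun_curl[OF \<phi>]]]
  ultimately show ?thesis by simp
qed

lemma weak_curl_UNIV:
  "weak_curl UNIV u w \<longleftrightarrow> (\<forall>\<phi>. vtest_fun UNIV \<phi> \<longrightarrow>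
      (\<integral>x. u x \<bullet> curl \<phi> x \<partial>lebesgue) = (\<integral>x. w x \<bullet> \<phi> x \<partial>lebesgue))"
  by (simp add: weak_curl_def lebesgue_on_UNIV_eq)

lemma weak_curl_vtest_fun: "vtest_fun UNIV \<psi> \<Longrightarrow> weak_curl UNIV \<psi> (curl \<psi>)"
  by (simp add: weak_curl_UNIV integral_curl_by_parts)

lemma smooth_grad_measurable: "smooth_on UNIV m \<Longrightarrow> grad m \<in> borel_measurable lebesgue"
proof -
  assume "smooth_on UNIV m"
  then have "continuous_on UNIV (\<lambda>x. grad m x $ j)" for j
    by (rule smooth_on_continuous[OF smooth_on_grad])
  then show ?thesis
    using continuous_on_vec_lambda[of UNIV "\<lambda>i x. grad m x $ i"]
    by (intro continuous_measurable_lebesgue) (simp add: grad_def[abs_def])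
qed

lemma norm_cross3_le: "norm (cross3 x y) \<le> norm x * norm y"
proof -
  have "(norm (cross3 x y))\<^sup>2 \<le> (norm x * norm y)\<^sup>2"
    using norm_cross_dot[of x y] by (smt (verit) zero_le_power2)
  then show ?thesis by (rule power2_le_imp_le) simp
qed

lemma cross3_measurable:
  fixes g u :: "'a \<Rightarrow> real^3"
  assumes "g \<in> borel_measurable M" "u \<in> borel_measurable M"
  shows "(\<lambda>x. cross3 (g x) (u x)) \<in> borel_measurable M"
proof -
  have "continuous_on UNIV (\<lambda>p::(real^3) \<times> (real^3). cross3 (fst p) (snd p))"
    by (intro continuous_on_cross continuous_intros)
  then show ?thesis
    by (rule borel_measurable_continuous_Pair[OF assms])
qed

lemma L2_cross:
  assumes "u \<in> L2 UNIV" "g \<in> borel_measurable lebesgue" "\<And>x. norm (g x) \<le> c"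
  shows "(\<lambda>x. cross3 (g x) (u x)) \<in> L2 UNIV"
proof (rule L2_dominated[OF assms(1) cross3_measurable])
  show "norm (cross3 (g x) (u x)) \<le> c * norm (u x)" for x
    using order_trans[OF norm_cross3_le mult_right_mono[OF assms(3)]] by simp
qed (use assms in \<open>auto simp: L2_UNIV\<close>)

text \<open>The multiplier is moved onto the test field, where the product rule is classical; the
  antisymmetry of the triple product then returns the gradient term to \<open>u\<close> with a
  positive sign. The bounds on \<open>m\<close> and \<open>grad m\<close> keep both fields square
  integrable.\<close>

lemma weak_curl_mult:
  assumes u: "u \<in> L2 UNIV" and w: "w \<in> L2 UNIV" and c: "weak_curl UNIV u w"
    and m: "smooth_on UNIV m" "\<And>x. \<bar>m x\<bar> \<le> M" "\<And>x. norm (grad m x) \<le> M'"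
  shows "(\<lambda>x. m x *\<^sub>R u x) \<in> L2 UNIV"
    "(\<lambda>x. m x *\<^sub>R w x + cross3 (grad m x) (u x)) \<in> L2 UNIV"
    "weak_curl UNIV (\<lambda>x. m x *\<^sub>R u x) (\<lambda>x. m x *\<^sub>R w x + cross3 (grad m x) (u x))"
proof -
  have mm: "m \<in> borel_measurable lebesgue"
    by (intro continuous_measurable_lebesgue smooth_on_continuous m)
  note gm = smooth_grad_measurable[OF m(1)]
  show mu: "(\<lambda>x. m x *\<^sub>R u x) \<in> L2 UNIV" using L2_mult[OF u mm m(2)] .
  have mw: "(\<lambda>x. m x *\<^sub>R w x) \<in> L2 UNIV" using L2_mult[OF w mm m(2)] .
  have gu: "(\<lambda>x. cross3 (grad m x) (u x)) \<in> L2 UNIV" using L2_cross[OF u gm m(3)] .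
  show "(\<lambda>x. m x *\<^sub>R w x + cross3 (grad m x) (u x)) \<in> L2 UNIV" using L2_add[OF mw gu] .
  show "weak_curl UNIV (\<lambda>x. m x *\<^sub>R u x) (\<lambda>x. m x *\<^sub>R w x + cross3 (grad m x) (u x))"
    unfolding weak_curl_UNIV
  proof (intro allI impI)
    fix \<phi> assume \<phi>: "vtest_fun UNIV \<phi>"
    note \<phi>L = vtest_fun_L2[OF \<phi>] and cL = vtest_fun_L2[OF vtest_fun_curl[OF \<phi>]]
    have m\<phi>: "vtest_fun UNIV (\<lambda>x. m x *\<^sub>R \<phi> x)" by (rule vtest_fun_mult[OF m(1) \<phi>])
    have cc: "curl (\<lambda>x. m x *\<^sub>R \<phi> x) x = m x *\<^sub>R curl \<phi> x + cross3 (grad m x) (\<phi> x)" for x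
      by (rule curl_mult[OF m(1) vtest_fun_differentiable[OF \<phi>]])
    have e: "m x *\<^sub>R u x \<bullet> curl \<phi> x = u x \<bullet> curl (\<lambda>x. m x *\<^sub>R \<phi> x) x + cross3 (grad m x) (u x) \<bullet> \<phi> x" for x
      by (simp add: cc inner_vec_def sum_3 cross3_def algebra_simps)
    have "(\<integral>x. m x *\<^sub>R u x \<bullet> curl \<phi> x \<partial>lebesgue)
        = (\<integral>x. u x \<bullet> curl (\<lambda>x. m x *\<^sub>R \<phi> x) x \<partial>lebesgue) + (\<integral>x. cross3 (grad m x) (u x) \<bullet> \<phi> x \<partial>lebesgue)"
      unfolding e
      by (intro Bochner_Integration.integral_add L2_inner_integrable u gu \<phi>L vtest_fun_L2[OF vtest_fun_curl[OF m\<phi>]])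
    also have "\<dots> = (\<integral>x. w x \<bullet> (m x *\<^sub>R \<phi> x) \<partial>lebesgue) + (\<integral>x. cross3 (grad m x) (u x) \<bullet> \<phi> x \<partial>lebesgue)"
      using c m\<phi> by (simp add: weak_curl_UNIV)
    also have "\<dots> = (\<integral>x. (m x *\<^sub>R w x + cross3 (grad m x) (u x)) \<bullet> \<phi> x \<partial>lebesgue)"
      using Bochner_Integration.integral_add[OF L2_inner_integrable[OF mw \<phi>L] L2_inner_integrable[OF gu \<phi>L]]
      by (simp add: inner_add_left)
    finally show "(\<integral>x. m x *\<^sub>R u x \<bullet> curl \<phi> x \<partial>lebesgue)
        = (\<integral>x. (m x *\<^sub>R w x + cross3 (grad m x) (u x)) \<bullet> \<phi> x \<partial>lebesgue)" .
  qed
qed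

section \<open>Mollification\<close>

lemma L2_dominated_convergence:
  fixes u :: "'a::euclidean_space \<Rightarrow> 'b::euclidean_space" and g :: "'a \<Rightarrow> 'c::euclidean_space"
  assumes s: "\<And>n. s n \<in> borel_measurable lebesgue" and u: "u \<in> borel_measurable lebesgue"
    and lim: "AE x in lebesgue. (\<lambda>n. s n x) \<longlonglongrightarrow> u x"
    and g: "g \<in> L2 UNIV" and bound: "\<And>n x. norm (s n x) \<le> norm (g x)"
  shows "\<And>n. s n \<in> L2 UNIV" "u \<in> L2 UNIV" "(\<lambda>n. lsq_of (s n)) \<longlonglongrightarrow> lsq_of u"
proof -
  show sL: "s n \<in> L2 UNIV" for n
    using bound by (intro L2_dominated[OF g s, where c=1]) auto
  have ub: "AE x in lebesgue. norm (u x) \<le> norm (g x)"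
    using lim by eventually_elim (rule tendsto_upperbound[OF tendsto_norm], auto simp: bound)
  have gi: "integrable lebesgue (\<lambda>x. (norm (g x))\<^sup>2)" using g by (simp add: L2_UNIV)
  have "integrable lebesgue (\<lambda>x. (norm (u x))\<^sup>2)"
    by (rule Bochner_Integration.integrable_bound[OF gi])
      (use u ub in \<open>auto intro!: power_mono elim!: eventually_mono\<close>)
  with u show uL: "u \<in> L2 UNIV" by (simp add: L2_UNIV)
  have "(\<lambda>n. \<integral>x. (norm (s n x - u x))\<^sup>2 \<partial>lebesgue) \<longlonglongrightarrow> (\<integral>x. 0 \<partial>(lebesgue :: 'a measure))"
  proof (rule integral_dominated_convergence[where w="\<lambda>x. 4 * (norm (g x))\<^sup>2"])
    show "integrable lebesgue (\<lambda>x. 4 * (norm (g x))\<^sup>2)" using gi by simp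
    show "AE x in lebesgue. (\<lambda>n. (norm (s n x - u x))\<^sup>2) \<longlonglongrightarrow> 0"
      using lim
    proof eventually_elim
      case (elim x)
      have "(\<lambda>n. (norm (s n x - u x))\<^sup>2) \<longlonglongrightarrow> (norm (u x - u x))\<^sup>2"
        by (intro tendsto_intros elim)
      then show ?case by simp
    qed
    show "AE x in lebesgue. norm ((norm (s n x - u x))\<^sup>2) \<le> 4 * (norm (g x))\<^sup>2" for n
      using ub
    proof eventually_elim
      case (elim x)
      have "norm (s n x - u x) \<le> 2 * norm (g x)"
        using norm_triangle_ineq4[of "s n x" "u x"] bound[of n x] elim by linarith
      from power_mono[OF this norm_ge_zero, of 2] show ?case by (simp add: power_mult_distrib)
    qed
  qed (use s u in auto)
  then have "(\<lambda>n. (norm (lsq_of (s n) - lsq_of u))\<^sup>2) \<longlonglongrightarrow> 0"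
    using norm_lsq_of_sq[OF L2_diff[OF sL uL]] by (simp add: lsq_of_simps sL uL)
  then have "(\<lambda>n. sqrt ((norm (lsq_of (s n) - lsq_of u))\<^sup>2)) \<longlonglongrightarrow> sqrt 0"
    by (rule tendsto_real_sqrt)
  then have "(\<lambda>n. norm (lsq_of (s n) - lsq_of u)) \<longlonglongrightarrow> 0" by simp
  then show "(\<lambda>n. lsq_of (s n)) \<longlonglongrightarrow> lsq_of u"
    by (simp add: tendsto_norm_zero_iff LIM_zero_iff)
qed

lemma L2_bounded_support:
  fixes u :: "'a::euclidean_space \<Rightarrow> 'b::euclidean_space"
  assumes "u \<in> borel_measurable lebesgue" "\<And>x. norm (u x) \<le> C" "\<And>x. norm x > R \<Longrightarrow> u x = 0"
  shows "u \<in> L2 UNIV"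
proof -
  have "integrable lebesgue (\<lambda>x. (norm (u x))\<^sup>2)"
  proof (rule integrable_bounded_support(1)[where C="C\<^sup>2" and R=R])
    show "norm ((norm (u x))\<^sup>2) \<le> C\<^sup>2" for x
      using power_mono[OF assms(2)[of x] norm_ge_zero, of 2] by simp
  qed (use assms in auto)
  with assms(1) show ?thesis by (simp add: L2_UNIV)
qed

lemma norm_closest_point_cball:
  fixes y :: "'a::euclidean_space"
  assumes "M \<ge> 0"
  shows "norm (closest_point (cball 0 M) y) \<le> norm y" "norm (closest_point (cball 0 M) y) \<le> M"
    "norm y \<le> M \<Longrightarrow> closest_point (cball 0 M) y = y"
    "continuous_on UNIV (closest_point (cball (0::'a) M))"
proof -
  have ne: "cball (0::'a) M \<noteq> {}" using assms by auto
  have "closest_point (cball 0 M) (0::'a) = 0" using assms by (intro closest_point_self) auto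
  then show "norm (closest_point (cball 0 M) y) \<le> norm y"
    using closest_point_lipschitz[OF convex_cball closed_cball ne, of y 0] by simp
  show "norm (closest_point (cball 0 M) y) \<le> M"
    using closest_point_in_set[OF closed_cball ne, of y] by simp
  show "norm y \<le> M \<Longrightarrow> closest_point (cball 0 M) y = y"
    by (rule closest_point_self) auto
  show "continuous_on UNIV (closest_point (cball (0::'a) M))"
    by (rule continuous_on_closest_point[OF convex_cball closed_cball ne])
qed

text \<open>Truncation in space and in values gives bounded functions with bounded support that tend
  to \<open>u\<close>. Continuous functions converging to \<open>u\<close> almost everywhere come
  without any bound; sending them through the same truncation makes them dominated and keeps the
  limit.\<close>

lemma L2_approx_continuous:
  fixes u :: "'a::euclidean_space \<Rightarrow> 'b::euclidean_space"
  assumes u: "u \<in> L2 UNIV" and e: "e > 0"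
  obtains v R where "continuous_on UNIV v" "\<And>x. norm x > R \<Longrightarrow> v x = 0" "v \<in> L2 UNIV"
    "norm (lsq_of v - lsq_of u) < e"
proof -
  define \<psi> where "\<psi> M x = max 0 (min 1 (M + 1 - norm x))" for M and x :: 'a
  define clip where "clip M = closest_point (cball (0::'b) M)" for M
  have \<psi>: "0 \<le> \<psi> M x" "\<psi> M x \<le> 1" "norm x > M + 1 \<Longrightarrow> \<psi> M x = 0" "norm x \<le> M \<Longrightarrow> \<psi> M x = 1" for M x
    by (auto simp: \<psi>_def)
  have \<psi>c: "continuous_on UNIV (\<psi> M)" for M
    unfolding \<psi>_def by (intro continuous_intros)
  have cut: "norm (\<psi> M x *\<^sub>R z) \<le> norm z" for M x z
    using \<psi>(1,2)[of M x] by (simp add: mult_left_le_one_le)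
  have um: "u \<in> borel_measurable lebesgue" using u by (simp add: L2_UNIV)
  define w where "w n x = \<psi> (real n) x *\<^sub>R clip (real n) (u x)" for n :: nat and x
  have wm: "w n \<in> borel_measurable lebesgue" for n
    unfolding w_def clip_def
    using measurable_compose[OF um borel_measurable_continuous_onI[OF norm_closest_point_cball(4)[of "real n"]]]
      continuous_measurable_lebesgue[OF \<psi>c] by simp
  have wlim: "(\<lambda>n. w n x) \<longlonglongrightarrow> u x" for x
  proof (rule tendsto_eventually)
    obtain N :: nat where N: "max (norm x) (norm (u x)) \<le> real N" using real_arch_simple by blast
    have "w n x = u x" if "N \<le> n" for n
    proof -
      have "norm x \<le> real n" "norm (u x) \<le> real n" using N that by auto
      then show ?thesis using norm_closest_point_cball(3)[of "real n" "u x"] \<psi>(4)[of x "real n"]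
        by (simp add: w_def clip_def)
    qed
    then show "\<forall>\<^sub>F n in sequentially. w n x = u x" by (auto simp: eventually_sequentially)
  qed
  have wb: "norm (w n x) \<le> norm (u x)" for n x
    using cut[of "real n" x "clip (real n) (u x)"] norm_closest_point_cball(1)[of "real n" "u x"]
    by (simp add: w_def clip_def)
  note L1 = L2_dominated_convergence[OF wm um always_eventually[OF allI[OF wlim]] u wb]
  obtain n where n: "norm (lsq_of (w n) - lsq_of u) < e/2"
    using LIMSEQ_D[OF L1(3), of "e/2"] e by auto
  have "u measurable_on UNIV" using lebesgue_measurable_imp_measurable_on[OF um] by simp
  then obtain N g where N: "negligible N" and g: "\<And>k::nat. continuous_on UNIV (g k)"
    and glim: "\<And>x. x \<notin> N \<Longrightarrow> (\<lambda>k. g k x) \<longlonglongrightarrow> u x"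
    by (auto simp: measurable_on_def)
  define v where "v k x = \<psi> (real n) x *\<^sub>R clip (real n) (g k x)" for k x
  have vc: "continuous_on UNIV (v k)" for k
    unfolding v_def clip_def
    by (intro continuous_intros \<psi>c continuous_on_compose2[OF norm_closest_point_cball(4) g]) auto
  have vlim: "AE x in lebesgue. (\<lambda>k. v k x) \<longlonglongrightarrow> w n x"
  proof -
    have "AE x in lebesgue. x \<notin> N" using N by (simp add: AE_not_in negligible_iff_null_sets)
    then show ?thesis
    proof eventually_elim
      case (elim x)
      have "continuous_on UNIV (clip (real n))"
        unfolding clip_def by (rule norm_closest_point_cball(4)) simp
      then have "isCont (clip (real n)) (u x)"
        by (simp add: continuous_on_eq_continuous_at)
      from isCont_tendsto_compose[OF this glim[OF elim]] show ?case
        unfolding v_def w_def by (intro tendsto_intros)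
    qed
  qed
  let ?g = "\<lambda>x::'a. real n * indicator (cball 0 (real n + 1)) x"
  have vb: "norm (v k x) \<le> norm (?g x)" for k x
  proof (cases "norm x \<le> real n + 1")
    case True
    then show ?thesis
      using order_trans[OF cut norm_closest_point_cball(2)[of "real n" "g k x"], of "real n" x]
      by (simp add: v_def clip_def)
  next
    case False
    then show ?thesis using \<psi>(3)[of "real n" x] by (simp add: v_def)
  qed
  have gL: "?g \<in> L2 UNIV"
  proof (rule L2_bounded_support[where C="real n" and R="real n + 1"])
    show "?g \<in> borel_measurable lebesgue" by (intro borel_measurable_times borel_measurable_indicator) auto
  qed (auto simp: indicator_def)
  note L2' = L2_dominated_convergence[OF continuous_measurable_lebesgue[OF vc] wm vlim gL vb]
  obtain k where k: "norm (lsq_of (v k) - lsq_of (w n)) < e/2"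
    using LIMSEQ_D[OF L2'(3), of "e/2"] e by auto
  show ?thesis
  proof (rule that)
    show "continuous_on UNIV (v k)" by (rule vc)
    show "v k x = 0" if "norm x > real n + 1" for x using \<psi>(3)[OF that] by (simp add: v_def)
    show "v k \<in> L2 UNIV" by (rule L2'(1))
    have "norm (lsq_of (v k) - lsq_of u) \<le> norm (lsq_of (v k) - lsq_of (w n)) + norm (lsq_of (w n) - lsq_of u)"
      using norm_triangle_ineq[of "lsq_of (v k) - lsq_of (w n)" "lsq_of (w n) - lsq_of u"] by simp
    with n k show "norm (lsq_of (v k) - lsq_of u) < e" by linarith
  qed
qed

section \<open>Convolution and approximation in L2\<close>

definition conv :: "('a::euclidean_space \<Rightarrow> real) \<Rightarrow> ('a \<Rightarrow> 'b::euclidean_space) \<Rightarrow> 'a \<Rightarrow> 'b" where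
  "conv k u x = (\<integral>y. k (x - y) *\<^sub>R u y \<partial>lebesgue)"

lemma integrable_shifted_mult:
  fixes u :: "'a::euclidean_space \<Rightarrow> 'b::euclidean_space"
  assumes k: "test_fun S k" and u: "integrable lebesgue u"
  shows "integrable lebesgue (\<lambda>y. k (x - y) *\<^sub>R u y)"
proof -
  obtain C where C: "C \<ge> 0" "\<And>x. \<bar>k x\<bar> \<le> C" using test_fun_bounded[OF k] by blast
  have c: "continuous_on UNIV (\<lambda>y. k (x - y))"
    by (intro continuous_on_compose2[OF test_fun_continuous[OF k]] continuous_intros) auto
  show ?thesis
  proof (rule Bochner_Integration.integrable_bound)
    show "integrable lebesgue (\<lambda>y. C *\<^sub>R u y)" using u by simp
    show "AE y in lebesgue. norm (k (x - y) *\<^sub>R u y) \<le> norm (C *\<^sub>R u y)"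
      using C by (auto intro!: mult_right_mono)
  qed (use continuous_measurable_lebesgue[OF c] u in auto)
qed

lemma integral_lebesgue_reflect:
  fixes g :: "'a::euclidean_space \<Rightarrow> real"
  assumes "continuous_on UNIV g"
  shows "(\<integral>y. g (x - y) \<partial>lebesgue) = (\<integral>y. g y \<partial>lebesgue)"
proof -
  have [measurable]: "g \<in> borel_measurable borel" using assms by (rule borel_measurable_continuous_onI)
  have c: "continuous_on UNIV (\<lambda>y. g (- y))"
    by (intro continuous_on_compose2[OF assms] continuous_intros) auto
  have "(\<integral>y. g y \<partial>lebesgue) = (\<integral>y. g y \<partial>distr lborel borel uminus)"
    using lborel_affine[of "-1" "0::'a"] by (simp add: integral_completion density_1)
  also have "\<dots> = (\<integral>y. g (- y) \<partial>lborel)" by (rule integral_distr) auto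
  also have "\<dots> = (\<integral>y. g (- y) \<partial>lebesgue)" by (subst integral_completion) auto
  also have "\<dots> = (\<integral>y. g (- (y + - x)) \<partial>lebesgue)"
    by (rule integral_lebesgue_shift[OF c, symmetric])
  finally show ?thesis by simp
qed

text \<open>Tonelli for \<open>lborel\<close> needs Borel integrands, whereas the fields are only
  Lebesgue measurable; the representative is built coordinate by coordinate.\<close>

lemma lsq_borel_representative:
  fixes u :: "'a::euclidean_space \<Rightarrow> 'b::euclidean_space"
  assumes "u \<in> borel_measurable lebesgue"
  shows "\<exists>v\<in>borel_measurable borel. AE x in lebesgue. u x = v x"
proof -
  have "\<exists>g\<in>borel_measurable lborel. AE x in lborel. u x \<bullet> i = g x" for i
    using assms by (intro completion_ex_borel_measurable_real) auto
  then obtain g where g: "\<And>i. g i \<in> borel_measurable lborel" "\<And>i. AE x in lborel. u x \<bullet> i = g i x"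
    by metis
  have "AE x in lborel. \<forall>i\<in>Basis. u x \<bullet> i = g i x"
    using g(2) by (intro AE_finite_allI) auto
  then have "AE x in lebesgue. \<forall>i\<in>Basis. u x \<bullet> i = g i x" by (rule AE_completion)
  then have "AE x in lebesgue. u x = (\<Sum>i\<in>Basis. g i x *\<^sub>R i)"
  proof eventually_elim
    case (elim x)
    have "u x = (\<Sum>i\<in>Basis. (u x \<bullet> i) *\<^sub>R i)" by (simp add: euclidean_representation)
    also have "\<dots> = (\<Sum>i\<in>Basis. g i x *\<^sub>R i)" using elim by (intro sum.cong) auto
    finally show ?case .
  qed
  moreover have "(\<lambda>x. \<Sum>i\<in>Basis. g i x *\<^sub>R i) \<in> borel_measurable borel" using g(1) by simp
  ultimately show ?thesis by (intro bexI[where x="\<lambda>x. \<Sum>i\<in>Basis. g i x *\<^sub>R i"])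
qed

lemma conv_cong_AE:
  assumes "AE y in lebesgue. u y = v y" "u \<in> borel_measurable lebesgue" "v \<in> borel_measurable lebesgue"
    "continuous_on UNIV k"
  shows "conv k u x = conv k v x"
proof -
  have "continuous_on UNIV (\<lambda>y. k (x - y))"
    by (intro continuous_on_compose2[OF assms(4)] continuous_intros) auto
  note [measurable] = continuous_measurable_lebesgue[OF this] assms(2,3)
  show ?thesis unfolding conv_def
    using assms(1) by (intro integral_cong_AE) (auto elim!: eventually_mono)
qed

lemma conv_continuous:
  fixes u :: "'a::euclidean_space \<Rightarrow> 'b::euclidean_space"
  assumes k: "test_fun S k" and u: "integrable lebesgue u"
  shows "continuous_on UNIV (conv k u)"
proof -
  obtain C where C: "C \<ge> 0" "\<And>x y. \<bar>k x - k y\<bar> \<le> C * norm (x - y)"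
    using test_fun_lipschitz[OF k] by blast
  define I where "I = (\<integral>y. norm (u y) \<partial>lebesgue)"
  have I: "I \<ge> 0" by (simp add: I_def)
  note i = integrable_shifted_mult[OF k u]
  have "dist (conv k u x) (conv k u z) \<le> (C * I) * dist x z" for x z
  proof -
    have "conv k u x - conv k u z = (\<integral>y. (k (x - y) - k (z - y)) *\<^sub>R u y \<partial>lebesgue)"
      unfolding conv_def using i by (simp add: scaleR_diff_left)
    also have "norm \<dots> \<le> (\<integral>y. norm ((k (x - y) - k (z - y)) *\<^sub>R u y) \<partial>lebesgue)"
      by (rule integral_norm_bound)
    also have "\<dots> \<le> (\<integral>y. (C * norm (x - z)) * norm (u y) \<partial>lebesgue)"
    proof (rule integral_mono)
      show "integrable lebesgue (\<lambda>y. norm ((k (x - y) - k (z - y)) *\<^sub>R u y))"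
        using i[of x] i[of z] by (intro integrable_norm) (simp add: scaleR_diff_left)
      show "norm ((k (x - y) - k (z - y)) *\<^sub>R u y) \<le> (C * norm (x - z)) * norm (u y)" for y
        using C(2)[of "x - y" "z - y"] by (auto intro!: mult_right_mono)
    qed (use u in simp)
    finally show ?thesis by (simp add: I_def dist_norm mult_ac)
  qed
  then have "(C * I)-lipschitz_on UNIV (conv k u)"
    using C(1) I by (intro lipschitz_onI) auto
  then show ?thesis by (rule lipschitz_on_continuous_on)
qed

text \<open>Cauchy-Schwarz for the kernel split as \<open>sqrt k\<close> times
  \<open>sqrt k * norm v\<close> gives a pointwise bound, since \<open>k\<close> has mass one;
  Tonelli then integrates \<open>k\<close> out in the other variable.\<close>

lemma Young_L2:
  fixes u :: "'a::euclidean_space \<Rightarrow> 'b::euclidean_space"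
  assumes k: "test_fun S k" "\<And>x. k x \<ge> 0" "(\<integral>x. k x \<partial>lebesgue) = 1"
    and u: "u \<in> L2 UNIV" "integrable lebesgue u"
  shows "conv k u \<in> L2 UNIV" "norm (lsq_of (conv k u)) \<le> norm (lsq_of u)"
proof -
  have um: "u \<in> borel_measurable lebesgue" using u by (simp add: L2_UNIV)
  obtain v where v: "v \<in> borel_measurable borel" "AE x in lebesgue. u x = v x"
    using lsq_borel_representative[OF um] by blast
  have vm: "v \<in> borel_measurable lebesgue" using v(1) by (intro measurable_completion) simp
  have vL: "v \<in> L2 UNIV" and luv: "lsq_of u = lsq_of v" using lsq_of_cong_AE[OF u(1) vm v(2)] by auto
  have vi: "integrable lebesgue v" using u(2) integrable_cong_AE[OF um vm v(2)] by simp
  note kc = test_fun_continuous[OF k(1)]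
  have cuv: "conv k u = conv k v" by (rule ext) (rule conv_cong_AE[OF v(2) um vm kc])
  note [measurable] = v(1) borel_measurable_continuous_onI[OF kc]
  have cm: "conv k v \<in> borel_measurable lebesgue"
    by (rule continuous_measurable_lebesgue[OF conv_continuous[OF k(1) vi]])
  have k1: "(\<integral>\<^sup>+y. ennreal (k (x - y)) \<partial>lborel) = 1" and k2: "(\<integral>\<^sup>+y. ennreal (k (y - x)) \<partial>lborel) = 1" for x
  proof -
    have c1: "continuous_on UNIV (\<lambda>y. k (x - y))" and c2: "continuous_on UNIV (\<lambda>y. k (y - x))"
      by (intro continuous_on_compose2[OF kc] continuous_intros; simp)+
    have i: "(\<integral>y. k (x - y) \<partial>lebesgue) = 1" "(\<integral>y. k (y - x) \<partial>lebesgue) = 1"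
      using integral_lebesgue_reflect[OF kc, of x] integral_lebesgue_shift[OF kc, of "- x"] k(3) by simp_all
    \<comment> \<open>A function that is not integrable has integral 0 by convention, so an integral
      equal to 1 proves integrability.\<close>
    have "integrable lebesgue (\<lambda>y. k (x - y))" "integrable lebesgue (\<lambda>y. k (y - x))"
      by (rule ccontr, use i in \<open>simp add: not_integrable_integral_eq\<close>)+
    note ii = this
    show "(\<integral>\<^sup>+y. ennreal (k (x - y)) \<partial>lborel) = 1"
      using nn_integral_eq_integral[OF ii(1)] k(2) i(1) by (simp add: nn_integral_completion)
    show "(\<integral>\<^sup>+y. ennreal (k (y - x)) \<partial>lborel) = 1"
      using nn_integral_eq_integral[OF ii(2)] k(2) i(2) by (simp add: nn_integral_completion)
  qed
  have pw: "ennreal ((norm (conv k v x))\<^sup>2) \<le> (\<integral>\<^sup>+y. ennreal (k (x - y) * (norm (v y))\<^sup>2) \<partial>lborel)" for x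
  proof -
    have "ennreal (norm (conv k v x)) \<le> (\<integral>\<^sup>+y. ennreal (norm (k (x - y) *\<^sub>R v y)) \<partial>lebesgue)"
      unfolding conv_def by (rule integral_norm_bound_ennreal[OF integrable_shifted_mult[OF k(1) vi]])
    also have "\<dots> = (\<integral>\<^sup>+y. ennreal (sqrt (k (x - y))) * ennreal (sqrt (k (x - y)) * norm (v y)) \<partial>lborel)"
      using k(2) by (simp add: nn_integral_completion flip: ennreal_mult mult.assoc)
    finally have "(ennreal (norm (conv k v x)))\<^sup>2 \<le>
        (\<integral>\<^sup>+y. ennreal (sqrt (k (x - y))) * ennreal (sqrt (k (x - y)) * norm (v y)) \<partial>lborel)\<^sup>2"
      by (rule power_mono) simp
    also have "\<dots> \<le> (\<integral>\<^sup>+y. (ennreal (sqrt (k (x - y))))\<^sup>2 \<partial>lborel)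
        * (\<integral>\<^sup>+y. (ennreal (sqrt (k (x - y)) * norm (v y)))\<^sup>2 \<partial>lborel)"
      by (rule Cauchy_Schwarz_nn_integral) auto
    also have "(\<integral>\<^sup>+y. (ennreal (sqrt (k (x - y))))\<^sup>2 \<partial>lborel) = 1"
      using k(2) k1[of x] by (simp add: ennreal_power)
    also have "(\<integral>\<^sup>+y. (ennreal (sqrt (k (x - y)) * norm (v y)))\<^sup>2 \<partial>lborel)
        = (\<integral>\<^sup>+y. ennreal (k (x - y) * (norm (v y))\<^sup>2) \<partial>lborel)"
      using k(2) by (simp add: ennreal_power power_mult_distrib)
    finally show ?thesis by (simp add: ennreal_power)
  qed
  have "(\<integral>\<^sup>+x. ennreal ((norm (conv k v x))\<^sup>2) \<partial>lborel)
      \<le> (\<integral>\<^sup>+x. \<integral>\<^sup>+y. ennreal (k (x - y) * (norm (v y))\<^sup>2) \<partial>lborel \<partial>lborel)"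
    by (intro nn_integral_mono pw)
  also have "\<dots> = (\<integral>\<^sup>+y. \<integral>\<^sup>+x. ennreal (k (x - y) * (norm (v y))\<^sup>2) \<partial>lborel \<partial>lborel)"
    by (rule lborel_pair.Fubini'[symmetric]) (simp add: split_beta')
  also have "\<dots> = (\<integral>\<^sup>+y. (\<integral>\<^sup>+x. ennreal (k (x - y)) \<partial>lborel) * ennreal ((norm (v y))\<^sup>2) \<partial>lborel)"
    using k(2) by (simp add: ennreal_mult nn_integral_multc)
  also have "\<dots> = (\<integral>\<^sup>+y. ennreal ((norm (v y))\<^sup>2) \<partial>lebesgue)"
    by (simp add: k2 nn_integral_completion)
  also have "\<dots> = ennreal ((norm (lsq_of v))\<^sup>2)" by (rule nn_integral_norm_lsq[OF vL])
  finally have b: "(\<integral>\<^sup>+x. ennreal ((norm (conv k v x))\<^sup>2) \<partial>lebesgue) \<le> ennreal ((norm (lsq_of v))\<^sup>2)"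
    by (simp add: nn_integral_completion)
  have cL: "conv k v \<in> L2 UNIV"
    using cm le_less_trans[OF b ennreal_less_top] by (simp add: L2_UNIV integrable_iff_bounded)
  then show "conv k u \<in> L2 UNIV" by (simp add: cuv)
  have "(norm (lsq_of (conv k v)))\<^sup>2 \<le> (norm (lsq_of v))\<^sup>2"
    using b unfolding nn_integral_norm_lsq[OF cL] by simp
  then show "norm (lsq_of (conv k u)) \<le> norm (lsq_of u)"
    unfolding cuv luv by (rule power2_le_imp_le) simp
qed

lemma compact_support_uniformly_continuous:
  fixes v :: "'a::euclidean_space \<Rightarrow> 'b::metric_space"
  assumes "continuous_on UNIV v" "\<And>x. norm x > R \<Longrightarrow> v x = c" "e > 0"
  obtains d where "d > 0" "\<And>x y. dist x y < d \<Longrightarrow> dist (v x) (v y) < e"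
proof -
  have "uniformly_continuous_on (cball 0 (R + 1)) v"
    using assms(1) by (intro compact_uniformly_continuous) (auto intro: continuous_on_subset)
  then obtain d where d: "d > 0" "\<And>x y. x \<in> cball 0 (R + 1) \<Longrightarrow> y \<in> cball 0 (R + 1) \<Longrightarrow> dist y x < d \<Longrightarrow> dist (v y) (v x) < e"
    using assms(3) unfolding uniformly_continuous_on_def by metis
  show ?thesis
  proof (rule that)
    show "min d 1 > 0" using d by simp
    fix x y :: 'a assume xy: "dist x y < min d 1"
    have n: "\<bar>norm x - norm y\<bar> < 1" using xy norm_triangle_ineq3[of x y] by (simp add: dist_norm)
    show "dist (v x) (v y) < e"
    proof (cases "norm x \<le> R + 1 \<and> norm y \<le> R + 1")
      case True then show ?thesis using d(2)[of y x] xy by auto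
    next
      case False
      then have "norm x > R" "norm y > R" using n by auto
      then show ?thesis using assms(2,3) by simp
    qed
  qed
qed

lemma integrable_L2_bounded_support:
  fixes u :: "'a::euclidean_space \<Rightarrow> 'b::euclidean_space"
  assumes u: "u \<in> L2 UNIV" and R: "\<And>x. norm x > R \<Longrightarrow> u x = 0"
  shows "integrable lebesgue u"
proof -
  have um: "u \<in> borel_measurable lebesgue" using u by (simp add: L2_UNIV)
  have i: "integrable lebesgue (\<lambda>x::'a. indicator (cball 0 R) x + (norm (u x))\<^sup>2)"
    using u lmeasurable_cball[of "0::'a" R] by (simp add: L2_UNIV lmeasurable_iff_integrable)
  show ?thesis
  proof (rule Bochner_Integration.integrable_bound[OF i um], rule always_eventually, rule allI)
    fix x
    have "2 * norm (u x) \<le> 1 + (norm (u x))\<^sup>2"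
      using sum_squares_bound[of 1 "norm (u x)"] by simp
    then have "norm (u x) \<le> 1 + (norm (u x))\<^sup>2"
      using norm_ge_zero[of "u x"] by linarith
    then show "norm (u x) \<le> norm (indicator (cball 0 R) x + (norm (u x))\<^sup>2 :: real)"
      using R[of x] by (cases "norm x \<le> R") auto
  qed
qed

text \<open>The radius \<open>d\<close> depends only on \<open>u\<close> and \<open>e\<close> and
  works for every nonnegative kernel of mass one supported in the ball, symmetric or not. The
  boundary argument needs this freedom: its kernels are concentrated away from the origin.\<close>

lemma mollify_approx:
  fixes u :: "'a::euclidean_space \<Rightarrow> 'b::euclidean_space"
  assumes u: "u \<in> L2 UNIV" and R: "\<And>x. norm x > R \<Longrightarrow> u x = 0" and e: "e > 0"
  obtains d where "d > 0"
    "\<And>k. test_fun (ball 0 d) k \<Longrightarrow> (\<And>x. k x \<ge> 0) \<Longrightarrow> (\<integral>x. k x \<partial>lebesgue) = 1 \<Longrightarrow>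
       norm (lsq_of (conv k u) - lsq_of u) < e"
proof -
  obtain v R' where v: "continuous_on UNIV v" "\<And>x. norm x > R' \<Longrightarrow> v x = 0" "v \<in> L2 UNIV"
    "norm (lsq_of v - lsq_of u) < e/4"
    using L2_approx_continuous[OF u, of "e/4"] e by (auto simp: algebra_simps)
  \<comment> \<open>\<open>c\<close> dominates the square root of the volume of the ball that
    carries \<open>conv k v - v\<close>, so a uniform error \<open>e / (4 * c)\<close> costs at most
    \<open>e / 4\<close> in norm; the summand 1 keeps it positive.\<close>
  define c where "c = sqrt (measure lebesgue (cball (0::'a) (R' + 1))) + 1"
  have c: "c > 0" using real_sqrt_ge_zero[OF measure_nonneg, of lebesgue "cball (0::'a) (R' + 1)"]
    unfolding c_def by linarith
  obtain d0 where d0: "d0 > 0" "\<And>x y. dist x y < d0 \<Longrightarrow> dist (v x) (v y) < e / (4 * c)"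
    using compact_support_uniformly_continuous[OF v(1), of R' 0 "e / (4*c)"] v(2) e c
    by (metis divide_pos_pos mult_pos_pos zero_less_numeral)
  define d where "d = min d0 1"
  have ui: "integrable lebesgue u" by (rule integrable_L2_bounded_support[OF u R])
  have vi: "integrable lebesgue v" by (rule integrable_L2_bounded_support[OF v(3,2)])
  show ?thesis
  proof (rule that)
    show "d > 0" using d0 by (simp add: d_def)
    fix k :: "'a \<Rightarrow> real"
    assume k: "test_fun (ball 0 d) k" "\<And>x. k x \<ge> 0" "(\<integral>x. k x \<partial>lebesgue) = 1"
    note kc = test_fun_continuous[OF k(1)]
    have k0: "k x = 0" if "norm x \<ge> d" for x
      using test_fun_support[OF k(1)] that by (force simp: subset_eq)
    note Yu = Young_L2[OF k u ui] and Yv = Young_L2[OF k v(3) vi]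
    have k1: "(\<integral>y. k (x - y) \<partial>lebesgue) = 1" for x
      using integral_lebesgue_reflect[OF kc] k(3) by simp
    have ki: "integrable lebesgue (\<lambda>y. k (x - y))" for x
      by (rule ccontr) (use k1[of x] in \<open>simp add: not_integrable_integral_eq\<close>)
    have d1: "norm (conv k v x - v x) \<le> e / (4 * c)" for x
    proof -
      have "conv k v x - v x = (\<integral>y. k (x - y) *\<^sub>R v y \<partial>lebesgue) - (\<integral>y. k (x - y) \<partial>lebesgue) *\<^sub>R v x"
        by (simp add: conv_def k1)
      also have "\<dots> = (\<integral>y. k (x - y) *\<^sub>R (v y - v x) \<partial>lebesgue)"
        using integrable_shifted_mult[OF k(1) vi] ki by (simp add: scaleR_diff_right)
      also have "norm \<dots> \<le> (\<integral>y. norm (k (x - y) *\<^sub>R (v y - v x)) \<partial>lebesgue)" by (rule integral_norm_bound)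
      also have "\<dots> \<le> (\<integral>y. k (x - y) * (e / (4 * c)) \<partial>lebesgue)"
      proof (rule integral_mono)
        show "integrable lebesgue (\<lambda>y. norm (k (x - y) *\<^sub>R (v y - v x)))"
          using integrable_shifted_mult[OF k(1) vi] ki by (intro integrable_norm) (simp add: scaleR_diff_right)
        show "integrable lebesgue (\<lambda>y. k (x - y) * (e / (4 * c)))" using ki by simp
        fix y
        show "norm (k (x - y) *\<^sub>R (v y - v x)) \<le> k (x - y) * (e / (4 * c))"
        proof (cases "norm (x - y) < d")
          case True
          then have "norm (v y - v x) \<le> e / (4 * c)"
            using d0(2)[of y x] by (simp add: d_def dist_norm norm_minus_commute less_imp_le)
          from mult_left_mono[OF this k(2)[of "x - y"]] show ?thesis using k(2)[of "x - y"] by simp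
        qed (simp add: k0)
      qed
      also have "\<dots> = e / (4 * c)" by (simp add: k1)
      finally show ?thesis .
    qed
    have d2: "conv k v x - v x = 0" if x: "norm x > R' + 1" for x
    proof -
      have "k (x - y) *\<^sub>R v y = 0" for y
      proof (cases "norm y > R'")
        case False
        then have "norm (x - y) \<ge> d" using x norm_triangle_ineq2[of x y] by (simp add: d_def)
        then show ?thesis by (simp add: k0)
      qed (simp add: v(2))
      then have "conv k v x = (\<integral>y. 0 \<partial>(lebesgue :: 'a measure))"
        unfolding conv_def by (intro Bochner_Integration.integral_cong refl)
      then show ?thesis using v(2)[of x] x by simp
    qed
    have "(norm (lsq_of (conv k v) - lsq_of v))\<^sup>2 = (\<integral>x. (norm (conv k v x - v x))\<^sup>2 \<partial>lebesgue)"
      using norm_lsq_of_sq[OF L2_diff[OF Yv(1) v(3)]] by (simp add: lsq_of_simps Yv v)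
    also have "\<dots> \<le> norm (\<integral>x. (norm (conv k v x - v x))\<^sup>2 \<partial>lebesgue)" by simp
    also have "\<dots> \<le> (e / (4 * c))\<^sup>2 * measure lebesgue (cball (0::'a) (R' + 1))"
    proof (rule integrable_bounded_support(2))
      show "(\<lambda>x. (norm (conv k v x - v x))\<^sup>2) \<in> borel_measurable lebesgue"
        using Yv v by (auto simp: L2_UNIV)
      show "norm ((norm (conv k v x - v x))\<^sup>2) \<le> (e / (4 * c))\<^sup>2" for x
        using power_mono[OF d1[of x] norm_ge_zero, of 2] by simp
    qed (use d2 in auto)
    also have "\<dots> \<le> (e / (4 * c))\<^sup>2 * c\<^sup>2"
    proof (intro mult_left_mono)
      have "measure lebesgue (cball (0::'a) (R' + 1)) = (sqrt (measure lebesgue (cball (0::'a) (R' + 1))))\<^sup>2" by simp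
      also have "\<dots> \<le> c\<^sup>2" unfolding c_def by (intro power_mono) auto
      finally show "measure lebesgue (cball (0::'a) (R' + 1)) \<le> c\<^sup>2" .
    qed simp
    also have "\<dots> = (e / 4)\<^sup>2" using c by (simp add: power_divide power_mult_distrib)
    finally have n1: "norm (lsq_of (conv k v) - lsq_of v) \<le> e / 4"
      using e by (auto intro: power2_le_imp_le)
    have uvi: "integrable lebesgue (\<lambda>y. u y - v y)" using ui vi by simp
    have cd: "conv k (\<lambda>y. u y - v y) = (\<lambda>x. conv k u x - conv k v x)"
      using integrable_shifted_mult[OF k(1) ui] integrable_shifted_mult[OF k(1) vi]
      by (simp add: conv_def scaleR_diff_right fun_eq_iff)
    have "norm (lsq_of (conv k u) - lsq_of (conv k v)) \<le> norm (lsq_of u - lsq_of v)"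
      using Young_L2(2)[OF k L2_diff[OF u v(3)] uvi] by (simp add: cd lsq_of_simps Yu Yv u v)
    also have "\<dots> < e / 4" using v(4) by (simp add: norm_minus_commute)
    finally have n2: "norm (lsq_of (conv k u) - lsq_of (conv k v)) < e / 4" .
    have "norm (lsq_of (conv k u) - lsq_of u) \<le> norm (lsq_of (conv k u) - lsq_of (conv k v))
        + norm (lsq_of (conv k v) - lsq_of v) + norm (lsq_of v - lsq_of u)"
      using norm_triangle_ineq[of "lsq_of (conv k u) - lsq_of (conv k v)" "lsq_of (conv k v) - lsq_of u"]
        norm_triangle_ineq[of "lsq_of (conv k v) - lsq_of v" "lsq_of v - lsq_of u"] by simp
    with n1 n2 v(4) e show "norm (lsq_of (conv k u) - lsq_of u) < e" by linarith
  qed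
qed

lemma mollifier_exists:
  fixes c :: "'a::euclidean_space"
  assumes "s > 0"
  obtains k where "test_fun (ball c s) k" "\<And>x. k x \<ge> 0" "(\<integral>x. k x \<partial>lebesgue) = 1"
proof -
  \<comment> \<open>The bump has radius \<open>s / 2\<close>, so that its closed support stays
    inside the open ball of radius \<open>s\<close>.\<close>
  define k0 where "k0 x = flat_exp 0 ((s/2)\<^sup>2 - (norm (x - c))\<^sup>2)" for x
  have sm: "smooth_on UNIV k0"
    unfolding k0_def by (intro smooth_on_compose[OF _ smooth_on_flat_exp] smooth_on_diff smooth_on_const smooth_on_norm_sq) auto
  have pos: "k0 x > 0 \<longleftrightarrow> norm (x - c) < s/2" for x
    using assms power_strict_mono[of "norm (x - c)" "s/2" 2] power2_less_imp_less[of "norm (x - c)" "s/2"]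
    by (auto simp: k0_def flat_exp_pos_iff)
  have nn: "k0 x \<ge> 0" for x by (simp add: k0_def flat_exp_nonneg)
  have t: "test_fun (ball c s) k0"
  proof (rule test_funI[OF sm compact_cball])
    show "cball c (s/2) \<subseteq> ball c s" using assms by auto
    show "k0 x = 0" if "x \<notin> cball c (s/2)" for x
      using that pos[of x] nn[of x] by (auto simp: dist_norm norm_minus_commute less_le)
  qed
  have "(\<integral>x. k0 x \<partial>lebesgue) \<noteq> 0"
  proof
    assume "(\<integral>x. k0 x \<partial>lebesgue) = 0"
    then have "AE x in lebesgue. k0 x = 0"
      using integral_nonneg_eq_0_iff_AE[OF test_fun_integrable[OF t]] nn by simp
    then have "AE x in lebesgue. x \<notin> ball c (s/2)"
    proof eventually_elim
      case (elim x) then show ?case using pos[of x] by (auto simp: dist_norm norm_minus_commute)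
    qed
    then have "negligible (ball c (s/2))"
      by (simp add: negligible_iff_null_sets AE_iff_null_sets)
    then show False using open_not_negligible[of "ball c (s/2)"] assms by simp
  qed
  moreover have "(\<integral>x. k0 x \<partial>lebesgue) \<ge> 0" by (simp add: nn)
  ultimately have p: "(\<integral>x. k0 x \<partial>lebesgue) > 0" by simp
  show ?thesis
  proof (rule that)
    show "test_fun (ball c s) (\<lambda>x. inverse (\<integral>x. k0 x \<partial>lebesgue) * k0 x)" by (rule test_fun_cmult[OF t])
    show "inverse (\<integral>x. k0 x \<partial>lebesgue) * k0 x \<ge> 0" for x using p nn by simp
    show "(\<integral>x. inverse (\<integral>x. k0 x \<partial>lebesgue) * k0 x \<partial>lebesgue) = 1" using p by simp
  qed
qed

section \<open>Green's formula up to a C2 boundary\<close>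

lemma has_derivative_quadratic:
  fixes f :: "'a::real_normed_vector \<Rightarrow> 'b::real_normed_vector"
  assumes "bounded_linear f'" "\<And>h. norm (f (x + h) - f x - f' h) \<le> C * (norm h)\<^sup>2"
  shows "(f has_derivative f') (at x)"
  unfolding has_derivative_at
proof (intro conjI assms(1))
  show "((\<lambda>h. norm (f (x + h) - f x - f' h) / norm h) \<longlongrightarrow> 0) (at 0)"
  proof (rule Lim_null_comparison)
    have "norm (norm (f (x + h) - f x - f' h) / norm h) \<le> C * norm h" if "h \<noteq> 0" for h
      using assms(2)[of h] that by (simp add: divide_le_eq power2_eq_square mult.assoc)
    then show "\<forall>\<^sub>F h in at 0. norm (norm (f (x + h) - f x - f' h) / norm h) \<le> C * norm h"
      by (auto simp: eventually_at_filter)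
    show "((\<lambda>h. C * norm h) \<longlongrightarrow> 0) (at 0)"
      by (auto intro!: tendsto_eq_intros)
  qed
qed

lemma fderiv_linear: "test_fun S k \<Longrightarrow> linear (\<lambda>v. fderiv k v x)"
  using has_derivative_linear[OF test_fun_has_derivative[of S k x]] by simp

text \<open>The uniform Taylor remainder of \<open>k\<close> is integrated against the integrable
  function \<open>u\<close>, which leaves an error quadratic in \<open>h\<close>.\<close>

lemma conv_has_derivative:
  fixes u :: "'a::euclidean_space \<Rightarrow> real"
  assumes k: "test_fun S k" and u: "integrable lebesgue u"
  shows "(conv k u has_derivative (\<lambda>h. conv (fderiv k h) u x)) (at x)"
proof -
  obtain C where C: "C \<ge> 0" "\<And>x h. \<bar>k (x + h) - k x - fderiv k h x\<bar> \<le> C * (norm h)\<^sup>2"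
    using test_fun_Taylor[OF k] by blast
  define I where "I = (\<integral>y. norm (u y) \<partial>lebesgue)"
  note i = integrable_shifted_mult[OF k u]
  note id = integrable_shifted_mult[OF test_fun_fderiv[OF k] u]
  have "linear (\<lambda>h. conv (fderiv k h) u x)"
  proof (rule linearI)
    fix a b :: 'a and c :: real
    show "conv (fderiv k (a + b)) u x = conv (fderiv k a) u x + conv (fderiv k b) u x"
      using id by (simp add: conv_def linear_add[OF fderiv_linear[OF k]] distrib_right)
    show "conv (fderiv k (c *\<^sub>R a)) u x = c *\<^sub>R conv (fderiv k a) u x"
      by (simp add: conv_def linear_scale[OF fderiv_linear[OF k]] mult.assoc)
  qed
  then have bl: "bounded_linear (\<lambda>h. conv (fderiv k h) u x)"
    by (simp add: linear_conv_bounded_linear)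
  have "norm (conv k u (x + h) - conv k u x - conv (fderiv k h) u x) \<le> (C * I) * (norm h)\<^sup>2" for h
  proof -
    have ii: "integrable lebesgue (\<lambda>y. (k (x - y + h) - k (x - y) - fderiv k h (x - y)) * u y)"
    proof -
      have "(k (x - y + h) - k (x - y) - fderiv k h (x - y)) * u y
          = k (x + h - y) *\<^sub>R u y - k (x - y) *\<^sub>R u y - fderiv k h (x - y) *\<^sub>R u y" for y
        by (simp add: left_diff_distrib algebra_simps)
      then show ?thesis by (simp only: Bochner_Integration.integrable_diff i id)
    qed
    have eq: "conv k u (x + h) - conv k u x - conv (fderiv k h) u x
        = (\<integral>y. (k (x - y + h) - k (x - y) - fderiv k h (x - y)) * u y \<partial>lebesgue)"
    proof -
      have "conv k u (x + h) - conv k u x - conv (fderiv k h) u x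
          = (\<integral>y. k (x + h - y) *\<^sub>R u y - k (x - y) *\<^sub>R u y - fderiv k h (x - y) *\<^sub>R u y \<partial>lebesgue)"
        unfolding conv_def by (simp only: Bochner_Integration.integral_diff Bochner_Integration.integrable_diff i id)
      also have "\<dots> = (\<integral>y. (k (x - y + h) - k (x - y) - fderiv k h (x - y)) * u y \<partial>lebesgue)"
        by (rule Bochner_Integration.integral_cong) (simp_all add: left_diff_distrib algebra_simps)
      finally show ?thesis .
    qed
    have "norm (conv k u (x + h) - conv k u x - conv (fderiv k h) u x)
        \<le> (\<integral>y. norm ((k (x - y + h) - k (x - y) - fderiv k h (x - y)) * u y) \<partial>lebesgue)"
      unfolding eq by (rule integral_norm_bound)
    also have "\<dots> \<le> (\<integral>y. (C * (norm h)\<^sup>2) * norm (u y) \<partial>lebesgue)"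
    proof (rule integral_mono)
      show "norm ((k (x - y + h) - k (x - y) - fderiv k h (x - y)) * u y) \<le> (C * (norm h)\<^sup>2) * norm (u y)" for y
        using mult_right_mono[OF C(2)[of "x - y" h] abs_ge_zero[of "u y"]] by (simp only: real_norm_def abs_mult)
    qed (use ii u in auto)
    finally show ?thesis by (simp add: I_def mult_ac)
  qed
  with bl show ?thesis by (rule has_derivative_quadratic)
qed

lemma conv_smooth:
  fixes u :: "'a::euclidean_space \<Rightarrow> real"
  assumes k: "test_fun S k" and u: "integrable lebesgue u"
  shows "smooth_on UNIV (conv k u)"
proof -
  have "smoothk_on n UNIV (conv k u)" for n
    using k
  proof (induction n arbitrary: k)
    case 0 then show ?case by (simp add: conv_continuous[OF _ u])
  next
    case (Suc n)
    show ?case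
      by (rule smoothk_on_SucI[OF open_UNIV conv_has_derivative[OF Suc.prems u]])
        (rule Suc.IH[OF test_fun_fderiv[OF Suc.prems]])
  qed
  then show ?thesis by (simp add: smooth_on_def)
qed

lemma fderiv_conv:
  fixes u :: "'a::euclidean_space \<Rightarrow> real"
  assumes "test_fun S k" "integrable lebesgue u"
  shows "fderiv (conv k u) v x = conv (fderiv k v) u x"
  using fun_cong[OF frechet_derivative_at[OF conv_has_derivative[OF assms]], of v x] by simp

lemma conv_component:
  fixes u :: "real^3 \<Rightarrow> real^3"
  assumes "test_fun S k" "integrable lebesgue u"
  shows "conv k u x $ i = conv k (\<lambda>y. u y $ i) x"
  unfolding conv_def
  using integral_bounded_linear[OF bounded_linear_vec_nth[of i] integrable_shifted_mult[OF assms, of x]] by simp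

lemma integrable_component:
  fixes u :: "'a::euclidean_space \<Rightarrow> real^3"
  shows "integrable lebesgue u \<Longrightarrow> integrable lebesgue (\<lambda>y. u y $ i)"
  by (rule integrable_bounded_linear[OF bounded_linear_vec_nth])

lemma conv_vtest_fun:
  fixes u :: "real^3 \<Rightarrow> real^3"
  assumes k: "test_fun (cball c s) k" and u: "integrable lebesgue u"
    and K: "compact K" "\<And>x. x \<notin> K \<Longrightarrow> u x = 0"
    and S: "\<And>x y. x \<in> K \<Longrightarrow> y \<in> cball c s \<Longrightarrow> x + y \<in> S"
  shows "vtest_fun S (conv k u)"
proof (rule vtest_funI)
  fix i
  let ?L = "{x + y |x y. x \<in> K \<and> y \<in> cball c s}"
  show "test_fun S (\<lambda>x. conv k u x $ i)"
  proof (rule test_funI)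
    show "smooth_on UNIV (\<lambda>x. conv k u x $ i)"
      unfolding conv_component[OF k u] by (rule conv_smooth[OF k integrable_component[OF u]])
    show "compact ?L" by (rule compact_sums[OF K(1) compact_cball])
    show "?L \<subseteq> S" using S by auto
    fix x assume x: "x \<notin> ?L"
    have "k (x - y) *\<^sub>R u y = 0" for y
    proof (cases "y \<in> K")
      case True
      have "x - y \<notin> cball c s"
      proof
        assume a: "x - y \<in> cball c s"
        have "\<exists>x' y'. x = x' + y' \<and> x' \<in> K \<and> y' \<in> cball c s"
          by (intro exI[of _ y] exI[of _ "x - y"]) (use a True in auto)
        with x show False by blast
      qed
      moreover have "k z = 0" if "z \<notin> cball c s" for z
        using test_fun_support[OF k] that by (meson subsetD)
      ultimately show ?thesis by simp
    qed (simp add: K(2))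
    then show "conv k u x $ i = 0" by (simp add: conv_def del: scaleR_eq_0_iff)
  qed
qed

text \<open>The induction runs over all \<open>g\<close>, since the derivative of the reflection is
  minus the reflection of the derivative.\<close>

lemma smooth_on_reflect:
  assumes "smooth_on UNIV g" shows "smooth_on UNIV (\<lambda>y. g (x - y))"
proof -
  have "smoothk_on k UNIV g \<Longrightarrow> smoothk_on k UNIV (\<lambda>y. g (x - y))" for k
  proof (induction k arbitrary: g)
    case 0 then show ?case by (auto intro!: continuous_on_compose2[of UNIV g] continuous_intros)
  next
    case (Suc k)
    show ?case
    proof (rule smoothk_on_SucI[OF open_UNIV])
      fix y
      have g: "(g has_derivative frechet_derivative g (at (x - y))) (at (x - y))"
        using smoothk_on_SucD[OF Suc.prems] by simp
      have "((\<lambda>y. x - y) has_derivative (\<lambda>v. - v)) (at y)"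
        by (auto intro!: derivative_eq_intros)
      from has_derivative_compose[OF this g]
      have "((\<lambda>y. g (x - y)) has_derivative (\<lambda>v. frechet_derivative g (at (x - y)) (- v))) (at y)" .
      then show "((\<lambda>y. g (x - y)) has_derivative (\<lambda>v. (-1) * fderiv g v (x - y))) (at y)"
        by (simp add: linear_neg[OF has_derivative_linear[OF g]])
    next
      fix i :: 'a assume "i \<in> Basis"
      then show "smoothk_on k UNIV (\<lambda>y. (-1) * fderiv g i (x - y))"
        using Suc.prems by (intro smoothk_on_mult smoothk_on_const Suc.IH[of "fderiv g i"]) auto
    qed
  qed
  then show ?thesis using assms by (simp add: smooth_on_def)
qed

lemma test_fun_reflect:
  assumes "test_fun S k" shows "test_fun UNIV (\<lambda>y. k (x - y))"
    "fderiv (\<lambda>y. k (x - y)) v y = - fderiv k v (x - y)"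
proof -
  obtain K where K: "compact K" "\<forall>x. x \<notin> K \<longrightarrow> k x = 0"
    using test_fun_support[OF assms] by auto
  show "test_fun UNIV (\<lambda>y. k (x - y))"
  proof (rule test_funI[OF smooth_on_reflect[OF test_fun_smooth[OF assms]]])
    show "compact ((\<lambda>z. x - z) ` K)" using K(1) by (intro compact_continuous_image continuous_intros)
    show "k (x - y) = 0" if "y \<notin> (\<lambda>z. x - z) ` K" for y
      using K(2) that by (metis (no_types, lifting) diff_diff_eq2 add_diff_cancel_left' image_eqI)
  qed auto
  note g = test_fun_has_derivative[OF assms, of "x - y"]
  have "((\<lambda>y. x - y) has_derivative (\<lambda>v. - v)) (at y)"
    by (auto intro!: derivative_eq_intros)
  from has_derivative_compose[OF this g]
  have "((\<lambda>y. k (x - y)) has_derivative (\<lambda>v. fderiv k (- v) (x - y))) (at y)" .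
  from fun_cong[OF frechet_derivative_at[OF this], of v]
  show "fderiv (\<lambda>y. k (x - y)) v y = - fderiv k v (x - y)"
    by (simp add: linear_neg[OF has_derivative_linear[OF g]])
qed

lemma curl_const: "curl (\<lambda>x. b) x = 0"
  by (simp add: vec_eq_iff forall_3 curl_components)

text \<open>For fixed \<open>x\<close> the field \<open>k (x - y) *\<^sub>R b\<close> in the
  variable \<open>y\<close> is an admissible test field. Its curl reproduces the partial derivatives
  of the convolution, and letting \<open>b\<close> vary recovers the whole vector.\<close>

lemma curl_conv:
  assumes k: "test_fun S k" and u: "u \<in> L2 UNIV" "integrable lebesgue u"
    and w: "w \<in> L2 UNIV" "integrable lebesgue w" and c: "weak_curl UNIV u w"
  shows "curl (conv k u) x = conv k w x"
proof -
  define g where "g j y = fderiv k (axis j 1) (x - y)" for j y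
  have gi: "integrable lebesgue (\<lambda>y. g j y * u y $ i)" for i j
    using integrable_shifted_mult[OF test_fun_fderiv[OF k] integrable_component[OF u(2)]] by (simp add: g_def)
  have gi': "integrable lebesgue (\<lambda>y. g j y * (b * u y $ i))" for i j b
    using integrable_mult_right[OF gi, of b j i] by (simp add: mult.left_commute)
  have fd: "fderiv (\<lambda>x. conv k u x $ i) (axis j 1) x = (\<integral>y. g j y * u y $ i \<partial>lebesgue)" for i j
    unfolding conv_component[OF k u(2)] fderiv_conv[OF k integrable_component[OF u(2)]]
    by (simp add: conv_def g_def)
  have "curl (conv k u) x \<bullet> b = conv k w x \<bullet> b" for b
  proof -
    let ?\<phi> = "\<lambda>y. k (x - y) *\<^sub>R b"
    have v: "vtest_fun UNIV ?\<phi>" by (rule vtest_fun_scaled[OF test_fun_reflect(1)[OF k]])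
    have cu: "curl ?\<phi> y = cross3 (- (\<chi> j. g j y)) b" for y
      using curl_mult[OF test_fun_smooth[OF test_fun_reflect(1)[OF k]], of "\<lambda>_. b" y x]
      by (simp add: curl_const grad_def test_fun_reflect(2)[OF k] g_def cross3_def vec_eq_iff forall_3)
    have "curl (conv k u) x \<bullet> b
      = (\<integral>y. g 2 y * (b $ 1 * u y $ 3) - g 3 y * (b $ 1 * u y $ 2)
        + (g 3 y * (b $ 2 * u y $ 1) - g 1 y * (b $ 2 * u y $ 3))
        + (g 1 y * (b $ 3 * u y $ 2) - g 2 y * (b $ 3 * u y $ 1)) \<partial>lebesgue)"
    proof -
      have e: "(\<integral>y. g j y * (b * u y $ i) \<partial>lebesgue) = b * (\<integral>y. g j y * u y $ i \<partial>lebesgue)" for i j b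
        by (simp add: mult.left_commute flip: integral_mult_right_zero)
      show ?thesis
        by (simp add: gi' e) (simp add: inner_vec_def sum_3 curl_components fd algebra_simps)
    qed
    also have "\<dots> = (\<integral>y. u y \<bullet> curl ?\<phi> y \<partial>lebesgue)"
      by (rule Bochner_Integration.integral_cong) (simp_all add: cu inner_vec_def sum_3 cross3_def algebra_simps)
    also have "\<dots> = (\<integral>y. w y \<bullet> ?\<phi> y \<partial>lebesgue)"
      using c v by (simp add: weak_curl_UNIV)
    also have "\<dots> = (\<integral>y. (k (x - y) *\<^sub>R w y) \<bullet> b \<partial>lebesgue)"
      by (simp add: inner_commute)
    also have "\<dots> = conv k w x \<bullet> b"
      unfolding conv_def by (rule integral_inner_left[OF integrable_shifted_mult[OF k w(2)]])
    finally show ?thesis .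
  qed
  then show ?thesis using vector_eq_rdot[of "curl (conv k u) x" "conv k w x"] by blast
qed

section \<open>Green's formula for fields that vanish on the obstacle\<close>

definition local_weak_curl :: "(real^3) set \<Rightarrow> (real^3 \<Rightarrow> real^3) \<Rightarrow> (real^3 \<Rightarrow> real^3) \<Rightarrow> bool" where
  "local_weak_curl \<Omega> H cH \<longleftrightarrow> H \<in> L2 UNIV \<and> cH \<in> L2 UNIV \<and>
     (\<forall>\<phi>. vtest_fun \<Omega> \<phi> \<longrightarrow> (\<integral>x. H x \<bullet> curl \<phi> x \<partial>lebesgue) = (\<integral>x. cH x \<bullet> \<phi> x \<partial>lebesgue))"

text \<open>\<open>local_weak_curl\<close> says nothing about test fields that touch the boundary of
  \<open>\<Omega>\<close>. A kernel concentrated near \<open>t *\<^sub>R \<nu>\<close> translates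
  the support of \<open>u\<close> into \<open>\<Omega>\<close> and mollifies at once, so
  \<open>conv k u\<close> is admissible; kernels shrinking to the origin recover \<open>u\<close>
  and \<open>w\<close>.\<close>

lemma green_shifted_support:
  assumes H: "local_weak_curl \<Omega> H cH" and \<Omega>: "open \<Omega>"
    and u: "u \<in> L2 UNIV" and w: "w \<in> L2 UNIV" and c: "weak_curl UNIV u w"
    and K: "compact K" "\<And>x. x \<notin> K \<Longrightarrow> u x = 0 \<and> w x = 0"
    and \<nu>: "\<And>e. e > 0 \<Longrightarrow> \<exists>t\<ge>0. t < e \<and> (\<forall>x\<in>K. x + t *\<^sub>R \<nu> \<in> \<Omega>)"
  shows "lsq_of cH \<bullet> lsq_of u = lsq_of H \<bullet> lsq_of w"
proof -
  have HL: "H \<in> L2 UNIV" "cH \<in> L2 UNIV" using H by (auto simp: local_weak_curl_def)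
  obtain R where R: "\<And>x. x \<in> K \<Longrightarrow> norm x \<le> R"
    using compact_imp_bounded[OF K(1)] by (auto simp: bounded_iff)
  have uR: "u x = 0" and wR: "w x = 0" if "norm x > R" for x using that K(2)[of x] R[of x] by auto
  note ui = integrable_L2_bounded_support[OF u uR] and wi = integrable_L2_bounded_support[OF w wR]
  have "\<bar>lsq_of cH \<bullet> lsq_of u - lsq_of H \<bullet> lsq_of w\<bar> \<le> e * (norm (lsq_of cH) + norm (lsq_of H))" if e: "e > 0" for e
  proof -
    obtain d1 where d1: "d1 > 0" "\<And>k. test_fun (ball 0 d1) k \<Longrightarrow> (\<And>x. k x \<ge> 0) \<Longrightarrow> (\<integral>x. k x \<partial>lebesgue) = 1 \<Longrightarrow>
       norm (lsq_of (conv k u) - lsq_of u) < e"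
      using mollify_approx[OF u uR e] by blast
    obtain d2 where d2: "d2 > 0" "\<And>k. test_fun (ball 0 d2) k \<Longrightarrow> (\<And>x. k x \<ge> 0) \<Longrightarrow> (\<integral>x. k x \<partial>lebesgue) = 1 \<Longrightarrow>
       norm (lsq_of (conv k w) - lsq_of w) < e"
      using mollify_approx[OF w wR e] by blast
    define d where "d = min d1 d2"
    have d: "d > 0" using d1 d2 by (simp add: d_def)
    obtain t where t: "t \<ge> 0" "t < d / (2 * (norm \<nu> + 1))" "\<And>x. x \<in> K \<Longrightarrow> x + t *\<^sub>R \<nu> \<in> \<Omega>"
      using \<nu>[of "d / (2 * (norm \<nu> + 1))"] d by (auto simp: add_nonneg_pos)
    have tn: "norm (t *\<^sub>R \<nu>) < d / 2"
    proof -
      have "t * (2 * (norm \<nu> + 1)) < d" using t(2) by (subst (asm) pos_less_divide_eq) (auto simp: add_nonneg_pos)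
      then show ?thesis using t(1) by (simp add: algebra_simps)
    qed
    have "compact ((\<lambda>x. x + t *\<^sub>R \<nu>) ` K)" using K(1) by (intro compact_continuous_image continuous_intros)
    moreover have "(\<lambda>x. x + t *\<^sub>R \<nu>) ` K \<subseteq> \<Omega>" using t(3) by auto
    ultimately obtain s0 where s0: "s0 > 0" "(\<Union>x\<in>(\<lambda>x. x + t *\<^sub>R \<nu>) ` K. cball x s0) \<subseteq> \<Omega>"
      using compact_subset_open_imp_cball_epsilon_subset[OF _ \<Omega>] by blast
    \<comment> \<open>\<open>s0\<close> keeps the smeared support inside \<open>\<Omega>\<close>;
      \<open>d / 2\<close>, together with a shift shorter than \<open>d / 2\<close>, keeps the
      kernel in \<open>ball 0 d\<close>, where both approximations hold.\<close>
    define s where "s = min s0 (d/2)"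
    have s: "s > 0" "s \<le> s0" "s \<le> d / 2" using s0 d by (auto simp: s_def)
    obtain k where k: "test_fun (ball (t *\<^sub>R \<nu>) s) k" "\<And>x. k x \<ge> 0" "(\<integral>x. k x \<partial>lebesgue) = 1"
      using mollifier_exists[OF s(1)] by blast
    have "ball (t *\<^sub>R \<nu>) s \<subseteq> ball 0 d"
    proof
      fix y assume "y \<in> ball (t *\<^sub>R \<nu>) s"
      then have "norm (y - t *\<^sub>R \<nu>) < d / 2" using s(3) by (simp add: dist_norm norm_minus_commute)
      then show "y \<in> ball 0 d" using norm_triangle_ineq[of "y - t *\<^sub>R \<nu>" "t *\<^sub>R \<nu>"] tn by simp
    qed
    then have kd: "test_fun (ball 0 d1) k" "test_fun (ball 0 d2) k"
      by (auto intro!: test_fun_mono[OF k(1)] simp: d_def)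
    have kc: "test_fun (cball (t *\<^sub>R \<nu>) s) k" by (rule test_fun_mono[OF k(1) ball_subset_cball])
    have vt: "vtest_fun \<Omega> (conv k u)"
    proof (rule conv_vtest_fun[OF kc ui K(1)])
      show "u x = 0" if "x \<notin> K" for x using K(2)[OF that] by simp
      fix x y assume xy: "x \<in> K" "y \<in> cball (t *\<^sub>R \<nu>) s"
      have "dist (x + t *\<^sub>R \<nu>) (x + y) \<le> s0" using xy(2) s(2) by simp
      then have "x + y \<in> (\<Union>x\<in>(\<lambda>x. x + t *\<^sub>R \<nu>) ` K. cball x s0)"
        using xy(1) by (intro UN_I[of "x + t *\<^sub>R \<nu>"]) (auto simp del: dist_add_cancel)
      then show "x + y \<in> \<Omega>" using s0(2) by blast
    qed
    have cc: "curl (conv k u) = conv k w"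
      by (rule ext) (rule curl_conv[OF k(1) u ui w wi c])
    note Yu = Young_L2(1)[OF k u ui] and Yw = Young_L2(1)[OF k w wi]
    have eq: "lsq_of H \<bullet> lsq_of (conv k w) = lsq_of cH \<bullet> lsq_of (conv k u)"
    proof -
      have "(\<integral>x. H x \<bullet> curl (conv k u) x \<partial>lebesgue) = (\<integral>x. cH x \<bullet> conv k u x \<partial>lebesgue)"
        using H vt by (simp add: local_weak_curl_def)
      then show ?thesis by (simp add: inner_lsq_of HL Yu Yw cc)
    qed
    have eq2: "lsq_of cH \<bullet> lsq_of u - lsq_of H \<bullet> lsq_of w
        = lsq_of H \<bullet> (lsq_of (conv k w) - lsq_of w) - lsq_of cH \<bullet> (lsq_of (conv k u) - lsq_of u)"
      using eq by (simp add: inner_diff_right)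
    have "\<bar>lsq_of cH \<bullet> lsq_of u - lsq_of H \<bullet> lsq_of w\<bar>
        \<le> norm (lsq_of H) * norm (lsq_of (conv k w) - lsq_of w)
        + norm (lsq_of cH) * norm (lsq_of (conv k u) - lsq_of u)"
      unfolding eq2 by (intro order_trans[OF abs_triangle_ineq4] add_mono Cauchy_Schwarz_ineq2)
    also have "\<dots> \<le> norm (lsq_of H) * e + norm (lsq_of cH) * e"
      using d1(2)[OF kd(1) k(2,3)] d2(2)[OF kd(2) k(2,3)] by (intro add_mono mult_left_mono) auto
    finally show ?thesis by (simp add: algebra_simps)
  qed
  note b = this
  have "((\<lambda>e. e * (norm (lsq_of cH) + norm (lsq_of H))) \<longlongrightarrow> 0 * (norm (lsq_of cH) + norm (lsq_of H))) (at_right 0)"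
    by (intro tendsto_intros)
  then have "\<bar>lsq_of cH \<bullet> lsq_of u - lsq_of H \<bullet> lsq_of w\<bar> \<le> 0 * (norm (lsq_of cH) + norm (lsq_of H))"
    by (rule tendsto_lowerbound) (auto simp: eventually_at_right_field intro!: exI[of _ 1] b)
  then show ?thesis by simp
qed

lemma smooth_step_deriv:
  obtains D C where "\<And>t. (smooth_step has_real_derivative D t) (at t)" "C \<ge> 0" "\<And>t. \<bar>D t\<bar> \<le> C"
    "\<And>t. t < 0 \<or> t > 1 \<Longrightarrow> D t = 0"
proof -
  define D where "D t = fderiv smooth_step 1 t" for t
  have d: "(smooth_step has_real_derivative D t) (at t)" for t
  proof -
    have h: "(smooth_step has_derivative frechet_derivative smooth_step (at t)) (at t)"
      using smooth_on_has_derivative[OF smooth_on_smooth_step] by simp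
    have "frechet_derivative smooth_step (at t) = (*) (D t)"
    proof
      fix v show "frechet_derivative smooth_step (at t) v = D t * v"
        using linear_scale[OF has_derivative_linear[OF h], of v 1] by (simp add: D_def)
    qed
    with h show ?thesis by (simp add: has_field_derivative_def)
  qed
  have z: "D t = 0" if "t < 0 \<or> t > 1" for t
    using that
  proof
    assume "t < 0"
    then have "frechet_derivative smooth_step (at t) = frechet_derivative (\<lambda>_. 0) (at t)"
      by (intro frechet_derivative_cong_open[of "{..<0}"]) (auto simp: smooth_step_simps)
    then show ?thesis by (simp add: D_def)
  next
    assume "t > 1"
    then have "frechet_derivative smooth_step (at t) = frechet_derivative (\<lambda>_. 1) (at t)"
      by (intro frechet_derivative_cong_open[of "{1<..}"]) (auto simp: smooth_step_simps)
    then show ?thesis by (simp add: D_def)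
  qed
  have "continuous_on UNIV D"
    unfolding D_def by (rule smooth_on_continuous[OF smooth_on_frechet[OF open_UNIV smooth_on_smooth_step]])
  then have "compact (D ` {0..1})"
    by (intro compact_continuous_image) (auto intro: continuous_on_subset)
  then obtain C where C: "\<And>t. t \<in> {0..1} \<Longrightarrow> \<bar>D t\<bar> \<le> C"
    by (metis compact_imp_bounded bounded_iff imageI real_norm_def)
  have "\<bar>D t\<bar> \<le> max C 0" for t
    using C[of t] z[of t] by (cases "t \<in> {0..1}") auto
  then show ?thesis using that[OF d _ _ z, of "max C 0"] by auto
qed

text \<open>The squared norm avoids the singularity of the norm at the centre. The function vanishes
  from radius \<open>sqrt 2 * r\<close> on; the factor 3/2 used below is a rational bound for
  this.\<close>

definition cutoff :: "'a::euclidean_space \<Rightarrow> real \<Rightarrow> 'a \<Rightarrow> real" where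
  "cutoff c r x = smooth_step (2 - (norm (x - c))\<^sup>2 / r\<^sup>2)"

lemma cutoff_simps:
  assumes "r > 0"
  shows "0 \<le> cutoff c r x" "cutoff c r x \<le> 1" "norm (x - c) \<le> r \<Longrightarrow> cutoff c r x = 1"
    "norm (x - c) \<ge> 3/2 * r \<Longrightarrow> cutoff c r x = 0" "smooth_on UNIV (cutoff c r)"
proof -
  show "0 \<le> cutoff c r x" "cutoff c r x \<le> 1" by (simp_all add: cutoff_def smooth_step_simps)
  show "cutoff c r x = 1" if "norm (x - c) \<le> r"
    using power_mono[OF that norm_ge_zero, of 2] assms by (simp add: cutoff_def smooth_step_simps)
  show "cutoff c r x = 0" if "norm (x - c) \<ge> 3/2 * r"
  proof -
    have "2 * r\<^sup>2 \<le> (3/2 * r)\<^sup>2" by (simp add: power_mult_distrib power_divide)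
    also have "\<dots> \<le> (norm (x - c))\<^sup>2" using that assms by (intro power_mono) auto
    finally show ?thesis using assms by (simp add: cutoff_def smooth_step_simps pos_le_divide_eq)
  qed
  show "smooth_on UNIV (cutoff c r)"
    unfolding cutoff_def divide_inverse
    by (rule smooth_on_compose[OF _ smooth_on_smooth_step])
      (auto intro!: smooth_on_diff smooth_on_mult smooth_on_const smooth_on_norm_sq)
qed

text \<open>By scaling, the constant depends neither on the centre nor on the radius, so wide
  cutoffs have small gradients. Where the derivative of the step is nonzero,
  \<open>norm (x - c)\<close> is at most \<open>3/2 * r\<close>.\<close>

lemma grad_cutoff_bound:
  obtains C where "C \<ge> 0" "\<And>c r x. r > 0 \<Longrightarrow> norm (grad (cutoff c r) x) \<le> C / r"
proof -
  obtain D C where D: "\<And>t. (smooth_step has_real_derivative D t) (at t)" "C \<ge> 0" "\<And>t. \<bar>D t\<bar> \<le> C"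
    "\<And>t. t < 0 \<or> t > 1 \<Longrightarrow> D t = 0"
    using smooth_step_deriv by blast
  have "norm (grad (cutoff c r) x) \<le> 3 * C / r" if r: "r > 0" for c r and x :: "real^3"
  proof -
    define s where "s = 2 - (norm (x - c))\<^sup>2 / r\<^sup>2"
    have "((\<lambda>x. 2 - (norm (x - c))\<^sup>2 / r\<^sup>2) has_derivative (\<lambda>v. - (2 * ((x - c) \<bullet> v)) / r\<^sup>2)) (at x)"
    proof -
      have "((\<lambda>x. (x - c) \<bullet> (x - c)) has_derivative (\<lambda>v. 2 * ((x - c) \<bullet> v))) (at x)"
        by (auto intro!: derivative_eq_intros simp: inner_commute)
      from has_derivative_diff[OF has_derivative_const[of 2] has_derivative_scaleR_right[OF this, of "1 / r\<^sup>2"]]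
      show ?thesis by (simp add: power2_norm_eq_inner)
    qed
    from has_derivative_compose[OF this D(1)[of s, unfolded has_field_derivative_def s_def]]
    have "(cutoff c r has_derivative (\<lambda>v. D s * (- (2 * ((x - c) \<bullet> v)) / r\<^sup>2))) (at x)"
      by (simp add: cutoff_def[abs_def] s_def)
    then have "(cutoff c r has_derivative (\<lambda>v. ((- 2 * D s / r\<^sup>2) *\<^sub>R (x - c)) \<bullet> v)) (at x)"
      by (simp add: mult_ac)
    then have g: "grad (cutoff c r) x = (- 2 * D s / r\<^sup>2) *\<^sub>R (x - c)" by (rule gradI)
    show ?thesis
    proof (cases "D s = 0")
      case False
      then have "s \<ge> 0" using D(4)[of s] by linarith
      then have "(norm (x - c))\<^sup>2 \<le> 2 * r\<^sup>2" using r by (simp add: s_def pos_divide_le_eq)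
      also have "\<dots> \<le> (3/2 * r)\<^sup>2" by (simp add: power_mult_distrib power_divide)
      finally have n: "norm (x - c) \<le> 3/2 * r" using r by (auto intro: power2_le_imp_le)
      have "norm (grad (cutoff c r) x) = 2 * \<bar>D s\<bar> / r\<^sup>2 * norm (x - c)"
        unfolding g by (simp add: abs_mult)
      also have "\<dots> \<le> 2 * C / r\<^sup>2 * (3/2 * r)"
        using D(2) D(3)[of s] n r by (intro mult_mono divide_right_mono) auto
      also have "\<dots> = 3 * C / r" using r by (simp add: power2_eq_square)
      finally show ?thesis .
    qed (use g D(2) r in simp)
  qed
  then show ?thesis using that[of "3 * C"] D(2) by auto
qed

lemma green_additive:
  assumes "u \<in> L2 UNIV" "v \<in> L2 UNIV" "w \<in> L2 UNIV" "z \<in> L2 UNIV"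
    "lsq_of cH \<bullet> lsq_of u = lsq_of H \<bullet> lsq_of w" "lsq_of cH \<bullet> lsq_of v = lsq_of H \<bullet> lsq_of z"
    "\<And>x. u x + v x = u' x" "\<And>x. w x + z x = w' x"
  shows "lsq_of cH \<bullet> lsq_of u' = lsq_of H \<bullet> lsq_of w'"
proof -
  have "lsq_of u' = lsq_of u + lsq_of v" "lsq_of w' = lsq_of w + lsq_of z"
    using lsq_of_simps(2)[OF assms(1,2)] lsq_of_simps(2)[OF assms(3,4)] assms(7,8) by simp_all
  then show ?thesis by (simp only: inner_add_right assms(5,6))
qed

lemma green_away_from_boundary:
  assumes H: "local_weak_curl \<Omega> H cH" and \<Omega>: "open \<Omega>"
    and u: "u \<in> L2 UNIV" and w: "w \<in> L2 UNIV" and c: "weak_curl UNIV u w"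
    and U: "open U" "- \<Omega> \<subseteq> U" "\<And>x. x \<in> U \<Longrightarrow> u x = 0 \<and> w x = 0"
  shows "lsq_of cH \<bullet> lsq_of u = lsq_of H \<bullet> lsq_of w"
proof -
  obtain C where C: "C \<ge> 0" "\<And>c r x. r > 0 \<Longrightarrow> norm (grad (cutoff c r) x) \<le> C / r"
    using grad_cutoff_bound by blast
  define zt where "zt n = cutoff (0::real^3) (real (Suc n))" for n
  have zt: "0 \<le> zt n x" "zt n x \<le> 1" "norm x \<le> real (Suc n) \<Longrightarrow> zt n x = 1"
    "norm x \<ge> 3/2 * real (Suc n) \<Longrightarrow> zt n x = 0" "smooth_on UNIV (zt n)" for n x
    using cutoff_simps(1-4)[where r="real (Suc n)" and c="0::real^3" and x=x] cutoff_simps(5)[of "real (Suc n)" 0] by (auto simp: zt_def)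
  have zta: "\<bar>zt n x\<bar> \<le> 1" for n x using zt(1,2)[of n x] by simp
  have gb: "norm (grad (zt n) x) \<le> C / real (Suc n)" for n x using C(2) by (simp add: zt_def)
  have gC: "norm (grad (zt n) x) \<le> C" for n x
    by (rule order_trans[OF gb]) (use C(1) in \<open>simp add: divide_le_eq mult_le_cancel_left1\<close>)
  define un where "un n x = zt n x *\<^sub>R u x" for n x
  define wn where "wn n x = zt n x *\<^sub>R w x + cross3 (grad (zt n) x) (u x)" for n x
  note wcm = weak_curl_mult[OF u w c zt(5) zta gC]
  have uL: "un n \<in> L2 UNIV" and wL: "wn n \<in> L2 UNIV" and cn: "weak_curl UNIV (un n) (wn n)" for n
    using wcm by (simp_all add: un_def[abs_def] wn_def[abs_def])
  have gn: "lsq_of cH \<bullet> lsq_of (un n) = lsq_of H \<bullet> lsq_of (wn n)" for n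
  proof (rule green_shifted_support[OF H \<Omega> uL wL cn, where K="cball 0 (2 * real (Suc n)) - U" and \<nu>=0])
    show "compact (cball 0 (2 * real (Suc n)) - U)" using U(1) by (simp add: compact_diff)
    show "un n x = 0 \<and> wn n x = 0" if "x \<notin> cball 0 (2 * real (Suc n)) - U" for x
    proof (cases "x \<in> U")
      case False
      then have x: "norm x > 2 * real (Suc n)" using that by auto
      then have z: "zt n x = 0" by (intro zt(4)) simp
      have "frechet_derivative (zt n) (at x) = frechet_derivative (\<lambda>_. 0) (at x)"
      proof (rule frechet_derivative_cong_open[of "- cball 0 (2 * real (Suc n))"])
        show "zt n y = 0" if "y \<in> - cball 0 (2 * real (Suc n))" for y
          using that by (intro zt(4)) auto
      qed (use x in auto)
      then have "grad (zt n) x = 0" by (simp add: grad_def vec_eq_iff)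
      with z show ?thesis by (simp add: un_def wn_def)
    qed (use U(3) in \<open>simp add: un_def wn_def\<close>)
    show "\<exists>t\<ge>0. t < e \<and> (\<forall>x\<in>cball 0 (2 * real (Suc n)) - U. x + t *\<^sub>R 0 \<in> \<Omega>)" if "e > 0" for e
      using that U(2) by (intro exI[of _ 0]) auto
  qed
  have limzt: "(\<lambda>n. zt n x) \<longlonglongrightarrow> 1" for x
  proof (rule tendsto_eventually)
    obtain N :: nat where "norm x \<le> real N" using real_arch_simple by blast
    then show "\<forall>\<^sub>F n in sequentially. zt n x = 1"
      by (auto simp: eventually_sequentially intro!: exI[of _ N] zt(3))
  qed
  have um: "u \<in> borel_measurable lebesgue" and wm: "w \<in> borel_measurable lebesgue"
    using u w by (auto simp: L2_UNIV)
  have A: "(\<lambda>n. lsq_of (un n)) \<longlonglongrightarrow> lsq_of u"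
  proof (rule L2_dominated_convergence(3)[OF L2_measurable[OF uL] um _ u])
    show "AE x in lebesgue. (\<lambda>n. un n x) \<longlonglongrightarrow> u x"
      using tendsto_scaleR[OF limzt tendsto_const] by (intro always_eventually allI) (simp add: un_def)
    show "norm (un n x) \<le> norm (u x)" for n x
      using zta[of n x] by (simp add: un_def mult_left_le_one_le)
  qed
  have w1: "(\<lambda>x. zt n x *\<^sub>R w x) \<in> L2 UNIV" and w2: "(\<lambda>x. cross3 (grad (zt n) x) (u x)) \<in> L2 UNIV" for n
    using L2_mult[OF w continuous_measurable_lebesgue[OF smooth_on_continuous[OF zt(5)]] zta]
      L2_cross[OF u smooth_grad_measurable[OF zt(5)] gC] by auto
  have B1: "(\<lambda>n. lsq_of (\<lambda>x. zt n x *\<^sub>R w x)) \<longlonglongrightarrow> lsq_of w"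
  proof (rule L2_dominated_convergence(3)[OF L2_measurable[OF w1] wm _ w])
    show "AE x in lebesgue. (\<lambda>n. zt n x *\<^sub>R w x) \<longlonglongrightarrow> w x"
      using tendsto_scaleR[OF limzt tendsto_const] by (intro always_eventually allI) simp
    show "norm (zt n x *\<^sub>R w x) \<le> norm (w x)" for n x
      using zta[of n x] by (simp add: mult_left_le_one_le)
  qed
  have B2: "(\<lambda>n. lsq_of (\<lambda>x. cross3 (grad (zt n) x) (u x))) \<longlonglongrightarrow> lsq_of (\<lambda>x. 0)"
  proof (rule L2_dominated_convergence(3)[OF L2_measurable[OF w2] _ _ L2_scaleR[OF u, of C]])
    have nb: "norm (cross3 (grad (zt n) x) (u x)) \<le> C / real (Suc n) * norm (u x)" for n x
      using order_trans[OF norm_cross3_le mult_right_mono[OF gb norm_ge_zero]] .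
    have "(\<lambda>n. cross3 (grad (zt n) x) (u x)) \<longlonglongrightarrow> 0" for x
    proof (rule Lim_null_comparison[OF always_eventually[OF allI[OF nb]]])
      have "(\<lambda>n. C / real (Suc n)) \<longlonglongrightarrow> 0" by (rule LIMSEQ_Suc[OF lim_const_over_n])
      from tendsto_mult_left_zero[OF this] show "(\<lambda>n. C / real (Suc n) * norm (u x)) \<longlonglongrightarrow> 0" .
    qed
    then show "AE x in lebesgue. (\<lambda>n. cross3 (grad (zt n) x) (u x)) \<longlonglongrightarrow> 0" by simp
    show "norm (cross3 (grad (zt n) x) (u x)) \<le> norm (C *\<^sub>R u x)" for n x
      using order_trans[OF norm_cross3_le mult_right_mono[OF gC norm_ge_zero]] C(1) by simp
  qed simp
  have B: "(\<lambda>n. lsq_of (wn n)) \<longlonglongrightarrow> lsq_of w"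
    using tendsto_add[OF B1 B2] by (simp add: wn_def[abs_def] lsq_of_simps w1 w2)
  have "(\<lambda>n. lsq_of cH \<bullet> lsq_of (un n)) \<longlonglongrightarrow> lsq_of cH \<bullet> lsq_of u"
    by (intro tendsto_inner tendsto_const A)
  moreover have "(\<lambda>n. lsq_of cH \<bullet> lsq_of (un n)) \<longlonglongrightarrow> lsq_of H \<bullet> lsq_of w"
    unfolding gn by (intro tendsto_inner tendsto_const B)
  ultimately show ?thesis by (rule LIMSEQ_unique)
qed

lemma C2_fun_continuous: "C2_fun h \<Longrightarrow> continuous_on UNIV h"
  unfolding C2_fun_def by (metis continuous_at_imp_continuous_on has_derivative_continuous)

text \<open>\<open>R \<nu>\<close> is the upward axis of the local graph. Moving strictly up from a
  point not below the graph ends strictly above it, in a set that is open and disjoint from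
  \<open>D\<close>, hence disjoint from \<open>closure D\<close>. Starting points on the boundary
  itself are covered.\<close>

lemma C2_boundary_shift:
  assumes "C2_boundary D" "q \<in> frontier D"
  obtains r \<nu> where "r > 0"
    "\<And>x t. x \<in> ball q r \<Longrightarrow> x \<notin> D \<Longrightarrow> 0 < t \<Longrightarrow> x + t *\<^sub>R \<nu> \<in> ball q r \<Longrightarrow> x + t *\<^sub>R \<nu> \<notin> closure D"
proof -
  obtain r and R :: "real^3 \<Rightarrow> real^3" and h :: "real^2 \<Rightarrow> real"
    where r: "r > 0" and R: "orthogonal_transformation R" and h: "C2_fun h"
    and D: "\<And>x. x \<in> ball q r \<Longrightarrow> x \<in> D \<longleftrightarrow> R (x - q) $ 3 < h (vector [R (x - q) $ 1, R (x - q) $ 2])"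
    using bspec[OF assms(1)[unfolded C2_boundary_def] assms(2)] by blast
  have lR: "linear R" using R by (simp add: orthogonal_transformation_def)
  obtain \<nu> where \<nu>: "R \<nu> = axis 3 1" using orthogonal_transformation_surj[OF R] by (metis surjD)
  define g where "g z = h (vector [R (z - q) $ 1, R (z - q) $ 2])" for z
  have g: "g z = h (\<chi> i. if i = 1 then R (z - q) $ 1 else R (z - q) $ 2)" for z
    unfolding g_def by (rule arg_cong[of _ _ h]) (simp add: vec_eq_iff forall_2)
  have Rc: "continuous_on UNIV (\<lambda>z. R (z - q) $ i)" for i
  proof (rule continuous_on_component, rule continuous_on_compose2[of UNIV R UNIV "\<lambda>z. z - q"])
    show "continuous_on UNIV R"
      using lR by (simp add: linear_continuous_on linear_conv_bounded_linear)
    show "continuous_on UNIV (\<lambda>z. z - q)" by (intro continuous_intros)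
  qed auto
  have gc: "continuous_on UNIV g"
    unfolding g
  proof (rule continuous_on_compose2[OF C2_fun_continuous[OF h]])
    have "continuous_on UNIV (\<lambda>z. if i = 1 then R (z - q) $ 1 else R (z - q) $ 2)" for i :: 2
      by (cases "i = 1") (simp_all add: Rc)
    then show "continuous_on UNIV (\<lambda>z. (\<chi> i. if i = 1 then R (z - q) $ 1 else R (z - q) $ 2) :: real^2)"
      using continuous_on_vec_lambda[of UNIV "\<lambda>i z. if i = 1 then R (z - q) $ 1 else R (z - q) $ 2"] by blast
  qed auto
  define S where "S = ball q r \<inter> {z. g z < R (z - q) $ 3}"
  have "open S" unfolding S_def by (intro open_Int open_ball open_Collect_less gc Rc)
  moreover have "S \<inter> D = {}" using D by (force simp: S_def g_def)
  ultimately have S: "S \<inter> closure D = {}" by (simp add: open_Int_closure_eq_empty)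
  have "x + t *\<^sub>R \<nu> \<notin> closure D"
    if x: "x \<in> ball q r" "x \<notin> D" and t: "0 < t" "x + t *\<^sub>R \<nu> \<in> ball q r" for x t
  proof -
    have e: "R (x + t *\<^sub>R \<nu> - q) = R (x - q) + t *\<^sub>R axis 3 1"
      using linear_add[OF lR, of "x - q" "t *\<^sub>R \<nu>"] linear_scale[OF lR, of t \<nu>] \<nu> by (simp add: algebra_simps)
    have "g x \<le> R (x - q) $ 3" using D[OF x(1)] x(2) by (simp add: g_def)
    then have "x + t *\<^sub>R \<nu> \<in> S" using t by (simp add: S_def g_def e axis_def)
    then show ?thesis using S by auto
  qed
  then show ?thesis using that r by blast
qed

lemma green_near_boundary:
  assumes H: "local_weak_curl (- closure D) H cH" and D: "open D" "C2_boundary D" "q \<in> frontier D"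
  shows "\<exists>r>0. \<forall>u w. u \<in> L2 UNIV \<longrightarrow> w \<in> L2 UNIV \<longrightarrow> weak_curl UNIV u w \<longrightarrow>
      (\<forall>x. x \<in> closure D \<or> x \<notin> cball q (3/2 * r) \<longrightarrow> u x = 0 \<and> w x = 0) \<longrightarrow>
      lsq_of cH \<bullet> lsq_of u = lsq_of H \<bullet> lsq_of w"
proof -
  obtain r \<nu> where r: "r > 0" and s:
    "\<And>x t. x \<in> ball q r \<Longrightarrow> x \<notin> D \<Longrightarrow> 0 < t \<Longrightarrow> x + t *\<^sub>R \<nu> \<in> ball q r \<Longrightarrow> x + t *\<^sub>R \<nu> \<notin> closure D"
    using C2_boundary_shift[OF D(2,3)] by blast
  \<comment> \<open>Half the radius is taken: supports then lie in \<open>cball q (3/4 * r)\<close>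
    and shifts are at most \<open>r / 8\<close>, so shifted points stay in
    \<open>ball q r\<close>.\<close>
  show ?thesis
  proof (intro exI[of _ "r / 2"] conjI allI impI)
    show "r / 2 > 0" using r by simp
    fix u w :: "real^3 \<Rightarrow> real^3"
    assume u: "u \<in> L2 UNIV" "w \<in> L2 UNIV" "weak_curl UNIV u w"
      and z: "\<forall>x. x \<in> closure D \<or> x \<notin> cball q (3/2 * (r / 2)) \<longrightarrow> u x = 0 \<and> w x = 0"
    show "lsq_of cH \<bullet> lsq_of u = lsq_of H \<bullet> lsq_of w"
    proof (rule green_shifted_support[OF H _ u])
      show "open (- closure D)" by auto
      show "compact (cball q (3/4 * r) - D)" using D(1) by (simp add: compact_diff)
      show "u x = 0 \<and> w x = 0" if "x \<notin> cball q (3/4 * r) - D" for x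
        using that z closure_subset[of D] by auto
      fix e :: real assume e: "e > 0"
      define t where "t = min (e / 2) (r / (8 * (norm \<nu> + 1)))"
      have p: "8 * (norm \<nu> + 1) > 0" by (intro mult_pos_pos add_nonneg_pos) auto
      have t: "t > 0" "t < e" using e r p by (auto simp: t_def)
      have "t \<le> r / (8 * (norm \<nu> + 1))" by (simp add: t_def)
      then have "t * (8 * (norm \<nu> + 1)) \<le> r" using p by (simp add: pos_le_divide_eq)
      then have "8 * (t * norm \<nu>) \<le> r" using t by (simp add: algebra_simps)
      then have tn: "norm (t *\<^sub>R \<nu>) \<le> r / 8" using t by simp
      have "x + t *\<^sub>R \<nu> \<in> - closure D" if x: "x \<in> cball q (3/4 * r) - D" for x
      proof -
        have "dist q (x + t *\<^sub>R \<nu>) \<le> dist q x + norm (t *\<^sub>R \<nu>)"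
          using dist_triangle[of q "x + t *\<^sub>R \<nu>" x] by (simp add: dist_norm)
        then have "x + t *\<^sub>R \<nu> \<in> ball q r" "x \<in> ball q r" using x tn r by auto
        then show ?thesis using s[of x t] x t by auto
      qed
      then show "\<exists>t\<ge>0. t < e \<and> (\<forall>x\<in>cball q (3/4 * r) - D. x + t *\<^sub>R \<nu> \<in> - closure D)"
        using t by (intro exI[of _ t]) auto
    qed
  qed
qed

text \<open>Localisation by induction in place of a partition of unity: finitely many boundary balls
  are removed one at a time, a cutoff splitting the field into a piece near one ball and a remainder
  vanishing on that ball. At the end the field vanishes near the whole boundary.\<close>

lemma green_C2_boundary:
  assumes H: "local_weak_curl (- closure D) H cH" and D: "open D" "bounded D" "C2_boundary D"
    and u: "u \<in> L2 UNIV" "w \<in> L2 UNIV" "weak_curl UNIV u w"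
    and z: "\<And>x. x \<in> closure D \<Longrightarrow> u x = 0 \<and> w x = 0"
  shows "lsq_of cH \<bullet> lsq_of u = lsq_of H \<bullet> lsq_of w"
proof -
  define P where "P q r \<longleftrightarrow> (\<forall>u w. u \<in> L2 UNIV \<longrightarrow> w \<in> L2 UNIV \<longrightarrow> weak_curl UNIV u w \<longrightarrow>
      (\<forall>x. x \<in> closure D \<or> x \<notin> cball q (3/2 * r) \<longrightarrow> u x = 0 \<and> w x = 0) \<longrightarrow>
      lsq_of cH \<bullet> lsq_of u = lsq_of H \<bullet> lsq_of w)" for q r
  have "\<forall>q\<in>frontier D. \<exists>r. r > 0 \<and> P q r"
    using green_near_boundary[OF H D(1,3), folded P_def] by blast
  from bchoice[OF this] obtain r where r: "\<And>q. q \<in> frontier D \<Longrightarrow> r q > 0"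
    and rP: "\<And>q. q \<in> frontier D \<Longrightarrow> P q (r q)" by blast
  have rg: "lsq_of cH \<bullet> lsq_of u = lsq_of H \<bullet> lsq_of w"
    if "q \<in> frontier D" "u \<in> L2 UNIV" "w \<in> L2 UNIV" "weak_curl UNIV u w"
      "\<forall>x. x \<in> closure D \<or> x \<notin> cball q (3/2 * r q) \<longrightarrow> u x = 0 \<and> w x = 0" for q u w
    using rP[OF that(1)] that(2-5) by (simp add: P_def)
  have "compact (frontier D)" using D(2) by (rule compact_frontier_bounded)
  moreover have "frontier D \<subseteq> (\<Union>q\<in>frontier D. ball q (r q))"
  proof
    fix q assume "q \<in> frontier D"
    then show "q \<in> (\<Union>q\<in>frontier D. ball q (r q))" using r[of q] by (intro UN_I[of q]) auto
  qed
  ultimately obtain F where F: "F \<subseteq> frontier D" "finite F" "frontier D \<subseteq> (\<Union>q\<in>F. ball q (r q))"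
    using compactE_image[of "frontier D" "frontier D" "\<lambda>q. ball q (r q)"] by (metis open_ball)
  \<comment> \<open>\<open>F0\<close> lists the balls of the cover in which the field may still be
    nonzero; for \<open>F0 = F\<close> only vanishing on \<open>closure D\<close> is
    assumed.\<close>
  have main: "\<forall>u w. u \<in> L2 UNIV \<longrightarrow> w \<in> L2 UNIV \<longrightarrow> weak_curl UNIV u w \<longrightarrow>
      (\<forall>x. x \<in> closure D \<or> x \<in> (\<Union>q\<in>F-F0. ball q (r q)) \<longrightarrow> u x = 0 \<and> w x = 0) \<longrightarrow>
      lsq_of cH \<bullet> lsq_of u = lsq_of H \<bullet> lsq_of w" if "finite F0" "F0 \<subseteq> F" for F0
    using that
  proof (induction F0 rule: finite_induct)
    case empty
    show ?case
    proof (intro allI impI)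
      fix u w assume u: "u \<in> L2 UNIV" "w \<in> L2 UNIV" "weak_curl UNIV u w"
        and z: "\<forall>x. x \<in> closure D \<or> x \<in> (\<Union>q\<in>F-{}. ball q (r q)) \<longrightarrow> u x = 0 \<and> w x = 0"
      show "lsq_of cH \<bullet> lsq_of u = lsq_of H \<bullet> lsq_of w"
      proof (rule green_away_from_boundary[OF H _ u, where U="D \<union> (\<Union>q\<in>F. ball q (r q))"])
        show "- (- closure D) \<subseteq> D \<union> (\<Union>q\<in>F. ball q (r q))"
          using F(3) D(1) by (auto simp: frontier_def interior_open)
        show "u x = 0 \<and> w x = 0" if "x \<in> D \<union> (\<Union>q\<in>F. ball q (r q))" for x
          using that z closure_subset[of D] by auto
      qed (use D(1) in auto)
    qed
  next
    case (insert q F0)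
    have q: "q \<in> frontier D" "q \<in> F" using insert.prems F(1) by auto
    show ?case
    proof (intro allI impI)
      fix u w assume u: "u \<in> L2 UNIV" "w \<in> L2 UNIV" "weak_curl UNIV u w"
        and z: "\<forall>x. x \<in> closure D \<or> x \<in> (\<Union>q'\<in>F - insert q F0. ball q' (r q')) \<longrightarrow> u x = 0 \<and> w x = 0"
      obtain C where C: "C \<ge> 0" "\<And>c r x. r > 0 \<Longrightarrow> norm (grad (cutoff c r) x) \<le> C / r"
        using grad_cutoff_bound by blast
      note rq = r[OF q(1)]
      define m where "m = cutoff q (r q)"
      note m = cutoff_simps[OF rq, where c=q, folded m_def]
      have ma: "\<bar>m x\<bar> \<le> 1" for x using m(1,2)[of x] by simp
      have gb: "norm (grad m x) \<le> C / r q" for x using C(2)[OF rq] by (simp add: m_def)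
      \<comment> \<open>\<open>grad m'\<close> is the negative of \<open>grad m\<close>, so the two
        additional curl terms cancel in the sum.\<close>
      define m' where "m' x = 1 - m x" for x
      have sm': "smooth_on UNIV m'" unfolding m'_def by (intro smooth_on_diff smooth_on_const m(5)) auto
      have ma': "\<bar>m' x\<bar> \<le> 1" for x using m(1,2)[of x] by (simp add: m'_def)
      have gm': "grad m' x = - grad m x" for x
        using fderiv_diff[of "\<lambda>_. 1" x m] smooth_on_differentiable[OF m(5), of x]
        by (simp add: vec_eq_iff m'_def[abs_def])
      have gb': "norm (grad m' x) \<le> C / r q" for x using gb by (simp add: gm')
      have gz: "grad m x = 0" if "x \<in> ball q (r q) \<or> x \<notin> cball q (3/2 * r q)" for x
      proof -
        have "frechet_derivative m (at x) = frechet_derivative (\<lambda>_. m x) (at x)"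
          using that
        proof
          assume "x \<in> ball q (r q)"
          then show ?thesis
            by (intro frechet_derivative_cong_open[of "ball q (r q)"])
              (auto simp: m(3) dist_norm norm_minus_commute less_imp_le)
        next
          assume "x \<notin> cball q (3/2 * r q)"
          then show ?thesis
            by (intro frechet_derivative_cong_open[of "- cball q (3/2 * r q)"])
              (auto simp: m(4) dist_norm norm_minus_commute less_imp_le)
        qed
        then show ?thesis by (simp add: vec_eq_iff)
      qed
      define u1 where "u1 x = m x *\<^sub>R u x" for x
      define w1 where "w1 x = m x *\<^sub>R w x + cross3 (grad m x) (u x)" for x
      define u2 where "u2 x = m' x *\<^sub>R u x" for x
      define w2 where "w2 x = m' x *\<^sub>R w x + cross3 (grad m' x) (u x)" for x
      note W1 = weak_curl_mult[OF u m(5) ma gb, folded u1_def w1_def]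
      note W2 = weak_curl_mult[OF u sm' ma' gb', folded u2_def w2_def]
      have G1: "lsq_of cH \<bullet> lsq_of u1 = lsq_of H \<bullet> lsq_of w1"
      proof (rule rg[OF q(1) W1], intro allI impI)
        fix x assume "x \<in> closure D \<or> x \<notin> cball q (3/2 * r q)"
        then show "u1 x = 0 \<and> w1 x = 0"
          using z m(4)[of x] gz[of x] by (auto simp: u1_def w1_def dist_norm norm_minus_commute)
      qed
      have z2: "u2 x = 0 \<and> w2 x = 0" if x: "x \<in> closure D \<or> x \<in> (\<Union>q'\<in>F - F0. ball q' (r q'))" for x
      proof (cases "x \<in> ball q (r q)")
        case True
        then have "m' x = 0" using m(3)[of x] by (auto simp: m'_def dist_norm norm_minus_commute)
        moreover have "grad m' x = 0" using gz[of x] True by (simp add: gm')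
        ultimately show ?thesis by (simp add: u2_def w2_def)
      next
        case False
        then have "u x = 0 \<and> w x = 0" using x z by auto
        then show ?thesis by (simp add: u2_def w2_def)
      qed
      have G2: "lsq_of cH \<bullet> lsq_of u2 = lsq_of H \<bullet> lsq_of w2"
        using insert.IH insert.prems W2 z2 by auto
      show "lsq_of cH \<bullet> lsq_of u = lsq_of H \<bullet> lsq_of w"
      proof (rule green_additive[OF W1(1) W2(1) W1(2) W2(2) G1 G2])
        show "u1 x + u2 x = u x" for x by (simp add: u1_def u2_def m'_def scaleR_diff_left)
        show "w1 x + w2 x = w x" for x by (simp add: w1_def w2_def m'_def gm' scaleR_diff_left)
      qed
    qed
  qed
  show ?thesis using main[OF F(2) subset_refl] u z by auto
qed

section \<open>Extension by zero from the exterior domain\<close>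

definition ext_zero :: "'a set \<Rightarrow> ('a \<Rightarrow> 'b::real_vector) \<Rightarrow> 'a \<Rightarrow> 'b" where
  "ext_zero \<Omega> u x = indicator \<Omega> x *\<^sub>R u x"

lemma integral_lebesgue_on:
  fixes g :: "'a::euclidean_space \<Rightarrow> 'b::euclidean_space"
  assumes "\<Omega> \<in> sets lebesgue"
  shows "(\<integral>x. g x \<partial>(lebesgue_on \<Omega>)) = (\<integral>x. indicator \<Omega> x *\<^sub>R g x \<partial>lebesgue)"
  using assms by (intro integral_restrict_space) simp

lemma L2_ext_zero:
  fixes u :: "'a::euclidean_space \<Rightarrow> 'b::euclidean_space"
  assumes "\<Omega> \<in> sets lebesgue"
  shows "u \<in> L2 \<Omega> \<longleftrightarrow> ext_zero \<Omega> u \<in> L2 UNIV"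
proof -
  have "indicator \<Omega> x *\<^sub>R (norm (u x))\<^sup>2 = (norm (indicator \<Omega> x *\<^sub>R u x))\<^sup>2" for x
    by (simp add: indicator_def)
  then show ?thesis
    using assms unfolding L2_UNIV
    by (simp add: L2_def ext_zero_def[abs_def] borel_measurable_restrict_space_iff integrable_restrict_space)
qed

lemma L2norm_ext_zero:
  fixes u :: "'a::euclidean_space \<Rightarrow> 'b::euclidean_space"
  assumes "\<Omega> \<in> sets lebesgue" "u \<in> L2 \<Omega>"
  shows "L2norm \<Omega> u = norm (lsq_of (ext_zero \<Omega> u))"
proof -
  have "indicator \<Omega> x *\<^sub>R (norm (u x))\<^sup>2 = (norm (indicator \<Omega> x *\<^sub>R u x))\<^sup>2" for x
    by (simp add: indicator_def)
  then show ?thesis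
    using assms by (simp add: norm_lsq_of_eq flip: L2_ext_zero)
      (simp add: L2norm_def integral_lebesgue_on ext_zero_def)
qed

lemma inner_lebesgue_on:
  fixes u v :: "'a::euclidean_space \<Rightarrow> 'b::euclidean_space"
  assumes "\<Omega> \<in> sets lebesgue" "u \<in> L2 \<Omega>" "v \<in> L2 UNIV"
  shows "(\<integral>x. u x \<bullet> v x \<partial>(lebesgue_on \<Omega>)) = lsq_of (ext_zero \<Omega> u) \<bullet> lsq_of v"
  using assms by (simp add: inner_lsq_of integral_lebesgue_on flip: L2_ext_zero) (simp add: ext_zero_def)

lemma L2_restrict:
  fixes u :: "'a::euclidean_space \<Rightarrow> 'b::euclidean_space"
  assumes "\<Omega> \<in> sets lebesgue" "u \<in> L2 UNIV"
  shows "u \<in> L2 \<Omega>" "ext_zero \<Omega> u \<in> L2 UNIV"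
proof -
  show "ext_zero \<Omega> u \<in> L2 UNIV"
    unfolding ext_zero_def[abs_def] using assms(1)
    by (intro L2_mult[OF assms(2), where c=1] borel_measurable_indicator) (auto simp: indicator_def)
  then show "u \<in> L2 \<Omega>" using L2_ext_zero[OF assms(1)] by blast
qed

lemma local_weak_curl_ext_zero:
  assumes \<Omega>: "\<Omega> \<in> sets lebesgue" and u: "u \<in> L2 \<Omega>" "w \<in> L2 \<Omega>" and c: "weak_curl \<Omega> u w"
  shows "local_weak_curl \<Omega> (ext_zero \<Omega> u) (ext_zero \<Omega> w)"
  unfolding local_weak_curl_def
proof (intro conjI allI impI)
  show uL: "ext_zero \<Omega> u \<in> L2 UNIV" and wL: "ext_zero \<Omega> w \<in> L2 UNIV"
    using u L2_ext_zero[OF \<Omega>] by blast+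
  fix \<phi> assume \<phi>: "vtest_fun \<Omega> \<phi>"
  then have "(\<integral>x. u x \<bullet> curl \<phi> x \<partial>(lebesgue_on \<Omega>)) = (\<integral>x. w x \<bullet> \<phi> x \<partial>(lebesgue_on \<Omega>))"
    using c by (simp add: weak_curl_def)
  then show "(\<integral>x. ext_zero \<Omega> u x \<bullet> curl \<phi> x \<partial>lebesgue) = (\<integral>x. ext_zero \<Omega> w x \<bullet> \<phi> x \<partial>lebesgue)"
    using vtest_fun_L2[OF \<phi>] vtest_fun_L2[OF vtest_fun_curl[OF \<phi>]]
    by (simp add: inner_lebesgue_on \<Omega> u inner_lsq_of uL wL)
qed

text \<open>The vanishing tangential trace is expressed against all test fields of the whole space;
  for the extensions by zero this is exactly the identity defining a weak curl.\<close>

lemma weak_curl_ext_zero: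
  assumes \<Omega>: "\<Omega> \<in> sets lebesgue" and u: "u \<in> L2 \<Omega>" "w \<in> L2 \<Omega>" and c: "tangential_trace_zero \<Omega> u w"
  shows "weak_curl UNIV (ext_zero \<Omega> u) (ext_zero \<Omega> w)"
  unfolding weak_curl_UNIV
proof (intro allI impI)
  have uL: "ext_zero \<Omega> u \<in> L2 UNIV" and wL: "ext_zero \<Omega> w \<in> L2 UNIV"
    using u L2_ext_zero[OF \<Omega>] by blast+
  fix \<phi> assume \<phi>: "vtest_fun UNIV \<phi>"
  then have "(\<integral>x. u x \<bullet> curl \<phi> x \<partial>(lebesgue_on \<Omega>)) = (\<integral>x. w x \<bullet> \<phi> x \<partial>(lebesgue_on \<Omega>))"
    using c by (simp add: tangential_trace_zero_def)
  then show "(\<integral>x. ext_zero \<Omega> u x \<bullet> curl \<phi> x \<partial>lebesgue) = (\<integral>x. ext_zero \<Omega> w x \<bullet> \<phi> x \<partial>lebesgue)"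
    using vtest_fun_L2[OF \<phi>] vtest_fun_L2[OF vtest_fun_curl[OF \<phi>]]
    by (simp add: inner_lebesgue_on \<Omega> u inner_lsq_of uL wL)
qed

text \<open>Difference quotients measured by \<open>L2norm\<close> become genuine derivatives of a
  curve in the Banach space of classes, one-sided at the end points.\<close>

lemma C1_L2_has_vector_derivative:
  fixes E :: "real \<Rightarrow> real^3 \<Rightarrow> real^3"
  assumes \<Omega>: "\<Omega> \<in> sets lebesgue" and C: "C1_L2 \<Omega> T E E'"
  defines "e \<equiv> \<lambda>t. lsq_of (ext_zero \<Omega> (E t))" and "e' \<equiv> \<lambda>t. lsq_of (ext_zero \<Omega> (E' t))"
  shows "\<And>t. t \<in> {0..T} \<Longrightarrow> (e has_vector_derivative e' t) (at t within {0..T})"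
    "continuous_on {0..T} e'"
proof -
  have EL: "E t \<in> L2 \<Omega>" "E' t \<in> L2 \<Omega>" if "t \<in> {0..T}" for t
    using C that by (auto simp: C1_L2_def)
  have xL: "ext_zero \<Omega> (E t) \<in> L2 UNIV" "ext_zero \<Omega> (E' t) \<in> L2 UNIV" if "t \<in> {0..T}" for t
    using EL[OF that] L2_ext_zero[OF \<Omega>] by blast+
  show "(e has_vector_derivative e' t) (at t within {0..T})" if t: "t \<in> {0..T}" for t
    unfolding has_vector_derivative_def has_derivative_within_alt
  proof (intro conjI allI impI)
    show "bounded_linear (\<lambda>x. x *\<^sub>R e' t)" by (rule bounded_linear_scaleR_left)
    fix \<delta> :: real assume \<delta>: "\<delta> > 0"
    have "((\<lambda>h. L2norm \<Omega> (\<lambda>x. (1/h) *\<^sub>R (E (t+h) x - E t x) - E' t x)) \<longlongrightarrow> 0)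
                    (at 0 within {h. t + h \<in> {0..T}})"
      using C t by (simp add: C1_L2_def)
    then obtain d where d: "d > 0" "\<And>h. t + h \<in> {0..T} \<Longrightarrow> h \<noteq> 0 \<Longrightarrow> \<bar>h\<bar> < d \<Longrightarrow>
        \<bar>L2norm \<Omega> (\<lambda>x. (1/h) *\<^sub>R (E (t+h) x - E t x) - E' t x)\<bar> < \<delta>"
      using \<delta> unfolding Lim_within by (auto simp: dist_norm)
    show "\<exists>d>0. \<forall>s\<in>{0..T}. norm (s - t) < d \<longrightarrow> norm (e s - e t - (s - t) *\<^sub>R e' t) \<le> \<delta> * norm (s - t)"
    proof (intro exI[of _ d] conjI ballI impI d(1))
      fix s assume s: "s \<in> {0..T}" "norm (s - t) < d"
      show "norm (e s - e t - (s - t) *\<^sub>R e' t) \<le> \<delta> * norm (s - t)"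
      proof (cases "s = t")
        case False
        define h where "h = s - t"
        have h: "h \<noteq> 0" "t + h = s" "\<bar>h\<bar> < d" using False s by (auto simp: h_def)
        let ?v = "\<lambda>x. (1/h) *\<^sub>R (E s x - E t x) - E' t x"
        have xv: "ext_zero \<Omega> ?v = (\<lambda>x. (1/h) *\<^sub>R (ext_zero \<Omega> (E s) x - ext_zero \<Omega> (E t) x) - ext_zero \<Omega> (E' t) x)"
          by (auto simp: ext_zero_def fun_eq_iff indicator_def)
        note d1 = L2_diff[OF xL(1)[OF s(1)] xL(1)[OF t]]
        have L: "lsq_of (ext_zero \<Omega> ?v) = (1/h) *\<^sub>R (e s - e t) - e' t"
          unfolding xv e_def e'_def using xL s(1) t d1 L2_scaleR[OF d1] by (simp add: lsq_of_simps)
        have "?v \<in> L2 \<Omega>"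
          unfolding L2_ext_zero[OF \<Omega>] xv using xL t by (intro L2_diff L2_scaleR d1)
        then have "norm ((1/h) *\<^sub>R (e s - e t) - e' t) < \<delta>"
          using d(2)[of h] h s(1) by (simp add: L2norm_ext_zero[OF \<Omega>] L)
        moreover have "e s - e t - (s - t) *\<^sub>R e' t = h *\<^sub>R ((1/h) *\<^sub>R (e s - e t) - e' t)"
          using h by (simp add: scaleR_diff_right h_def)
        ultimately show ?thesis
          using h by (simp add: h_def mult.commute mult_left_mono)
      qed simp
    qed
  qed
  show "continuous_on {0..T} e'"
    unfolding continuous_on_def
  proof
    fix t assume t: "t \<in> {0..T}"
    have "((\<lambda>s. L2norm \<Omega> (\<lambda>x. E' s x - E' t x)) \<longlongrightarrow> 0) (at t within {0..T})"
      using C t by (simp add: C1_L2_def)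
    moreover have "\<forall>\<^sub>F s in at t within {0..T}. L2norm \<Omega> (\<lambda>x. E' s x - E' t x) = norm (e' s - e' t)"
      unfolding eventually_at_filter
    proof (intro always_eventually allI impI)
      fix s assume "s \<noteq> t" and s: "s \<in> {0..T}"
      have xv: "ext_zero \<Omega> (\<lambda>x. E' s x - E' t x) = (\<lambda>x. ext_zero \<Omega> (E' s) x - ext_zero \<Omega> (E' t) x)"
        by (auto simp: ext_zero_def fun_eq_iff indicator_def)
      have "(\<lambda>x. E' s x - E' t x) \<in> L2 \<Omega>"
        unfolding L2_ext_zero[OF \<Omega>] xv using xL s t by (intro L2_diff)
      then show "L2norm \<Omega> (\<lambda>x. E' s x - E' t x) = norm (e' s - e' t)"
        using xL s t by (simp add: L2norm_ext_zero[OF \<Omega>] xv e'_def lsq_of_simps)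
    qed
    ultimately have "((\<lambda>s. norm (e' s - e' t)) \<longlongrightarrow> 0) (at t within {0..T})"
      by (rule Lim_transform_eventually)
    then show "(e' \<longlongrightarrow> e' t) (at t within {0..T})"
      by (simp add: tendsto_norm_zero_iff LIM_zero_iff)
  qed
qed

section \<open>The Laplace transform of the Maxwell system\<close>

text \<open>Integration by parts for a curve in a Banach space. The boundary term at
  \<open>T\<close> survives and is the origin of every \<open>exp (- \<tau> * T)\<close> error
  below.\<close>

lemma laplace_derivative:
  fixes e :: "real \<Rightarrow> 'a::banach"
  assumes T: "0 \<le> T" and d: "\<And>t. t \<in> {0..T} \<Longrightarrow> (e has_vector_derivative e' t) (at t within {0..T})"
    and c: "continuous_on {0..T} e'" and e0: "e 0 = 0"
  shows "integral {0..T} (\<lambda>t. exp (- \<tau> * t) *\<^sub>R e' t)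
    = exp (- \<tau> * T) *\<^sub>R e T + \<tau> *\<^sub>R integral {0..T} (\<lambda>t. exp (- \<tau> * t) *\<^sub>R e t)"
proof -
  have ce: "continuous_on {0..T} e"
    by (rule continuous_on_vector_derivative[OF d])
  have i1: "(\<lambda>t. exp (- \<tau> * t) *\<^sub>R e' t) integrable_on {0..T}"
    and i2: "(\<lambda>t. exp (- \<tau> * t) *\<^sub>R e t) integrable_on {0..T}"
    by (intro integrable_continuous_interval continuous_intros c ce)+
  have "((\<lambda>t. exp (- \<tau> * t) *\<^sub>R e' t - \<tau> *\<^sub>R (exp (- \<tau> * t) *\<^sub>R e t)) has_integral
      (exp (- \<tau> * T) *\<^sub>R e T - exp (- \<tau> * 0) *\<^sub>R e 0)) {0..T}"
  proof (rule fundamental_theorem_of_calculus[OF T])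
    fix t assume t: "t \<in> {0..T}"
    have "((\<lambda>t. exp (- \<tau> * t)) has_real_derivative (exp (- \<tau> * t) * (- \<tau>))) (at t within {0..T})"
      by (auto intro!: derivative_eq_intros)
    from has_vector_derivative_scaleR[OF this d[OF t]]
    show "((\<lambda>t. exp (- \<tau> * t) *\<^sub>R e t) has_vector_derivative
        exp (- \<tau> * t) *\<^sub>R e' t - \<tau> *\<^sub>R (exp (- \<tau> * t) *\<^sub>R e t)) (at t within {0..T})"
      by (simp add: mult.commute)
  qed
  from integral_unique[OF this] i1 i2
  have "integral {0..T} (\<lambda>t. exp (- \<tau> * t) *\<^sub>R e' t) - \<tau> *\<^sub>R integral {0..T} (\<lambda>t. exp (- \<tau> * t) *\<^sub>R e t)
      = exp (- \<tau> * T) *\<^sub>R e T"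
    by (simp add: e0 integral_diff integrable_cmul del: scaleR_scaleR)
  then show ?thesis by (simp add: algebra_simps)
qed

lemma inner_laplace:
  fixes e :: "real \<Rightarrow> 'a::{banach, real_inner}"
  assumes "continuous_on {0..T} e"
  shows "integral {0..T} (\<lambda>t. exp (- \<tau> * t) *\<^sub>R e t) \<bullet> v = integral {0..T} (\<lambda>t. exp (- \<tau> * t) * (e t \<bullet> v))"
proof -
  have i: "(\<lambda>t. exp (- \<tau> * t) *\<^sub>R e t) integrable_on {0..T}"
    by (intro integrable_continuous_interval continuous_intros assms)
  show ?thesis
    using integral_linear[OF i bounded_linear_inner_left[of v]] by (simp add: o_def)
qed

lemma LINT_interval_continuous:
  fixes g :: "real \<Rightarrow> real"
  assumes "continuous_on {0..T} g"
  shows "(LINT t:{0..T}|lborel. g t) = integral {0..T} g"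
  by (rule set_borel_integral_eq_integral(2)[OF borel_integrable_atLeastAtMost'[OF assms]])

text \<open>The test space of the exterior problem, realised on the whole space. The curl travels as
  a second argument instead of being an operator on classes, and representatives are chosen to
  vanish pointwise on \<open>closure D\<close>, as Green's formula requires.\<close>

definition H0curl :: "(real^3) set \<Rightarrow> (real^3, real^3) lsq \<Rightarrow> (real^3, real^3) lsq \<Rightarrow> bool" where
  "H0curl D U C \<longleftrightarrow> (\<exists>u w. u \<in> L2 UNIV \<and> w \<in> L2 UNIV \<and> weak_curl UNIV u w \<and>
     (\<forall>x\<in>closure D. u x = 0 \<and> w x = 0) \<and> U = lsq_of u \<and> C = lsq_of w)"

lemma weak_curl_lsq_of:
  assumes "u \<in> L2 UNIV" "w \<in> L2 UNIV"
  shows "weak_curl UNIV u w \<longleftrightarrow>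
    (\<forall>\<phi>. vtest_fun UNIV \<phi> \<longrightarrow> lsq_of u \<bullet> lsq_of (curl \<phi>) = lsq_of w \<bullet> lsq_of \<phi>)"
  using assms vtest_fun_L2 vtest_fun_L2[OF vtest_fun_curl]
  by (simp add: weak_curl_UNIV inner_lsq_of)

text \<open>The pairing in the hypothesis is the squared norm of the part of \<open>U\<close>
  outside \<open>\<Omega>\<close>. Stated as a pairing, the vanishing can be checked under a time
  integral.\<close>

lemma lsq_of_ext_zero_eqI:
  assumes "\<Omega> \<in> sets lebesgue" "U \<bullet> lsq_of (ext_zero (- \<Omega>) (rep_lsq U)) = 0"
  shows "lsq_of (ext_zero \<Omega> (rep_lsq U)) = U"
proof -
  define u where "u = rep_lsq U"
  have u: "u \<in> L2 UNIV" "U = lsq_of u" by (simp_all add: u_def rep_lsq_L2 lsq_of_rep)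
  have m: "- \<Omega> \<in> sets lebesgue" using assms(1) by (simp add: Compl_in_sets_lebesgue)
  note L = L2_restrict(2)[OF assms(1) u(1)] L2_restrict(2)[OF m u(1)]
  have s: "u = (\<lambda>x. ext_zero \<Omega> u x + ext_zero (- \<Omega>) u x)"
    by (auto simp: ext_zero_def fun_eq_iff indicator_def)
  have d: "lsq_of u = lsq_of (ext_zero \<Omega> u) + lsq_of (ext_zero (- \<Omega>) u)"
    using lsq_of_simps(2)[OF L] s by simp
  have "lsq_of (ext_zero \<Omega> u) \<bullet> lsq_of (ext_zero (- \<Omega>) u) = 0"
  proof -
    have "ext_zero \<Omega> u x \<bullet> ext_zero (- \<Omega>) u x = 0" for x
      by (cases "x \<in> \<Omega>") (simp_all add: ext_zero_def)
    then show ?thesis by (simp add: inner_lsq_of[OF L])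
  qed
  moreover have "(lsq_of (ext_zero \<Omega> u) + lsq_of (ext_zero (- \<Omega>) u)) \<bullet> lsq_of (ext_zero (- \<Omega>) u) = 0"
    using assms(2)[folded u_def] by (simp only: d[symmetric] u(2)[symmetric])
  ultimately have "lsq_of (ext_zero (- \<Omega>) u) = 0" by (simp add: inner_add_left)
  then show ?thesis using d unfolding u_def[symmetric] u(2)[symmetric] by simp
qed

text \<open>\<open>eT\<close> and \<open>hT\<close> are the classes of the two fields at time
  \<open>T\<close>; they do not depend on \<open>\<tau>\<close> and are therefore chosen before it.
  Eliminating the magnetic field between the two transformed equations leaves a bilinear form in the
  electric field alone.\<close>

lemma maxwell_laplace_weak:
  fixes D B :: "(real^3) set" and W :: "real \<Rightarrow> real^3 \<Rightarrow> real^3"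
  assumes D: "open D" "bounded D" "C2_boundary D" and \<epsilon>: "\<epsilon> > 0" and \<mu>: "\<mu> > 0" and T: "0 < T"
    and B: "B \<inter> closure D = {}" "(\<lambda>x. indicator B x *\<^sub>R a) \<in> L2 UNIV"
    and f: "continuous_on {0..T} f"
    and sol: "maxwell_solution D \<epsilon> \<mu> T (\<lambda>x t. (f t * indicator B x) *\<^sub>R a) E H"
    and W: "\<And>\<tau>. \<tau> > 0 \<Longrightarrow> W \<tau> \<in> L2 (- closure D)"
      "\<And>\<tau> \<phi>. \<tau> > 0 \<Longrightarrow> \<phi> \<in> L2 (- closure D) \<Longrightarrow>
        (\<integral>x. W \<tau> x \<bullet> \<phi> x \<partial>(lebesgue_on (- closure D))) =
        (LINT t:{0..T}|lborel. exp (- \<tau> * t) * (\<integral>x. E t x \<bullet> \<phi> x \<partial>(lebesgue_on (- closure D))))"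
  shows "\<exists>eT hT. \<forall>\<tau>>0. \<exists>C. H0curl D (lsq_of (ext_zero (- closure D) (W \<tau>))) C \<and>
      (\<forall>\<Psi> K. H0curl D \<Psi> K \<longrightarrow>
        \<tau>\<^sup>2 * (lsq_of (ext_zero (- closure D) (W \<tau>)) \<bullet> \<Psi>) + 1 / (\<mu> * \<epsilon>) * (C \<bullet> K)
        = \<tau> / \<epsilon> * ftilde T f \<tau> * (lsq_of (\<lambda>x. indicator B x *\<^sub>R a) \<bullet> \<Psi>)
          - exp (- \<tau> * T) * (\<tau> * (eT \<bullet> \<Psi>) + 1 / \<epsilon> * (hT \<bullet> K)))"
proof -
  define \<Omega> where "\<Omega> = - closure D"
  have \<Omega>o: "open \<Omega>" by (simp add: \<Omega>_def open_Compl)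
  have \<Omega>: "\<Omega> \<in> sets lebesgue" using \<Omega>o by (simp add: borel_open sets_completionI_sets)
  have \<Omega>c: "- \<Omega> = closure D" by (simp add: \<Omega>_def)
  have \<Omega>m: "- \<Omega> \<in> sets lebesgue" using \<Omega> by (simp add: Compl_in_sets_lebesgue)
  note W' = W[folded \<Omega>_def]
  obtain E' H' cE cH where C1: "C1_L2 \<Omega> T E E'" "C1_L2 \<Omega> T H H'"
    and c: "\<And>t. t \<in> {0..T} \<Longrightarrow> cE t \<in> L2 \<Omega> \<and> cH t \<in> L2 \<Omega> \<and>
          weak_curl \<Omega> (E t) (cE t) \<and> weak_curl \<Omega> (H t) (cH t) \<and>
          tangential_trace_zero \<Omega> (E t) (cE t) \<and>
          (AE x in lebesgue_on \<Omega>. \<epsilon> *\<^sub>R E' t x - cH t x = (f t * indicator B x) *\<^sub>R a) \<and>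
          (AE x in lebesgue_on \<Omega>. \<mu> *\<^sub>R H' t x + cE t x = 0)"
    and init: "L2norm \<Omega> (E 0) = 0" "L2norm \<Omega> (H 0) = 0"
    using sol unfolding maxwell_solution_def Let_def \<Omega>_def[symmetric] by blast
  have L: "E t \<in> L2 \<Omega>" "E' t \<in> L2 \<Omega>" "H t \<in> L2 \<Omega>" "H' t \<in> L2 \<Omega>" "cE t \<in> L2 \<Omega>" "cH t \<in> L2 \<Omega>"
    if "t \<in> {0..T}" for t
    using C1 c[OF that] that by (auto simp: C1_L2_def)
  have X: "ext_zero \<Omega> (E t) \<in> L2 UNIV" "ext_zero \<Omega> (E' t) \<in> L2 UNIV" "ext_zero \<Omega> (H t) \<in> L2 UNIV"
    "ext_zero \<Omega> (H' t) \<in> L2 UNIV" "ext_zero \<Omega> (cE t) \<in> L2 UNIV" "ext_zero \<Omega> (cH t) \<in> L2 UNIV"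
    if "t \<in> {0..T}" for t
    using L[OF that] L2_ext_zero[OF \<Omega>] by blast+
  define e where "e t = lsq_of (ext_zero \<Omega> (E t))" for t
  define e' where "e' t = lsq_of (ext_zero \<Omega> (E' t))" for t
  define h where "h t = lsq_of (ext_zero \<Omega> (H t))" for t
  define h' where "h' t = lsq_of (ext_zero \<Omega> (H' t))" for t
  define ce where "ce t = lsq_of (ext_zero \<Omega> (cE t))" for t
  define ch where "ch t = lsq_of (ext_zero \<Omega> (cH t))" for t
  define b where "b = lsq_of (\<lambda>x. indicator B x *\<^sub>R a)"
  note de = C1_L2_has_vector_derivative[OF \<Omega> C1(1), folded e_def[abs_def] e'_def[abs_def] e'_def]
  note dh = C1_L2_has_vector_derivative[OF \<Omega> C1(2), folded h_def[abs_def] h'_def[abs_def] h'_def]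
  have con_e: "continuous_on {0..T} e" and con_h: "continuous_on {0..T} h"
    by (rule continuous_on_vector_derivative[OF de(1)], assumption, rule continuous_on_vector_derivative[OF dh(1)])
  have T0: "0 \<in> {0..T}" "T \<in> {0..T}" using T by auto
  have e0: "e 0 = 0" and h0: "h 0 = 0"
    using init L2norm_ext_zero[OF \<Omega> L(1)[OF T0(1)]] L2norm_ext_zero[OF \<Omega> L(3)[OF T0(1)]]
    by (simp_all add: e_def h_def)
  have eq1: "\<epsilon> *\<^sub>R e' t - ch t = f t *\<^sub>R b" if t: "t \<in> {0..T}" for t
  proof -
    have "AE x in lebesgue. x \<in> \<Omega> \<longrightarrow> \<epsilon> *\<^sub>R E' t x - cH t x = (f t * indicator B x) *\<^sub>R a"
      using c[OF t] \<Omega> by (simp add: AE_restrict_space_iff)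
    then have "AE x in lebesgue. \<epsilon> *\<^sub>R ext_zero \<Omega> (E' t) x - ext_zero \<Omega> (cH t) x = f t *\<^sub>R indicator B x *\<^sub>R a"
    proof eventually_elim
      case (elim x)
      then show ?case using B(1) by (auto simp: ext_zero_def indicator_def \<Omega>_def)
    qed
    then have "lsq_of (\<lambda>x. \<epsilon> *\<^sub>R ext_zero \<Omega> (E' t) x - ext_zero \<Omega> (cH t) x) = lsq_of (\<lambda>x. f t *\<^sub>R indicator B x *\<^sub>R a)"
      using X[OF t] B(2) by (subst lsq_of_eq_iff) (auto intro!: L2_diff L2_scaleR simp del: scaleR_scaleR)
    then show ?thesis
      using X[OF t] B(2) L2_scaleR[OF X(2)[OF t], of \<epsilon>] L2_scaleR[OF B(2), of "f t"]
      by (simp add: lsq_of_simps e'_def ch_def b_def del: scaleR_scaleR)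
  qed
  have eq2: "ce t = - \<mu> *\<^sub>R h' t" if t: "t \<in> {0..T}" for t
  proof -
    have "AE x in lebesgue. x \<in> \<Omega> \<longrightarrow> \<mu> *\<^sub>R H' t x + cE t x = 0"
      using c[OF t] \<Omega> by (simp add: AE_restrict_space_iff)
    then have "AE x in lebesgue. \<mu> *\<^sub>R ext_zero \<Omega> (H' t) x + ext_zero \<Omega> (cE t) x = 0"
      by eventually_elim (auto simp: ext_zero_def indicator_def)
    then have "lsq_of (\<lambda>x. \<mu> *\<^sub>R ext_zero \<Omega> (H' t) x + ext_zero \<Omega> (cE t) x) = lsq_of (\<lambda>x. 0)"
      using X[OF t] by (subst lsq_of_eq_iff) (auto intro!: L2_add L2_scaleR L2_zero)
    then have "\<mu> *\<^sub>R h' t + ce t = 0"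
      using X[OF t] L2_scaleR[OF X(4)[OF t], of \<mu>]
      by (simp add: lsq_of_simps h'_def ce_def)
    then show ?thesis by (simp add: add_eq_0_iff)
  qed
  have con_ce: "continuous_on {0..T} ce"
    using dh(2) eq2 by (subst continuous_on_cong[OF refl eq2]) (auto intro!: continuous_intros)
  have con_ch: "continuous_on {0..T} ch"
  proof -
    have "ch t = \<epsilon> *\<^sub>R e' t - f t *\<^sub>R b" if "t \<in> {0..T}" for t using eq1[OF that] by (simp add: algebra_simps)
    then show ?thesis using de(2) f by (subst continuous_on_cong[OF refl, of _ _ "\<lambda>t. \<epsilon> *\<^sub>R e' t - f t *\<^sub>R b"]) (auto intro!: continuous_intros)
  qed
  \<comment> \<open>The boundary regularity enters here: \<open>\<Psi>\<close> need not be supported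
    in the open exterior, so the local curl equation of the magnetic field cannot be tested with it
    directly.\<close>
  have green: "ch t \<bullet> \<Psi> = h t \<bullet> K" if t: "t \<in> {0..T}" and \<Psi>: "H0curl D \<Psi> K" for t \<Psi> K
  proof -
    obtain u w where u: "u \<in> L2 UNIV" "w \<in> L2 UNIV" "weak_curl UNIV u w" "\<forall>x\<in>closure D. u x = 0 \<and> w x = 0"
      "\<Psi> = lsq_of u" "K = lsq_of w" using \<Psi> by (auto simp: H0curl_def)
    have "local_weak_curl (- closure D) (ext_zero \<Omega> (H t)) (ext_zero \<Omega> (cH t))"
      using local_weak_curl_ext_zero[OF \<Omega> L(3,6)[OF t]] c[OF t] by (simp add: \<Omega>_def)
    from green_C2_boundary[OF this D u(1-3)] u(4) show ?thesis by (simp add: u(5,6) ch_def h_def)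
  qed
  have wce: "e t \<bullet> lsq_of (curl \<phi>) = ce t \<bullet> lsq_of \<phi>" if t: "t \<in> {0..T}" and \<phi>: "vtest_fun UNIV \<phi>" for t \<phi>
    using weak_curl_ext_zero[OF \<Omega> L(1,5)[OF t]] c[OF t] \<phi>
    by (simp add: weak_curl_lsq_of[OF X(1,5)[OF t]] e_def ce_def)
  have main: "\<exists>C. H0curl D (lsq_of (ext_zero \<Omega> (W \<tau>))) C \<and>
      (\<forall>\<Psi> K. H0curl D \<Psi> K \<longrightarrow>
        \<tau>\<^sup>2 * (lsq_of (ext_zero \<Omega> (W \<tau>)) \<bullet> \<Psi>) + 1 / (\<mu> * \<epsilon>) * (C \<bullet> K)
        = \<tau> / \<epsilon> * ftilde T f \<tau> * (b \<bullet> \<Psi>)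
          - exp (- \<tau> * T) * (\<tau> * (e T \<bullet> \<Psi>) + 1 / \<epsilon> * (h T \<bullet> K)))" if \<tau>: "\<tau> > 0" for \<tau>
  proof -
    let ?L = "\<lambda>g. integral {0..T} (\<lambda>t. exp (- \<tau> * t) *\<^sub>R g t)"
    define m where "m = exp (- \<tau> * T)"
    have WX: "ext_zero \<Omega> (W \<tau>) \<in> L2 UNIV" using W'(1)[OF \<tau>] L2_ext_zero[OF \<Omega>] by blast
    \<comment> \<open>\<open>W\<close> is given only through its pairings; comparing them with those
      of the vector valued integral identifies its class.\<close>
    have WE: "lsq_of (ext_zero \<Omega> (W \<tau>)) = ?L e"
    proof -
      have "lsq_of (ext_zero \<Omega> (W \<tau>)) \<bullet> \<theta> = ?L e \<bullet> \<theta>" for \<theta>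
      proof -
        obtain v where v: "v \<in> L2 UNIV" "\<theta> = lsq_of v" using lsq_cases by blast
        have "lsq_of (ext_zero \<Omega> (W \<tau>)) \<bullet> \<theta> = (\<integral>x. W \<tau> x \<bullet> v x \<partial>(lebesgue_on \<Omega>))"
          using inner_lebesgue_on[OF \<Omega> W'(1)[OF \<tau>] v(1)] v(2) by simp
        also have "\<dots> = (LINT t:{0..T}|lborel. exp (- \<tau> * t) * (\<integral>x. E t x \<bullet> v x \<partial>(lebesgue_on \<Omega>)))"
          by (rule W'(2)[OF \<tau> L2_restrict(1)[OF \<Omega> v(1)]])
        also have "\<dots> = (LINT t:{0..T}|lborel. exp (- \<tau> * t) * (e t \<bullet> \<theta>))"
          using inner_lebesgue_on[OF \<Omega> L(1) v(1)] v(2)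
          by (intro set_lebesgue_integral_cong) (auto simp: e_def)
        also have "\<dots> = integral {0..T} (\<lambda>t. exp (- \<tau> * t) * (e t \<bullet> \<theta>))"
          by (intro LINT_interval_continuous continuous_intros con_e)
        also have "\<dots> = ?L e \<bullet> \<theta>" by (rule inner_laplace[OF con_e, symmetric])
        finally show ?thesis .
      qed
      then show ?thesis using vector_eq_rdot[of "lsq_of (ext_zero \<Omega> (W \<tau>))" "?L e"] by blast
    qed
    define C where "C = ?L ce"
    \<comment> \<open>Faraday's law makes the transformed curl a multiple of the transform of
      \<open>h'\<close>, and integration by parts brings out the final value.\<close>
    have C: "C = - \<mu> *\<^sub>R (m *\<^sub>R h T + \<tau> *\<^sub>R ?L h)"
    proof -
      have "C = ?L (\<lambda>t. - \<mu> *\<^sub>R h' t)"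
        unfolding C_def by (rule integral_cong) (simp add: eq2)
      also have "\<dots> = integral {0..T} (\<lambda>t. - \<mu> *\<^sub>R (exp (- \<tau> * t) *\<^sub>R h' t))"
        by (rule integral_cong) (simp add: mult.commute)
      also have "\<dots> = - \<mu> *\<^sub>R ?L h'" by (rule integral_cmul)
      also have "?L h' = m *\<^sub>R h T + \<tau> *\<^sub>R ?L h"
        using laplace_derivative[OF less_imp_le[OF T] dh h0] by (simp add: m_def)
      finally show ?thesis .
    qed
    \<comment> \<open>Each \<open>ce t\<close> vanishes outside \<open>\<Omega>\<close>; pairing
      with the outer part carries this property through the integral.\<close>
    have Cz: "C \<bullet> lsq_of (ext_zero (- \<Omega>) (rep_lsq C)) = 0"
    proof -
      note Z = L2_restrict(2)[OF \<Omega>m rep_lsq_L2[of C]]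
      have "ce t \<bullet> lsq_of (ext_zero (- \<Omega>) (rep_lsq C)) = 0" if "t \<in> {0..T}" for t
      proof -
        have "ext_zero \<Omega> (cE t) x \<bullet> ext_zero (- \<Omega>) (rep_lsq C) x = 0" for x
          by (cases "x \<in> \<Omega>") (simp_all add: ext_zero_def)
        then show ?thesis by (simp add: ce_def inner_lsq_of[OF X(5)[OF that] Z])
      qed
      then have "integral {0..T} (\<lambda>t. exp (- \<tau> * t) * (ce t \<bullet> lsq_of (ext_zero (- \<Omega>) (rep_lsq C))))
          = integral {0..T} (\<lambda>t. 0)"
        by (intro integral_cong) simp
      then show ?thesis unfolding C_def inner_laplace[OF con_ce] by simp
    qed
    have Cx: "lsq_of (ext_zero \<Omega> (rep_lsq C)) = C" by (rule lsq_of_ext_zero_eqI[OF \<Omega> Cz])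
    have HW: "H0curl D (lsq_of (ext_zero \<Omega> (W \<tau>))) C"
      unfolding H0curl_def
    proof (rule exI[of _ "ext_zero \<Omega> (W \<tau>)"], rule exI[of _ "ext_zero \<Omega> (rep_lsq C)"], intro conjI)
      show CL: "ext_zero \<Omega> (rep_lsq C) \<in> L2 UNIV" by (rule L2_restrict(2)[OF \<Omega> rep_lsq_L2])
      show "weak_curl UNIV (ext_zero \<Omega> (W \<tau>)) (ext_zero \<Omega> (rep_lsq C))"
        unfolding weak_curl_lsq_of[OF WX CL] Cx WE
      proof (intro allI impI)
        fix \<phi> assume \<phi>: "vtest_fun UNIV \<phi>"
        show "?L e \<bullet> lsq_of (curl \<phi>) = C \<bullet> lsq_of \<phi>"
          unfolding C_def inner_laplace[OF con_e] inner_laplace[OF con_ce]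
          by (rule integral_cong) (simp add: wce[OF _ \<phi>])
      qed
      show "\<forall>x\<in>closure D. ext_zero \<Omega> (W \<tau>) x = 0 \<and> ext_zero \<Omega> (rep_lsq C) x = 0"
        by (simp add: ext_zero_def \<Omega>_def)
    qed (use WX Cx in auto)
    moreover have "\<tau>\<^sup>2 * (lsq_of (ext_zero \<Omega> (W \<tau>)) \<bullet> \<Psi>) + 1 / (\<mu> * \<epsilon>) * (C \<bullet> K)
        = \<tau> / \<epsilon> * ftilde T f \<tau> * (b \<bullet> \<Psi>)
          - exp (- \<tau> * T) * (\<tau> * (e T \<bullet> \<Psi>) + 1 / \<epsilon> * (h T \<bullet> K))" if \<Psi>: "H0curl D \<Psi> K" for \<Psi> K
    proof -
      define F where "F = ftilde T f \<tau>"
      have F: "F = integral {0..T} (\<lambda>t. exp (- \<tau> * t) * f t)"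
        unfolding F_def ftilde_def by (intro LINT_interval_continuous continuous_intros f)
      have Le': "?L e' = m *\<^sub>R e T + \<tau> *\<^sub>R ?L e"
        using laplace_derivative[OF less_imp_le[OF T] de e0] by (simp add: m_def)
      have i1: "(\<lambda>t. exp (- \<tau> * t) * (ch t \<bullet> \<Psi>)) integrable_on {0..T}"
        by (intro integrable_continuous_interval continuous_intros con_ch)
      have i2: "(\<lambda>t. exp (- \<tau> * t) * f t) integrable_on {0..T}"
        by (intro integrable_continuous_interval continuous_intros f)
      have "\<epsilon> * (?L e' \<bullet> \<Psi>) = integral {0..T} (\<lambda>t. \<epsilon> * (exp (- \<tau> * t) * (e' t \<bullet> \<Psi>)))"
        unfolding inner_laplace[OF de(2)] by (rule integral_mult_right[symmetric])
      also have "\<dots> = integral {0..T} (\<lambda>t. exp (- \<tau> * t) * (ch t \<bullet> \<Psi>) + exp (- \<tau> * t) * f t * (b \<bullet> \<Psi>))"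
      proof (rule integral_cong)
        fix t assume "t \<in> {0..T}"
        then have "\<epsilon> * (e' t \<bullet> \<Psi>) = ch t \<bullet> \<Psi> + f t * (b \<bullet> \<Psi>)"
          using arg_cong[OF eq1, of t "\<lambda>v. v \<bullet> \<Psi>"] by (simp add: inner_diff_left)
        then have "exp (- \<tau> * t) * (\<epsilon> * (e' t \<bullet> \<Psi>)) = exp (- \<tau> * t) * (ch t \<bullet> \<Psi> + f t * (b \<bullet> \<Psi>))" by simp
        then show "\<epsilon> * (exp (- \<tau> * t) * (e' t \<bullet> \<Psi>)) = exp (- \<tau> * t) * (ch t \<bullet> \<Psi>) + exp (- \<tau> * t) * f t * (b \<bullet> \<Psi>)"
          by (simp add: algebra_simps)
      qed
      also have "\<dots> = integral {0..T} (\<lambda>t. exp (- \<tau> * t) * (ch t \<bullet> \<Psi>)) + F * (b \<bullet> \<Psi>)"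
        using i1 i2 by (simp add: integral_add integrable_on_mult_left F)
      also have "integral {0..T} (\<lambda>t. exp (- \<tau> * t) * (ch t \<bullet> \<Psi>)) = integral {0..T} (\<lambda>t. exp (- \<tau> * t) * (h t \<bullet> K))"
        by (rule integral_cong) (simp add: green[OF _ \<Psi>])
      also have "\<dots> = ?L h \<bullet> K" by (rule inner_laplace[OF con_h, symmetric])
      finally have A: "\<epsilon> * ((m *\<^sub>R e T + \<tau> *\<^sub>R ?L e) \<bullet> \<Psi>) = ?L h \<bullet> K + F * (b \<bullet> \<Psi>)"
        unfolding Le' .
      have Cm: "C \<bullet> K = - \<mu> * (m * (h T \<bullet> K) + \<tau> * (?L h \<bullet> K))"
        unfolding C by (simp add: inner_add_left)
      define x where "x = ?L e \<bullet> \<Psi>"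
      define y where "y = ?L h \<bullet> K"
      have A': "\<epsilon> * (m * (e T \<bullet> \<Psi>) + \<tau> * x) = y + F * (b \<bullet> \<Psi>)"
        using A by (simp add: inner_add_left x_def y_def)
      \<comment> \<open>Ampere's law solved for the magnetic pairing; inserting it into Faraday's
        law eliminates the magnetic transform.\<close>
      have y: "y = \<epsilon> * (m * (e T \<bullet> \<Psi>) + \<tau> * x) - F * (b \<bullet> \<Psi>)" using A' by simp
      have "\<tau>\<^sup>2 * x + 1 / (\<mu> * \<epsilon>) * (- \<mu> * (m * (h T \<bullet> K) + \<tau> * y))
          = \<tau> / \<epsilon> * F * (b \<bullet> \<Psi>) - m * (\<tau> * (e T \<bullet> \<Psi>) + 1 / \<epsilon> * (h T \<bullet> K))"
        unfolding y using \<epsilon> \<mu> by (simp add: field_simps power2_eq_square)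
      then show ?thesis unfolding WE Cm x_def[symmetric] y_def[symmetric] F_def[symmetric] m_def[symmetric] .
    qed
    ultimately show ?thesis by blast
  qed
  show ?thesis
    unfolding \<Omega>_def[symmetric] b_def[symmetric] by (intro exI[of _ "e T"] exI[of _ "h T"] allI impI main)
qed

section \<open>Weighted decay estimates\<close>

text \<open>Weak form of curl curl V + \<kappa>^2 V = g b on the whole space. Amplitude
  \<open>g\<close> and profile \<open>b\<close> are separate because \<open>g\<close> carries the
  dependence on the pulse, while constants in the estimates may depend on \<open>b\<close>.\<close>

definition maxwell_source ::
  "real \<Rightarrow> real \<Rightarrow> (real^3 \<Rightarrow> real^3) \<Rightarrow> (real^3 \<Rightarrow> real^3) \<Rightarrow> (real^3 \<Rightarrow> real^3) \<Rightarrow> bool" where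
  "maxwell_source \<kappa> g b V cV \<longleftrightarrow> V \<in> L2 UNIV \<and> cV \<in> L2 UNIV \<and> weak_curl UNIV V cV \<and>
    (\<forall>\<Psi> K. \<Psi> \<in> L2 UNIV \<and> K \<in> L2 UNIV \<and> weak_curl UNIV \<Psi> K \<longrightarrow>
      lsq_of cV \<bullet> lsq_of K + \<kappa>\<^sup>2 * (lsq_of V \<bullet> lsq_of \<Psi>) = g * (lsq_of b \<bullet> lsq_of \<Psi>))"

text \<open>The inequality first bounds \<open>U\<close> by
  \<open>G / (\<theta> * \<kappa>\<^sup>2)\<close>; feeding this back into the right-hand side
  bounds the whole energy.\<close>

lemma energy_absorb:
  fixes A U G \<kappa> \<theta> :: real
  assumes \<kappa>: "\<kappa> > 0" and \<theta>: "\<theta> > 0" and p: "A \<ge> 0" "U \<ge> 0" "G \<ge> 0"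
    and e: "\<theta> * (A\<^sup>2 + \<kappa>\<^sup>2 * U\<^sup>2) \<le> G * U"
  shows "A\<^sup>2 + \<kappa>\<^sup>2 * U\<^sup>2 \<le> (G / (\<theta> * \<kappa>))\<^sup>2"
proof -
  have "\<theta> * (\<kappa>\<^sup>2 * U\<^sup>2) \<le> G * U"
    using e \<theta> by (smt (verit, best) mult_left_mono zero_le_power2)
  then have "U * (\<theta> * \<kappa>\<^sup>2 * U) \<le> U * G" by (simp add: power2_eq_square mult_ac)
  then have "\<theta> * \<kappa>\<^sup>2 * U \<le> G" using p by (cases "U = 0") auto
  then have "U \<le> G / (\<theta> * \<kappa>\<^sup>2)" using \<theta> \<kappa> by (simp add: pos_le_divide_eq mult_ac)
  then have "G * U \<le> G * (G / (\<theta> * \<kappa>\<^sup>2))" using p by (intro mult_left_mono) auto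
  with e have "\<theta> * (A\<^sup>2 + \<kappa>\<^sup>2 * U\<^sup>2) \<le> G * (G / (\<theta> * \<kappa>\<^sup>2))" by linarith
  then have "(A\<^sup>2 + \<kappa>\<^sup>2 * U\<^sup>2) * \<theta> \<le> G * (G / (\<theta> * \<kappa>\<^sup>2))"
    by (simp only: mult.commute)
  then have "A\<^sup>2 + \<kappa>\<^sup>2 * U\<^sup>2 \<le> G * (G / (\<theta> * \<kappa>\<^sup>2)) / \<theta>"
    by (rule pos_le_divide_eq[OF \<theta>, THEN iffD2])
  also have "\<dots> = (G / (\<theta> * \<kappa>))\<^sup>2" by (simp add: power2_eq_square)
  finally show ?thesis .
qed

lemma maxwell_source_energy:
  assumes s: "maxwell_source \<kappa> g b V cV" and \<kappa>: "\<kappa> > 0" and b: "b \<in> L2 UNIV"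
  shows "(norm (lsq_of cV))\<^sup>2 + \<kappa>\<^sup>2 * (norm (lsq_of V))\<^sup>2 \<le> (\<bar>g\<bar> * norm (lsq_of b) / \<kappa>)\<^sup>2"
proof -
  have "(norm (lsq_of cV))\<^sup>2 + \<kappa>\<^sup>2 * (norm (lsq_of V))\<^sup>2 = g * (lsq_of b \<bullet> lsq_of V)"
    using s unfolding maxwell_source_def power2_norm_eq_inner by blast
  also have "\<dots> \<le> \<bar>g\<bar> * \<bar>lsq_of b \<bullet> lsq_of V\<bar>" by (simp flip: abs_mult)
  also have "\<dots> \<le> \<bar>g\<bar> * (norm (lsq_of b) * norm (lsq_of V))"
    by (intro mult_left_mono Cauchy_Schwarz_ineq2) auto
  finally show ?thesis
    using energy_absorb[OF \<kappa>, of 1 "norm (lsq_of cV)" "norm (lsq_of V)" "\<bar>g\<bar> * norm (lsq_of b)"]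
    by (simp add: mult.assoc)
qed

lemma norm_lsq_mono:
  fixes u :: "'a::euclidean_space \<Rightarrow> 'b::euclidean_space" and v :: "'a \<Rightarrow> 'c::euclidean_space"
  assumes "u \<in> L2 UNIV" "v \<in> L2 UNIV" "c \<ge> 0" "\<And>x. norm (u x) \<le> c * norm (v x)"
  shows "norm (lsq_of u) \<le> c * norm (lsq_of v)"
proof -
  have "(norm (lsq_of u))\<^sup>2 \<le> (\<integral>x. c\<^sup>2 * (norm (v x))\<^sup>2 \<partial>lebesgue)"
    unfolding norm_lsq_of_sq[OF assms(1)]
  proof (rule integral_mono)
    show "(norm (u x))\<^sup>2 \<le> c\<^sup>2 * (norm (v x))\<^sup>2" for x
      using power_mono[OF assms(4)[of x] norm_ge_zero, of 2] by (simp add: power_mult_distrib)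
  qed (use assms in \<open>simp_all add: L2_UNIV\<close>)
  also have "\<dots> = (c * norm (lsq_of v))\<^sup>2"
    by (simp add: power_mult_distrib norm_lsq_of_sq[OF assms(2)])
  finally show ?thesis using assms(3) by (auto intro: power2_le_imp_le)
qed

lemma has_derivative_norm_sq:
  fixes c :: "'a::real_inner"
  shows "((\<lambda>x. (norm (x - c))\<^sup>2) has_derivative (\<lambda>v. 2 * ((x - c) \<bullet> v))) (at x)"
  unfolding power2_norm_eq_inner
  by (auto intro!: derivative_eq_intros simp: inner_commute)

lemma grad_compose:
  assumes "(h has_real_derivative h') (at (m x))" "(m has_derivative (\<lambda>v. g \<bullet> v)) (at x)"
  shows "((\<lambda>x. h (m x)) has_derivative (\<lambda>v. (h' *\<^sub>R g) \<bullet> v)) (at x)"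
  using has_derivative_compose[OF assms(2) assms(1)[unfolded has_field_derivative_def]] by simp

lemma radial_has_derivative:
  fixes c :: "real^3"
  assumes "(h has_real_derivative h') (at ((norm (x - c))\<^sup>2))"
  shows "((\<lambda>x. h ((norm (x - c))\<^sup>2)) has_derivative (\<lambda>v. ((2 * h') *\<^sub>R (x - c)) \<bullet> v)) (at x)"
proof -
  have "((\<lambda>x. (norm (x - c))\<^sup>2) has_derivative (\<lambda>v. (2 *\<^sub>R (x - c)) \<bullet> v)) (at x)"
    using has_derivative_norm_sq[of c x] by simp
  from grad_compose[OF assms this] show ?thesis by (simp add: mult.commute)
qed

text \<open>Testing with \<open>exp (2 * \<kappa> * \<theta> * \<rho> x) *\<^sub>R V x\<close>
  produces one commutator term. As \<open>grad \<rho>\<close> has norm at most 1, this term is at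
  most the fraction \<open>\<theta>\<close> of the weighted energy, and \<open>1 - \<theta>\<close>
  of it remains. Boundedness of \<open>\<rho>\<close> keeps the test field square
  integrable.\<close>

lemma agmon_estimate:
  assumes s: "maxwell_source \<kappa> g b V cV" and \<kappa>: "\<kappa> > 0" and b: "b \<in> L2 UNIV"
    and \<theta>: "0 < \<theta>" "\<theta> < 1"
    and \<rho>: "smooth_on UNIV \<rho>" "\<And>x. \<bar>\<rho> x\<bar> \<le> M" "\<And>x. norm (grad \<rho> x) \<le> 1"
    and MB: "\<And>x. b x \<noteq> 0 \<Longrightarrow> \<rho> x \<le> MB" and N: "N \<in> sets lebesgue" "\<And>x. x \<in> N \<Longrightarrow> MN \<le> \<rho> x"
  shows "(norm (lsq_of (ext_zero N cV)))\<^sup>2 + \<kappa>\<^sup>2 * (norm (lsq_of (ext_zero N V)))\<^sup>2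
    \<le> (\<bar>g\<bar> * norm (lsq_of b) / ((1 - \<theta>) * \<kappa>) * exp (- (\<kappa> * \<theta> * (MN - MB))))\<^sup>2"
proof -
  have V: "V \<in> L2 UNIV" "cV \<in> L2 UNIV" "weak_curl UNIV V cV"
    using s by (auto simp: maxwell_source_def)
  define E where "E x = exp (\<kappa> * \<theta> * \<rho> x)" for x
  define m where "m x = exp (2 * \<kappa> * \<theta> * \<rho> x)" for x
  have mE: "m x = E x * E x" for x by (simp add: m_def E_def flip: exp_add)
  have Ep: "E x > 0" for x by (simp add: E_def)
  have kt: "\<kappa> * \<theta> \<ge> 0" using \<kappa> \<theta> by simp
  have sE: "smooth_on UNIV E" and sm: "smooth_on UNIV m"
    unfolding E_def m_def
    by (intro smooth_on_compose[OF _ smooth_on_exp] smooth_on_mult smooth_on_const \<rho>(1); simp)+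
  have Eb: "\<bar>E x\<bar> \<le> exp (\<kappa> * \<theta> * M)" for x
    using mult_left_mono[OF order_trans[OF abs_ge_self \<rho>(2)[of x]] kt] by (simp add: E_def)
  have mb: "\<bar>m x\<bar> \<le> exp (\<kappa> * \<theta> * M) * exp (\<kappa> * \<theta> * M)" for x
    unfolding mE abs_mult by (intro mult_mono Eb) auto
  have gm: "grad m x = (2 * \<kappa> * \<theta> * m x) *\<^sub>R grad \<rho> x" for x
  proof (rule gradI)
    have d: "(\<rho> has_derivative (\<lambda>v. grad \<rho> x \<bullet> v)) (at x)"
    proof -
      have "frechet_derivative \<rho> (at x) = (\<lambda>v. grad \<rho> x \<bullet> v)"
        by (rule ext) (rule fderiv_grad[OF smooth_on_differentiable[OF \<rho>(1) UNIV_I]])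
      then show ?thesis using smooth_on_has_derivative[OF \<rho>(1) UNIV_I, of x] by simp
    qed
    have "((\<lambda>r. exp (2 * \<kappa> * \<theta> * r)) has_real_derivative (2 * \<kappa> * \<theta> * m x)) (at (\<rho> x))"
      by (auto intro!: derivative_eq_intros simp: m_def)
    from grad_compose[OF this d]
    show "(m has_derivative (\<lambda>v. ((2 * \<kappa> * \<theta> * m x) *\<^sub>R grad \<rho> x) \<bullet> v)) (at x)"
      by (simp add: m_def[abs_def])
  qed
  define M' where "M' = 2 * \<kappa> * \<theta> * (exp (\<kappa> * \<theta> * M) * exp (\<kappa> * \<theta> * M))"
  have gmb: "norm (grad m x) \<le> M'" for x
  proof -
    have "norm (grad m x) = 2 * \<kappa> * \<theta> * \<bar>m x\<bar> * norm (grad \<rho> x)"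
      using \<kappa> \<theta> by (simp add: gm abs_mult)
    also have "\<dots> \<le> 2 * \<kappa> * \<theta> * (exp (\<kappa> * \<theta> * M) * exp (\<kappa> * \<theta> * M)) * 1"
      using \<kappa> \<theta> by (intro mult_mono mult_left_mono mb \<rho>(3)) auto
    finally show ?thesis by (simp add: M'_def)
  qed
  note WC = weak_curl_mult[OF V sm mb gmb]
  let ?\<Psi> = "\<lambda>x. m x *\<^sub>R V x" and ?K = "\<lambda>x. m x *\<^sub>R cV x + cross3 (grad m x) (V x)"
  have Em: "E \<in> borel_measurable lebesgue"
    by (rule continuous_measurable_lebesgue[OF smooth_on_continuous[OF sE]])
  define U where "U x = E x *\<^sub>R V x" for x
  define A where "A x = E x *\<^sub>R cV x" for x
  have U: "U \<in> L2 UNIV" and A: "A \<in> L2 UNIV"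
    unfolding U_def[abs_def] A_def[abs_def] by (rule L2_mult[OF _ Em Eb], rule V)+
  have "(1 - \<theta>) * ((norm (lsq_of A))\<^sup>2 + \<kappa>\<^sup>2 * (norm (lsq_of U))\<^sup>2)
      = (\<integral>x. (1 - \<theta>) * ((norm (A x))\<^sup>2 + \<kappa>\<^sup>2 * (norm (U x))\<^sup>2) \<partial>lebesgue)"
    using U A by (simp add: norm_lsq_of_sq L2_UNIV)
  also have "\<dots> \<le> (\<integral>x. cV x \<bullet> ?K x + \<kappa>\<^sup>2 * (V x \<bullet> ?\<Psi> x) \<partial>lebesgue)"
  proof (rule integral_mono)
    show "integrable lebesgue (\<lambda>x. (1 - \<theta>) * ((norm (A x))\<^sup>2 + \<kappa>\<^sup>2 * (norm (U x))\<^sup>2))"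
      using U A by (simp add: L2_UNIV)
    show "integrable lebesgue (\<lambda>x. cV x \<bullet> ?K x + \<kappa>\<^sup>2 * (V x \<bullet> ?\<Psi> x))"
      by (intro Bochner_Integration.integrable_add integrable_mult_right L2_inner_integrable V WC)
    fix x
    define \<alpha> where "\<alpha> = norm (A x)"
    define \<beta> where "\<beta> = \<kappa> * norm (U x)"
    \<comment> \<open>The weight is split evenly between the two factors, so the commutator is a
      product of \<open>A x\<close> and \<open>U x\<close> and the arithmetic-geometric mean
      inequality applies.\<close>
    have e1: "cV x \<bullet> ?K x + \<kappa>\<^sup>2 * (V x \<bullet> ?\<Psi> x)
        = \<alpha>\<^sup>2 + 2 * \<kappa> * \<theta> * (A x \<bullet> cross3 (grad \<rho> x) (U x)) + \<beta>\<^sup>2"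
      unfolding \<alpha>_def \<beta>_def power_mult_distrib power2_norm_eq_inner
      by (simp add: A_def U_def gm mE inner_add_right cross_mult_left cross_mult_right power2_eq_square algebra_simps)
    have "\<bar>A x \<bullet> cross3 (grad \<rho> x) (U x)\<bar> \<le> norm (A x) * (1 * norm (U x))"
      by (intro order_trans[OF Cauchy_Schwarz_ineq2] mult_left_mono order_trans[OF norm_cross3_le]
          mult_right_mono \<rho>(3)) auto
    then have "2 * \<kappa> * \<theta> * \<bar>A x \<bullet> cross3 (grad \<rho> x) (U x)\<bar> \<le> 2 * \<kappa> * \<theta> * (norm (A x) * norm (U x))"
      using kt by (intro mult_left_mono) auto
    also have "\<dots> = \<theta> * (2 * \<alpha> * \<beta>)" by (simp add: \<alpha>_def \<beta>_def)
    also have "\<dots> \<le> \<theta> * (\<alpha>\<^sup>2 + \<beta>\<^sup>2)" using \<theta> by (intro mult_left_mono sum_squares_bound) auto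
    finally have f: "2 * \<kappa> * \<theta> * \<bar>A x \<bullet> cross3 (grad \<rho> x) (U x)\<bar> \<le> \<theta> * (\<alpha>\<^sup>2 + \<beta>\<^sup>2)" .
    have "\<bar>2 * \<kappa> * \<theta> * (A x \<bullet> cross3 (grad \<rho> x) (U x))\<bar> = 2 * \<kappa> * \<theta> * \<bar>A x \<bullet> cross3 (grad \<rho> x) (U x)\<bar>"
      using \<kappa> \<theta> by (simp add: abs_mult)
    with f have "- (\<theta> * (\<alpha>\<^sup>2 + \<beta>\<^sup>2)) \<le> 2 * \<kappa> * \<theta> * (A x \<bullet> cross3 (grad \<rho> x) (U x))"
      by linarith
    then show "(1 - \<theta>) * ((norm (A x))\<^sup>2 + \<kappa>\<^sup>2 * (norm (U x))\<^sup>2) \<le> cV x \<bullet> ?K x + \<kappa>\<^sup>2 * (V x \<bullet> ?\<Psi> x)"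
      unfolding e1 by (simp add: \<alpha>_def[symmetric] \<beta>_def[symmetric] power_mult_distrib[symmetric] algebra_simps)
  qed
  also have "\<dots> = lsq_of cV \<bullet> lsq_of ?K + \<kappa>\<^sup>2 * (lsq_of V \<bullet> lsq_of ?\<Psi>)"
    unfolding inner_lsq_of[OF V(2) WC(2)] inner_lsq_of[OF V(1) WC(1)]
    by (simp only: Bochner_Integration.integral_add integrable_mult_right L2_inner_integrable V WC integral_mult_right_zero)
  also have "\<dots> = g * (lsq_of b \<bullet> lsq_of ?\<Psi>)"
    using s WC by (simp add: maxwell_source_def)
  also have "lsq_of b \<bullet> lsq_of ?\<Psi> = lsq_of (\<lambda>x. E x *\<^sub>R b x) \<bullet> lsq_of U"
    using b U WC(1) L2_mult[OF b Em Eb] by (simp add: inner_lsq_of U_def mE mult_ac)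
  also have "g * \<dots> \<le> \<bar>g\<bar> * \<bar>lsq_of (\<lambda>x. E x *\<^sub>R b x) \<bullet> lsq_of U\<bar>" by (simp flip: abs_mult)
  also have "\<dots> \<le> \<bar>g\<bar> * (norm (lsq_of (\<lambda>x. E x *\<^sub>R b x)) * norm (lsq_of U))"
    by (intro mult_left_mono Cauchy_Schwarz_ineq2) auto
  also have "\<dots> \<le> \<bar>g\<bar> * ((exp (\<kappa> * \<theta> * MB) * norm (lsq_of b)) * norm (lsq_of U))"
  proof (intro mult_left_mono mult_right_mono norm_lsq_mono L2_mult[OF b Em Eb] b)
    show "norm (E x *\<^sub>R b x) \<le> exp (\<kappa> * \<theta> * MB) * norm (b x)" for x
    proof (cases "b x = 0")
      case False
      then show ?thesis using mult_left_mono[OF MB[OF False] kt] Ep[of x]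
        by (simp add: E_def)
    qed simp
  qed auto
  finally have "(1 - \<theta>) * ((norm (lsq_of A))\<^sup>2 + \<kappa>\<^sup>2 * (norm (lsq_of U))\<^sup>2)
      \<le> (\<bar>g\<bar> * (exp (\<kappa> * \<theta> * MB) * norm (lsq_of b))) * norm (lsq_of U)" by (simp add: mult.assoc)
  from energy_absorb[OF \<kappa> _ _ _ _ this]
  have main: "(norm (lsq_of A))\<^sup>2 + \<kappa>\<^sup>2 * (norm (lsq_of U))\<^sup>2
      \<le> (\<bar>g\<bar> * (exp (\<kappa> * \<theta> * MB) * norm (lsq_of b)) / ((1 - \<theta>) * \<kappa>))\<^sup>2"
    using \<theta> by simp
  \<comment> \<open>On \<open>N\<close> the weight \<open>E\<close> is at least
    \<open>1 / q\<close>.\<close>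
  define q where "q = exp (- (\<kappa> * \<theta> * MN))"
  have nb: "norm (ext_zero N u x) \<le> q * norm (E x *\<^sub>R u x)" for u :: "real^3 \<Rightarrow> real^3" and x
  proof (cases "x \<in> N")
    case True
    have "1 = q * exp (\<kappa> * \<theta> * MN)" by (simp add: q_def flip: exp_add)
    also have "\<dots> \<le> q * E x"
      using mult_left_mono[OF N(2)[OF True] kt] by (intro mult_left_mono) (simp_all add: E_def q_def)
    finally have "1 * norm (u x) \<le> (q * E x) * norm (u x)" by (intro mult_right_mono) auto
    then show ?thesis using True Ep[of x] by (simp add: ext_zero_def mult.assoc)
  qed (simp add: ext_zero_def q_def)
  have q: "q \<ge> 0" by (simp add: q_def)
  have n1: "norm (lsq_of (ext_zero N cV)) \<le> q * norm (lsq_of A)"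
    using norm_lsq_mono[OF L2_restrict(2)[OF N(1) V(2)] A q] nb by (simp add: A_def)
  have n2: "norm (lsq_of (ext_zero N V)) \<le> q * norm (lsq_of U)"
    using norm_lsq_mono[OF L2_restrict(2)[OF N(1) V(1)] U q] nb by (simp add: U_def)
  have "(norm (lsq_of (ext_zero N cV)))\<^sup>2 + \<kappa>\<^sup>2 * (norm (lsq_of (ext_zero N V)))\<^sup>2
      \<le> (q * norm (lsq_of A))\<^sup>2 + \<kappa>\<^sup>2 * (q * norm (lsq_of U))\<^sup>2"
    by (intro add_mono mult_left_mono power_mono n1 n2) auto
  also have "\<dots> = q\<^sup>2 * ((norm (lsq_of A))\<^sup>2 + \<kappa>\<^sup>2 * (norm (lsq_of U))\<^sup>2)"
    by (simp add: power_mult_distrib algebra_simps)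
  also have "\<dots> \<le> q\<^sup>2 * (\<bar>g\<bar> * (exp (\<kappa> * \<theta> * MB) * norm (lsq_of b)) / ((1 - \<theta>) * \<kappa>))\<^sup>2"
    by (intro mult_left_mono main) auto
  also have "\<dots> = (\<bar>g\<bar> * norm (lsq_of b) / ((1 - \<theta>) * \<kappa>) * (q * exp (\<kappa> * \<theta> * MB)))\<^sup>2"
    by (simp add: power_mult_distrib power_divide)
  also have "q * exp (\<kappa> * \<theta> * MB) = exp (- (\<kappa> * \<theta> * (MN - MB)))"
    by (simp add: q_def algebra_simps flip: exp_add)
  finally show ?thesis .
qed

text \<open>\<open>s\<close> smooths the distance at \<open>p\<close> and \<open>\<delta>\<close>
  makes it bounded; both modifications keep the gradient at most 1. The price is at most
  \<open>s\<close> as an upper bound near the source and \<open>\<delta> * r\<^sup>2\<close> as a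
  lower bound at radius \<open>r\<close>.\<close>

lemma radial_weight:
  fixes p :: "real^3"
  assumes s: "s > 0" and \<delta>: "\<delta> > 0"
  defines "\<rho> \<equiv> \<lambda>x. sqrt (s\<^sup>2 + (norm (x - p))\<^sup>2) / (1 + \<delta> * sqrt (s\<^sup>2 + (norm (x - p))\<^sup>2))"
  shows "smooth_on UNIV \<rho>" "\<And>x. \<bar>\<rho> x\<bar> \<le> 1 / \<delta>" "\<And>x. norm (grad \<rho> x) \<le> 1"
    "\<And>x. \<rho> x \<le> s + norm (x - p)"
    "\<And>x r. r \<ge> 0 \<Longrightarrow> norm (x - p) \<ge> r \<Longrightarrow> r - \<delta> * r\<^sup>2 \<le> \<rho> x"
proof -
  define t where "t x = sqrt (s\<^sup>2 + (norm (x - p))\<^sup>2)" for x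
  have q: "s\<^sup>2 + (norm (x - p))\<^sup>2 > 0" for x using s by (simp add: add_pos_nonneg)
  have t: "t x > 0" for x using q by (simp add: t_def)
  have \<rho>: "\<rho> = (\<lambda>x. t x / (1 + \<delta> * t x))" by (simp add: \<rho>_def t_def)
  have den: "1 + \<delta> * t x > 0" for x using t[of x] \<delta> by (simp add: add_pos_pos)
  have st: "smooth_on UNIV t"
    unfolding t_def using q
    by (intro smooth_on_compose[OF _ smooth_on_sqrt] smooth_on_add smooth_on_const smooth_on_norm_sq) auto
  show "smooth_on UNIV \<rho>"
    unfolding \<rho> using den
    by (intro smooth_on_divide smooth_on_add smooth_on_mult smooth_on_const st) (auto simp: less_le)
  show "\<bar>\<rho> x\<bar> \<le> 1 / \<delta>" for x
  proof -
    have "\<bar>\<rho> x\<bar> = t x / (1 + \<delta> * t x)" using t[of x] den[of x] by (simp add: \<rho>)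
    also have "\<dots> \<le> 1 / \<delta>" using den[of x] \<delta> by (simp add: divide_simps)
    finally show ?thesis .
  qed
  have pt: "norm (x - p) \<le> t x" for x
    unfolding t_def by (rule real_le_rsqrt) simp
  have tp: "t x \<le> s + norm (x - p)" for x
    unfolding t_def by (rule real_le_lsqrt) (use s in \<open>auto simp: power2_sum\<close>)
  show "norm (grad \<rho> x) \<le> 1" for x
  proof -
    define h where "h y = sqrt (s\<^sup>2 + y) / (1 + \<delta> * sqrt (s\<^sup>2 + y))" for y
    define d where "d = (1 / (2 * t x)) / (1 + \<delta> * t x)\<^sup>2"
    have "((\<lambda>y. sqrt (s\<^sup>2 + y)) has_real_derivative 1 / (2 * t x)) (at ((norm (x - p))\<^sup>2))"
    proof -
      have "((\<lambda>y. s\<^sup>2 + y) has_real_derivative 0 + 1) (at ((norm (x - p))\<^sup>2))"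
        by (intro DERIV_add DERIV_const DERIV_ident)
      from DERIV_chain2[OF DERIV_real_sqrt[OF q[of x]] this] show ?thesis
        by (rule DERIV_cong) (simp add: t_def inverse_eq_divide)
    qed
    note sq = this
    have "(h has_real_derivative d) (at ((norm (x - p))\<^sup>2))"
    proof -
      have "((\<lambda>y. 1 + \<delta> * sqrt (s\<^sup>2 + y)) has_real_derivative (0 + \<delta> * (1 / (2 * t x)))) (at ((norm (x - p))\<^sup>2))"
        by (intro DERIV_add DERIV_const DERIV_cmult sq)
      from DERIV_divide[OF sq this]
      have "(h has_real_derivative (1 / (2 * t x) * (1 + \<delta> * t x) - t x * (0 + \<delta> * (1 / (2 * t x))))
          / ((1 + \<delta> * t x) * (1 + \<delta> * t x))) (at ((norm (x - p))\<^sup>2))"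
        using den[of x] by (simp add: h_def[abs_def] t_def)
      moreover have "(1 / (2 * t x) * (1 + \<delta> * t x) - t x * (0 + \<delta> * (1 / (2 * t x)))) / ((1 + \<delta> * t x) * (1 + \<delta> * t x)) = d"
        using t[of x] by (simp add: d_def power2_eq_square field_simps)
      ultimately show ?thesis by simp
    qed
    from gradI[OF radial_has_derivative[OF this]]
    have g: "grad \<rho> x = (2 * d) *\<^sub>R (x - p)" by (simp add: \<rho>_def h_def)
    have "2 * d * norm (x - p) \<le> 2 * d * t x"
      using pt[of x] t[of x] by (intro mult_left_mono) (auto simp: d_def)
    also have "\<dots> = 1 / (1 + \<delta> * t x)\<^sup>2" using t[of x] by (simp add: d_def)
    also have "\<dots> \<le> 1"
    proof -
      have "1 \<le> (1 + \<delta> * t x)\<^sup>2" using t[of x] \<delta> by (intro one_le_power) simp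
      then show ?thesis by (simp add: divide_le_eq)
    qed
    finally show ?thesis using t[of x] by (simp add: g d_def)
  qed
  show "\<rho> x \<le> s + norm (x - p)" for x
  proof -
    have "\<rho> x \<le> t x" using t[of x] den[of x] \<delta> by (simp add: \<rho> divide_le_eq algebra_simps)
    then show ?thesis using tp by (rule order_trans)
  qed
  show "r - \<delta> * r\<^sup>2 \<le> \<rho> x" if r: "r \<ge> 0" "norm (x - p) \<ge> r" for x r
  proof -
    have rt: "r \<le> t x" using r(2) pt[of x] by simp
    have dr: "1 + \<delta> * r > 0" using r \<delta> by (simp add: add_pos_nonneg)
    \<comment> \<open>Clearing the denominator of the lower bound leaves a cubic remainder of the
      favourable sign.\<close>
    have "(r - \<delta> * r\<^sup>2) * (1 + \<delta> * r) = r - \<delta>\<^sup>2 * r ^ 3"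
      by (simp add: algebra_simps power2_eq_square power3_eq_cube)
    also have "\<dots> \<le> r" using r by simp
    finally have "r - \<delta> * r\<^sup>2 \<le> r / (1 + \<delta> * r)" using dr by (simp add: pos_le_divide_eq)
    also have "\<dots> \<le> t x / (1 + \<delta> * t x)"
      using dr den[of x] rt by (simp add: divide_simps algebra_simps)
    finally show ?thesis by (simp add: \<rho>)
  qed
qed

lemma maxwell_source_decay:
  fixes p :: "real^3"
  assumes b: "b \<in> L2 UNIV" "\<And>x. b x \<noteq> 0 \<Longrightarrow> norm (x - p) \<le> \<eta>"
    and \<theta>: "0 < \<theta>" "\<theta> < 1" and s: "s > 0" and r: "r \<ge> 0"
    and src: "maxwell_source \<kappa> g b V cV" and \<kappa>: "\<kappa> > 0"
  defines "N \<equiv> {x. r \<le> norm (x - p)}"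
  shows "(norm (lsq_of (ext_zero N cV)))\<^sup>2 + \<kappa>\<^sup>2 * (norm (lsq_of (ext_zero N V)))\<^sup>2
    \<le> (\<bar>g\<bar> * norm (lsq_of b) / ((1 - \<theta>) * \<kappa>) * exp (- (\<kappa> * \<theta> * (r - \<eta> - 2 * s))))\<^sup>2"
proof -
  \<comment> \<open>Makes \<open>\<delta> * r\<^sup>2\<close> at most \<open>s\<close>. Together
    with the smoothing at the source this is the loss \<open>2 * s\<close> in the exponent.\<close>
  define \<delta> where "\<delta> = s / (r\<^sup>2 + 1)"
  have p1: "r\<^sup>2 + 1 > 0" by (simp add: add_nonneg_pos)
  have \<delta>: "\<delta> > 0" using s p1 by (simp add: \<delta>_def)
  have dr: "\<delta> * r\<^sup>2 \<le> s"
    using s p1 by (simp add: \<delta>_def pos_divide_le_eq algebra_simps)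
  note w = radial_weight[OF s \<delta>, where p=p]
  have "closed N" unfolding N_def by (intro closed_Collect_le continuous_intros)
  then have N: "N \<in> sets lebesgue" by simp
  let ?\<rho> = "\<lambda>x. sqrt (s\<^sup>2 + (norm (x - p))\<^sup>2) / (1 + \<delta> * sqrt (s\<^sup>2 + (norm (x - p))\<^sup>2))"
  have "(norm (lsq_of (ext_zero N cV)))\<^sup>2 + \<kappa>\<^sup>2 * (norm (lsq_of (ext_zero N V)))\<^sup>2
    \<le> (\<bar>g\<bar> * norm (lsq_of b) / ((1 - \<theta>) * \<kappa>) * exp (- (\<kappa> * \<theta> * ((r - s) - (s + \<eta>)))))\<^sup>2"
  proof (rule agmon_estimate[OF src \<kappa> b(1) \<theta> w(1-3) _ N])
    show "?\<rho> x \<le> s + \<eta>" if "b x \<noteq> 0" for x using w(4)[of x] b(2)[OF that] by linarith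
    show "r - s \<le> ?\<rho> x" if "x \<in> N" for x
      using w(5)[OF r, of x] that dr by (simp add: N_def)
  qed
  then show ?thesis by (simp add: algebra_simps)
qed

section \<open>The lower bound for the free-space field\<close>

lemma linear_exp_small:
  fixes A \<delta> e :: real
  assumes "A \<ge> 0" "\<delta> > 0" "e > 0"
  obtains k0 where "k0 \<ge> 1" "\<And>k. k \<ge> k0 \<Longrightarrow> (k * A + 1) * exp (- (k * \<delta>)) \<le> e"
proof -
  \<comment> \<open>From here on the quadratic term of the exponential series beats the linear
    factor.\<close>
  define k0 where "k0 = max 1 (2 * (A + 1) / (e * \<delta>\<^sup>2))"
  have k01: "k0 \<ge> 1" by (simp add: k0_def)
  have "(k * A + 1) * exp (- (k * \<delta>)) \<le> e" if k: "k \<ge> k0" for k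
  proof -
  have k1: "k \<ge> 1" using k by (simp add: k0_def)
  have "2 * (A + 1) / (e * \<delta>\<^sup>2) \<le> k" using k by (simp add: k0_def)
  then have ek: "2 * (A + 1) \<le> k * (e * \<delta>\<^sup>2)" using assms by (simp add: pos_divide_le_eq)
  have "(k * \<delta>)\<^sup>2 / 2 \<le> 1 + k * \<delta> + (k * \<delta>)\<^sup>2 / 2" using k1 assms by simp
  also have "\<dots> \<le> exp (k * \<delta>)" using k1 assms by (intro exp_lower_Taylor_quadratic) simp
  finally have ex: "(k * \<delta>)\<^sup>2 / 2 \<le> exp (k * \<delta>)" .
  have "k * A + 1 \<le> k * (A + 1)" using k1 by (simp add: algebra_simps)
  also have "\<dots> \<le> k * (k * (e * \<delta>\<^sup>2) / 2)" using ek k1 by (intro mult_left_mono) auto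
  also have "\<dots> = e * ((k * \<delta>)\<^sup>2 / 2)" by (simp add: power2_eq_square)
  also have "\<dots> \<le> e * exp (k * \<delta>)" using ex assms by (intro mult_left_mono) auto
  finally show ?thesis by (simp add: exp_minus field_simps)
  qed
  with k01 show ?thesis by (rule that)
qed

text \<open>Crude Laplace asymptotics: the exponential weight concentrates at the point of the ball closest
  to the pole, where the linear factor is positive because it is positive at the centre.\<close>
lemma laplace_ball_lower:
  fixes x0 p c :: "'a::euclidean_space"
  assumes \<eta>: "\<eta> > 0" and far: "norm (p - x0) > \<eta>" and c: "(p - x0) \<bullet> c > 0" and e: "e > 0"
  shows "\<exists>c0>0. \<exists>k0\<ge>1. \<forall>k F. k \<ge> k0 \<longrightarrow> integrable lebesgue F \<longrightarrow> (\<forall>x. x \<notin> ball p \<eta> \<longrightarrow> F x = 0) \<longrightarrow>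
      (\<forall>x\<in>ball p \<eta>. F x = (k * norm (x - x0) + 1) * exp (- (k * norm (x - x0))) / norm (x - x0) ^ 3 * ((x - x0) \<bullet> c)) \<longrightarrow>
      c0 * exp (- (k * (norm (p - x0) - \<eta> + e))) \<le> (\<integral>x. F x \<partial>lebesgue)"
proof -
  define d where "d = norm (p - x0)"
  define rs where "rs = d - \<eta>"
  define r where "r x = norm (x - x0)" for x
  define q where "q x = (x - x0) \<bullet> c" for x
  have dp: "d > 0" "rs > 0" "d = rs + \<eta>" using far \<eta> by (auto simp: d_def rs_def)
  have rge: "rs \<le> r x" if "x \<in> cball p \<eta>" for x
    using that norm_triangle_ineq[of "p - x" "x - x0"] by (simp add: rs_def d_def r_def dist_norm)
  have rle: "r x \<le> d + \<eta>" if "x \<in> cball p \<eta>" for x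
    using that norm_triangle_ineq[of "x - p" "p - x0"] by (simp add: d_def r_def dist_norm norm_minus_commute)
  \<comment> \<open>Equality in the triangle inequality would put \<open>x\<close> on the segment
    from \<open>x0\<close> to \<open>p\<close>, where the linear factor is positive. By compactness
    the part of the ball with nonpositive factor is therefore farther from the pole by a fixed gap
    \<open>\<delta>\<close>.\<close>
  have strict: "rs < r x" if x: "x \<in> cball p \<eta>" "q x \<le> 0" for x
  proof (rule ccontr)
    assume "\<not> rs < r x"
    then have re: "r x = rs" using rge[OF x(1)] by simp
    have px: "norm (p - x) \<le> \<eta>" using x(1) by (simp add: dist_norm)
    have "d \<le> norm (p - x) + norm (x - x0)"
      using norm_triangle_ineq[of "p - x" "x - x0"] by (simp add: d_def)
    then have pe: "norm (p - x) = \<eta>" using px re dp by (simp add: r_def)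
    have "norm ((p - x) + (x - x0)) = norm (p - x) + norm (x - x0)"
      using pe re dp by (simp add: r_def d_def)
    then have "norm (p - x) *\<^sub>R (x - x0) = norm (x - x0) *\<^sub>R (p - x)" by (simp only: norm_triangle_eq)
    then have "\<eta> *\<^sub>R (x - x0) = rs *\<^sub>R (p - x)" using pe re by (simp add: r_def)
    then have "(\<eta> *\<^sub>R (x - x0)) \<bullet> c = (rs *\<^sub>R (p - x)) \<bullet> c" by simp
    moreover have "(p - x) \<bullet> c = (p - x0) \<bullet> c - q x" by (simp add: q_def inner_diff_left)
    ultimately have "\<eta> * q x + rs * q x = rs * ((p - x0) \<bullet> c)" by (simp add: q_def algebra_simps)
    moreover have "\<eta> * q x \<le> 0" "rs * q x \<le> 0" using x(2) \<eta> dp by (auto simp: mult_nonneg_nonpos)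
    ultimately show False using mult_pos_pos[OF dp(2) c] by linarith
  qed
  have "\<exists>\<delta>>0. \<forall>x\<in>cball p \<eta>. q x \<le> 0 \<longrightarrow> rs + \<delta> \<le> r x"
  proof -
    let ?K = "cball p \<eta> \<inter> {x. q x \<le> 0}"
    have cl: "closed {x. q x \<le> 0}" unfolding q_def by (intro closed_Collect_le continuous_intros)
    have K: "compact ?K" by (intro compact_Int_closed compact_cball cl)
    show ?thesis
    proof (cases "?K = {}")
      case False
      have "continuous_on ?K r" unfolding r_def by (intro continuous_intros)
      from continuous_attains_inf[OF K False this] obtain z where z: "z \<in> ?K" "\<forall>x\<in>?K. r z \<le> r x" by blast
      then have "rs < r z" using strict by auto
      then show ?thesis using z(2) by (intro exI[of _ "r z - rs"]) auto
    qed (intro exI[of _ 1], auto)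
  qed
  then obtain \<delta> where \<delta>: "\<delta> > 0" "\<And>x. x \<in> cball p \<eta> \<Longrightarrow> q x \<le> 0 \<Longrightarrow> rs + \<delta> \<le> r x" by blast
  \<comment> \<open>\<open>\<delta> / 4\<close> leaves half of the gap between the main part and the
    negative part, \<open>e / 2\<close> respects the allowed loss, and \<open>\<eta> / 2\<close>
    keeps the point \<open>z\<close> on the axis inside the ball.\<close>
  define t where "t = min (\<delta> / 4) (min (e / 2) (\<eta> / 2))"
  have t: "t > 0" "t \<le> \<delta> / 4" "t \<le> e / 2" "t < \<eta>" using \<delta> e \<eta> by (auto simp: t_def)
  define z where "z = x0 + ((rs + t) / d) *\<^sub>R (p - x0)"
  have rz: "r z = rs + t" using dp t by (simp add: r_def z_def d_def)
  have zp: "norm (z - p) = \<eta> - t"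
  proof -
    have "z - p = ((rs + t) / d - 1) *\<^sub>R (p - x0)" by (simp add: z_def algebra_simps)
    then have "norm (z - p) = \<bar>(rs + t) / d - 1\<bar> * d" by (simp add: d_def)
    also have "(rs + t) / d - 1 = - ((\<eta> - t) / d)" using dp by (simp add: field_simps)
    finally show ?thesis using dp t by simp
  qed
  have qz: "q z > 0" using dp t c by (simp add: q_def z_def)
  \<comment> \<open>Small enough for the linear factor to keep half of its value at
    \<open>z\<close>.\<close>
  define \<sigma> where "\<sigma> = min t (q z / (2 * (norm c + 1)))"
  have nc: "norm c + 1 > 0" by (simp add: add_nonneg_pos)
  have \<sigma>: "\<sigma> > 0" using t qz nc by (simp add: \<sigma>_def)
  have near: "x \<in> ball p \<eta> \<and> r x < rs + 2 * t \<and> q z / 2 \<le> q x" if x: "x \<in> ball z \<sigma>" for x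
  proof (intro conjI)
    have xz: "norm (x - z) < \<sigma>" using x by (simp add: dist_norm norm_minus_commute)
    then have xt: "norm (x - z) < t" by (simp add: \<sigma>_def)
    show "x \<in> ball p \<eta>"
      using norm_triangle_ineq[of "x - z" "z - p"] zp xt by (simp add: dist_norm norm_minus_commute)
    show "r x < rs + 2 * t"
      using norm_triangle_ineq[of "x - z" "z - x0"] rz xt by (simp add: r_def)
    have "norm (x - z) * norm c \<le> q z / (2 * (norm c + 1)) * (norm c + 1)"
      using xz qz nc by (intro mult_mono) (auto simp: \<sigma>_def)
    also have "\<dots> = q z / 2"
    proof -
      have "\<alpha> / (2 * \<beta>) * \<beta> = \<alpha> / 2" if "\<beta> > 0" for \<alpha> \<beta> :: real using that by simp
      from this[OF nc] show ?thesis .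
    qed
    finally have "\<bar>(x - z) \<bullet> c\<bar> \<le> q z / 2" using Cauchy_Schwarz_ineq2[of "x - z" c] by simp
    moreover have "q x = q z + (x - z) \<bullet> c" by (simp add: q_def inner_diff_left)
    ultimately show "q z / 2 \<le> q x" by linarith
  qed
  define v1 where "v1 = measure lebesgue (ball z \<sigma>)"
  define v2 where "v2 = measure lebesgue (ball p \<eta>)"
  have v1: "v1 > 0" using \<sigma> by (simp add: v1_def content_ball_pos)
  have v2: "v2 > 0" using \<eta> by (simp add: v2_def content_ball_pos)
  define m1 where "m1 = q z / 2 / (d + \<eta>) ^ 3"
  have m1: "m1 > 0" using qz dp \<eta> by (simp add: m1_def)
  define Q where "Q = (d + \<eta>) * norm c"
  have Q: "Q \<ge> 0" using dp \<eta> by (simp add: Q_def)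
  define m2 where "m2 = Q / rs ^ 3"
  have m2: "m2 \<ge> 0" using Q dp by (simp add: m2_def)
  \<comment> \<open>Beyond \<open>k0\<close> the negative contribution is at most half of the
    positive one; \<open>m2 + 1\<close> keeps the denominator positive when \<open>m2\<close> is
    0.\<close>
  obtain k0 where k0: "k0 \<ge> 1" "\<And>k. k \<ge> k0 \<Longrightarrow> (k * (d + \<eta>) + 1) * exp (- (k * (\<delta> / 2))) \<le> v1 * m1 / (2 * (v2 * (m2 + 1)))"
    using linear_exp_small[of "d + \<eta>" "\<delta> / 2" "v1 * m1 / (2 * (v2 * (m2 + 1)))"] dp \<eta> \<delta> v1 v2 m1 m2
    by (auto simp: add_nonneg_pos)
  show ?thesis
  proof (rule exI[of _ "v1 * m1 / 2"], rule conjI[rotated], rule exI[of _ k0], intro conjI allI impI)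
    show "v1 * m1 / 2 > 0" using v1 m1 by simp
    show "k0 \<ge> 1" by (rule k0)
    fix k and F :: "'a \<Rightarrow> real"
    assume k: "k \<ge> k0" and Fi: "integrable lebesgue F" and F0: "\<forall>x. x \<notin> ball p \<eta> \<longrightarrow> F x = 0"
      and F: "\<forall>x\<in>ball p \<eta>. F x = (k * norm (x - x0) + 1) * exp (- (k * norm (x - x0))) / norm (x - x0) ^ 3 * ((x - x0) \<bullet> c)"
    have kp: "k > 0" using k k0 by simp
    define E1 where "E1 = m1 * exp (- (k * (rs + 2 * t)))"
    define E2 where "E2 = (k * (d + \<eta>) + 1) * exp (- (k * (rs + \<delta>))) * m2"
    have E1: "E1 \<ge> 0" using m1 by (simp add: E1_def)
    have E2: "E2 \<ge> 0" using m2 kp dp \<eta> by (simp add: E2_def)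
    have Fq: "F x = (k * r x + 1) * exp (- (k * r x)) / r x ^ 3 * q x" if "x \<in> ball p \<eta>" for x
      using F that by (simp add: r_def q_def)
    have low: "indicator (ball z \<sigma>) x * E1 - indicator (ball p \<eta>) x * E2 \<le> F x" for x
    proof (cases "x \<in> ball p \<eta>")
      case False
      then have "x \<notin> ball z \<sigma>" using near by blast
      then show ?thesis using False F0 by simp
    next
      case True
      then have xc: "x \<in> cball p \<eta>" by auto
      have rx: "r x > 0" using rge[OF xc] dp by simp
      show ?thesis
      proof (cases "x \<in> ball z \<sigma>")
        case xs: True
        note n = near[OF xs]
        have "E1 = 1 * exp (- (k * (rs + 2 * t))) / (d + \<eta>) ^ 3 * (q z / 2)" by (simp add: E1_def m1_def mult_ac)
        also have "\<dots> \<le> (k * r x + 1) * exp (- (k * r x)) / r x ^ 3 * q x"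
          using n kp rx rle[OF xc] qz dp \<eta>
          by (intro mult_mono frac_le power_mono mult_left_mono) auto
        also have "\<dots> = F x" using Fq[OF True] by simp
        finally show ?thesis using xs True E2 by simp
      next
        case xs: False
        show ?thesis
        proof (cases "q x \<le> 0")
          case False
          then have "0 \<le> F x" using Fq[OF True] kp rx by simp
          then show ?thesis using xs True E2 by simp
        next
          case qx: True
          note rd = \<delta>(2)[OF xc qx]
          have qQ: "- q x \<le> Q"
          proof -
            have "- q x \<le> norm (x - x0) * norm c"
              using Cauchy_Schwarz_ineq2[of "x - x0" c] by (simp add: q_def)
            also have "\<dots> \<le> Q" unfolding Q_def using rle[OF xc] by (intro mult_right_mono) (auto simp: r_def)
            finally show ?thesis .
          qed
          have "(k * r x + 1) * exp (- (k * r x)) / r x ^ 3 * (- q x)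
              \<le> (k * (d + \<eta>) + 1) * exp (- (k * (rs + \<delta>))) / rs ^ 3 * Q"
            using qQ qx kp rx rd rle[OF xc] rge[OF xc] dp \<eta>
            by (intro mult_mono frac_le power_mono add_mono mult_left_mono) auto
          also have "\<dots> = E2" by (simp add: E2_def m2_def)
          finally show ?thesis using xs True Fq[OF True] by simp
        qed
      qed
    qed
    have i1: "integrable lebesgue (\<lambda>x. indicator (ball z \<sigma>) x * E1)" and i2: "integrable lebesgue (\<lambda>x. indicator (ball p \<eta>) x * E2)"
      using lmeasurable_ball[of z \<sigma>] lmeasurable_ball[of p \<eta>]
      by (auto simp: lmeasurable_iff_integrable intro!: integrable_mult_left)
    have "v1 * E1 - v2 * E2 = (\<integral>x. indicator (ball z \<sigma>) x * E1 - indicator (ball p \<eta>) x * E2 \<partial>lebesgue)"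
      using i1 i2 by (simp add: v1_def v2_def)
    also have "\<dots> \<le> (\<integral>x. F x \<partial>lebesgue)"
      by (intro integral_mono Bochner_Integration.integrable_diff i1 i2 Fi low)
    finally have L: "v1 * E1 - v2 * E2 \<le> (\<integral>x. F x \<partial>lebesgue)" .
    have "v2 * E2 \<le> v1 * E1 / 2"
    proof -
      have sp: "exp (- (k * (rs + \<delta>))) \<le> exp (- (k * (\<delta> / 2))) * exp (- (k * (rs + 2 * t)))"
      proof -
        have "k * (\<delta> / 2 + (rs + 2 * t)) \<le> k * (rs + \<delta>)" using kp t by (intro mult_left_mono) auto
        then show ?thesis by (simp add: algebra_simps flip: exp_add)
      qed
      have "E2 \<le> (k * (d + \<eta>) + 1) * (exp (- (k * (\<delta> / 2))) * exp (- (k * (rs + 2 * t)))) * m2"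
        unfolding E2_def using sp kp dp \<eta> m2 by (intro mult_right_mono mult_left_mono) auto
      also have "\<dots> = ((k * (d + \<eta>) + 1) * exp (- (k * (\<delta> / 2)))) * (exp (- (k * (rs + 2 * t))) * m2)" by simp
      also have "\<dots> \<le> v1 * m1 / (2 * (v2 * (m2 + 1))) * (exp (- (k * (rs + 2 * t))) * (m2 + 1))"
        using k0(2)[OF k] m2 v1 v2 m1 by (intro mult_mono) auto
      also have "\<dots> = v1 * E1 / (2 * v2)" 
      proof -
        have "v1 * m1 / (2 * (v2 * M)) * (X * M) = v1 * (m1 * X) / (2 * v2)" if "M > 0" for M X :: real
          using that v2 by (simp add: field_simps)
        from this[of "m2 + 1"] m2 show ?thesis by (simp add: E1_def)
      qed
      finally show ?thesis using v2 by (simp add: field_simps)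
    qed
    with L have "v1 * E1 / 2 \<le> (\<integral>x. F x \<partial>lebesgue)" by linarith
    moreover have "v1 * m1 / 2 * exp (- (k * (norm (p - x0) - \<eta> + e))) \<le> v1 * E1 / 2"
    proof -
      have "k * (rs + 2 * t) \<le> k * (norm (p - x0) - \<eta> + e)"
        using kp t by (intro mult_left_mono) (auto simp: rs_def d_def)
      then show ?thesis using v1 m1 by (simp add: E1_def)
    qed
    ultimately show "v1 * m1 / 2 * exp (- (k * (norm (p - x0) - \<eta> + e))) \<le> (\<integral>x. F x \<partial>lebesgue)" by linarith
  qed
qed

section \<open>Radial test fields and the Yukawa profile\<close>

lemma smooth_real_deriv:
  fixes h :: "real \<Rightarrow> real"
  assumes "smooth_on UNIV h"
  shows "smooth_on UNIV (deriv h)" "(h has_real_derivative deriv h s) (at s)"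
proof -
  have d: "(h has_real_derivative fderiv h 1 s) (at s)" for s
  proof -
    have h: "(h has_derivative frechet_derivative h (at s)) (at s)"
      by (rule smooth_on_has_derivative[OF assms UNIV_I])
    have "frechet_derivative h (at s) = (*) (fderiv h 1 s)"
    proof
      fix v show "frechet_derivative h (at s) v = fderiv h 1 s * v"
        using linear_scale[OF has_derivative_linear[OF h], of v 1] by simp
    qed
    then show ?thesis unfolding has_field_derivative_def using h by metis
  qed
  have e: "deriv h = fderiv h 1" using DERIV_imp_deriv[OF d] by auto
  show "smooth_on UNIV (deriv h)" unfolding e by (rule smooth_on_frechet[OF open_UNIV assms])
  show "(h has_real_derivative deriv h s) (at s)" using d by (simp add: e)
qed

lemma deriv_zero_open:
  fixes h :: "real \<Rightarrow> real"
  assumes "open S" "s \<in> S" "\<And>y. y \<in> S \<Longrightarrow> h y = c"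
  shows "deriv h s = 0"
proof (rule DERIV_imp_deriv)
  show "(h has_real_derivative 0) (at s)"
    by (rule has_field_derivative_transform_within_open[OF DERIV_const assms(1,2)]) (simp add: assms(3))
qed

lemma smooth_radial:
  "smooth_on UNIV q \<Longrightarrow> smooth_on UNIV (\<lambda>x. q ((norm (x - c))\<^sup>2))"
  by (rule smooth_on_compose[OF open_UNIV]) (auto intro: smooth_on_norm_sq)

lemma curl_radial:
  assumes q: "smooth_on UNIV q" and u: "\<And>i. (\<lambda>y. u y $ i) differentiable (at x)"
  shows "curl (\<lambda>x. q ((norm (x - c))\<^sup>2) *\<^sub>R u x) x
    = q ((norm (x - c))\<^sup>2) *\<^sub>R curl u x + (2 * deriv q ((norm (x - c))\<^sup>2)) *\<^sub>R cross3 (x - c) (u x)"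
  using curl_mult[OF smooth_radial[OF q] u, of c] gradI[OF radial_has_derivative[OF smooth_real_deriv(2)[OF q]]]
  by (simp add: cross_mult_left)

lemma has_derivative_linear_component:
  fixes L :: "real^3 \<Rightarrow> real^3"
  assumes "linear L"
  shows "((\<lambda>y. L (y - c) $ i) has_derivative (\<lambda>v. L v $ i)) (at x)"
proof -
  have bl: "bounded_linear (\<lambda>v. L v $ i)"
    using bounded_linear_compose[OF bounded_linear_vec_nth] assms by (simp add: linear_conv_bounded_linear)
  have "((\<lambda>y. y - c) has_derivative (\<lambda>v. v)) (at x)" by (auto intro!: derivative_eq_intros)
  from bounded_linear.has_derivative[OF bl this] show ?thesis .
qed

lemma curl_linear:
  assumes "linear L"
  shows "curl (\<lambda>x. L (x - c)) x = vector [L (axis 2 1) $ 3 - L (axis 3 1) $ 2,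
    L (axis 3 1) $ 1 - L (axis 1 1) $ 3, L (axis 1 1) $ 2 - L (axis 2 1) $ 1]"
    "(\<lambda>y. L (y - c) $ i) differentiable (at x)"
proof -
  have "fderiv (\<lambda>y. L (y - c) $ i) v x = L v $ i" for i v
    using fun_cong[OF frechet_derivative_at[OF has_derivative_linear_component[OF assms]], of v] by simp
  then show "curl (\<lambda>x. L (x - c)) x = vector [L (axis 2 1) $ 3 - L (axis 3 1) $ 2,
    L (axis 3 1) $ 1 - L (axis 1 1) $ 3, L (axis 1 1) $ 2 - L (axis 2 1) $ 1]"
    by (simp add: vec_eq_iff forall_3 curl_components)
  show "(\<lambda>y. L (y - c) $ i) differentiable (at x)"
    using has_derivative_linear_component[OF assms] by (auto simp: differentiable_def)
qed

lemma curl_add: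
  assumes "\<And>i. (\<lambda>y. u y $ i) differentiable (at x)" "\<And>i. (\<lambda>y. w y $ i) differentiable (at x)"
  shows "curl (\<lambda>x. u x + w x) x = curl u x + curl w x"
  using fderiv_add[OF assms] by (simp add: vec_eq_iff forall_3 curl_components)

text \<open>For a radial function \<open>\<theta>\<close> the double curl of \<open>\<theta> b\<close> is a gradient minus the Laplacian of
  \<open>\<theta>\<close> times \<open>b\<close>; gradients are orthogonal to weak curls.\<close>
lemma weak_curl_radial:
  fixes b c :: "real^3" and \<kappa> :: real
  assumes \<Theta>: "smooth_on UNIV \<Theta>" "\<And>s. s > S \<Longrightarrow> \<Theta> s = 0"
    and V: "V \<in> L2 UNIV" "cV \<in> L2 UNIV" "weak_curl UNIV V cV"
  defines "sq \<equiv> \<lambda>x. (norm (x - c))\<^sup>2"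
  defines "v \<equiv> \<lambda>x. \<Theta> (sq x) *\<^sub>R b"
    and "\<omega> \<equiv> \<lambda>x. (\<kappa>\<^sup>2 * \<Theta> (sq x) - 4 * sq x * deriv (deriv \<Theta>) (sq x) - 6 * deriv \<Theta> (sq x)) *\<^sub>R b"
  shows "vtest_fun UNIV v" "vtest_fun UNIV \<omega>"
    "curl v x = (2 * deriv \<Theta> (sq x)) *\<^sub>R cross3 (x - c) b"
    "lsq_of cV \<bullet> lsq_of (curl (curl v)) + \<kappa>\<^sup>2 * (lsq_of V \<bullet> lsq_of (curl v)) = lsq_of cV \<bullet> lsq_of \<omega>"
proof -
  note \<Theta>1 = smooth_real_deriv[OF \<Theta>(1)]
  note \<Theta>2 = smooth_real_deriv[OF \<Theta>1(1)]
  note \<Theta>3 = smooth_real_deriv[OF \<Theta>2(1)]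
  have z1: "deriv \<Theta> s = 0" if "s > S" for s using deriv_zero_open[of "{S<..}" s \<Theta> 0] that \<Theta>(2) by auto
  have z2: "deriv (deriv \<Theta>) s = 0" if "s > S" for s
    using deriv_zero_open[of "{S<..}" s "deriv \<Theta>" 0] that z1 by auto
  have comp: "test_fun UNIV m" if sm: "smooth_on UNIV m" and mz: "\<And>x. sq x > S \<Longrightarrow> m x = 0" for m
  proof (rule test_funI[OF sm compact_cball[of c "sqrt \<bar>S\<bar>"]])
    show "m x = 0" if x: "x \<notin> cball c (sqrt \<bar>S\<bar>)" for x
    proof (rule mz)
      have "sqrt \<bar>S\<bar> < norm (x - c)" using x by (simp add: dist_norm norm_minus_commute)
      then have "(sqrt \<bar>S\<bar>)\<^sup>2 < sq x" unfolding sq_def by (intro power_strict_mono) auto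
      then show "S < sq x" by simp
    qed
  qed auto
  show v: "vtest_fun UNIV v"
    unfolding v_def by (intro vtest_fun_scaled comp) (auto simp: sq_def[abs_def] \<Theta>(2) intro!: smooth_radial \<Theta>(1))
  have so: "smooth_on UNIV (\<lambda>x. \<kappa>\<^sup>2 * \<Theta> (sq x) - 4 * sq x * deriv (deriv \<Theta>) (sq x) - 6 * deriv \<Theta> (sq x))"
    unfolding sq_def
    by (intro smooth_on_diff smooth_on_mult smooth_on_const smooth_on_norm_sq smooth_radial \<Theta> \<Theta>1 \<Theta>2 open_UNIV)
  show \<omega>: "vtest_fun UNIV \<omega>"
    unfolding \<omega>_def by (intro vtest_fun_scaled comp so) (simp add: \<Theta>(2) z1 z2)
  have lb: "linear (\<lambda>y. cross3 y b)" by (auto intro!: linearI simp: cross_add_left cross_mult_left)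
  have dc: "(\<lambda>y. b $ i) differentiable (at x)" for i x by simp
  have cv: "curl v x = (2 * deriv \<Theta> (sq x)) *\<^sub>R cross3 (x - c) b" for x
    using curl_radial[OF \<Theta>(1) dc, where x=x and c=c] by (simp add: v_def sq_def curl_const)
  show "curl v x = (2 * deriv \<Theta> (sq x)) *\<^sub>R cross3 (x - c) b" by (rule cv)
  have s2: "smooth_on UNIV (\<lambda>s. 2 * deriv \<Theta> s)"
    by (intro smooth_on_mult smooth_on_const \<Theta>1 open_UNIV)
  have d2: "deriv (\<lambda>s. 2 * deriv \<Theta> s) s = 2 * deriv (deriv \<Theta>) s" for s
    by (rule DERIV_imp_deriv) (intro DERIV_cmult \<Theta>2)
  have c1: "curl (\<lambda>x. cross3 (x - c) b) x = (-2) *\<^sub>R b" for x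
    unfolding curl_linear(1)[OF lb]
    by (simp add: vec_eq_iff forall_3 cross3_def axis_def)
  have cc: "curl (curl v) x = (2 * deriv \<Theta> (sq x)) *\<^sub>R ((-2) *\<^sub>R b)
      + (2 * (2 * deriv (deriv \<Theta>) (sq x))) *\<^sub>R cross3 (x - c) (cross3 (x - c) b)" for x
  proof -
    have cvf: "curl v = (\<lambda>x. (2 * deriv \<Theta> ((norm (x - c))\<^sup>2)) *\<^sub>R cross3 (x - c) b)"
      by (rule ext) (simp add: cv sq_def)
    show ?thesis
      unfolding cvf using curl_radial[OF s2 curl_linear(2)[OF lb, where c=c and x=x], where c=c]
      by (simp add: c1 d2 sq_def)
  qed
  \<comment> \<open>\<open>Z\<close> is the gradient of the divergence of \<open>v\<close>, that is
    of 2 \<Theta>'(s) ((x - c) . b) with s = |x - c|^2, and \<open>\<omega>\<close> is \<kappa>^2 v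
    minus the Laplacian of \<open>v\<close>: in three dimensions the Laplacian of \<Theta>(s) is 4 s
    \<Theta>''(s) + 6 \<Theta>'(s).\<close>
  define Z where "Z x = (deriv (deriv \<Theta>) (sq x)) *\<^sub>R ((4 * ((x - c) \<bullet> b)) *\<^sub>R (x - c)) + (deriv \<Theta> (sq x)) *\<^sub>R (2 *\<^sub>R b)" for x
  have Ze: "curl (curl v) x + \<kappa>\<^sup>2 *\<^sub>R v x = \<omega> x + Z x" for x
  proof -
    have "(2 * t1) *\<^sub>R ((-2) *\<^sub>R b) + (2 * (2 * t2)) *\<^sub>R cross3 y (cross3 y b) + k *\<^sub>R (t0 *\<^sub>R b)
        = (k * t0 - 4 * (norm y)\<^sup>2 * t2 - 6 * t1) *\<^sub>R b + (t2 *\<^sub>R ((4 * (y \<bullet> b)) *\<^sub>R y) + t1 *\<^sub>R (2 *\<^sub>R b))"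
      for t0 t1 t2 k :: real and y
      unfolding power2_norm_eq_inner
      by (simp add: vec_eq_iff forall_3 cross3_def inner_vec_def sum_3 algebra_simps)
    then show ?thesis unfolding cc unfolding v_def \<omega>_def Z_def sq_def .
  qed
  have cz: "curl Z x = 0" for x
  proof -
    let ?w = "\<lambda>x. (4 * ((x - c) \<bullet> b)) *\<^sub>R (x - c)"
    have li: "linear (\<lambda>y::real^3. y)" by (rule linearI) auto
    have sl: "smooth_on UNIV (\<lambda>x. 4 * ((x - c) \<bullet> b))"
      unfolding inner_diff_left by (intro smooth_on_mult smooth_on_diff smooth_on_inner smooth_on_const open_UNIV)
    have gl: "grad (\<lambda>x. 4 * ((x - c) \<bullet> b)) x = 4 *\<^sub>R b" for x
      by (rule gradI) (auto intro!: derivative_eq_intros simp: inner_commute)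
    have cl0: "curl (\<lambda>x. x - c) x = 0" for x
      unfolding curl_linear(1)[OF li] by (simp add: vec_eq_iff forall_3 axis_def)
    have cw: "curl ?w x = cross3 (4 *\<^sub>R b) (x - c)" for x
      using curl_mult[OF sl curl_linear(2)[OF li, where c=c and x=x]] by (simp add: gl cl0)
    have dw: "(\<lambda>y. ?w y $ i) differentiable (at x)" for i
    proof -
      have "(\<lambda>y. (4 * ((y - c) \<bullet> b)) * (y - c) $ i) differentiable (at x)"
        by (rule differentiable_mult[OF smooth_on_differentiable[OF sl UNIV_I] curl_linear(2)[OF li, where c=c and x=x]])
      then show ?thesis by simp
    qed
    have db: "(\<lambda>y. (2 *\<^sub>R b) $ i) differentiable (at x)" for i by simp
    have dr: "(\<lambda>y. (q (sq y) *\<^sub>R u y) $ i) differentiable (at x)"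
      if "smooth_on UNIV q" "\<And>i. (\<lambda>y. u y $ i) differentiable (at x)" for q :: "real \<Rightarrow> real" and u :: "real^3 \<Rightarrow> real^3" and i
      using differentiable_mult[OF smooth_on_differentiable[OF smooth_radial[OF that(1)] UNIV_I] that(2)]
      by (simp add: sq_def)
    have "curl Z x = curl (\<lambda>x. (deriv (deriv \<Theta>) (sq x)) *\<^sub>R ?w x) x + curl (\<lambda>x. (deriv \<Theta> (sq x)) *\<^sub>R (2 *\<^sub>R b)) x"
      unfolding Z_def[abs_def] by (rule curl_add[OF dr[OF \<Theta>2(1) dw] dr[OF \<Theta>1(1) db]])
    also have "\<dots> = 0"
      using curl_radial[OF \<Theta>2(1) dw, where c=c] curl_radial[OF \<Theta>1(1) db, where c=c]
      by (simp add: sq_def cw curl_const cross_mult_left cross_mult_right cross_skew[of b "x - c"])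
    finally show ?thesis .
  qed
  have vc: "vtest_fun UNIV (curl v)" and vcc: "vtest_fun UNIV (curl (curl v))"
    using vtest_fun_curl[OF v] vtest_fun_curl[OF vtest_fun_curl[OF v]] .
  have Zt: "vtest_fun UNIV Z"
  proof (rule vtest_funI)
    fix i
    have "Z x $ i = curl (curl v) x $ i + \<kappa>\<^sup>2 * v x $ i - \<omega> x $ i" for x
      using arg_cong[OF Ze[of x], of "\<lambda>u. u $ i"] by simp
    then show "test_fun UNIV (\<lambda>x. Z x $ i)"
      using vtest_funD[OF v, of i] vtest_funD[OF vcc, of i] vtest_funD[OF \<omega>, of i]
      by (simp add: test_fun_add test_fun_diff test_fun_cmult)
  qed
  have w: "lsq_of V \<bullet> lsq_of (curl \<phi>) = lsq_of cV \<bullet> lsq_of \<phi>" if "vtest_fun UNIV \<phi>" for \<phi>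
    using V that weak_curl_lsq_of[OF V(1,2)] by blast
  have "curl Z = (\<lambda>x. 0)" using cz by auto
  \<comment> \<open>A test field without curl pairs to zero with the weak curl
    \<open>cV\<close>.\<close>
  then have cVZ: "lsq_of cV \<bullet> lsq_of Z = 0"
    using w[OF Zt] by (simp add: lsq_of_simps)
  note L = vtest_fun_L2[OF v] vtest_fun_L2[OF vcc] vtest_fun_L2[OF \<omega>] vtest_fun_L2[OF Zt]
  have "lsq_of (curl (curl v)) + \<kappa>\<^sup>2 *\<^sub>R lsq_of v = lsq_of (\<lambda>x. curl (curl v) x + \<kappa>\<^sup>2 *\<^sub>R v x)"
    using L L2_scaleR[OF L(1), of "\<kappa>\<^sup>2"] by (simp add: lsq_of_simps)
  also have "\<dots> = lsq_of \<omega> + lsq_of Z"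
    using L unfolding Ze by (simp add: lsq_of_simps)
  finally have "lsq_of cV \<bullet> (lsq_of (curl (curl v)) + \<kappa>\<^sup>2 *\<^sub>R lsq_of v) = lsq_of cV \<bullet> (lsq_of \<omega> + lsq_of Z)" by simp
  \<comment> \<open>The zeroth order term is rewritten by the weak curl identity for
    \<open>v\<close>, so that only \<open>cV\<close> is left on the other side.\<close>
  then show "lsq_of cV \<bullet> lsq_of (curl (curl v)) + \<kappa>\<^sup>2 * (lsq_of V \<bullet> lsq_of (curl v)) = lsq_of cV \<bullet> lsq_of \<omega>"
    by (simp add: inner_add_right cVZ w[OF v])
qed

text \<open>The kernel exp(- \<kappa> r) / r in the variable s = r^2, in line with radial functions
  of the squared distance. \<open>yukawa1\<close> and \<open>yukawa2\<close> are its first two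
  derivatives in s.\<close>

definition yukawa :: "real \<Rightarrow> real \<Rightarrow> real" where
  "yukawa \<kappa> s = exp (- (\<kappa> * sqrt s)) / sqrt s"

definition yukawa1 :: "real \<Rightarrow> real \<Rightarrow> real" where
  "yukawa1 \<kappa> s = - ((\<kappa> * sqrt s + 1) * exp (- (\<kappa> * sqrt s)) / (2 * sqrt s ^ 3))"

definition yukawa2 :: "real \<Rightarrow> real \<Rightarrow> real" where
  "yukawa2 \<kappa> s = (\<kappa>\<^sup>2 * s + 3 * \<kappa> * sqrt s + 3) * exp (- (\<kappa> * sqrt s)) / (4 * sqrt s ^ 5)"

text \<open>The last equation is the modified Helmholtz equation away from the pole, with the radial
  Laplacian written in s = r^2.\<close>

lemma yukawa_deriv:
  assumes s: "s > 0"
  shows "(yukawa \<kappa> has_real_derivative yukawa1 \<kappa> s) (at s)"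
    "(yukawa1 \<kappa> has_real_derivative yukawa2 \<kappa> s) (at s)"
    "\<kappa>\<^sup>2 * yukawa \<kappa> s - 4 * s * yukawa2 \<kappa> s - 6 * yukawa1 \<kappa> s = 0"
proof -
  define r where "r = sqrt s"
  have r: "r > 0" "s = r * r" using s by (simp_all add: r_def)
  note ds = DERIV_real_sqrt[OF s, folded r_def]
  have e: "((\<lambda>r. exp (- (\<kappa> * r))) has_real_derivative (exp (- (\<kappa> * r)) * (- \<kappa>))) (at r)"
    by (rule DERIV_fun_exp[OF DERIV_minus[OF DERIV_cmult_Id]])
  have "((\<lambda>r. exp (- (\<kappa> * r)) / r) has_real_derivative
      (exp (- (\<kappa> * r)) * (- \<kappa>) * r - exp (- (\<kappa> * r)) * 1) / (r * r)) (at (sqrt s))"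
    unfolding r_def[symmetric] using r by (intro DERIV_divide e DERIV_ident) auto
  from DERIV_chain2[OF this ds]
  show "(yukawa \<kappa> has_real_derivative yukawa1 \<kappa> s) (at s)"
    unfolding yukawa_def[abs_def]
    by (rule DERIV_cong) (use r in \<open>simp add: yukawa1_def r_def[symmetric] field_simps power3_eq_cube\<close>)
  have d1: "((\<lambda>r. (\<kappa> * r + 1) * exp (- (\<kappa> * r))) has_real_derivative (- \<kappa>\<^sup>2 * r * exp (- (\<kappa> * r)))) (at r)"
  proof -
    have "((\<lambda>r. \<kappa> * r + 1) has_real_derivative \<kappa> + 0) (at r)"
      by (rule DERIV_add[OF DERIV_cmult_Id DERIV_const])
    from DERIV_mult[OF this e] show ?thesis
      by (rule DERIV_cong) (simp add: algebra_simps power2_eq_square)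
  qed
  have d2: "((\<lambda>r. 2 * r ^ 3) has_real_derivative (6 * r\<^sup>2)) (at r)"
    by (rule DERIV_cong[OF DERIV_cmult[OF DERIV_power[OF DERIV_ident]]]) (simp add: power2_eq_square)
  have "((\<lambda>r. (\<kappa> * r + 1) * exp (- (\<kappa> * r)) / (2 * r ^ 3)) has_real_derivative
      ((- \<kappa>\<^sup>2 * r * exp (- (\<kappa> * r))) * (2 * r ^ 3) - ((\<kappa> * r + 1) * exp (- (\<kappa> * r))) * (6 * r\<^sup>2))
        / ((2 * r ^ 3) * (2 * r ^ 3))) (at (sqrt s))"
    unfolding r_def[symmetric] using r by (intro DERIV_divide d1 d2) auto
  from DERIV_minus[OF DERIV_chain2[OF this ds]]
  show "(yukawa1 \<kappa> has_real_derivative yukawa2 \<kappa> s) (at s)"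
    unfolding yukawa1_def[abs_def]
  proof (rule DERIV_cong)
    have "(\<kappa>\<^sup>2 * (r * r) + 3 * \<kappa> * r + 3) * X / (4 * r ^ 5)
        = - (((- \<kappa>\<^sup>2 * r * X) * (2 * r ^ 3) - ((\<kappa> * r + 1) * X) * (6 * r\<^sup>2))
        / ((2 * r ^ 3) * (2 * r ^ 3)) * (inverse r / 2))" for X
      using r(1) by (simp add: field_simps power2_eq_square eval_nat_numeral)
    then show "- (((- \<kappa>\<^sup>2 * r * exp (- (\<kappa> * r))) * (2 * r ^ 3) - ((\<kappa> * r + 1) * exp (- (\<kappa> * r))) * (6 * r\<^sup>2))
        / ((2 * r ^ 3) * (2 * r ^ 3)) * (inverse r / 2)) = yukawa2 \<kappa> s"
      by (simp add: yukawa2_def r_def[symmetric] r(2)[symmetric])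
  qed
  have "\<kappa>\<^sup>2 * (X / r) - 4 * (r * r) * ((\<kappa>\<^sup>2 * (r * r) + 3 * \<kappa> * r + 3) * X / (4 * r ^ 5))
      - 6 * (- ((\<kappa> * r + 1) * X / (2 * r ^ 3))) = 0" for X
    using r(1) by (simp add: field_simps power2_eq_square eval_nat_numeral)
  from this[of "exp (- (\<kappa> * r))"]
  show "\<kappa>\<^sup>2 * yukawa \<kappa> s - 4 * s * yukawa2 \<kappa> s - 6 * yukawa1 \<kappa> s = 0"
    by (simp add: yukawa_def yukawa1_def yukawa2_def r_def[symmetric] r(2)[symmetric])
qed

lemma smooth_on_yukawa: "smooth_on {0<..} (yukawa \<kappa>)"
proof -
  have "smooth_on {0<..} (\<lambda>s. exp (- \<kappa> * sqrt s))"
    by (rule smooth_on_compose[OF _ smooth_on_exp])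
      (auto intro!: smooth_on_mult smooth_on_const smooth_on_sqrt smooth_on_uminus)
  then have "smooth_on {0<..} (\<lambda>s. exp (- \<kappa> * sqrt s) / sqrt s)"
    by (intro smooth_on_divide smooth_on_sqrt) auto
  then show ?thesis by (simp add: yukawa_def[abs_def])
qed

lemma annular_cutoff:
  assumes \<rho>: "0 < \<rho>" "\<rho> \<le> R"
  obtains \<zeta> C where "smooth_on UNIV \<zeta>" "\<And>s. s \<le> \<rho>\<^sup>2 / 4 \<Longrightarrow> \<zeta> s = 0" "\<And>s. 2 * R\<^sup>2 \<le> s \<Longrightarrow> \<zeta> s = 0"
    "\<And>s. 3 / 4 * \<rho>\<^sup>2 \<le> s \<Longrightarrow> s \<le> R\<^sup>2 \<Longrightarrow> \<zeta> s = 1" "C > 0"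
    "\<And>s. \<bar>deriv \<zeta> s\<bar> \<le> C" "\<And>s. \<bar>deriv (deriv \<zeta>) s\<bar> \<le> C"
    "\<And>s. 3 / 4 * \<rho>\<^sup>2 < s \<Longrightarrow> s < R\<^sup>2 \<Longrightarrow> deriv \<zeta> s = 0 \<and> deriv (deriv \<zeta>) s = 0"
    "\<And>s. s < \<rho>\<^sup>2 / 4 \<or> 2 * R\<^sup>2 < s \<Longrightarrow> deriv \<zeta> s = 0 \<and> deriv (deriv \<zeta>) s = 0"
proof -
  \<comment> \<open>The first factor rises from 0 at \<open>\<rho>\<^sup>2 / 4\<close> to 1 at
    \<open>3 / 4 * \<rho>\<^sup>2\<close>, the second falls from 1 at \<open>R\<^sup>2\<close> to 0
    at \<open>2 * R\<^sup>2\<close>. Reaching 1 before \<open>\<rho>\<^sup>2\<close> puts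
    \<open>s = \<rho>\<^sup>2\<close> into the open range where the derivatives vanish, if \<rho> <
    R.\<close>
  define X where "X s = smooth_step ((s - \<rho>\<^sup>2 / 4) / (\<rho>\<^sup>2 / 2)) * smooth_step (2 - s / R\<^sup>2)" for s
  have R: "R > 0" using \<rho> by simp
  have sX: "smooth_on UNIV X"
    unfolding X_def divide_inverse
    by (intro smooth_on_mult smooth_on_compose[OF _ smooth_on_smooth_step] smooth_on_diff smooth_on_const smooth_on_ident) auto
  have X0: "X s = 0" if "s \<le> \<rho>\<^sup>2 / 4" for s
    using that \<rho> by (simp add: X_def smooth_step_simps divide_nonpos_nonneg)
  have X2: "X s = 0" if "2 * R\<^sup>2 \<le> s" for s
    using that R by (simp add: X_def smooth_step_simps pos_le_divide_eq)
  have X1: "X s = 1" if "3 / 4 * \<rho>\<^sup>2 \<le> s" "s \<le> R\<^sup>2" for s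
    using that R \<rho> by (simp add: X_def smooth_step_simps pos_le_divide_eq pos_divide_le_eq)
  have dd: "deriv X s = 0 \<and> deriv (deriv X) s = 0" if "open S" "s \<in> S" "\<And>y. y \<in> S \<Longrightarrow> X y = c" for S s c
  proof -
    have "deriv X y = 0" if "y \<in> S" for y
      using deriv_zero_open[OF \<open>open S\<close> that] \<open>\<And>y. y \<in> S \<Longrightarrow> X y = c\<close> by blast
    then show ?thesis using deriv_zero_open[OF that(1,2), of "deriv X" 0] that(2) by blast
  qed
  have mid: "deriv X s = 0 \<and> deriv (deriv X) s = 0" if "3 / 4 * \<rho>\<^sup>2 < s" "s < R\<^sup>2" for s
    by (rule dd[of "{3 / 4 * \<rho>\<^sup>2<..<R\<^sup>2}" s 1]) (use that X1 in auto)
  have out: "deriv X s = 0 \<and> deriv (deriv X) s = 0" if "s < \<rho>\<^sup>2 / 4 \<or> 2 * R\<^sup>2 < s" for s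
    using that
  proof
    assume "s < \<rho>\<^sup>2 / 4"
    then show ?thesis by (intro dd[of "{..<\<rho>\<^sup>2 / 4}" s 0]) (use X0 in auto)
  next
    assume "2 * R\<^sup>2 < s"
    then show ?thesis by (intro dd[of "{2 * R\<^sup>2<..}" s 0]) (use X2 in auto)
  qed
  note s1 = smooth_real_deriv(1)[OF sX]
  note s2 = smooth_real_deriv(1)[OF s1]
  have "test_fun UNIV (deriv X)" "test_fun UNIV (deriv (deriv X))"
    by (rule test_funI[OF _ compact_Icc[of "\<rho>\<^sup>2 / 4" "2 * R\<^sup>2"]], use s1 s2 out in \<open>auto simp: not_le\<close>)+
  then obtain C1 C2 where c: "C1 \<ge> 0" "C2 \<ge> 0" "\<And>s. \<bar>deriv X s\<bar> \<le> C1" "\<And>s. \<bar>deriv (deriv X) s\<bar> \<le> C2"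
    by (metis test_fun_bounded)
  have C: "C1 + C2 + 1 > 0" "\<bar>deriv X s\<bar> \<le> C1 + C2 + 1" "\<bar>deriv (deriv X) s\<bar> \<le> C1 + C2 + 1"
    for s using c(1,2) c(3)[of s] c(4)[of s] by linarith+
  show ?thesis by (rule that[OF sX X0 X2 X1 C mid out])
qed

text \<open>The profile is an exact radial solution of the modified Helmholtz equation in an annulus; the
  residual created by the cutoffs is of size one inside and exponentially small outside.\<close>
lemma yukawa_profile:
  assumes \<rho>: "0 < \<rho>" "\<rho> \<le> R"
  obtains C where "C > 0"
    "\<And>\<kappa>. \<kappa> \<ge> 0 \<Longrightarrow> \<exists>\<Theta>. smooth_on UNIV \<Theta> \<and> (\<forall>s>2 * R\<^sup>2. \<Theta> s = 0) \<and>
      (\<forall>s. \<rho>\<^sup>2 \<le> s \<and> s < R\<^sup>2 \<longrightarrow> deriv \<Theta> s = yukawa1 \<kappa> s) \<and>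
      (\<forall>s\<ge>0. \<bar>\<kappa>\<^sup>2 * \<Theta> s - 4 * s * deriv (deriv \<Theta>) s - 6 * deriv \<Theta> s\<bar> \<le> C * (1 + \<kappa>)) \<and>
      (\<forall>s>\<rho>\<^sup>2. \<bar>\<kappa>\<^sup>2 * \<Theta> s - 4 * s * deriv (deriv \<Theta>) s - 6 * deriv \<Theta> s\<bar> \<le> C * (1 + \<kappa>) * exp (- (\<kappa> * R))) \<and>
      (\<forall>s>2 * R\<^sup>2. \<kappa>\<^sup>2 * \<Theta> s - 4 * s * deriv (deriv \<Theta>) s - 6 * deriv \<Theta> s = 0)"
proof -
  obtain X C1 where X: "smooth_on UNIV X" "\<And>s. s \<le> \<rho>\<^sup>2 / 4 \<Longrightarrow> X s = 0" "\<And>s. 2 * R\<^sup>2 \<le> s \<Longrightarrow> X s = 0"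
    "\<And>s. 3 / 4 * \<rho>\<^sup>2 \<le> s \<Longrightarrow> s \<le> R\<^sup>2 \<Longrightarrow> X s = 1" and C1: "C1 > 0"
    "\<And>s. \<bar>deriv X s\<bar> \<le> C1" "\<And>s. \<bar>deriv (deriv X) s\<bar> \<le> C1"
    and mid: "\<And>s. 3 / 4 * \<rho>\<^sup>2 < s \<Longrightarrow> s < R\<^sup>2 \<Longrightarrow> deriv X s = 0 \<and> deriv (deriv X) s = 0"
    and out: "\<And>s. s < \<rho>\<^sup>2 / 4 \<or> 2 * R\<^sup>2 < s \<Longrightarrow> deriv X s = 0 \<and> deriv (deriv X) s = 0"
    by (rule annular_cutoff[OF \<rho>]) (rule that; blast)
  have R: "R > 0" using \<rho> by simp
  note dX = smooth_real_deriv(2)[OF X(1)]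
  note dX' = smooth_real_deriv(2)[OF smooth_real_deriv(1)[OF X(1)]]
  define C where "C = C1 * (4 + 20 / \<rho> + 8 * R)"
  have C: "C > 0" using C1 \<rho> R by (simp add: C_def add_pos_pos)
  show ?thesis
  proof (rule that[OF C])
    fix \<kappa> :: real assume \<kappa>: "\<kappa> \<ge> 0"
    define \<Theta> where "\<Theta> s = X s * yukawa \<kappa> s" for s
    have r4: "\<rho>\<^sup>2 / 4 > 0" using \<rho> by simp
    have z: "\<Theta> s = 0" if "s \<le> \<rho>\<^sup>2 / 4 \<or> 2 * R\<^sup>2 \<le> s" for s using that X(2,3) by (auto simp: \<Theta>_def)
    \<comment> \<open>The kernel is singular at s = 0, but the cutoff vanishes below
      \<open>\<rho>\<^sup>2 / 4\<close>; two overlapping open sets glue the smooth pieces.\<close>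
    have "smooth_on {0<..} \<Theta>"
      unfolding \<Theta>_def by (intro smooth_on_mult smooth_on_yukawa smooth_on_subset[OF X(1)]) auto
    moreover have "smooth_on {..<\<rho>\<^sup>2 / 4} \<Theta>"
      by (rule smooth_on_cong[OF _ smooth_on_const[of _ 0]]) (auto simp: z)
    ultimately have "smooth_on ({0<..} \<union> {..<\<rho>\<^sup>2 / 4}) \<Theta>" by (intro smooth_on_Un) auto
    moreover have "x \<in> {0<..} \<union> {..<\<rho>\<^sup>2 / 4}" for x
      unfolding Un_iff greaterThan_iff lessThan_iff using r4 by linarith
    then have "{0<..} \<union> {..<\<rho>\<^sup>2 / 4} = UNIV" by blast
    ultimately have S: "smooth_on UNIV \<Theta>" by simp
    have d1: "(\<Theta> has_real_derivative (deriv X s * yukawa \<kappa> s + yukawa1 \<kappa> s * X s)) (at s)" if "s > 0" for s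
      unfolding \<Theta>_def[abs_def] by (intro DERIV_mult dX yukawa_deriv that)
    have D1: "deriv \<Theta> s = deriv X s * yukawa \<kappa> s + yukawa1 \<kappa> s * X s" if "s > 0" for s
      using DERIV_imp_deriv[OF d1[OF that]] .
    have D2: "deriv (deriv \<Theta>) s = (deriv (deriv X) s * yukawa \<kappa> s + yukawa1 \<kappa> s * deriv X s)
        + (yukawa2 \<kappa> s * X s + deriv X s * yukawa1 \<kappa> s)" if s: "s > 0" for s
    proof (rule DERIV_imp_deriv, rule has_field_derivative_transform_within_open)
      show "((\<lambda>s. deriv X s * yukawa \<kappa> s + yukawa1 \<kappa> s * X s) has_real_derivative
        (deriv (deriv X) s * yukawa \<kappa> s + yukawa1 \<kappa> s * deriv X s)
        + (yukawa2 \<kappa> s * X s + deriv X s * yukawa1 \<kappa> s)) (at s)"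
        by (intro DERIV_add DERIV_mult dX dX' yukawa_deriv s)
      show "open {0::real<..}" "s \<in> {0<..}" using s by auto
      show "deriv X y * yukawa \<kappa> y + yukawa1 \<kappa> y * X y = deriv \<Theta> y" if "y \<in> {0<..}" for y
        using D1[of y] that by simp
    qed
    define Om where "Om s = \<kappa>\<^sup>2 * \<Theta> s - 4 * s * deriv (deriv \<Theta>) s - 6 * deriv \<Theta> s" for s
    have Om: "Om s = - 8 * s * deriv X s * yukawa1 \<kappa> s - (4 * s * deriv (deriv X) s + 6 * deriv X s) * yukawa \<kappa> s"
      if s: "s > 0" for s
    proof -
      \<comment> \<open>The terms without derivatives of the cutoff cancel by the Helmholtz
        equation, so the residual lives in the two transition layers only.\<close>
      have "Om s = X s * (\<kappa>\<^sup>2 * yukawa \<kappa> s - 4 * s * yukawa2 \<kappa> s - 6 * yukawa1 \<kappa> s)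
        - 8 * s * deriv X s * yukawa1 \<kappa> s - (4 * s * deriv (deriv X) s + 6 * deriv X s) * yukawa \<kappa> s"
        unfolding Om_def D1[OF s] D2[OF s] by (simp add: \<Theta>_def algebra_simps)
      then show ?thesis by (simp only: yukawa_deriv(3)[OF s])
    qed
    have Om0: "Om s = 0" if "s < \<rho>\<^sup>2 / 4" for s
    proof -
      have "deriv \<Theta> y = 0" if "y < \<rho>\<^sup>2 / 4" for y
        using deriv_zero_open[of "{..<\<rho>\<^sup>2 / 4}" y \<Theta> 0] z that by auto
      then have "deriv (deriv \<Theta>) s = 0" "deriv \<Theta> s = 0"
        using deriv_zero_open[of "{..<\<rho>\<^sup>2 / 4}" s "deriv \<Theta>" 0] that by auto
      then show ?thesis using z[of s] that by (simp add: Om_def)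
    qed
    have Om2: "Om s = 0" if "s > 2 * R\<^sup>2" for s
    proof -
      have "s > 0" using that R by (smt (verit) zero_le_power2)
      then show ?thesis using Om[of s] out[of s] that by simp
    qed
    have bnd: "\<bar>Om s\<bar> \<le> C * (1 + \<kappa>) * exp (- (\<kappa> * sqrt s))" if s: "\<rho>\<^sup>2 / 4 \<le> s" "s \<le> 2 * R\<^sup>2" for s
    proof -
      have s0: "s > 0" using s r4 by linarith
      define r where "r = sqrt s"
      have r: "r > 0" "s = r * r" using s0 by (simp_all add: r_def)
      have "(\<rho> / 2)\<^sup>2 \<le> r\<^sup>2" using s(1) r by (simp add: power2_eq_square)
      then have r1: "\<rho> / 2 \<le> r" by (rule power2_le_imp_le) (use r in simp)
      have "r\<^sup>2 \<le> (2 * R)\<^sup>2"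
      proof -
        have "r\<^sup>2 \<le> 2 * R\<^sup>2" using s(2) r by (simp add: power2_eq_square)
        also have "\<dots> \<le> (2 * R)\<^sup>2" by (simp add: power_mult_distrib)
        finally show ?thesis .
      qed
      then have r2: "r \<le> 2 * R" by (rule power2_le_imp_le) (use R in simp)
      have ir: "1 / r \<le> 2 / \<rho>" using r1 \<rho> r by (simp add: field_simps)
      define x where "x = exp (- (\<kappa> * r))"
      have x: "x > 0" by (simp add: x_def)
      have y0: "yukawa \<kappa> s = x / r" "yukawa1 \<kappa> s = - ((\<kappa> * r + 1) * x / (2 * r ^ 3))"
        by (simp_all add: yukawa_def yukawa1_def r_def x_def)
      have "\<bar>Om s\<bar> \<le> \<bar>8 * s * deriv X s * yukawa1 \<kappa> s\<bar> + \<bar>(4 * s * deriv (deriv X) s + 6 * deriv X s) * yukawa \<kappa> s\<bar>"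
        unfolding Om[OF s0] by (rule order_trans[OF abs_triangle_ineq4]) simp
      also have "\<bar>8 * s * deriv X s * yukawa1 \<kappa> s\<bar> = 8 * s * \<bar>deriv X s\<bar> * ((\<kappa> * r + 1) * x / (2 * r ^ 3))"
      proof -
        have "\<bar>yukawa1 \<kappa> s\<bar> = (\<kappa> * r + 1) * x / (2 * r ^ 3)"
          using r(1) x \<kappa> by (simp add: y0(2) abs_mult)
        then show ?thesis using s0 by (simp add: abs_mult)
      qed
      also have "\<dots> \<le> 8 * s * C1 * ((\<kappa> * r + 1) * x / (2 * r ^ 3))"
        using r s0 x \<kappa> C1 by (intro mult_right_mono mult_left_mono) auto
      also have "\<dots> = C1 * x * (4 * \<kappa> + 4 * (1 / r))"
        using r by (simp add: r(2) field_simps power3_eq_cube)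
      also have "\<bar>(4 * s * deriv (deriv X) s + 6 * deriv X s) * yukawa \<kappa> s\<bar> \<le> (4 * s * C1 + 6 * C1) * (x / r)"
      proof -
        have "\<bar>4 * s * deriv (deriv X) s\<bar> \<le> 4 * s * C1" "\<bar>6 * deriv X s\<bar> \<le> 6 * C1"
          using C1 s0 by (auto simp: abs_mult)
        then have "\<bar>4 * s * deriv (deriv X) s + 6 * deriv X s\<bar> \<le> 4 * s * C1 + 6 * C1"
          using abs_triangle_ineq[of "4 * s * deriv (deriv X) s" "6 * deriv X s"] by linarith
        then show ?thesis unfolding abs_mult using y0 x r by (intro mult_mono) auto
      qed
      also have "(4 * s * C1 + 6 * C1) * (x / r) = C1 * x * (4 * r + 6 * (1 / r))"
        using r by (simp add: r(2) field_simps)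
      finally have "\<bar>Om s\<bar> \<le> C1 * x * (4 * \<kappa> + 4 * (1 / r)) + C1 * x * (4 * r + 6 * (1 / r))" by simp
      also have "\<dots> = C1 * x * (4 * \<kappa> + 10 * (1 / r) + 4 * r)" by (simp add: algebra_simps)
      also have "\<dots> \<le> C1 * x * ((4 + 20 / \<rho> + 8 * R) * (1 + \<kappa>))"
      proof (intro mult_left_mono)
        have "4 * \<kappa> + 10 * (1 / r) + 4 * r \<le> 4 * \<kappa> + 20 / \<rho> + 8 * R" using ir r2 by simp
        also have "\<dots> \<le> (4 + 20 / \<rho> + 8 * R) * (1 + \<kappa>)"
        proof -
          have "4 * \<kappa> \<le> (4 + 20 / \<rho> + 8 * R) * \<kappa>" using \<kappa> \<rho> R by (intro mult_right_mono) auto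
          then show ?thesis unfolding distrib_left mult_1_right by linarith
        qed
        finally show "4 * \<kappa> + 10 * (1 / r) + 4 * r \<le> (4 + 20 / \<rho> + 8 * R) * (1 + \<kappa>)" .
      qed (use C1 x in auto)
      also have "\<dots> = C * (1 + \<kappa>) * exp (- (\<kappa> * sqrt s))" by (simp add: C_def x_def r_def)
      finally show ?thesis .
    qed
    have all: "\<bar>Om s\<bar> \<le> C * (1 + \<kappa>)" for s
    proof (cases "\<rho>\<^sup>2 / 4 \<le> s \<and> s \<le> 2 * R\<^sup>2")
      case True
      then have s0: "s > 0" using r4 by linarith
      have "C * (1 + \<kappa>) * exp (- (\<kappa> * sqrt s)) \<le> C * (1 + \<kappa>) * 1"
        using C \<kappa> s0 by (intro mult_left_mono) auto
      then show ?thesis using bnd[of s] True by simp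
    next
      case False
      then show ?thesis using Om0[of s] Om2[of s] C \<kappa> by auto
    qed
    have far: "\<bar>Om s\<bar> \<le> C * (1 + \<kappa>) * exp (- (\<kappa> * R))" if s: "s > \<rho>\<^sup>2" for s
    proof -
      have rp: "\<rho>\<^sup>2 > 0" using \<rho> by simp
      \<comment> \<open>Below \<open>R\<^sup>2\<close> the cutoff is constant and the residual zero;
        in the outer layer \<open>sqrt s\<close> is at least \<open>R\<close>, which supplies the
        exponential factor.\<close>
      consider "s < R\<^sup>2" | "R\<^sup>2 \<le> s" "s \<le> 2 * R\<^sup>2" | "s > 2 * R\<^sup>2" by linarith
      then show ?thesis
      proof cases
        case 1
        have "3 / 4 * \<rho>\<^sup>2 < s" using s rp by linarith
        from mid[OF this 1] have "deriv X s = 0 \<and> deriv (deriv X) s = 0" .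
        moreover have "s > 0" using s rp by linarith
        ultimately show ?thesis using Om[of s] C \<kappa> by simp
      next
        case 2
        have "R \<le> sqrt s" using 2(1) by (rule real_le_rsqrt)
        then have "C * (1 + \<kappa>) * exp (- (\<kappa> * sqrt s)) \<le> C * (1 + \<kappa>) * exp (- (\<kappa> * R))"
          using C \<kappa> by (intro mult_left_mono) (auto simp: mult_left_mono)
        moreover have "\<rho>\<^sup>2 / 4 \<le> s" using s rp by linarith
        ultimately show ?thesis using bnd[of s] 2 by linarith
      next
        case 3 then show ?thesis using Om2[of s] C \<kappa> by simp
      qed
    qed
    have mid1: "deriv \<Theta> s = yukawa1 \<kappa> s" if s: "\<rho>\<^sup>2 \<le> s" "s < R\<^sup>2" for s
    proof -
      have rp: "\<rho>\<^sup>2 > 0" using \<rho> by simp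
      have s0: "s > 0" "3 / 4 * \<rho>\<^sup>2 < s" using s rp by linarith+
      show ?thesis using D1[OF s0(1)] mid[OF s0(2) s(2)] X(4)[of s] s0(2) s(2) by simp
    qed
    show "\<exists>\<Theta>. smooth_on UNIV \<Theta> \<and> (\<forall>s>2 * R\<^sup>2. \<Theta> s = 0) \<and>
      (\<forall>s. \<rho>\<^sup>2 \<le> s \<and> s < R\<^sup>2 \<longrightarrow> deriv \<Theta> s = yukawa1 \<kappa> s) \<and>
      (\<forall>s\<ge>0. \<bar>\<kappa>\<^sup>2 * \<Theta> s - 4 * s * deriv (deriv \<Theta>) s - 6 * deriv \<Theta> s\<bar> \<le> C * (1 + \<kappa>)) \<and>
      (\<forall>s>\<rho>\<^sup>2. \<bar>\<kappa>\<^sup>2 * \<Theta> s - 4 * s * deriv (deriv \<Theta>) s - 6 * deriv \<Theta> s\<bar> \<le> C * (1 + \<kappa>) * exp (- (\<kappa> * R))) \<and>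
      (\<forall>s>2 * R\<^sup>2. \<kappa>\<^sup>2 * \<Theta> s - 4 * s * deriv (deriv \<Theta>) s - 6 * deriv \<Theta> s = 0)"
    proof (rule exI[of _ \<Theta>], intro conjI allI impI)
      show "smooth_on UNIV \<Theta>" by (rule S)
      show "\<Theta> s = 0" if "s > 2 * R\<^sup>2" for s using z[of s] that by simp
      show "deriv \<Theta> s = yukawa1 \<kappa> s" if "\<rho>\<^sup>2 \<le> s \<and> s < R\<^sup>2" for s using mid1[of s] that by blast
    qed (fold Om_def, rule all, rule far, assumption, rule Om2, assumption)
  qed
qed

text \<open>The segment from \<open>p\<close> to \<open>x\<close> contains a point of the ball at
  depth \<open>t\<close> below the sphere; the ball is open, so the bound is obtained in the limit
  of small \<open>t\<close>.\<close>

lemma setdist_ball_le: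
  fixes D :: "'a::euclidean_space set"
  assumes \<eta>: "\<eta> > 0" and x: "x \<in> closure D" and out: "norm (x - p) \<ge> \<eta>"
  shows "setdist D (ball p \<eta>) + \<eta> \<le> norm (x - p)"
proof -
  have n: "norm (x - p) > 0" using \<eta> out by linarith
  have "setdist D (ball p \<eta>) \<le> norm (x - p) - \<eta> + t" if t: "0 < t" "t < \<eta>" for t
  proof -
    define y where "y = p + ((\<eta> - t) / norm (x - p)) *\<^sub>R (x - p)"
    have "norm (y - p) = \<eta> - t" using t n by (simp add: y_def)
    then have yB: "y \<in> ball p \<eta>" using t by (simp add: dist_norm norm_minus_commute)
    have "x - y = (1 - (\<eta> - t) / norm (x - p)) *\<^sub>R (x - p)" by (simp add: y_def algebra_simps)
    then have "norm (x - y) = \<bar>1 - (\<eta> - t) / norm (x - p)\<bar> * norm (x - p)" by simp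
    also have "\<dots> = \<bar>(1 - (\<eta> - t) / norm (x - p)) * norm (x - p)\<bar>" by (simp add: abs_mult)
    also have "(1 - (\<eta> - t) / norm (x - p)) * norm (x - p) = norm (x - p) - (\<eta> - t)"
    proof -
      have "(1 - \<alpha> / \<beta>) * \<beta> = \<beta> - \<alpha>" if "\<beta> > 0" for \<alpha> \<beta> :: real
        using that by (simp add: field_simps)
      from this[OF n] show ?thesis .
    qed
    finally have "norm (x - y) = norm (x - p) - \<eta> + t" using out t by simp
    moreover have "setdist (closure D) (ball p \<eta>) \<le> dist x y" using x yB by (rule setdist_le_dist)
    ultimately show ?thesis by (simp add: dist_norm setdist_closure_1)
  qed
  note b = this
  have "setdist D (ball p \<eta>) \<le> norm (x - p) - \<eta> + 0"
  proof (rule tendsto_lowerbound)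
    show "((\<lambda>t. norm (x - p) - \<eta> + t) \<longlongrightarrow> norm (x - p) - \<eta> + 0) (at_right 0)" by (intro tendsto_intros)
    show "\<forall>\<^sub>F t in at_right 0. setdist D (ball p \<eta>) \<le> norm (x - p) - \<eta> + t"
      using \<eta> b by (auto simp: eventually_at_right_field intro!: exI[of _ \<eta>])
  qed simp
  then show ?thesis by simp
qed

text \<open>The pole has to avoid the line through \<open>p\<close> in the direction
  \<open>a\<close>: there the component of \<open>p - x0\<close> orthogonal to \<open>a\<close> is
  zero and the integral over the source ball loses its positive factor. Openness of \<open>D\<close>
  allows a small sideways move.\<close>

lemma pole_near_ball:
  fixes D :: "(real^3) set"
  assumes D: "open D" "D \<noteq> {}" and \<eta>: "\<eta> > 0" and a: "norm a = 1" and \<delta>: "\<delta> > 0"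
  obtains x0 \<rho> where "\<rho> > 0" "cball x0 \<rho> \<subseteq> D" "norm (p - x0) < setdist D (ball p \<eta>) + \<eta> + \<delta>"
    "(p - x0) - ((p - x0) \<bullet> a) *\<^sub>R a \<noteq> 0"
proof -
  have ne: "ball p \<eta> \<noteq> {}" using \<eta> by auto
  have "setdist D (ball p \<eta>) < setdist D (ball p \<eta>) + \<delta> / 2" using \<delta> by simp
  from setdist_ltE[OF this D(2) ne]
  obtain x y where xy: "x \<in> D" "y \<in> ball p \<eta>" "dist x y < setdist D (ball p \<eta>) + \<delta> / 2" by blast
  have xn: "norm (p - x) < setdist D (ball p \<eta>) + \<eta> + \<delta> / 2"
    using xy(2,3) norm_triangle_ineq[of "p - y" "y - x"] by (simp add: dist_norm norm_minus_commute)
  define c where "c z = (p - z) - ((p - z) \<bullet> a) *\<^sub>R a" for z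
  have aa: "a \<bullet> a = 1" using a by (simp flip: power2_norm_eq_inner)
  have "\<exists>x0\<in>D. norm (p - x0) < setdist D (ball p \<eta>) + \<eta> + \<delta> \<and> c x0 \<noteq> 0"
  proof (cases "c x = 0")
    case False
    then show ?thesis using xy(1) xn \<delta> by (intro bexI[of _ x]) auto
  next
    case True
    obtain e where e: "e \<noteq> 0" "orthogonal a e"
      using orthogonal_to_vector_exists[of a] by (force simp: orthogonal_commute)
    obtain r where r: "r > 0" "ball x r \<subseteq> D" using D(1) xy(1) open_contains_ball by blast
    \<comment> \<open>Short enough to stay in \<open>D\<close> and to spend at most the remaining
      \<open>\<delta> / 2\<close>.\<close>
    define t where "t = min (r / 2) (\<delta> / 2) / norm e"
    have t: "t > 0" "t * norm e \<le> r / 2" "t * norm e \<le> \<delta> / 2" using e r \<delta> by (auto simp: t_def)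
    define x0 where "x0 = x + t *\<^sub>R e"
    have "dist x x0 < r" using t r by (simp add: x0_def dist_norm)
    then have "x0 \<in> D" using r(2) by auto
    moreover have "norm (p - x0) < setdist D (ball p \<eta>) + \<eta> + \<delta>"
      using norm_triangle_ineq4[of "p - x" "t *\<^sub>R e"] xn t by (simp add: x0_def algebra_simps)
    moreover have "c x0 = c x - t *\<^sub>R e"
      using e(2) by (simp add: c_def x0_def orthogonal_def inner_commute inner_diff_left inner_add_left algebra_simps)
    ultimately show ?thesis using True t e by (intro bexI[of _ x0]) auto
  qed
  then obtain x0 where x0: "x0 \<in> D" "norm (p - x0) < setdist D (ball p \<eta>) + \<eta> + \<delta>" "c x0 \<noteq> 0" by blast
  obtain \<rho> where "\<rho> > 0" "cball x0 \<rho> \<subseteq> D" using D(1) x0(1) open_contains_cball by blast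
  then show ?thesis using that x0 by (simp add: c_def)
qed

lemma L2_indicator_ball: "(\<lambda>x. indicator (ball p \<eta>) x *\<^sub>R a) \<in> L2 UNIV"
  for p :: "'a::euclidean_space" and a :: "'b::euclidean_space"
proof (rule L2_bounded_support)
  show "(\<lambda>x. indicator (ball p \<eta>) x *\<^sub>R a) \<in> borel_measurable lebesgue"
    by (intro borel_measurable_scaleR borel_measurable_indicator) auto
  show "norm (indicator (ball p \<eta>) x *\<^sub>R a) \<le> norm a" for x by (simp add: indicator_def)
  show "indicator (ball p \<eta>) x *\<^sub>R a = 0" if "norm x > norm p + \<eta>" for x
    using that norm_triangle_ineq2[of x p] by (auto simp: indicator_def dist_norm norm_minus_commute)
qed

text \<open>Duality: the equation for \<open>V\<close>, tested with the curl of a radial field,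
  equates the pairing of \<open>cV\<close> with the residual \<open>w\<close> to an integral over
  the source ball. The residual is at most linear in \<kappa> on \<open>cball x0 \<rho>\<close>,
  which lies in \<open>D\<close>, and exponentially small elsewhere, so only \<open>cV\<close>
  inside \<open>D\<close> can account for the size of that integral.\<close>

lemma maxwell_source_lower:
  fixes D :: "(real^3) set" and p a :: "real^3"
  assumes D: "open D" "D \<noteq> {}" and \<eta>: "\<eta> > 0" and disj: "cball p \<eta> \<inter> closure D = {}"
    and a: "norm a = 1" and \<delta>: "\<delta> > 0"
  defines "b \<equiv> \<lambda>x. indicator (ball p \<eta>) x *\<^sub>R a"
  shows "\<exists>c>0. \<exists>k0\<ge>1. \<forall>\<kappa>\<ge>k0. \<forall>g V cV. maxwell_source \<kappa> g b V cV \<longrightarrow>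
    \<bar>g\<bar> * c / (1 + \<kappa>) * exp (- (\<kappa> * (setdist D (ball p \<eta>) + \<delta>))) \<le> norm (lsq_of (ext_zero (closure D) cV))"
proof -
  obtain x0 \<rho> where \<rho>: "\<rho> > 0" "cball x0 \<rho> \<subseteq> D" and xn: "norm (p - x0) < setdist D (ball p \<eta>) + \<eta> + \<delta> / 2"
    and cn: "(p - x0) - ((p - x0) \<bullet> a) *\<^sub>R a \<noteq> 0"
    by (rule pole_near_ball[OF D \<eta> a half_gt_zero[OF \<delta>], of p]) (rule that; assumption)
  define c where "c = (p - x0) - ((p - x0) \<bullet> a) *\<^sub>R a"
  have aa: "a \<bullet> a = 1" using a by (simp flip: power2_norm_eq_inner)
  have ca: "c \<bullet> a = 0" by (simp add: c_def inner_diff_left aa)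
  have "(p - x0) \<bullet> c = c \<bullet> c"
  proof -
    have "p - x0 = c + ((p - x0) \<bullet> a) *\<^sub>R a" by (simp add: c_def)
    then have "(p - x0) \<bullet> c = (c + ((p - x0) \<bullet> a) *\<^sub>R a) \<bullet> c" by simp
    also have "\<dots> = c \<bullet> c" using ca by (simp add: inner_add_left inner_commute[of a c])
    finally show ?thesis .
  qed
  then have cp: "(p - x0) \<bullet> c > 0" using cn by (simp add: c_def[symmetric])
  have x0D: "x0 \<in> D" using \<rho> by auto
  have disj': "x \<notin> D" if "x \<in> cball p \<eta>" for x using that disj closure_subset[of D] by auto
  have far: "norm (p - x0) > \<eta>" 
  proof (rule ccontr)
    assume "\<not> norm (p - x0) > \<eta>"
    then have "x0 \<in> cball p \<eta>" by (simp add: dist_norm)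
    with disj'[of x0] x0D show False by blast
  qed
  \<comment> \<open>With this polarisation the curl of the radial field, paired with
    \<open>a\<close>, contains the linear factor \<open>(x - x0) \<bullet> c\<close>, which is
    positive at the centre \<open>p\<close>.\<close>
  define b' where "b' = cross3 a c"
  have b'a: "a \<bullet> cross3 y b' = y \<bullet> c" for y
  proof -
    have "a \<bullet> cross3 y (cross3 a c) = (a \<bullet> a) * (y \<bullet> c) - (c \<bullet> a) * (y \<bullet> a)"
      by (simp add: cross3_def inner_vec_def sum_3 algebra_simps)
    then show ?thesis by (simp add: b'_def aa ca)
  qed
  \<comment> \<open>The sphere of radius \<open>R\<close> about the pole encloses the source ball,
    and the summand 1 makes the outer residual smaller than the main term by a factor
    \<open>exp (- \<kappa>)\<close>.\<close>
  define R where "R = norm (p - x0) + \<eta> + \<delta> + 1 + \<rho>"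
  have R: "R > 0" "\<rho> \<le> R" using \<rho> \<eta> \<delta> norm_ge_zero[of "p - x0"] unfolding R_def by linarith+
  obtain C where C: "C > 0" and prof:
    "\<And>\<kappa>. \<kappa> \<ge> 0 \<Longrightarrow> \<exists>\<Theta>. smooth_on UNIV \<Theta> \<and> (\<forall>s>2 * R\<^sup>2. \<Theta> s = 0) \<and>
      (\<forall>s. \<rho>\<^sup>2 \<le> s \<and> s < R\<^sup>2 \<longrightarrow> deriv \<Theta> s = yukawa1 \<kappa> s) \<and>
      (\<forall>s\<ge>0. \<bar>\<kappa>\<^sup>2 * \<Theta> s - 4 * s * deriv (deriv \<Theta>) s - 6 * deriv \<Theta> s\<bar> \<le> C * (1 + \<kappa>)) \<and>
      (\<forall>s>\<rho>\<^sup>2. \<bar>\<kappa>\<^sup>2 * \<Theta> s - 4 * s * deriv (deriv \<Theta>) s - 6 * deriv \<Theta> s\<bar> \<le> C * (1 + \<kappa>) * exp (- (\<kappa> * R))) \<and>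
      (\<forall>s>2 * R\<^sup>2. \<kappa>\<^sup>2 * \<Theta> s - 4 * s * deriv (deriv \<Theta>) s - 6 * deriv \<Theta> s = 0)"
    by (rule yukawa_profile[OF \<rho>(1) R(2)]) (rule that; assumption)
  obtain c0 k0 where c0: "c0 > 0" "k0 \<ge> 1" and lap:
    "\<forall>k F. k \<ge> k0 \<longrightarrow> integrable lebesgue F \<longrightarrow> (\<forall>x. x \<notin> ball p \<eta> \<longrightarrow> F x = 0) \<longrightarrow>
      (\<forall>x\<in>ball p \<eta>. F x = (k * norm (x - x0) + 1) * exp (- (k * norm (x - x0))) / norm (x - x0) ^ 3 * ((x - x0) \<bullet> c)) \<longrightarrow>
      c0 * exp (- (k * (norm (p - x0) - \<eta> + \<delta> / 2))) \<le> (\<integral>x. F x \<partial>lebesgue)"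
    using laplace_ball_lower[OF \<eta> far cp half_gt_zero[OF \<delta>]] by (elim exE conjE) (rule that)
  have bL: "b \<in> L2 UNIV" unfolding b_def by (rule L2_indicator_ball)
  define K where "K = cball x0 (2 * R)"
  define iK where "iK x = (indicator K x :: real)" for x
  have iKL: "iK \<in> L2 UNIV"
  proof (rule L2_bounded_support[where C=1 and R="norm x0 + 2 * R"])
    show "iK \<in> borel_measurable lebesgue" unfolding iK_def K_def by (intro borel_measurable_indicator) auto
    show "norm (iK x) \<le> 1" for x by (simp add: iK_def indicator_def)
    show "iK x = 0" if "norm x > norm x0 + 2 * R" for x
      using that norm_triangle_ineq2[of x x0] by (auto simp: iK_def K_def indicator_def dist_norm norm_minus_commute)
  qed
  define N where "N = norm b' * norm (lsq_of iK) + 1"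
  have N: "N \<ge> 1" by (simp add: N_def)
  \<comment> \<open>\<open>q\<close> collects the constants of the outer contribution; beyond
    \<open>k1\<close> it consumes at most half of the main term.\<close>
  define q where "q = C * N * (norm (lsq_of b) + 1)"
  have q: "q > 0" using C N by (simp add: q_def add_nonneg_pos)
  obtain k1 where k1: "k1 \<ge> 1" "\<And>k. k \<ge> k1 \<Longrightarrow> (k * 1 + 1) * exp (- (k * 1)) \<le> c0 / (2 * q)"
    by (rule linear_exp_small[of 1 1 "c0 / (2 * q)"]) (use c0 q in \<open>auto intro: that\<close>)
  define E where "E \<kappa> = exp (- (\<kappa> * (norm (p - x0) - \<eta> + \<delta> / 2)))" for \<kappa>
  have main: "\<bar>g\<bar> * (c0 / (2 * (C * N))) / (1 + \<kappa>) * exp (- (\<kappa> * (setdist D (ball p \<eta>) + \<delta>)))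
      \<le> norm (lsq_of (ext_zero (closure D) cV))"
    if \<kappa>: "\<kappa> \<ge> max k0 k1" and src: "maxwell_source \<kappa> g b V cV" for \<kappa> g V cV
  proof -
    have \<kappa>1: "\<kappa> \<ge> 1" "\<kappa> \<ge> k0" "\<kappa> \<ge> k1" using \<kappa> c0 by auto
    have V: "V \<in> L2 UNIV" "cV \<in> L2 UNIV" "weak_curl UNIV V cV" using src by (auto simp: maxwell_source_def)
    obtain \<Theta> where \<Theta>: "smooth_on UNIV \<Theta>" "\<And>s. s > 2 * R\<^sup>2 \<Longrightarrow> \<Theta> s = 0"
      and \<Theta>y: "\<And>s. \<rho>\<^sup>2 \<le> s \<Longrightarrow> s < R\<^sup>2 \<Longrightarrow> deriv \<Theta> s = yukawa1 \<kappa> s"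
      and O1: "\<And>s. s \<ge> 0 \<Longrightarrow> \<bar>\<kappa>\<^sup>2 * \<Theta> s - 4 * s * deriv (deriv \<Theta>) s - 6 * deriv \<Theta> s\<bar> \<le> C * (1 + \<kappa>)"
      and O2: "\<And>s. s > \<rho>\<^sup>2 \<Longrightarrow> \<bar>\<kappa>\<^sup>2 * \<Theta> s - 4 * s * deriv (deriv \<Theta>) s - 6 * deriv \<Theta> s\<bar> \<le> C * (1 + \<kappa>) * exp (- (\<kappa> * R))"
      and O3: "\<And>s. s > 2 * R\<^sup>2 \<Longrightarrow> \<kappa>\<^sup>2 * \<Theta> s - 4 * s * deriv (deriv \<Theta>) s - 6 * deriv \<Theta> s = 0"
      using prof[of \<kappa>] \<kappa>1 by auto
    define sq where "sq x = (norm (x - x0))\<^sup>2" for x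
    define v where "v x = \<Theta> (sq x) *\<^sub>R b'" for x
    define Om where "Om s = \<kappa>\<^sup>2 * \<Theta> s - 4 * s * deriv (deriv \<Theta>) s - 6 * deriv \<Theta> s" for s
    define w where "w x = Om (sq x) *\<^sub>R b'" for x
    note R13 = weak_curl_radial(1,3)[OF \<Theta> V, where c=x0 and b=b',
      folded sq_def, folded v_def[abs_def]]
    note R24 = weak_curl_radial(2,4)[OF \<Theta> V, where c=x0 and b=b' and \<kappa>=\<kappa>,
      folded sq_def, folded Om_def, folded v_def[abs_def] w_def[abs_def]]
    have wL: "w \<in> L2 UNIV" by (rule vtest_fun_L2[OF R24(1)])
    note vL = vtest_fun_L2[OF vtest_fun_curl[OF R13(1)]]
    note vvL = vtest_fun_L2[OF vtest_fun_curl[OF vtest_fun_curl[OF R13(1)]]]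
    have eq: "lsq_of cV \<bullet> lsq_of w = g * (lsq_of b \<bullet> lsq_of (curl v))"
      using R24(2) src vL vvL weak_curl_vtest_fun[OF vtest_fun_curl[OF R13(1)]]
      by (simp add: maxwell_source_def)
    have low: "c0 * E \<kappa> \<le> - (lsq_of b \<bullet> lsq_of (curl v))"
    proof -
      let ?F = "\<lambda>x. - (b x \<bullet> curl v x)"
      have "c0 * E \<kappa> \<le> (\<integral>x. ?F x \<partial>lebesgue)"
        unfolding E_def
      proof (rule lap[rule_format, OF \<kappa>1(2)])
        show "integrable lebesgue ?F" using L2_inner_integrable[OF bL vL] by simp
        show "?F x = 0" if "x \<notin> ball p \<eta>" for x using that by (simp add: b_def)
        fix x assume x: "x \<in> ball p \<eta>"
        then have "x \<notin> D" using disj'[of x] by auto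
        then have r1: "\<rho> < norm (x - x0)" using \<rho>(2) by (force simp: dist_norm norm_minus_commute)
        have r2: "norm (x - x0) < R"
          using x norm_triangle_ineq[of "x - p" "p - x0"] \<delta> \<rho> by (simp add: R_def dist_norm norm_minus_commute)
        have "\<rho>\<^sup>2 \<le> sq x" "sq x < R\<^sup>2"
          using r1 r2 \<rho> by (auto simp: sq_def intro!: power_mono power_strict_mono)
        note d = \<Theta>y[OF this]
        have sr: "sqrt (sq x) = norm (x - x0)" by (simp add: sq_def)
        have "b x \<bullet> curl v x = 2 * deriv \<Theta> (sq x) * ((x - x0) \<bullet> c)"
          using x by (simp add: R13(2) b_def b'a)
        then show "?F x = (\<kappa> * norm (x - x0) + 1) * exp (- (\<kappa> * norm (x - x0))) / norm (x - x0) ^ 3 * ((x - x0) \<bullet> c)"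
          by (simp add: d yukawa1_def sr)
      qed
      then show ?thesis by (simp add: inner_lsq_of bL vL)
    qed
    define In where "In = cball x0 \<rho>"
    have In: "In \<in> sets lebesgue" "- In \<in> sets lebesgue"
      by (simp_all add: In_def Compl_in_sets_lebesgue)
    note L1 = L2_restrict(2)[OF In(1) wL] and L2' = L2_restrict(2)[OF In(2) wL] and L3 = L2_restrict(2)[OF In(1) V(2)]
    have wz: "w x = 0" if "x \<notin> K" for x
    proof -
      have "2 * R < norm (x - x0)" using that by (simp add: K_def dist_norm norm_minus_commute)
      then have "(2 * R)\<^sup>2 < sq x" unfolding sq_def using R by (intro power_strict_mono) auto
      moreover have "2 * R\<^sup>2 \<le> (2 * R)\<^sup>2" by (simp add: power_mult_distrib)
      ultimately have "2 * R\<^sup>2 < sq x" by linarith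
      from O3[OF this] show ?thesis by (simp add: w_def Om_def)
    qed
    have n1: "norm (lsq_of (ext_zero In w)) \<le> C * (1 + \<kappa>) * N"
    proof -
      have "norm (lsq_of (ext_zero In w)) \<le> (C * (1 + \<kappa>) * norm b') * norm (lsq_of iK)"
      proof (rule norm_lsq_mono[OF L1 iKL])
        show "norm (ext_zero In w x) \<le> C * (1 + \<kappa>) * norm b' * norm (iK x)" for x
        proof (cases "x \<in> K")
          case True
          have "\<bar>Om (sq x)\<bar> * norm b' \<le> C * (1 + \<kappa>) * norm b'"
            using O1[of "sq x"] by (intro mult_right_mono) (auto simp: Om_def sq_def)
          moreover have "norm (ext_zero In w x) \<le> \<bar>Om (sq x)\<bar> * norm b'"
            by (simp add: ext_zero_def w_def indicator_def)
          ultimately show ?thesis using True by (simp add: iK_def)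
        qed (simp add: ext_zero_def wz iK_def)
      qed (use C \<kappa>1 in simp)
      also have "\<dots> \<le> C * (1 + \<kappa>) * N"
        unfolding N_def mult.assoc[of _ "norm b'"] using C \<kappa>1 by (intro mult_left_mono) auto
      finally show ?thesis .
    qed
    have n2: "norm (lsq_of (ext_zero (- In) w)) \<le> C * (1 + \<kappa>) * exp (- (\<kappa> * R)) * N"
    proof -
      have "norm (lsq_of (ext_zero (- In) w)) \<le> (C * (1 + \<kappa>) * exp (- (\<kappa> * R)) * norm b') * norm (lsq_of iK)"
      proof (rule norm_lsq_mono[OF L2' iKL])
        show "norm (ext_zero (- In) w x) \<le> C * (1 + \<kappa>) * exp (- (\<kappa> * R)) * norm b' * norm (iK x)" for x
        proof (cases "x \<in> K \<and> x \<notin> In")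
          case True
          then have "\<rho> < norm (x - x0)" by (simp add: In_def dist_norm norm_minus_commute)
          then have "\<rho>\<^sup>2 < sq x" unfolding sq_def using \<rho> by (intro power_strict_mono) auto
          then have "\<bar>Om (sq x)\<bar> * norm b' \<le> C * (1 + \<kappa>) * exp (- (\<kappa> * R)) * norm b'"
            using O2[of "sq x"] by (intro mult_right_mono) (auto simp: Om_def)
          then show ?thesis using True by (simp add: iK_def ext_zero_def w_def)
        next
          case False
          then have "ext_zero (- In) w x = 0" using wz[of x] by (auto simp: ext_zero_def)
          then show ?thesis using C \<kappa>1 by simp
        qed
      qed (use C \<kappa>1 in simp)
      also have "\<dots> \<le> C * (1 + \<kappa>) * exp (- (\<kappa> * R)) * N"
        unfolding N_def mult.assoc[of _ "norm b'"] using C \<kappa>1 by (intro mult_left_mono) auto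
      finally show ?thesis .
    qed
    have "lsq_of cV \<bullet> lsq_of w = lsq_of (ext_zero In cV) \<bullet> lsq_of (ext_zero In w) + lsq_of cV \<bullet> lsq_of (ext_zero (- In) w)"
    proof -
      have "w = (\<lambda>x. ext_zero In w x + ext_zero (- In) w x)"
        by (auto simp: ext_zero_def indicator_def fun_eq_iff)
      then have "lsq_of w = lsq_of (ext_zero In w) + lsq_of (ext_zero (- In) w)"
        using lsq_of_simps(2)[OF L1 L2'] by simp
      moreover have "lsq_of cV \<bullet> lsq_of (ext_zero In w) = lsq_of (ext_zero In cV) \<bullet> lsq_of (ext_zero In w)"
        unfolding inner_lsq_of[OF V(2) L1] inner_lsq_of[OF L3 L1]
        by (rule Bochner_Integration.integral_cong) (auto simp: ext_zero_def indicator_def)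
      ultimately show ?thesis by (simp add: inner_add_right)
    qed
    then have "\<bar>lsq_of cV \<bullet> lsq_of w\<bar> \<le> norm (lsq_of (ext_zero In cV)) * norm (lsq_of (ext_zero In w))
        + norm (lsq_of cV) * norm (lsq_of (ext_zero (- In) w))"
      by (simp only:) (intro order_trans[OF abs_triangle_ineq] add_mono Cauchy_Schwarz_ineq2)
    also have "\<dots> \<le> norm (lsq_of (ext_zero In cV)) * (C * (1 + \<kappa>) * N)
        + (\<bar>g\<bar> * norm (lsq_of b)) * (C * (1 + \<kappa>) * exp (- (\<kappa> * R)) * N)"
    proof (intro add_mono mult_mono mult_left_mono n1 n2)
      \<comment> \<open>The plain energy bound is enough for \<open>cV\<close> on the whole space,
        because it is multiplied by \<open>exp (- (\<kappa> * R))\<close>.\<close>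
      have "(norm (lsq_of cV))\<^sup>2 \<le> (\<bar>g\<bar> * norm (lsq_of b) / \<kappa>)\<^sup>2"
        using maxwell_source_energy[OF src _ bL] \<kappa>1 by (smt (verit) mult_nonneg_nonneg zero_le_power2)
      then have "norm (lsq_of cV) \<le> \<bar>g\<bar> * norm (lsq_of b) / \<kappa>"
        by (rule power2_le_imp_le) (use \<kappa>1 in simp)
      also have "\<dots> \<le> \<bar>g\<bar> * norm (lsq_of b) / 1" using \<kappa>1 by (intro divide_left_mono) auto
      finally show "norm (lsq_of cV) \<le> \<bar>g\<bar> * norm (lsq_of b)" by simp
    qed auto
    finally have up: "\<bar>lsq_of cV \<bullet> lsq_of w\<bar> \<le> norm (lsq_of (ext_zero In cV)) * (C * (1 + \<kappa>) * N)
        + (\<bar>g\<bar> * norm (lsq_of b)) * (C * (1 + \<kappa>) * exp (- (\<kappa> * R)) * N)" .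
    have tail: "norm (lsq_of b) * (C * (1 + \<kappa>) * exp (- (\<kappa> * R)) * N) \<le> c0 * E \<kappa> / 2"
    proof -
      have "exp (- (\<kappa> * R)) \<le> exp (- (\<kappa> * 1)) * E \<kappa>"
      proof -
        have "\<kappa> * (1 + (norm (p - x0) - \<eta> + \<delta> / 2)) \<le> \<kappa> * R"
          using \<kappa>1 \<eta> \<delta> \<rho> by (intro mult_left_mono) (auto simp: R_def)
        then show ?thesis by (simp add: E_def algebra_simps flip: exp_add)
      qed
      then have "norm (lsq_of b) * (C * (1 + \<kappa>) * exp (- (\<kappa> * R)) * N)
          \<le> (norm (lsq_of b) + 1) * (C * (1 + \<kappa>) * (exp (- (\<kappa> * 1)) * E \<kappa>) * N)"
        using C \<kappa>1 N by (intro mult_mono mult_right_mono mult_left_mono) (auto simp: E_def)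
      also have "\<dots> = q * ((\<kappa> * 1 + 1) * exp (- (\<kappa> * 1))) * E \<kappa>" by (simp add: q_def algebra_simps)
      also have "\<dots> \<le> q * (c0 / (2 * q)) * E \<kappa>"
        using k1(2)[OF \<kappa>1(3)] q by (intro mult_right_mono mult_left_mono) (auto simp: E_def)
      also have "\<dots> = c0 * E \<kappa> / 2" using q by simp
      finally show ?thesis .
    qed
    have "\<bar>g\<bar> * (c0 * E \<kappa>) \<le> \<bar>g\<bar> * \<bar>lsq_of b \<bullet> lsq_of (curl v)\<bar>"
      using low by (intro mult_left_mono) auto
    also have "\<dots> = \<bar>lsq_of cV \<bullet> lsq_of w\<bar>" by (simp add: eq abs_mult)
    also note up
    also have "(\<bar>g\<bar> * norm (lsq_of b)) * (C * (1 + \<kappa>) * exp (- (\<kappa> * R)) * N) \<le> \<bar>g\<bar> * (c0 * E \<kappa> / 2)"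
      unfolding mult.assoc[of "\<bar>g\<bar>"] using tail by (intro mult_left_mono) (auto simp: mult.assoc)
    finally have "\<bar>g\<bar> * (c0 * E \<kappa>) \<le> norm (lsq_of (ext_zero In cV)) * (C * (1 + \<kappa>) * N) + \<bar>g\<bar> * (c0 * E \<kappa> / 2)"
      by simp
    then have "\<bar>g\<bar> * (c0 * E \<kappa> / 2) \<le> norm (lsq_of (ext_zero In cV)) * (C * (1 + \<kappa>) * N)" by simp
    then have "\<bar>g\<bar> * (c0 * E \<kappa> / 2) / (C * (1 + \<kappa>) * N) \<le> norm (lsq_of (ext_zero In cV))"
      using C \<kappa>1 N by (subst pos_divide_le_eq) auto
    moreover have "\<bar>g\<bar> * (c0 * E \<kappa> / 2) / (C * (1 + \<kappa>) * N) = \<bar>g\<bar> * (c0 / (2 * (C * N))) / (1 + \<kappa>) * E \<kappa>"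
      using C N \<kappa>1 by (simp add: field_simps)
    moreover have "\<bar>g\<bar> * (c0 / (2 * (C * N))) / (1 + \<kappa>) * exp (- (\<kappa> * (setdist D (ball p \<eta>) + \<delta>)))
        \<le> \<bar>g\<bar> * (c0 / (2 * (C * N))) / (1 + \<kappa>) * E \<kappa>"
    proof (intro mult_left_mono)
      have "\<kappa> * (norm (p - x0) - \<eta> + \<delta> / 2) \<le> \<kappa> * (setdist D (ball p \<eta>) + \<delta>)"
        using \<kappa>1 xn by (intro mult_left_mono) auto
      then show "exp (- (\<kappa> * (setdist D (ball p \<eta>) + \<delta>))) \<le> E \<kappa>" by (simp add: E_def)
    qed (use C c0 \<kappa>1 N in simp)
    moreover have "norm (lsq_of (ext_zero In cV)) \<le> 1 * norm (lsq_of (ext_zero (closure D) cV))"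
    proof (rule norm_lsq_mono[OF L3])
      show "ext_zero (closure D) cV \<in> L2 UNIV" by (rule L2_restrict(2)[OF _ V(2)]) simp
      have "In \<subseteq> closure D" using \<rho>(2) closure_subset[of D] by (auto simp: In_def)
      then show "norm (ext_zero In cV x) \<le> 1 * norm (ext_zero (closure D) cV x)" for x
        by (auto simp: ext_zero_def indicator_def)
    qed simp
    ultimately show ?thesis by linarith
  qed
  show ?thesis
  proof (rule exI[of _ "c0 / (2 * (C * N))"], rule conjI[rotated], rule exI[of _ "max k0 k1"], intro conjI allI impI)
    show "max k0 k1 \<ge> 1" using c0 by simp
    show "c0 / (2 * (C * N)) > 0" using c0 C N by simp
  qed (rule main)
qed

section \<open>Rate of the indicator\<close>

text \<open>The algebra behind both bounds: up to terms with a factor \<open>m\<close>, the indicator is the energy of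
  \<open>W - V\<close>, and this energy is minimal among all competitors \<open>P\<close> for \<open>W\<close>.\<close>
lemma energy_identity:
  fixes V cV W C P K b e h :: "'a::real_inner"
  assumes \<kappa>: "\<kappa> > 0" and m: "0 \<le> m" and M: "0 \<le> M"
    and VV: "cV \<bullet> cV + \<kappa>\<^sup>2 * (V \<bullet> V) = g * (b \<bullet> V)"
    and VW: "cV \<bullet> C + \<kappa>\<^sup>2 * (V \<bullet> W) = g * (b \<bullet> W)"
    and VP: "cV \<bullet> K + \<kappa>\<^sup>2 * (V \<bullet> P) = g * (b \<bullet> P)"
    and WW: "C \<bullet> C + \<kappa>\<^sup>2 * (W \<bullet> W) = g * (b \<bullet> W) - m * (\<kappa> * (e \<bullet> W) + h \<bullet> C)"
    and WP: "C \<bullet> K + \<kappa>\<^sup>2 * (W \<bullet> P) = g * (b \<bullet> P) - m * (\<kappa> * (e \<bullet> P) + h \<bullet> K)"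
    and eh: "norm e \<le> M" "norm h \<le> M"
  defines "J \<equiv> - (g * (b \<bullet> (W - V)))" and "n0 \<equiv> \<bar>g\<bar> * norm b / \<kappa> + 2 * m * M"
  shows "(norm (C - cV))\<^sup>2 + \<kappa>\<^sup>2 * (norm (W - V))\<^sup>2 - 2 * m * M * n0 \<le> J"
    "J \<le> (norm (K - cV))\<^sup>2 + \<kappa>\<^sup>2 * (norm (P - V))\<^sup>2 + 4 * m\<^sup>2 * M\<^sup>2 + 2 * m * M * n0"
proof -
  \<comment> \<open>The energy norm of a pair; the final-time functional \<open>l\<close> below is
    bounded by \<open>2 * M\<close> with respect to it.\<close>
  define N where "N u c = sqrt ((norm c)\<^sup>2 + \<kappa>\<^sup>2 * (norm u)\<^sup>2)" for u c :: 'a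
  have N2: "(N u c)\<^sup>2 = c \<bullet> c + \<kappa>\<^sup>2 * (u \<bullet> u)" for u c
    by (simp add: N_def power2_norm_eq_inner)
  have N0: "0 \<le> N u c" for u c by (simp add: N_def)
  have cN: "norm c \<le> N u c" for u c unfolding N_def by (rule real_le_rsqrt) simp
  have uN: "\<kappa> * norm u \<le> N u c" for u c unfolding N_def by (rule real_le_rsqrt) (simp add: power_mult_distrib)
  define l where "l u c = \<kappa> * (e \<bullet> u) + h \<bullet> c" for u c
  have lN: "\<bar>l u c\<bar> \<le> 2 * M * N u c" for u c
  proof -
    have "\<bar>l u c\<bar> \<le> \<bar>\<kappa> * (e \<bullet> u)\<bar> + \<bar>h \<bullet> c\<bar>" unfolding l_def by (rule abs_triangle_ineq)
    also have "\<bar>\<kappa> * (e \<bullet> u)\<bar> \<le> \<kappa> * (norm e * norm u)"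
      using \<kappa> Cauchy_Schwarz_ineq2[of e u] by (simp add: abs_mult)
    also have "\<kappa> * (norm e * norm u) = norm e * (\<kappa> * norm u)" by simp
    also have "\<dots> \<le> M * N u c" using eh uN \<kappa> M by (intro mult_mono) auto
    also have "\<bar>h \<bullet> c\<bar> \<le> norm h * norm c" by (rule Cauchy_Schwarz_ineq2)
    also have "\<dots> \<le> M * N u c" using eh cN M by (intro mult_mono) auto
    finally show ?thesis by simp
  qed
  \<comment> \<open>The equation of \<open>W\<close> tested with \<open>W\<close> itself gives a
    quadratic inequality for its energy norm, which is then divided by \<open>N W C\<close>.\<close>
  have nW: "N W C \<le> n0"
  proof -
    have "(N W C)\<^sup>2 \<le> \<bar>g\<bar> * (norm b * norm W) + m * (2 * M * N W C)"
    proof -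
      have "(N W C)\<^sup>2 = g * (b \<bullet> W) - m * l W C" unfolding N2 WW l_def by simp
      moreover have "g * (b \<bullet> W) \<le> \<bar>g\<bar> * (norm b * norm W)"
      proof (rule order_trans[OF abs_ge_self])
        show "\<bar>g * (b \<bullet> W)\<bar> \<le> \<bar>g\<bar> * (norm b * norm W)"
          unfolding abs_mult by (intro mult_left_mono Cauchy_Schwarz_ineq2) simp
      qed
      moreover have "m * (- l W C) \<le> m * (2 * M * N W C)"
        using lN[of W C] m by (intro mult_left_mono) auto
      ultimately show ?thesis by simp
    qed
    moreover have "\<bar>g\<bar> * (norm b * norm W) \<le> \<bar>g\<bar> * norm b / \<kappa> * N W C"
    proof -
      have "\<bar>g\<bar> * norm b / \<kappa> * (\<kappa> * norm W) \<le> \<bar>g\<bar> * norm b / \<kappa> * N W C"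
        using \<kappa> by (intro mult_left_mono uN) auto
      then show ?thesis using \<kappa> by simp
    qed
    ultimately have *: "N W C * N W C \<le> N W C * n0"
      unfolding n0_def power2_eq_square distrib_left by (simp only: mult_ac)
    show ?thesis
    proof (cases "N W C = 0")
      case True
      then show ?thesis using m M \<kappa> by (simp add: n0_def)
    next
      case False
      then show ?thesis using * N0[of W C] by (simp add: mult_le_cancel_left)
    qed
  qed
  have lW: "\<bar>m * l W C\<bar> \<le> 2 * m * M * n0"
  proof -
    have "\<bar>m * l W C\<bar> \<le> m * (2 * M * N W C)" using lN[of W C] m by (simp add: abs_mult mult_left_mono)
    also have "\<dots> \<le> m * (2 * M * n0)" using nW m M by (intro mult_left_mono) auto
    finally show ?thesis by simp
  qed
  have "(N (W - V) (C - cV))\<^sup>2 = (C \<bullet> C + \<kappa>\<^sup>2 * (W \<bullet> W)) - 2 * (cV \<bullet> C + \<kappa>\<^sup>2 * (V \<bullet> W)) + (cV \<bullet> cV + \<kappa>\<^sup>2 * (V \<bullet> V))"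
    unfolding N2 by (simp add: inner_diff_left inner_diff_right inner_commute algebra_simps)
  then have J: "J = (N (W - V) (C - cV))\<^sup>2 + m * l W C"
    unfolding VV VW WW by (simp add: J_def l_def inner_diff_right algebra_simps)
  have "(N (W - V) (C - cV))\<^sup>2 = (norm (C - cV))\<^sup>2 + \<kappa>\<^sup>2 * (norm (W - V))\<^sup>2" by (simp add: N_def)
  with J lW show "(norm (C - cV))\<^sup>2 + \<kappa>\<^sup>2 * (norm (W - V))\<^sup>2 - 2 * m * M * n0 \<le> J" by linarith
  define Z where "Z = N (P - W) (K - C)"
  \<comment> \<open>After expanding the squares, the equations of \<open>V\<close> and
    \<open>W\<close> tested with \<open>P\<close> and with \<open>W\<close> remove everything but
    the final-time terms.\<close>
  have "(N (P - V) (K - cV))\<^sup>2 - Z\<^sup>2 - (N (W - V) (C - cV))\<^sup>2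
      = 2 * ((C \<bullet> K + \<kappa>\<^sup>2 * (W \<bullet> P)) - (cV \<bullet> K + \<kappa>\<^sup>2 * (V \<bullet> P))
        - ((C \<bullet> C + \<kappa>\<^sup>2 * (W \<bullet> W)) - (cV \<bullet> C + \<kappa>\<^sup>2 * (V \<bullet> W))))"
    unfolding N2 Z_def by (simp add: inner_diff_left inner_diff_right inner_commute algebra_simps)
  also have "\<dots> = - (2 * (m * l (P - W) (K - C)))"
    unfolding VP VW WW WP by (simp add: l_def inner_diff_right algebra_simps)
  finally have R: "(N (W - V) (C - cV))\<^sup>2 = (N (P - V) (K - cV))\<^sup>2 - Z\<^sup>2 + 2 * (m * l (P - W) (K - C))"
    by linarith
  \<comment> \<open>The error tested with \<open>P - W\<close> is absorbed by the square
    \<open>Z\<^sup>2\<close> that minimality leaves over, so it costs only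
    \<open>4 * m\<^sup>2 * M\<^sup>2\<close>.\<close>
  have "2 * (m * l (P - W) (K - C)) \<le> 2 * (m * (2 * M * Z))"
    using lN[of "P - W" "K - C"] m unfolding Z_def by (intro mult_left_mono) auto
  also have "\<dots> = 2 * Z * (2 * m * M)" by simp
  also have "\<dots> \<le> Z\<^sup>2 + (2 * m * M)\<^sup>2" by (rule sum_squares_bound)
  finally have "(N (W - V) (C - cV))\<^sup>2 \<le> (N (P - V) (K - cV))\<^sup>2 + 4 * m\<^sup>2 * M\<^sup>2"
    using R by (simp add: power_mult_distrib)
  moreover have "(N (P - V) (K - cV))\<^sup>2 = (norm (K - cV))\<^sup>2 + \<kappa>\<^sup>2 * (norm (P - V))\<^sup>2" by (simp add: N_def)
  ultimately show "J \<le> (norm (K - cV))\<^sup>2 + \<kappa>\<^sup>2 * (norm (P - V))\<^sup>2 + 4 * m\<^sup>2 * M\<^sup>2 + 2 * m * M * n0"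
    using J lW by linarith
qed

text \<open>The competitor agrees with \<open>V\<close> up to radius \<open>r1\<close>, so it
  differs from \<open>V\<close> only in \<open>N\<close>. The constant is uniform in
  \<open>\<kappa> \<ge> 1\<close>: the gradient of the cutoff multiplies \<open>V\<close> without
  derivatives, and the term \<open>\<kappa>\<^sup>2\<close> times the squared norm of
  \<open>V\<close> pays for it.\<close>

lemma cutoff_competitor:
  fixes p :: "real^3"
  assumes r: "0 < r1" "r1 < r2"
  defines "N \<equiv> {x. r1 \<le> norm (x - p)}"
  shows "\<exists>C\<ge>0. \<forall>\<kappa>\<ge>1. \<forall>V cV. V \<in> L2 UNIV \<longrightarrow> cV \<in> L2 UNIV \<longrightarrow> weak_curl UNIV V cV \<longrightarrow>
    (\<exists>\<Psi> K. \<Psi> \<in> L2 UNIV \<and> K \<in> L2 UNIV \<and> weak_curl UNIV \<Psi> K \<and>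
      (\<forall>x. r2 < norm (x - p) \<longrightarrow> \<Psi> x = 0 \<and> K x = 0) \<and>
      (norm (lsq_of K - lsq_of cV))\<^sup>2 + \<kappa>\<^sup>2 * (norm (lsq_of \<Psi> - lsq_of V))\<^sup>2
      \<le> C * ((norm (lsq_of (ext_zero N cV)))\<^sup>2 + \<kappa>\<^sup>2 * (norm (lsq_of (ext_zero N V)))\<^sup>2))"
proof -
  have r12: "r1\<^sup>2 < r2\<^sup>2" using r by (intro power_strict_mono) auto
  define ps where "ps x = smooth_step ((r2\<^sup>2 - (norm (x - p))\<^sup>2) / (r2\<^sup>2 - r1\<^sup>2))" for x
  have ps: "0 \<le> ps x" "ps x \<le> 1" for x by (simp_all add: ps_def smooth_step_simps)
  have psa: "\<bar>ps x\<bar> \<le> 1" "\<bar>ps x - 1\<bar> \<le> 1" for x using ps[of x] by simp_all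
  have ps0: "ps x = 0" if "r2 \<le> norm (x - p)" for x
  proof -
    have "r2\<^sup>2 \<le> (norm (x - p))\<^sup>2" using that r by (intro power_mono) auto
    then have "(r2\<^sup>2 - (norm (x - p))\<^sup>2) / (r2\<^sup>2 - r1\<^sup>2) \<le> 0" using r12 by (intro divide_nonpos_pos) auto
    then show ?thesis by (simp add: ps_def smooth_step_simps)
  qed
  have ps1: "ps x = 1" if "norm (x - p) \<le> r1" for x
  proof -
    have "(norm (x - p))\<^sup>2 \<le> r1\<^sup>2" using that by (intro power_mono) auto
    then have "1 \<le> (r2\<^sup>2 - (norm (x - p))\<^sup>2) / (r2\<^sup>2 - r1\<^sup>2)" using r12 by (simp add: pos_le_divide_eq)
    then show ?thesis by (simp add: ps_def smooth_step_simps)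
  qed
  have sps: "smooth_on UNIV ps"
    unfolding ps_def divide_inverse
    by (intro smooth_on_compose[OF _ smooth_on_smooth_step] smooth_on_mult smooth_on_diff smooth_on_const smooth_on_norm_sq) auto
  have tps: "test_fun UNIV ps"
    by (rule test_funI[OF sps compact_cball[of p r2]]) (auto simp: ps0 dist_norm norm_minus_commute)
  obtain C where C: "C \<ge> 0" "\<And>x v. \<bar>fderiv ps v x\<bar> \<le> C * norm v" using fderiv_bound[OF tps] by blast
  have gC: "norm (grad ps x) \<le> C" for x
  proof -
    have "norm (grad ps x) * norm (grad ps x) = fderiv ps (grad ps x) x"
      using fderiv_grad[OF smooth_on_differentiable[OF sps UNIV_I], of x "grad ps x"]
      by (simp flip: power2_eq_square power2_norm_eq_inner)
    also have "\<dots> \<le> C * norm (grad ps x)" using C(2)[of x "grad ps x"] by linarith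
    finally show ?thesis by (cases "grad ps x = 0") (auto simp: C(1))
  qed
  have g0: "grad ps x = 0" if "norm (x - p) < r1 \<or> r2 < norm (x - p)" for x
  proof -
    have "frechet_derivative ps (at x) = frechet_derivative (\<lambda>_. ps x) (at x)"
      using that
    proof
      assume "norm (x - p) < r1"
      then show ?thesis
        by (intro frechet_derivative_cong_open[of "ball p r1"]) (auto simp: ps1 dist_norm norm_minus_commute)
    next
      assume "r2 < norm (x - p)"
      then show ?thesis
        by (intro frechet_derivative_cong_open[of "- cball p r2"]) (auto simp: ps0 dist_norm norm_minus_commute)
    qed
    then show ?thesis by (simp add: vec_eq_iff)
  qed
  have "closed N" unfolding N_def by (intro closed_Collect_le continuous_intros)
  then have N: "N \<in> sets lebesgue" by simp
  show ?thesis
  proof (rule exI[of _ "2 + 2 * C\<^sup>2"], intro conjI allI impI)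
    fix \<kappa> :: real and V cV :: "real^3 \<Rightarrow> real^3"
    assume \<kappa>: "1 \<le> \<kappa>" and V: "V \<in> L2 UNIV" "cV \<in> L2 UNIV" "weak_curl UNIV V cV"
    note WC = weak_curl_mult[OF V sps psa(1) gC]
    define \<Psi> where "\<Psi> x = ps x *\<^sub>R V x" for x
    define K where "K x = ps x *\<^sub>R cV x + cross3 (grad ps x) (V x)" for x
    note WC' = WC[folded \<Psi>_def K_def]
    note L = L2_restrict(2)[OF N V(1)] L2_restrict(2)[OF N V(2)]
    define \<alpha> where "\<alpha> = norm (lsq_of (ext_zero N cV))"
    define \<beta> where "\<beta> = norm (lsq_of (ext_zero N V))"
    have n1: "norm (lsq_of \<Psi> - lsq_of V) \<le> 1 * \<beta>"
    proof -
      have d: "(\<lambda>x. \<Psi> x - V x) \<in> L2 UNIV" using L2_diff[OF WC'(1) V(1)] .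
      have "norm (lsq_of (\<lambda>x. \<Psi> x - V x)) \<le> 1 * \<beta>"
        unfolding \<beta>_def
      proof (rule norm_lsq_mono[OF d L(1)])
        show "norm (\<Psi> x - V x) \<le> 1 * norm (ext_zero N V x)" for x
        proof (cases "x \<in> N")
          case True
          have "\<Psi> x - V x = (ps x - 1) *\<^sub>R V x" by (simp add: \<Psi>_def scaleR_diff_left)
          then show ?thesis using True psa(2)[of x] by (simp add: ext_zero_def mult_left_le_one_le)
        next
          case False
          then show ?thesis using ps1[of x] by (simp add: \<Psi>_def N_def)
        qed
      qed simp
      then show ?thesis by (simp add: lsq_of_simps WC'(1) V(1))
    qed
    have n2: "norm (lsq_of K - lsq_of cV) \<le> 1 * \<alpha> + C * \<beta>"
    proof -
      let ?a = "\<lambda>x. (ps x - 1) *\<^sub>R cV x" and ?b = "\<lambda>x. cross3 (grad ps x) (V x)"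
      have psm: "(\<lambda>x. ps x - 1) \<in> borel_measurable lebesgue"
        using continuous_measurable_lebesgue[OF smooth_on_continuous[OF sps]] by simp
      have aL: "?a \<in> L2 UNIV" by (rule L2_mult[OF V(2) psm psa(2)])
      have bL: "?b \<in> L2 UNIV" by (rule L2_cross[OF V(1) smooth_grad_measurable[OF sps] gC])
      have "lsq_of K - lsq_of cV = lsq_of (\<lambda>x. K x - cV x)" by (simp add: lsq_of_simps WC'(2) V(2))
      also have "(\<lambda>x. K x - cV x) = (\<lambda>x. ?a x + ?b x)" by (simp add: K_def scaleR_diff_left fun_eq_iff)
      also have "lsq_of \<dots> = lsq_of ?a + lsq_of ?b" by (rule lsq_of_simps(2)[OF aL bL])
      finally have "norm (lsq_of K - lsq_of cV) \<le> norm (lsq_of ?a) + norm (lsq_of ?b)"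
        using norm_triangle_ineq[of "lsq_of ?a" "lsq_of ?b"] by simp
      moreover have "norm (lsq_of ?a) \<le> 1 * \<alpha>"
        unfolding \<alpha>_def
      proof (rule norm_lsq_mono[OF aL L(2)])
        show "norm (?a x) \<le> 1 * norm (ext_zero N cV x)" for x
        proof (cases "x \<in> N")
          case True
          then show ?thesis using psa(2)[of x] by (simp add: ext_zero_def mult_left_le_one_le)
        next
          case False
          then show ?thesis using ps1[of x] by (simp add: N_def)
        qed
      qed simp
      moreover have "norm (lsq_of ?b) \<le> C * \<beta>"
        unfolding \<beta>_def
      proof (rule norm_lsq_mono[OF bL L(1) C(1)])
        show "norm (?b x) \<le> C * norm (ext_zero N V x)" for x
        proof (cases "x \<in> N")
          case True
          then show ?thesis
            using order_trans[OF norm_cross3_le mult_right_mono[OF gC norm_ge_zero]] by (simp add: ext_zero_def)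
        next
          case False
          then show ?thesis using g0[of x] C(1) by (simp add: N_def)
        qed
      qed
      ultimately show ?thesis by linarith
    qed
    have "(norm (lsq_of K - lsq_of cV))\<^sup>2 + \<kappa>\<^sup>2 * (norm (lsq_of \<Psi> - lsq_of V))\<^sup>2 \<le> (\<alpha> + C * \<beta>)\<^sup>2 + \<kappa>\<^sup>2 * \<beta>\<^sup>2"
      using n1 n2 by (intro add_mono mult_left_mono power_mono) auto
    also have "\<dots> \<le> (2 * \<alpha>\<^sup>2 + 2 * (C * \<beta>)\<^sup>2) + \<kappa>\<^sup>2 * \<beta>\<^sup>2"
      using sum_squares_bound[of \<alpha> "C * \<beta>"] by (simp add: power2_sum)
    also have "\<dots> \<le> (2 + 2 * C\<^sup>2) * (\<alpha>\<^sup>2 + \<kappa>\<^sup>2 * \<beta>\<^sup>2)"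
    proof -
      have "1 \<le> \<kappa>\<^sup>2" using \<kappa> by (simp add: one_le_power)
      then have "2 * C\<^sup>2 * (1 * \<beta>\<^sup>2) \<le> 2 * C\<^sup>2 * (\<kappa>\<^sup>2 * \<beta>\<^sup>2)"
        by (intro mult_left_mono mult_right_mono) auto
      moreover have "0 \<le> 2 * C\<^sup>2 * \<alpha>\<^sup>2" "0 \<le> \<kappa>\<^sup>2 * \<beta>\<^sup>2" by auto
      ultimately show ?thesis unfolding power_mult_distrib distrib_right distrib_left by linarith
    qed
    finally have fin: "(norm (lsq_of K - lsq_of cV))\<^sup>2 + \<kappa>\<^sup>2 * (norm (lsq_of \<Psi> - lsq_of V))\<^sup>2
      \<le> (2 + 2 * C\<^sup>2) * (\<alpha>\<^sup>2 + \<kappa>\<^sup>2 * \<beta>\<^sup>2)" .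
    show "\<exists>\<Psi> K. \<Psi> \<in> L2 UNIV \<and> K \<in> L2 UNIV \<and> weak_curl UNIV \<Psi> K \<and>
      (\<forall>x. r2 < norm (x - p) \<longrightarrow> \<Psi> x = 0 \<and> K x = 0) \<and>
      (norm (lsq_of K - lsq_of cV))\<^sup>2 + \<kappa>\<^sup>2 * (norm (lsq_of \<Psi> - lsq_of V))\<^sup>2
      \<le> (2 + 2 * C\<^sup>2) * ((norm (lsq_of (ext_zero N cV)))\<^sup>2 + \<kappa>\<^sup>2 * (norm (lsq_of (ext_zero N V)))\<^sup>2)"
    proof (rule exI[of _ \<Psi>], rule exI[of _ K], intro conjI allI impI)
      show "\<Psi> x = 0" "K x = 0" if "r2 < norm (x - p)" for x
        using that ps0[of x] g0[of x] by (simp_all add: \<Psi>_def K_def)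
    qed (use WC' fin in \<open>simp_all add: \<alpha>_def \<beta>_def\<close>)
  qed simp
qed

section \<open>Two-sided exponential bounds and the logarithmic limit\<close>

lemma log_rate_limit:
  fixes I :: "real \<Rightarrow> real"
  assumes "\<And>e. e > 0 \<Longrightarrow> \<forall>\<^sub>F t in at_top. exp (- (L + e) * t) \<le> I t \<and> I t \<le> exp (- (L - e) * t)"
  shows "((\<lambda>t. ln \<bar>I t\<bar> / t) \<longlongrightarrow> - L) at_top" "\<exists>t0>0. \<forall>t\<ge>t0. I t > 0"
proof -
  show "((\<lambda>t. ln \<bar>I t\<bar> / t) \<longlongrightarrow> - L) at_top"
  proof (rule tendstoI)
    fix e :: real assume e: "e > 0"
    have "\<forall>\<^sub>F t in at_top. exp (- (L + e/2) * t) \<le> I t \<and> I t \<le> exp (- (L - e/2) * t)"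
      using assms[of "e/2"] e by simp
    then show "\<forall>\<^sub>F t in at_top. dist (ln \<bar>I t\<bar> / t) (- L) < e"
      using eventually_gt_at_top[of 0]
    proof eventually_elim
      case (elim t)
      have p: "I t > 0" using elim less_le_trans[OF exp_gt_zero] by blast
      have "- (L + e/2) * t \<le> ln (I t)" using elim p ln_le_cancel_iff[of "exp (- (L + e/2) * t)" "I t"] by simp
      moreover have "ln (I t) \<le> - (L - e/2) * t" using elim p ln_le_cancel_iff[of "I t" "exp (- (L - e/2) * t)"] by simp
      ultimately have "- (L + e/2) \<le> ln (I t) / t" "ln (I t) / t \<le> - (L - e/2)"
        using elim by (simp_all only: pos_le_divide_eq pos_divide_le_eq)
      then show ?case using p e by (simp add: dist_real_def)
    qed
  qed
  obtain t1 where t1: "\<And>t. t \<ge> t1 \<Longrightarrow> exp (- (L + 1) * t) \<le> I t"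
    using assms[of 1] by (auto simp: eventually_at_top_linorder)
  have "I t > 0" if "t \<ge> max t1 1" for t
    using t1[of t] that less_le_trans[OF exp_gt_zero] by auto
  then show "\<exists>t0>0. \<forall>t\<ge>t0. I t > 0" by (intro exI[of _ "max t1 1"]) auto
qed

lemma ftilde_bounded:
  assumes T: "0 < T" and f: "continuous_on {0..T} f"
  obtains F0 where "F0 \<ge> 0" "\<And>\<tau>. \<tau> \<ge> 0 \<Longrightarrow> \<bar>ftilde T f \<tau>\<bar> \<le> F0"
proof -
  have "compact (f ` {0..T})" using f by (intro compact_continuous_image) auto
  then obtain B where B: "\<And>t. t \<in> {0..T} \<Longrightarrow> \<bar>f t\<bar> \<le> B"
    by (metis compact_imp_bounded bounded_iff imageI real_norm_def)
  have B0: "B \<ge> 0" using B[of 0] T by auto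
  have "\<bar>ftilde T f \<tau>\<bar> \<le> B * T" if \<tau>: "\<tau> \<ge> 0" for \<tau>
  proof -
    have c: "continuous_on {0..T} (\<lambda>t. exp (- \<tau> * t) * f t)" by (intro continuous_intros f)
    have "norm (integral {0..T} (\<lambda>t. exp (- \<tau> * t) * f t)) \<le> B * (T - 0)"
    proof (rule integral_bound[OF less_imp_le[OF T] c])
      fix t assume t: "t \<in> {0..T}"
      have "exp (- \<tau> * t) * \<bar>f t\<bar> \<le> 1 * B"
        using t \<tau> B[OF t] by (intro mult_mono) auto
      then show "norm (exp (- \<tau> * t) * f t) \<le> B" by (simp add: abs_mult)
    qed
    then show ?thesis unfolding ftilde_def using LINT_interval_continuous[OF c] by simp
  qed
  then show ?thesis using that[of "B * T"] B0 T by auto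
qed

lemma power2_le_self: "0 \<le> (m::real) \<Longrightarrow> m \<le> 1 \<Longrightarrow> m\<^sup>2 \<le> m"
  by (simp add: power2_eq_square mult_left_le)

text \<open>\<open>R\<close> precedes \<open>\<delta>\<close>: the final-time error has one fixed
  constant, while \<open>c\<close> and \<open>A\<close> may degenerate as \<delta> tends to 0. The
  lower bound keeps \<open>F \<tau>\<close>, since the pulse may have a small transform; the upper
  bound replaces it by \<open>F0\<close>.\<close>

lemma enclosure_bounds:
  fixes D :: "(real^3) set" and p a :: "real^3" and F :: "real \<Rightarrow> real"
  assumes D: "open D" "D \<noteq> {}" and \<eta>: "\<eta> > 0" and disj: "cball p \<eta> \<inter> closure D = {}"
    and a: "norm a = 1" and \<sigma>: "\<sigma> > 0" and \<mu>: "\<mu> > 0" and T: "T > 0"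
    and F: "\<And>\<tau>. \<tau> \<ge> 0 \<Longrightarrow> \<bar>F \<tau>\<bar> \<le> F0"
  defines "b \<equiv> \<lambda>x. indicator (ball p \<eta>) x *\<^sub>R a"
  assumes src: "\<And>\<tau>. \<tau> > 0 \<Longrightarrow> maxwell_source (\<sigma> * \<tau>) (\<mu> * \<tau> * F \<tau>) b (V \<tau>) (cV \<tau>)"
    and WC: "\<And>\<tau>. \<tau> > 0 \<Longrightarrow> H0curl D (W \<tau>) (C \<tau>)"
    and eq: "\<And>\<tau> \<Psi> K. \<tau> > 0 \<Longrightarrow> H0curl D \<Psi> K \<Longrightarrow> C \<tau> \<bullet> K + (\<sigma> * \<tau>)\<^sup>2 * (W \<tau> \<bullet> \<Psi>)
      = \<mu> * \<tau> * F \<tau> * (lsq_of b \<bullet> \<Psi>) - exp (- \<tau> * T) * (\<sigma> * \<tau> * (e \<bullet> \<Psi>) + h \<bullet> K)"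
  defines "J \<equiv> \<lambda>\<tau>. - (\<mu> * \<tau> * F \<tau> * (lsq_of b \<bullet> (W \<tau> - lsq_of (V \<tau>))))"
    and "d \<equiv> setdist D (ball p \<eta>)"
  shows "\<exists>R\<ge>0. (\<forall>\<delta>>0. \<exists>c>0. \<forall>\<^sub>F \<tau> in at_top. c * (F \<tau>)\<^sup>2 * exp (- (2 * \<sigma> * (d + \<delta>)) * \<tau>) - R * exp (- T * \<tau>) \<le> J \<tau>) \<and>
    (\<forall>\<delta>>0. \<exists>A\<ge>0. \<forall>\<^sub>F \<tau> in at_top. J \<tau> \<le> A * exp (- (2 * \<sigma> * (d - \<delta>)) * \<tau>) + R * exp (- T * \<tau>))"
proof -
  define M where "M = max (norm e) (norm h)"
  have M: "norm e \<le> M" "norm h \<le> M" "0 \<le> M" by (auto simp: M_def le_max_iff_disj)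
  have F0: "F0 \<ge> 0" using F[of 0] by simp
  have bL: "b \<in> L2 UNIV"
    unfolding b_def by (rule L2_indicator_ball)
  define \<beta> where "\<beta> = norm (lsq_of b)"
  \<comment> \<open>With the factor \<open>exp (- \<tau> * T)\<close> at most 1 and \<open>F\<close>
    bounded by \<open>F0\<close>, this dominates the constant \<open>n0\<close> of the energy
    identity for every \<open>\<tau> > 0\<close>.\<close>
  define N1 where "N1 = \<mu> * F0 * \<beta> / \<sigma> + 2 * M"
  define R where "R = 4 * M\<^sup>2 + 2 * M * N1"
  have N1: "0 \<le> N1" using M F0 \<mu> \<sigma> by (simp add: N1_def \<beta>_def)
  have R: "0 \<le> R" using M N1 by (simp add: R_def)
  have gk: "\<bar>\<mu> * \<tau> * F \<tau>\<bar> * \<beta> / (\<sigma> * \<tau>) \<le> \<mu> * F0 * \<beta> / \<sigma>" if \<tau>: "\<tau> > 0" for \<tau>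
  proof -
    have "\<bar>\<mu> * \<tau> * F \<tau>\<bar> * \<beta> / (\<sigma> * \<tau>) = \<mu> * \<bar>F \<tau>\<bar> * \<beta> / \<sigma>" using \<tau> \<mu> \<sigma> by (simp add: abs_mult)
    also have "\<dots> \<le> \<mu> * F0 * \<beta> / \<sigma>"
      using F[of \<tau>] \<tau> \<mu> \<sigma> by (intro divide_right_mono mult_right_mono mult_left_mono) (auto simp: \<beta>_def)
    finally show ?thesis .
  qed
  have m: "0 \<le> exp (- \<tau> * T)" "exp (- \<tau> * T) \<le> 1" if "\<tau> > 0" for \<tau> using that T by simp_all
  have err: "4 * (exp (- \<tau> * T))\<^sup>2 * M\<^sup>2 + 2 * exp (- \<tau> * T) * M * (\<bar>\<mu> * \<tau> * F \<tau>\<bar> * \<beta> / (\<sigma> * \<tau>) + 2 * exp (- \<tau> * T) * M)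
      \<le> R * exp (- T * \<tau>)" if \<tau>: "\<tau> > 0" for \<tau>
  proof -
    note m = m[OF \<tau>]
    have "\<bar>\<mu> * \<tau> * F \<tau>\<bar> * \<beta> / (\<sigma> * \<tau>) + 2 * exp (- \<tau> * T) * M \<le> N1"
      unfolding N1_def using gk[OF \<tau>] mult_right_mono[OF m(2) M(3)] by simp
    then have "2 * exp (- \<tau> * T) * M * (\<bar>\<mu> * \<tau> * F \<tau>\<bar> * \<beta> / (\<sigma> * \<tau>) + 2 * exp (- \<tau> * T) * M) \<le> 2 * exp (- \<tau> * T) * M * N1"
      using m M by (intro mult_left_mono) auto
    moreover have "4 * (exp (- \<tau> * T))\<^sup>2 * M\<^sup>2 \<le> 4 * exp (- \<tau> * T) * M\<^sup>2"
      using power2_le_self[OF m] by (intro mult_right_mono mult_left_mono) auto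
    ultimately show ?thesis by (simp add: R_def algebra_simps)
  qed
  \<comment> \<open>Both bounds come from one use of the energy identity. The test pair matters for
    the second one; the first is applied later with zero fields.\<close>
  have low: "(norm (C \<tau> - lsq_of (cV \<tau>)))\<^sup>2 - R * exp (- T * \<tau>) \<le> J \<tau>"
    and up: "J \<tau> \<le> (norm (lsq_of \<zeta> - lsq_of (cV \<tau>)))\<^sup>2 + (\<sigma> * \<tau>)\<^sup>2 * (norm (lsq_of \<psi> - lsq_of (V \<tau>)))\<^sup>2 + R * exp (- T * \<tau>)"
    if \<tau>: "\<tau> > 0" and z: "\<psi> \<in> L2 UNIV" "\<zeta> \<in> L2 UNIV" "weak_curl UNIV \<psi> \<zeta>"
      "\<And>x. x \<in> closure D \<Longrightarrow> \<psi> x = 0 \<and> \<zeta> x = 0" for \<tau> \<psi> \<zeta>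
  proof -
    obtain u w where uw: "u \<in> L2 UNIV" "w \<in> L2 UNIV" "weak_curl UNIV u w" "W \<tau> = lsq_of u" "C \<tau> = lsq_of w"
      using WC[OF \<tau>] unfolding H0curl_def by (elim exE conjE) (rule that)
    note s = src[OF \<tau>, unfolded maxwell_source_def]
    have st: "lsq_of (cV \<tau>) \<bullet> lsq_of K + (\<sigma> * \<tau>)\<^sup>2 * (lsq_of (V \<tau>) \<bullet> lsq_of \<Psi>) = \<mu> * \<tau> * F \<tau> * (lsq_of b \<bullet> lsq_of \<Psi>)"
      if "\<Psi> \<in> L2 UNIV" "K \<in> L2 UNIV" "weak_curl UNIV \<Psi> K" for \<Psi> K using s that by blast
    have sV: "V \<tau> \<in> L2 UNIV" "cV \<tau> \<in> L2 UNIV" "weak_curl UNIV (V \<tau>) (cV \<tau>)" using s by blast+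
    have z0: "H0curl D (lsq_of \<psi>) (lsq_of \<zeta>)" unfolding H0curl_def using z by blast
    have k: "0 < \<sigma> * \<tau>" using \<sigma> \<tau> by simp
    note ids = energy_identity[OF k m(1)[OF \<tau>] M(3) st[OF sV] st[OF uw(1-3), folded uw(4,5)] st[OF z(1-3)]
        eq[OF \<tau> WC[OF \<tau>]] eq[OF \<tau> z0] M(1,2), folded \<beta>_def]
    have "0 \<le> 4 * (exp (- \<tau> * T))\<^sup>2 * M\<^sup>2" by simp
    moreover have "0 \<le> (\<sigma> * \<tau>)\<^sup>2 * (norm (W \<tau> - lsq_of (V \<tau>)))\<^sup>2" by simp
    ultimately show "(norm (C \<tau> - lsq_of (cV \<tau>)))\<^sup>2 - R * exp (- T * \<tau>) \<le> J \<tau>"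
      using ids(1) err[OF \<tau>] unfolding J_def by linarith
    show "J \<tau> \<le> (norm (lsq_of \<zeta> - lsq_of (cV \<tau>)))\<^sup>2 + (\<sigma> * \<tau>)\<^sup>2 * (norm (lsq_of \<psi> - lsq_of (V \<tau>)))\<^sup>2 + R * exp (- T * \<tau>)"
      using ids(2) err[OF \<tau>] unfolding J_def by linarith
  qed
  have lower: "\<exists>c>0. \<forall>\<^sub>F \<tau> in at_top. c * (F \<tau>)\<^sup>2 * exp (- (2 * \<sigma> * (d + \<delta>)) * \<tau>) - R * exp (- T * \<tau>) \<le> J \<tau>"
    if \<delta>: "\<delta> > 0" for \<delta>
  proof -
    obtain c k0 where c: "c > 0" and k0: "k0 \<ge> 1"
      and ck: "\<And>\<kappa> g V cV. \<kappa> \<ge> k0 \<Longrightarrow> maxwell_source \<kappa> g b V cV \<Longrightarrow>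
        \<bar>g\<bar> * c / (1 + \<kappa>) * exp (- (\<kappa> * (d + \<delta>))) \<le> norm (lsq_of (ext_zero (closure D) cV))"
      using maxwell_source_lower[OF D \<eta> disj a \<delta>, folded b_def d_def] by (elim exE conjE) (rule that, blast+)
    \<comment> \<open>\<open>\<mu> * \<tau> * c / (1 + \<sigma> * \<tau>)\<close> increases with
      \<open>\<tau>\<close>; its value at 1, squared, serves for all
      \<open>\<tau> \<ge> 1\<close>.\<close>
    define c' where "c' = (\<mu> * c / (1 + \<sigma>))\<^sup>2"
    have "c' > 0" using \<mu> c \<sigma> by (simp add: c'_def)
    moreover have "c' * (F \<tau>)\<^sup>2 * exp (- (2 * \<sigma> * (d + \<delta>)) * \<tau>) - R * exp (- T * \<tau>) \<le> J \<tau>"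
      if t: "\<tau> \<ge> max 1 (k0 / \<sigma>)" for \<tau>
    proof -
      have \<tau>: "\<tau> > 0" "\<tau> \<ge> 1" and k: "\<sigma> * \<tau> \<ge> k0"
        using t \<sigma> by (auto simp: pos_divide_le_eq mult.commute)
      have "\<bar>F \<tau>\<bar> * (\<mu> * c / (1 + \<sigma>)) \<le> \<bar>F \<tau>\<bar> * (\<mu> * \<tau> * c / (1 + \<sigma> * \<tau>))"
      proof (intro mult_left_mono)
        have "\<mu> * c * (1 + \<sigma> * \<tau>) \<le> \<mu> * c * (\<tau> * (1 + \<sigma>))"
          using \<mu> c \<tau> by (intro mult_left_mono) (auto simp: algebra_simps)
        moreover have "1 + \<sigma> * \<tau> > 0" "1 + \<sigma> > 0" using \<sigma> \<tau> by (auto intro: add_pos_pos)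
        ultimately show "\<mu> * c / (1 + \<sigma>) \<le> \<mu> * \<tau> * c / (1 + \<sigma> * \<tau>)"
          by (simp add: frac_le_eq pos_divide_le_eq pos_le_divide_eq mult_ac)
      qed simp
      also have "\<dots> = \<bar>\<mu> * \<tau> * F \<tau>\<bar> * c / (1 + \<sigma> * \<tau>)" using \<mu> \<tau> by (simp add: abs_mult)
      finally have "\<bar>F \<tau>\<bar> * (\<mu> * c / (1 + \<sigma>)) * exp (- (\<sigma> * \<tau> * (d + \<delta>)))
          \<le> \<bar>\<mu> * \<tau> * F \<tau>\<bar> * c / (1 + \<sigma> * \<tau>) * exp (- (\<sigma> * \<tau> * (d + \<delta>)))" by (intro mult_right_mono) auto
      also have "\<dots> \<le> norm (lsq_of (ext_zero (closure D) (cV \<tau>)))" by (rule ck[OF k src[OF \<tau>(1)]])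
      \<comment> \<open>\<open>C \<tau>\<close> has a representative vanishing on
        \<open>closure D\<close>, so on that set the difference is \<open>cV \<tau>\<close> up to
        sign.\<close>
      also have "\<dots> \<le> norm (C \<tau> - lsq_of (cV \<tau>))"
      proof -
        obtain w where uw: "w \<in> L2 UNIV" "\<forall>x\<in>closure D. w x = 0" "C \<tau> = lsq_of w"
          using WC[OF \<tau>(1)] unfolding H0curl_def by blast
        have cL: "cV \<tau> \<in> L2 UNIV" using src[OF \<tau>(1)] by (simp add: maxwell_source_def)
        have "norm (lsq_of (ext_zero (closure D) (cV \<tau>))) \<le> 1 * norm (lsq_of (\<lambda>x. w x - cV \<tau> x))"
          using uw(2) by (intro norm_lsq_mono L2_restrict(2)[OF _ cL] L2_diff[OF uw(1) cL])
            (auto simp: ext_zero_def indicator_def)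
        then show ?thesis by (simp add: uw(3) lsq_of_simps(3)[OF uw(1) cL])
      qed
      finally have "(\<bar>F \<tau>\<bar> * (\<mu> * c / (1 + \<sigma>)) * exp (- (\<sigma> * \<tau> * (d + \<delta>))))\<^sup>2 \<le> (norm (C \<tau> - lsq_of (cV \<tau>)))\<^sup>2"
        using \<mu> c \<sigma> by (intro power_mono) auto
      also have "(\<bar>F \<tau>\<bar> * (\<mu> * c / (1 + \<sigma>)) * exp (- (\<sigma> * \<tau> * (d + \<delta>))))\<^sup>2
          = c' * (F \<tau>)\<^sup>2 * exp (- (2 * \<sigma> * (d + \<delta>)) * \<tau>)"
        unfolding c'_def power_mult_distrib exp_double[symmetric] by (simp add: mult_ac power2_abs)
      finally show ?thesis
        using low[OF \<tau>(1), of "\<lambda>_. 0" "\<lambda>_. 0"] by (simp add: weak_curl_def L2_UNIV)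
    qed
    ultimately show ?thesis unfolding eventually_at_top_linorder by blast
  qed
  have upper: "\<exists>A\<ge>0. \<forall>\<^sub>F \<tau> in at_top. J \<tau> \<le> A * exp (- (2 * \<sigma> * (d - \<delta>)) * \<tau>) + R * exp (- T * \<tau>)"
    if \<delta>: "\<delta> > 0" for \<delta>
  proof -
    have d: "d \<ge> 0" by (simp add: d_def setdist_pos_le)
    \<comment> \<open>The budget \<open>\<delta>\<close> is halved: \<open>3 * s\<close> for the
      radius and the weight, \<open>q * d\<close> for the Agmon factor \<open>1 - q\<close>. The
      bound \<open>\<eta> / 2\<close> keeps \<open>r1\<close> positive, and \<open>d + 1\<close>
      keeps the denominator of \<open>q\<close> positive.\<close>
    define s where "s = min (\<eta> / 2) (\<delta> / 6)"
    define q where "q = min (1/2) (\<delta> / (2 * (d + 1)))"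
    have s: "s > 0" "s \<le> \<eta> / 2" "3 * s \<le> \<delta> / 2" using \<delta> \<eta> by (auto simp: s_def)
    have d1: "d + 1 > 0" using d by simp
    have q: "q > 0" "q \<le> 1/2" unfolding q_def using \<delta> d1 by (simp del: distrib_left_numeral) (rule min.cobounded1)
    have "q * d \<le> \<delta> / (2 * (d + 1)) * (d + 1)"
      unfolding q_def using d d1 \<delta> by (intro mult_mono min.cobounded2) auto
    also have "\<dots> = \<delta> / 2" using d1 by (simp add: field_simps)
    finally have qd: "q * d \<le> \<delta> / 2" .
    \<comment> \<open>Both radii lie below \<open>\<eta> + d\<close>, a lower bound for the distance
      from \<open>p\<close> to \<open>closure D\<close>, so a field cut off at \<open>r2\<close>
      vanishes on \<open>closure D\<close>.\<close>
    define r1 where "r1 = \<eta> + d - s"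
    define r2 where "r2 = \<eta> + d - s / 2"
    have r: "0 < r1" "r1 < r2" using s \<eta> d by (auto simp: r1_def r2_def)
    define N where "N = {x. r1 \<le> norm (x - p)}"
    obtain A0 where A0: "A0 \<ge> 0" and comp: "\<And>\<kappa> V cV. \<kappa> \<ge> 1 \<Longrightarrow> V \<in> L2 UNIV \<Longrightarrow> cV \<in> L2 UNIV \<Longrightarrow> weak_curl UNIV V cV \<Longrightarrow>
      (\<exists>\<Psi> K. \<Psi> \<in> L2 UNIV \<and> K \<in> L2 UNIV \<and> weak_curl UNIV \<Psi> K \<and>
      (\<forall>x. r2 < norm (x - p) \<longrightarrow> \<Psi> x = 0 \<and> K x = 0) \<and>
      (norm (lsq_of K - lsq_of cV))\<^sup>2 + \<kappa>\<^sup>2 * (norm (lsq_of \<Psi> - lsq_of V))\<^sup>2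
      \<le> A0 * ((norm (lsq_of (ext_zero N cV)))\<^sup>2 + \<kappa>\<^sup>2 * (norm (lsq_of (ext_zero N V)))\<^sup>2))"
      using cutoff_competitor[OF r, of p, folded N_def] by (elim exE conjE) (rule that, blast+)
    define A where "A = A0 * (\<mu> * F0 * \<beta> / \<sigma> / q)\<^sup>2"
    have "A \<ge> 0" using A0 by (simp add: A_def)
    moreover have "J \<tau> \<le> A * exp (- (2 * \<sigma> * (d - \<delta>)) * \<tau>) + R * exp (- T * \<tau>)"
      if t: "\<tau> \<ge> max 1 (1 / \<sigma>)" for \<tau>
    proof -
      have \<tau>: "\<tau> > 0" and k: "\<sigma> * \<tau> \<ge> 1" using t \<sigma> by (auto simp: pos_divide_le_eq mult.commute)
      have sV: "V \<tau> \<in> L2 UNIV" "cV \<tau> \<in> L2 UNIV" "weak_curl UNIV (V \<tau>) (cV \<tau>)"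
        using src[OF \<tau>] unfolding maxwell_source_def by blast+
      obtain \<psi> \<zeta> where z: "\<psi> \<in> L2 UNIV" "\<zeta> \<in> L2 UNIV" "weak_curl UNIV \<psi> \<zeta>"
        "\<forall>x. r2 < norm (x - p) \<longrightarrow> \<psi> x = 0 \<and> \<zeta> x = 0"
        "(norm (lsq_of \<zeta> - lsq_of (cV \<tau>)))\<^sup>2 + (\<sigma> * \<tau>)\<^sup>2 * (norm (lsq_of \<psi> - lsq_of (V \<tau>)))\<^sup>2
          \<le> A0 * ((norm (lsq_of (ext_zero N (cV \<tau>))))\<^sup>2 + (\<sigma> * \<tau>)\<^sup>2 * (norm (lsq_of (ext_zero N (V \<tau>))))\<^sup>2)"
        using comp[OF k sV] by (elim exE conjE) (rule that)
      have zD: "\<psi> x = 0 \<and> \<zeta> x = 0" if x: "x \<in> closure D" for x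
      proof -
        have "x \<notin> cball p \<eta>" using x disj by blast
        then have "\<eta> \<le> norm (x - p)" by (simp add: dist_norm norm_minus_commute)
        from setdist_ball_le[OF \<eta> x this] have "r2 < norm (x - p)" using s by (simp add: r2_def d_def)
        then show ?thesis using z(4) by blast
      qed
      have dec: "(norm (lsq_of (ext_zero N (cV \<tau>))))\<^sup>2 + (\<sigma> * \<tau>)\<^sup>2 * (norm (lsq_of (ext_zero N (V \<tau>))))\<^sup>2
          \<le> (\<bar>\<mu> * \<tau> * F \<tau>\<bar> * \<beta> / ((1 - (1 - q)) * (\<sigma> * \<tau>)) * exp (- (\<sigma> * \<tau> * (1 - q) * (r1 - \<eta> - 2 * s))))\<^sup>2"
        unfolding N_def \<beta>_def
      proof (rule maxwell_source_decay[OF bL _ _ _ s(1) less_imp_le[OF r(1)] src[OF \<tau>]])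
        show "norm (x - p) \<le> \<eta>" if "b x \<noteq> 0" for x
          using that by (auto simp: b_def indicator_def dist_norm norm_minus_commute split: if_splits)
      qed (use q k in auto)
      also have "\<dots> \<le> (\<mu> * F0 * \<beta> / \<sigma> / q * exp (- (\<sigma> * (d - \<delta>) * \<tau>)))\<^sup>2"
      proof (intro power_mono mult_mono)
        have "\<bar>\<mu> * \<tau> * F \<tau>\<bar> * \<beta> / ((1 - (1 - q)) * (\<sigma> * \<tau>)) = \<bar>\<mu> * \<tau> * F \<tau>\<bar> * \<beta> / (\<sigma> * \<tau>) / q" by (simp add: mult.commute)
        also have "\<dots> \<le> \<mu> * F0 * \<beta> / \<sigma> / q" using gk[OF \<tau>] q by (intro divide_right_mono) auto
        finally show "\<bar>\<mu> * \<tau> * F \<tau>\<bar> * \<beta> / ((1 - (1 - q)) * (\<sigma> * \<tau>)) \<le> \<mu> * F0 * \<beta> / \<sigma> / q" .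
        have "0 \<le> 3 * q * s" using q s by simp
        then have "d - \<delta> \<le> (1 - q) * (r1 - \<eta> - 2 * s)" using qd s by (simp add: r1_def algebra_simps)
        then have "\<sigma> * \<tau> * (d - \<delta>) \<le> \<sigma> * \<tau> * ((1 - q) * (r1 - \<eta> - 2 * s))" using k by (intro mult_left_mono) auto
        then show "exp (- (\<sigma> * \<tau> * (1 - q) * (r1 - \<eta> - 2 * s))) \<le> exp (- (\<sigma> * (d - \<delta>) * \<tau>))" by (simp add: mult_ac)
      qed (use \<mu> F0 \<sigma> q k in \<open>auto simp: \<beta>_def\<close>)
      also have "\<dots> = (\<mu> * F0 * \<beta> / \<sigma> / q)\<^sup>2 * exp (- (2 * \<sigma> * (d - \<delta>)) * \<tau>)"
        unfolding power_mult_distrib[of _ "exp _"] exp_double[symmetric] by (simp add: mult_ac)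
      finally have "A0 * ((norm (lsq_of (ext_zero N (cV \<tau>))))\<^sup>2 + (\<sigma> * \<tau>)\<^sup>2 * (norm (lsq_of (ext_zero N (V \<tau>))))\<^sup>2)
          \<le> A * exp (- (2 * \<sigma> * (d - \<delta>)) * \<tau>)"
        unfolding A_def mult.assoc[of A0] by (rule mult_left_mono) (rule A0)
      then show ?thesis using up[OF \<tau> z(1-3) zD] z(5) by linarith
    qed
    ultimately show ?thesis unfolding eventually_at_top_linorder by blast
  qed
  show ?thesis using R lower upper by blast
qed

lemma exp_rate_mono: "y \<le> x \<Longrightarrow> 0 \<le> \<tau> \<Longrightarrow> exp (- x * \<tau>) \<le> exp (- y * \<tau>)" for x y \<tau> :: real
  by (simp add: mult_right_mono)

text \<open>Constants and the power \<open>2 * \<gamma>\<close> of \<open>\<tau>\<close> are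
  absorbed by half of the allowed exponent; \<open>L < T\<close> makes the remainder subordinate to
  the main term.\<close>

lemma exponential_rate:
  fixes F J :: "real \<Rightarrow> real"
  assumes L: "L < T" and c0: "c0 > 0" and R: "R \<ge> 0"
    and F: "\<forall>\<^sub>F \<tau> in at_top. \<tau> powr \<gamma> * \<bar>F \<tau>\<bar> \<ge> c0"
    and low: "\<And>\<delta>. \<delta> > 0 \<Longrightarrow> \<exists>c>0. \<forall>\<^sub>F \<tau> in at_top. c * (F \<tau>)\<^sup>2 * exp (- (L + \<delta>) * \<tau>) - R * exp (- T * \<tau>) \<le> J \<tau>"
    and up: "\<And>\<delta>. \<delta> > 0 \<Longrightarrow> \<exists>A\<ge>0. \<forall>\<^sub>F \<tau> in at_top. J \<tau> \<le> A * exp (- (L - \<delta>) * \<tau>) + R * exp (- T * \<tau>)"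
    and e: "e > 0"
  shows "\<forall>\<^sub>F \<tau> in at_top. exp (- (L + e) * \<tau>) \<le> J \<tau> \<and> J \<tau> \<le> exp (- (L - e) * \<tau>)"
proof (rule eventually_conj)
  \<comment> \<open>Capped at \<open>T - L\<close>, so that \<open>exp (- T * \<tau>)\<close> does
    not exceed \<open>exp (- (L + e') * \<tau>)\<close>.\<close>
  define e' where "e' = min e (T - L)"
  have e': "e' > 0" "e' \<le> e" "L + e' \<le> T" using e L by (auto simp: e'_def)
  obtain c where c: "c > 0"
    and cl: "\<forall>\<^sub>F \<tau> in at_top. c * (F \<tau>)\<^sup>2 * exp (- (L + e' / 2) * \<tau>) - R * exp (- T * \<tau>) \<le> J \<tau>"
    using low[of "e' / 2"] e' by auto
  \<comment> \<open>In the factor \<open>1 + R\<close> the part \<open>R\<close> pays for the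
    remainder and 1 is left over as the claimed bound. The exponent \<open>2 * \<gamma>\<close>
    arises because \<open>F\<close> enters squared.\<close>
  have "((\<lambda>\<tau>. (1 + R) * (\<tau> powr (2 * \<gamma>) * exp (- (e' / 2) * \<tau>))) \<longlongrightarrow> 0) at_top"
    using e'(1) by real_asymp
  then have small: "\<forall>\<^sub>F \<tau> in at_top. (1 + R) * (\<tau> powr (2 * \<gamma>) * exp (- (e' / 2) * \<tau>)) < c * c0\<^sup>2"
    by (rule order_tendstoD) (use c c0 in simp)
  show "\<forall>\<^sub>F \<tau> in at_top. exp (- (L + e) * \<tau>) \<le> J \<tau>"
    using cl small F eventually_gt_at_top[of 0]
  proof eventually_elim
    case (elim \<tau>)
    define P where "P = \<tau> powr (2 * \<gamma>)"
    have P: "P > 0" using elim by (simp add: P_def)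
    have "c0\<^sup>2 \<le> (\<tau> powr \<gamma> * \<bar>F \<tau>\<bar>)\<^sup>2" using elim c0 by (intro power_mono) auto
    also have "\<dots> = P * (F \<tau>)\<^sup>2"
    proof -
      have "\<tau> powr \<gamma> * \<tau> powr \<gamma> = P" by (simp add: P_def flip: powr_add)
      then show ?thesis unfolding power_mult_distrib power2_abs by (simp only: power2_eq_square)
    qed
    finally have "c * c0\<^sup>2 \<le> c * (P * (F \<tau>)\<^sup>2)" using c by (intro mult_left_mono) auto
    then have "P * ((1 + R) * exp (- (e' / 2) * \<tau>)) \<le> P * (c * (F \<tau>)\<^sup>2)"
      using elim(2) by (simp add: P_def mult_ac)
    then have "(1 + R) * exp (- (e' / 2) * \<tau>) \<le> c * (F \<tau>)\<^sup>2" using P by simp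
    then have "(1 + R) * exp (- (e' / 2) * \<tau>) * exp (- (L + e' / 2) * \<tau>) \<le> c * (F \<tau>)\<^sup>2 * exp (- (L + e' / 2) * \<tau>)"
      by (intro mult_right_mono) auto
    also have "(1 + R) * exp (- (e' / 2) * \<tau>) * exp (- (L + e' / 2) * \<tau>) = (1 + R) * exp (- (L + e') * \<tau>)"
      by (simp add: mult.assoc algebra_simps flip: exp_add)
    finally have "(1 + R) * exp (- (L + e') * \<tau>) - R * exp (- T * \<tau>) \<le> J \<tau>" using elim by linarith
    moreover have "R * exp (- T * \<tau>) \<le> R * exp (- (L + e') * \<tau>)"
      using e' elim R by (intro mult_left_mono exp_rate_mono) auto
    ultimately have "exp (- (L + e') * \<tau>) \<le> J \<tau>" by (simp add: algebra_simps)
    moreover have "exp (- (L + e) * \<tau>) \<le> exp (- (L + e') * \<tau>)" using e' elim by (intro exp_rate_mono) auto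
    ultimately show ?case by linarith
  qed
  obtain A where A: "A \<ge> 0"
    and au: "\<forall>\<^sub>F \<tau> in at_top. J \<tau> \<le> A * exp (- (L - e / 2) * \<tau>) + R * exp (- T * \<tau>)"
    using up[of "e / 2"] e by auto
  have "((\<lambda>\<tau>. (A + R) * exp (- (e / 2) * \<tau>)) \<longlongrightarrow> 0) at_top"
    using e by real_asymp
  then have small: "\<forall>\<^sub>F \<tau> in at_top. (A + R) * exp (- (e / 2) * \<tau>) < 1"
    by (rule order_tendstoD) simp
  show "\<forall>\<^sub>F \<tau> in at_top. J \<tau> \<le> exp (- (L - e) * \<tau>)"
    using au small eventually_gt_at_top[of 0]
  proof eventually_elim
    case (elim \<tau>)
    have "R * exp (- T * \<tau>) \<le> R * exp (- (L - e / 2) * \<tau>)"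
      using L e elim R by (intro mult_left_mono exp_rate_mono) auto
    then have "J \<tau> \<le> (A + R) * exp (- (L - e / 2) * \<tau>)" using elim by (simp add: algebra_simps)
    also have "\<dots> = (A + R) * exp (- (e / 2) * \<tau>) * exp (- (L - e) * \<tau>)"
      by (simp add: mult.assoc algebra_simps flip: exp_add)
    also have "\<dots> \<le> 1 * exp (- (L - e) * \<tau>)" using elim by (intro mult_right_mono) auto
    finally show ?case by simp
  qed
qed

theorem theorem1p1:
  fixes D :: "(real^3) set" and \<epsilon> \<mu> T \<eta> :: real and p a :: "real^3"
    and f :: "real \<Rightarrow> real"
    and E H :: "real \<Rightarrow> real^3 \<Rightarrow> real^3"
    and We V :: "real \<Rightarrow> real^3 \<Rightarrow> real^3"
  assumes D: "open D" "bounded D" "D \<noteq> {}" "C2_boundary D" "connected (- closure D)"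
    and eps: "\<epsilon> > 0" and mu: "\<mu> > 0" and T: "0 < T"
    and eta: "\<eta> > 0" and B: "closure (ball p \<eta>) \<inter> closure D = {}"
    and a: "norm a = 1"
    and f: "H1_interval T f" "f 0 = 0"
    and sol: "maxwell_solution D \<epsilon> \<mu> T (\<lambda>x t. (f t * indicator (ball p \<eta>) x) *\<^sub>R a) E H"
    and We: "\<forall>\<tau>>0. We \<tau> \<in> L2 (- closure D) \<and>
               (\<forall>\<phi> \<in> L2 (- closure D).
                  (\<integral>x. We \<tau> x \<bullet> \<phi> x \<partial>(lebesgue_on (- closure D))) =
                  (LINT t:{0..T}|lborel. exp (- \<tau> * t) *
                        (\<integral>x. E t x \<bullet> \<phi> x \<partial>(lebesgue_on (- closure D)))))"
    and V: "\<forall>\<tau>>0. V \<tau> \<in> L2 UNIV \<and> (\<exists>cV \<in> L2 UNIV. weak_curl UNIV (V \<tau>) cV \<and>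
               (\<forall>\<Psi> c\<Psi>. \<Psi> \<in> L2 UNIV \<and> c\<Psi> \<in> L2 UNIV \<and> weak_curl UNIV \<Psi> c\<Psi> \<longrightarrow>
                  (\<integral>x. (1 / (\<mu> * \<epsilon>)) * (cV x \<bullet> c\<Psi> x) + \<tau>^2 * (V \<tau> x \<bullet> \<Psi> x) \<partial>lebesgue)
                  + (\<integral>x. ((- \<tau> / \<epsilon> * ftilde T f \<tau> * indicator (ball p \<eta>) x) *\<^sub>R a) \<bullet> \<Psi> x \<partial>lebesgue)
                  = 0))"
    and growth: "\<exists>\<gamma>::real. Liminf at_top (\<lambda>\<tau>. ereal (\<tau> powr \<gamma> * \<bar>ftilde T f \<tau>\<bar>)) > 0"
    and Tlarge: "T > 2 * sqrt (\<mu> * \<epsilon>) * setdist D (ball p \<eta>)"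
  shows "(\<exists>\<tau>0>0. \<forall>\<tau>\<ge>\<tau>0.
            (\<integral>x. ((- \<tau> / \<epsilon> * ftilde T f \<tau> * indicator (ball p \<eta>) x) *\<^sub>R a) \<bullet> (We \<tau> x - V \<tau> x)
               \<partial>(lebesgue_on (ball p \<eta>))) > 0)
       \<and> ((\<lambda>\<tau>. ln \<bar>\<integral>x. ((- \<tau> / \<epsilon> * ftilde T f \<tau> * indicator (ball p \<eta>) x) *\<^sub>R a) \<bullet> (We \<tau> x - V \<tau> x)
               \<partial>(lebesgue_on (ball p \<eta>))\<bar> / \<tau>)
            \<longlongrightarrow> - 2 * sqrt (\<mu> * \<epsilon>) * setdist D (ball p \<eta>)) at_top"
proof -
  define \<Omega> where "\<Omega> = - closure D"
  define \<sigma> where "\<sigma> = sqrt (\<mu> * \<epsilon>)"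
  define b where "b x = indicator (ball p \<eta>) x *\<^sub>R a" for x
  define W where "W \<tau> = lsq_of (ext_zero \<Omega> (We \<tau>))" for \<tau>
  define F where "F = ftilde T f"
  define d where "d = setdist D (ball p \<eta>)"
  define I where "I \<tau> = (\<integral>x. ((- \<tau> / \<epsilon> * ftilde T f \<tau> * indicator (ball p \<eta>) x) *\<^sub>R a) \<bullet> (We \<tau> x - V \<tau> x)
      \<partial>(lebesgue_on (ball p \<eta>)))" for \<tau>
  have k: "\<mu> * \<epsilon> > 0" and \<sigma>: "\<sigma> > 0" and \<sigma>2: "\<sigma>\<^sup>2 = \<mu> * \<epsilon>" using eps mu by (simp_all add: \<sigma>_def)
  have disj: "cball p \<eta> \<inter> closure D = {}" using B eta by simp
  then have disj': "ball p \<eta> \<inter> closure D = {}" using ball_subset_cball[of p \<eta>] by blast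
  have \<Omega>: "\<Omega> \<in> sets lebesgue" unfolding \<Omega>_def by (intro sets_completionI_sets borel_open open_Compl) simp
  have bL: "b \<in> L2 UNIV" using L2_indicator_ball unfolding b_def .
  have cf: "continuous_on {0..T} f" using f by (simp add: H1_interval_def)
  have WeL: "We \<tau> \<in> L2 (- closure D)" if "\<tau> > 0" for \<tau> using We that by blast
  have Wpair: "(\<integral>x. We \<tau> x \<bullet> \<phi> x \<partial>(lebesgue_on (- closure D))) =
      (LINT t:{0..T}|lborel. exp (- \<tau> * t) * (\<integral>x. E t x \<bullet> \<phi> x \<partial>(lebesgue_on (- closure D))))"
    if "\<tau> > 0" "\<phi> \<in> L2 (- closure D)" for \<tau> \<phi> using We that by blast
  have "\<exists>eT hT. \<forall>\<tau>>0. \<exists>C. H0curl D (W \<tau>) C \<and>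
      (\<forall>\<Psi> K. H0curl D \<Psi> K \<longrightarrow> \<tau>\<^sup>2 * (W \<tau> \<bullet> \<Psi>) + 1 / (\<mu> * \<epsilon>) * (C \<bullet> K)
        = \<tau> / \<epsilon> * F \<tau> * (lsq_of b \<bullet> \<Psi>) - exp (- \<tau> * T) * (\<tau> * (eT \<bullet> \<Psi>) + 1 / \<epsilon> * (hT \<bullet> K)))"
    unfolding W_def F_def b_def[abs_def] \<Omega>_def
    by (rule maxwell_laplace_weak[OF D(1,2,4) eps mu T disj' L2_indicator_ball cf sol]) (fact WeL Wpair)+
  then obtain eT hT where "\<forall>\<tau>>0. \<exists>C. H0curl D (W \<tau>) C \<and>
      (\<forall>\<Psi> K. H0curl D \<Psi> K \<longrightarrow> \<tau>\<^sup>2 * (W \<tau> \<bullet> \<Psi>) + 1 / (\<mu> * \<epsilon>) * (C \<bullet> K)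
        = \<tau> / \<epsilon> * F \<tau> * (lsq_of b \<bullet> \<Psi>) - exp (- \<tau> * T) * (\<tau> * (eT \<bullet> \<Psi>) + 1 / \<epsilon> * (hT \<bullet> K)))"
    by (elim exE) (rule that)
  then obtain C where C: "\<forall>\<tau>>0. H0curl D (W \<tau>) (C \<tau>) \<and>
      (\<forall>\<Psi> K. H0curl D \<Psi> K \<longrightarrow> \<tau>\<^sup>2 * (W \<tau> \<bullet> \<Psi>) + 1 / (\<mu> * \<epsilon>) * (C \<tau> \<bullet> K)
        = \<tau> / \<epsilon> * F \<tau> * (lsq_of b \<bullet> \<Psi>) - exp (- \<tau> * T) * (\<tau> * (eT \<bullet> \<Psi>) + 1 / \<epsilon> * (hT \<bullet> K)))"
    by (metis (no_types))
  have WC: "H0curl D (W \<tau>) (C \<tau>)" if "\<tau> > 0" for \<tau> using C that by blast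
  \<comment> \<open>The transformed equation multiplied by \<open>\<mu> * \<epsilon>\<close>.
    Rescaling the final values by \<open>\<sigma>\<close> and \<open>\<mu>\<close> brings the error
    into the form \<open>\<kappa> * (e \<bullet> \<Psi>) + h \<bullet> K\<close> with
    \<open>\<kappa> = \<sigma> * \<tau>\<close>.\<close>
  have eq: "C \<tau> \<bullet> K + (\<sigma> * \<tau>)\<^sup>2 * (W \<tau> \<bullet> \<Psi>)
      = \<mu> * \<tau> * F \<tau> * (lsq_of b \<bullet> \<Psi>) - exp (- \<tau> * T) * (\<sigma> * \<tau> * ((\<sigma> *\<^sub>R eT) \<bullet> \<Psi>) + (\<mu> *\<^sub>R hT) \<bullet> K)"
    if \<tau>: "\<tau> > 0" and H: "H0curl D \<Psi> K" for \<tau> \<Psi> K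
  proof -
    have "\<tau>\<^sup>2 * (W \<tau> \<bullet> \<Psi>) + 1 / (\<mu> * \<epsilon>) * (C \<tau> \<bullet> K)
        = \<tau> / \<epsilon> * F \<tau> * (lsq_of b \<bullet> \<Psi>) - exp (- \<tau> * T) * (\<tau> * (eT \<bullet> \<Psi>) + 1 / \<epsilon> * (hT \<bullet> K))"
      using C \<tau> H by blast
    then have "(\<mu> * \<epsilon>) * (\<tau>\<^sup>2 * (W \<tau> \<bullet> \<Psi>) + 1 / (\<mu> * \<epsilon>) * (C \<tau> \<bullet> K))
        = (\<mu> * \<epsilon>) * (\<tau> / \<epsilon> * F \<tau> * (lsq_of b \<bullet> \<Psi>) - exp (- \<tau> * T) * (\<tau> * (eT \<bullet> \<Psi>) + 1 / \<epsilon> * (hT \<bullet> K)))"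
      by simp
    moreover have "(\<mu> * \<epsilon>) * (\<tau>\<^sup>2 * (W \<tau> \<bullet> \<Psi>) + 1 / (\<mu> * \<epsilon>) * (C \<tau> \<bullet> K)) = C \<tau> \<bullet> K + (\<sigma> * \<tau>)\<^sup>2 * (W \<tau> \<bullet> \<Psi>)"
      unfolding power_mult_distrib \<sigma>2 using eps mu by (simp add: distrib_left)
    moreover have "(\<mu> * \<epsilon>) * (\<tau> / \<epsilon> * F \<tau> * (lsq_of b \<bullet> \<Psi>) - exp (- \<tau> * T) * (\<tau> * (eT \<bullet> \<Psi>) + 1 / \<epsilon> * (hT \<bullet> K)))
        = \<mu> * \<tau> * F \<tau> * (lsq_of b \<bullet> \<Psi>) - exp (- \<tau> * T) * (\<sigma>\<^sup>2 * \<tau> * (eT \<bullet> \<Psi>) + \<mu> * (hT \<bullet> K))"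
      unfolding \<sigma>2 using eps mu by (simp add: field_simps)
    moreover have "\<sigma>\<^sup>2 * \<tau> * (eT \<bullet> \<Psi>) + \<mu> * (hT \<bullet> K) = \<sigma> * \<tau> * ((\<sigma> *\<^sub>R eT) \<bullet> \<Psi>) + (\<mu> *\<^sub>R hT) \<bullet> K"
      by (simp add: power2_eq_square)
    ultimately show ?thesis by metis
  qed
  \<comment> \<open>The same factor \<open>\<mu> * \<epsilon>\<close> normalises the equation of
    \<open>V\<close>; the source then has amplitude \<open>\<mu> * \<tau> * F \<tau>\<close>, its
    sign reversed by moving it to the right-hand side.\<close>
  have "\<exists>c. maxwell_source (\<sigma> * \<tau>) (\<mu> * \<tau> * F \<tau>) b (V \<tau>) c" if \<tau>: "\<tau> > 0" for \<tau>
  proof -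
    have VL: "V \<tau> \<in> L2 UNIV" using V \<tau> by blast
    obtain c where c: "c \<in> L2 UNIV" "weak_curl UNIV (V \<tau>) c"
      and ceq: "\<forall>\<Psi> K. \<Psi> \<in> L2 UNIV \<and> K \<in> L2 UNIV \<and> weak_curl UNIV \<Psi> K \<longrightarrow>
        (\<integral>x. (1 / (\<mu> * \<epsilon>)) * (c x \<bullet> K x) + \<tau>^2 * (V \<tau> x \<bullet> \<Psi> x) \<partial>lebesgue)
        + (\<integral>x. ((- \<tau> / \<epsilon> * ftilde T f \<tau> * indicator (ball p \<eta>) x) *\<^sub>R a) \<bullet> \<Psi> x \<partial>lebesgue) = 0"
      using V \<tau> by blast
    have "lsq_of c \<bullet> lsq_of K + (\<sigma> * \<tau>)\<^sup>2 * (lsq_of (V \<tau>) \<bullet> lsq_of \<Psi>) = \<mu> * \<tau> * F \<tau> * (lsq_of b \<bullet> lsq_of \<Psi>)"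
      if z: "\<Psi> \<in> L2 UNIV" "K \<in> L2 UNIV" "weak_curl UNIV \<Psi> K" for \<Psi> K
    proof -
      have i1: "(\<integral>x. (1 / (\<mu> * \<epsilon>)) * (c x \<bullet> K x) + \<tau>\<^sup>2 * (V \<tau> x \<bullet> \<Psi> x) \<partial>lebesgue)
          = 1 / (\<mu> * \<epsilon>) * (lsq_of c \<bullet> lsq_of K) + \<tau>\<^sup>2 * (lsq_of (V \<tau>) \<bullet> lsq_of \<Psi>)"
        using L2_inner_integrable[OF c(1) z(2)] L2_inner_integrable[OF VL z(1)]
        by (simp add: inner_lsq_of c(1) z(1,2) VL)
      have i2: "(\<integral>x. ((- \<tau> / \<epsilon> * ftilde T f \<tau> * indicator (ball p \<eta>) x) *\<^sub>R a) \<bullet> \<Psi> x \<partial>lebesgue)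
          = (\<integral>x. (- \<tau> / \<epsilon> * F \<tau>) * (b x \<bullet> \<Psi> x) \<partial>lebesgue)"
        by (rule Bochner_Integration.integral_cong) (simp_all add: b_def F_def)
      have i3: "(\<integral>x. (- \<tau> / \<epsilon> * F \<tau>) * (b x \<bullet> \<Psi> x) \<partial>lebesgue) = - \<tau> / \<epsilon> * F \<tau> * (lsq_of b \<bullet> lsq_of \<Psi>)"
        by (subst integral_mult_right_zero) (simp add: inner_lsq_of bL z(1))
      have "1 / (\<mu> * \<epsilon>) * (lsq_of c \<bullet> lsq_of K) + \<tau>\<^sup>2 * (lsq_of (V \<tau>) \<bullet> lsq_of \<Psi>)
          + - \<tau> / \<epsilon> * F \<tau> * (lsq_of b \<bullet> lsq_of \<Psi>) = 0"
        using ceq[rule_format, OF conjI[OF z(1) conjI[OF z(2,3)]]] unfolding i1 i2 i3 .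
      then have "1 / (\<mu> * \<epsilon>) * (lsq_of c \<bullet> lsq_of K) + \<tau>\<^sup>2 * (lsq_of (V \<tau>) \<bullet> lsq_of \<Psi>)
          = \<tau> / \<epsilon> * F \<tau> * (lsq_of b \<bullet> lsq_of \<Psi>)" by simp
      then have "(\<mu> * \<epsilon>) * (1 / (\<mu> * \<epsilon>) * (lsq_of c \<bullet> lsq_of K) + \<tau>\<^sup>2 * (lsq_of (V \<tau>) \<bullet> lsq_of \<Psi>))
          = (\<mu> * \<epsilon>) * (\<tau> / \<epsilon> * F \<tau> * (lsq_of b \<bullet> lsq_of \<Psi>))" by simp
      moreover have "(\<mu> * \<epsilon>) * (1 / (\<mu> * \<epsilon>) * (lsq_of c \<bullet> lsq_of K) + \<tau>\<^sup>2 * (lsq_of (V \<tau>) \<bullet> lsq_of \<Psi>))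
          = lsq_of c \<bullet> lsq_of K + (\<sigma> * \<tau>)\<^sup>2 * (lsq_of (V \<tau>) \<bullet> lsq_of \<Psi>)"
        unfolding power_mult_distrib \<sigma>2 using eps mu by (simp add: distrib_left)
      moreover have "(\<mu> * \<epsilon>) * (\<tau> / \<epsilon> * F \<tau> * (lsq_of b \<bullet> lsq_of \<Psi>)) = \<mu> * \<tau> * F \<tau> * (lsq_of b \<bullet> lsq_of \<Psi>)"
        using eps by simp
      ultimately show ?thesis by metis
    qed
    then show ?thesis unfolding maxwell_source_def using VL c by blast
  qed
  then obtain cV where src: "\<And>\<tau>. \<tau> > 0 \<Longrightarrow> maxwell_source (\<sigma> * \<tau>) (\<mu> * \<tau> * F \<tau>) b (V \<tau>) (cV \<tau>)"
    by metis
  \<comment> \<open>On the ball the extension by zero changes nothing, since the ball is disjoint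
    from \<open>closure D\<close>. The minus sign in the source makes the indicator a positive
    multiple of the quantity \<open>J\<close> of the energy estimates.\<close>
  have IJ: "I \<tau> = 1 / (\<mu> * \<epsilon>) * - (\<mu> * \<tau> * F \<tau> * (lsq_of b \<bullet> (W \<tau> - lsq_of (V \<tau>))))" if \<tau>: "\<tau> > 0" for \<tau>
  proof -
    have VL: "V \<tau> \<in> L2 UNIV" using V \<tau> by blast
    have WL: "ext_zero \<Omega> (We \<tau>) \<in> L2 UNIV" using WeL[OF \<tau>] L2_ext_zero[OF \<Omega>, of "We \<tau>"] by (simp add: \<Omega>_def)
    have dL: "(\<lambda>x. ext_zero \<Omega> (We \<tau>) x - V \<tau> x) \<in> L2 UNIV" by (rule L2_diff[OF WL VL])
    have "I \<tau> = (\<integral>x. (- \<tau> / \<epsilon> * F \<tau>) * (b x \<bullet> (ext_zero \<Omega> (We \<tau>) x - V \<tau> x)) \<partial>lebesgue)"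
      unfolding I_def integral_lebesgue_on[OF lmeasurable_ball[THEN fmeasurableD]]
    proof (rule Bochner_Integration.integral_cong[OF refl])
      fix x
      show "indicat_real (ball p \<eta>) x *\<^sub>R (((- \<tau> / \<epsilon> * ftilde T f \<tau> * indicator (ball p \<eta>) x) *\<^sub>R a) \<bullet> (We \<tau> x - V \<tau> x))
          = (- \<tau> / \<epsilon> * F \<tau>) * (b x \<bullet> (ext_zero \<Omega> (We \<tau>) x - V \<tau> x))"
      proof (cases "x \<in> ball p \<eta>")
        case True
        then have "x \<in> \<Omega>" using disj' by (auto simp: \<Omega>_def)
        with True show ?thesis by (simp add: b_def F_def ext_zero_def)
      qed (simp add: b_def)
    qed
    also have "\<dots> = (- \<tau> / \<epsilon> * F \<tau>) * (lsq_of b \<bullet> lsq_of (\<lambda>x. ext_zero \<Omega> (We \<tau>) x - V \<tau> x))"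
      unfolding inner_lsq_of[OF bL dL] by (rule integral_mult_right_zero)
    also have "\<dots> = (- \<tau> / \<epsilon> * F \<tau>) * (lsq_of b \<bullet> (W \<tau> - lsq_of (V \<tau>)))"
      by (simp only: lsq_of_simps(3)[OF WL VL] W_def)
    also have "\<dots> = 1 / (\<mu> * \<epsilon>) * - (\<mu> * \<tau> * F \<tau> * (lsq_of b \<bullet> (W \<tau> - lsq_of (V \<tau>))))"
      using eps mu by simp
    finally show ?thesis .
  qed
  obtain F0 where F0: "\<And>\<tau>. \<tau> \<ge> 0 \<Longrightarrow> \<bar>F \<tau>\<bar> \<le> F0"
    unfolding F_def using ftilde_bounded[OF T cf] by blast
  have "\<exists>R\<ge>0. (\<forall>\<delta>>0. \<exists>c>0. \<forall>\<^sub>F \<tau> in at_top. c * (F \<tau>)\<^sup>2 * exp (- (2 * \<sigma> * (d + \<delta>)) * \<tau>) - R * exp (- T * \<tau>)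
        \<le> - (\<mu> * \<tau> * F \<tau> * (lsq_of b \<bullet> (W \<tau> - lsq_of (V \<tau>))))) \<and>
      (\<forall>\<delta>>0. \<exists>A\<ge>0. \<forall>\<^sub>F \<tau> in at_top. - (\<mu> * \<tau> * F \<tau> * (lsq_of b \<bullet> (W \<tau> - lsq_of (V \<tau>))))
        \<le> A * exp (- (2 * \<sigma> * (d - \<delta>)) * \<tau>) + R * exp (- T * \<tau>))"
    unfolding d_def b_def[abs_def]
    by (rule enclosure_bounds[OF D(1,3) eta disj a \<sigma> mu T]) (fact F0 WC src[unfolded b_def[abs_def]] eq[unfolded b_def[abs_def]])+
  then obtain R where R: "R \<ge> 0"
    and low: "\<forall>\<delta>>0. \<exists>c>0. \<forall>\<^sub>F \<tau> in at_top. c * (F \<tau>)\<^sup>2 * exp (- (2 * \<sigma> * (d + \<delta>)) * \<tau>) - R * exp (- T * \<tau>)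
        \<le> - (\<mu> * \<tau> * F \<tau> * (lsq_of b \<bullet> (W \<tau> - lsq_of (V \<tau>))))"
    and up: "\<forall>\<delta>>0. \<exists>A\<ge>0. \<forall>\<^sub>F \<tau> in at_top. - (\<mu> * \<tau> * F \<tau> * (lsq_of b \<bullet> (W \<tau> - lsq_of (V \<tau>))))
        \<le> A * exp (- (2 * \<sigma> * (d - \<delta>)) * \<tau>) + R * exp (- T * \<tau>)"
    by (elim exE conjE) (rule that)
  obtain \<gamma> where "Liminf at_top (\<lambda>\<tau>. ereal (\<tau> powr \<gamma> * \<bar>F \<tau>\<bar>)) > 0" using growth unfolding F_def by blast
  \<comment> \<open>The lower limit may be infinite, so a real number strictly between 0 and it is
    chosen.\<close>
  then obtain c0 where c0: "0 < ereal c0" "ereal c0 < Liminf at_top (\<lambda>\<tau>. ereal (\<tau> powr \<gamma> * \<bar>F \<tau>\<bar>))"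
    using ereal_dense2 by blast
  have Fl: "\<forall>\<^sub>F \<tau> in at_top. \<tau> powr \<gamma> * \<bar>F \<tau>\<bar> \<ge> c0"
    using less_LiminfD[OF c0(2)] by (rule eventually_mono) simp
  define L where "L = 2 * \<sigma> * d"
  have "\<forall>\<^sub>F \<tau> in at_top. exp (- (L + e) * \<tau>) \<le> I \<tau> \<and> I \<tau> \<le> exp (- (L - e) * \<tau>)" if e: "e > 0" for e
  proof (rule exponential_rate[OF _ _ _ Fl _ _ e])
    show "L < T" using Tlarge by (simp add: L_def \<sigma>_def d_def)
    show "c0 > 0" using c0(1) by simp
    show "0 \<le> 1 / (\<mu> * \<epsilon>) * R" using R k by simp
    fix \<delta> :: real assume \<delta>: "\<delta> > 0"
    \<comment> \<open>A loss in distance becomes a loss in the rate through the factor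
      \<open>2 * \<sigma>\<close>.\<close>
    have ld: "2 * \<sigma> * (d + \<delta> / (2 * \<sigma>)) = L + \<delta>" "2 * \<sigma> * (d - \<delta> / (2 * \<sigma>)) = L - \<delta>"
      using \<sigma> by (simp_all add: L_def distrib_left right_diff_distrib)
    have \<delta>': "\<delta> / (2 * \<sigma>) > 0" using \<delta> \<sigma> by simp
    obtain c where c: "c > 0" and cl: "\<forall>\<^sub>F \<tau> in at_top. c * (F \<tau>)\<^sup>2 * exp (- (L + \<delta>) * \<tau>) - R * exp (- T * \<tau>)
        \<le> - (\<mu> * \<tau> * F \<tau> * (lsq_of b \<bullet> (W \<tau> - lsq_of (V \<tau>))))"
      using low[rule_format, OF \<delta>'] unfolding ld by blast
    have "\<forall>\<^sub>F \<tau> in at_top. 1 / (\<mu> * \<epsilon>) * c * (F \<tau>)\<^sup>2 * exp (- (L + \<delta>) * \<tau>) - 1 / (\<mu> * \<epsilon>) * R * exp (- T * \<tau>) \<le> I \<tau>"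
      using cl eventually_gt_at_top[of 0]
    proof eventually_elim
      case (elim \<tau>)
      from mult_left_mono[OF elim(1), of "1 / (\<mu> * \<epsilon>)"] k show ?case
        unfolding IJ[OF elim(2)] right_diff_distrib mult.assoc by simp
    qed
    moreover have "1 / (\<mu> * \<epsilon>) * c > 0" using k c by simp
    ultimately show "\<exists>c>0. \<forall>\<^sub>F \<tau> in at_top. c * (F \<tau>)\<^sup>2 * exp (- (L + \<delta>) * \<tau>) - 1 / (\<mu> * \<epsilon>) * R * exp (- T * \<tau>) \<le> I \<tau>"
      by blast
    obtain A where A: "A \<ge> 0" and au: "\<forall>\<^sub>F \<tau> in at_top. - (\<mu> * \<tau> * F \<tau> * (lsq_of b \<bullet> (W \<tau> - lsq_of (V \<tau>))))
        \<le> A * exp (- (L - \<delta>) * \<tau>) + R * exp (- T * \<tau>)"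
      using up[rule_format, OF \<delta>'] unfolding ld by blast
    have "\<forall>\<^sub>F \<tau> in at_top. I \<tau> \<le> 1 / (\<mu> * \<epsilon>) * A * exp (- (L - \<delta>) * \<tau>) + 1 / (\<mu> * \<epsilon>) * R * exp (- T * \<tau>)"
      using au eventually_gt_at_top[of 0]
    proof eventually_elim
      case (elim \<tau>)
      from mult_left_mono[OF elim(1), of "1 / (\<mu> * \<epsilon>)"] k show ?case
        unfolding IJ[OF elim(2)] distrib_left mult.assoc by simp
    qed
    moreover have "1 / (\<mu> * \<epsilon>) * A \<ge> 0" using k A by simp
    ultimately show "\<exists>A\<ge>0. \<forall>\<^sub>F \<tau> in at_top. I \<tau> \<le> A * exp (- (L - \<delta>) * \<tau>) + 1 / (\<mu> * \<epsilon>) * R * exp (- T * \<tau>)"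
      by blast
  qed
  note lim = log_rate_limit[of L I, OF this]
  have "- 2 * sqrt (\<mu> * \<epsilon>) * setdist D (ball p \<eta>) = - L" by (simp add: L_def \<sigma>_def d_def)
  then show ?thesis using lim unfolding I_def by simp
qed

end
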